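(* Let $\Phi_1^{\mathrm{AJ}},\Phi_2^{\mathrm{AJ}}:(\Delta_0\otimes\mathrm{Div}(\mathcal{H}_\mathfrak{p}^{\mathrm{ur}})\otimes V_{k,k})_\Gamma\to\mathbf{D}_{f,L}/\mathrm{Fil}^{\frac{k+2}{2}}(\mathbf{D}_{f,L})$ be any two $\mathfrak{p}$-adic Abel–Jacobi maps. Then for every optimal embedding $\Psi\in\mathrm{Emb}(\mathcal{O},\mathcal{R})$, \[\Phi_1^{\mathrm{AJ}}\big([(\gamma_\Psi\cdot x-x)\otimes\tau_\Psi\otimes\delta_K^{-k/2}P_\Psi^{k/2}]\big)=\Phi_2^{\mathrm{AJ}}\big([(\gamma_\Psi\cdot x-x)\otimes\tau_\Psi\otimes\delta_K^{-k/2}P_\Psi^{k/2}]\big).\] That is, the $\mathfrak{p}$-adic Abel–Jacobi image of the Stark–Heegner cycle is independent of the choice of $\mathfrak{p}$-adic Abel–Jacobi map.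
   Context: Let $p$ be a rational prime, $F$ an imaginary quadratic field of class number one in which $p$ is unramified, $\mathfrak{p}$ a prime above $p$, $F_\mathfrak{p}$ its completion. Let $k\ge0$ be even, $\mathcal{N}=\mathfrak{p}\mathcal{M}$ square-free with $\mathfrak{p}\nmid\mathcal{M}$, and $f$ a cuspidal Bianchi Hecke eigenform of parallel weight $(k,k)$ and level $U_0(\mathcal{N})$, new at $\mathfrak{p}$. Let $K/F$ be quadratic with relative discriminant $\mathcal{D}_K$ prime to $\mathcal{N}$, $\mathfrak{p}$ inert in $K$, all primes dividing $\mathcal{M}$ split in $K$. Let $L/\mathbb{Q}_p$ be finite, containing $K_\mathfrak{p}$, all embeddings of $F_\mathfrak{p}$ and the Hecke eigenvalues of $f$. Fix $\delta_K\in\mathcal{O}_K\setminus\mathcal{O}_F$ with $\delta_K^2$ generating the discriminant ideal, and a cusp $x\in\mathbb{P}^1(F)$. $V_{k,k}=V_k\otimes V_k$ (polynomials of degree $\le k$ over $L$, action $\left(\begin{smallmatrix}a&b\\c&d\end{smallmatrix}\right)\cdot P(x)=\frac{(a+cx)^k}{(ad-bc)^{k/2}}P(\frac{b+dx}{a+cx})$, through the two conjugate embeddings $F\hookrightarrow L$). $\mathcal{R}=\{\left(\begin{smallmatrix}a&b\\c&d\end{smallmatrix}\right)\in M_2(\mathcal{O}_F[1/\mathfrak{p}]):c\in\mathcal{M}\}$; $\Gamma$ is the image in $\mathrm{PGL}_2$ of its determinant-one elements. $\Delta_0=\mathrm{Div}^0(\mathbb{P}^1(F))$; $\mathcal{H}_\mathfrak{p}^{\mathrm{ur}}=\mathbb{P}^1(\mathbb{Q}_p^{\mathrm{ur}})\setminus\mathbb{P}^1(F_\mathfrak{p})$;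 $\mathrm{Div}(\mathcal{H}_\mathfrak{p}^{\mathrm{ur}})$ the divisors supported there fixed by $\mathrm{Gal}(\mathbb{Q}_p^{\mathrm{ur}}/L\cap\mathbb{Q}_p^{\mathrm{ur}})$, $\mathrm{Div}^0$ the degree-zero ones. $\partial_1:(\Delta_0\otimes\mathrm{Div}^0(\mathcal{H}_\mathfrak{p}^{\mathrm{ur}})\otimes V_{k,k})_\Gamma\to(\Delta_0\otimes\mathrm{Div}(\mathcal{H}_\mathfrak{p}^{\mathrm{ur}})\otimes V_{k,k})_\Gamma$ is the natural map and $\delta:\mathrm{H}_1(\Gamma,\Delta_0\otimes V_{k,k})\to(\Delta_0\otimes\mathrm{Div}^0\otimes V_{k,k})_\Gamma$ the connecting map of the sequence $0\to\mathrm{Div}^0\to\mathrm{Div}\to\mathbb{Z}\to0$ tensored with $\Delta_0\otimes V_{k,k}$. $\mathbf{MS}_\Gamma(L)$ is the space of $\Gamma$-equivariant maps $\mu:\Delta_0\to\mathcal{D}$, where $\mathcal{D}$ is the continuous dual (with right action dual to the weight-$k$ action) of: locally analytic functions on $\mathbb{P}^1(F_\mathfrak{p})$ with pole of order $\le k$ at $\infty$ ($p$ inert), or their completed tensor product with degree-$\le k$ polynomials on $\mathcal{O}_{\bar{\mathfrak{p}}}$ ($p=\mathfrak{p}\bar{\mathfrak{p}}$ split); $\mathbf{MS}_\Gamma(L)_{(f)}$ is its (one-dimensional) $f$-isotypic Hecke subspace and $\mathrm{pr}_f$ the projection of duals. Fix an embedding $\sigma:F_\mathfrak{p}\hookrightarrow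 L$ and $\log_p$ with $\log_p(p)=0$. $\Phi_f^{\log,\sigma},\Phi_f^{\mathrm{ord}}:(\Delta_0\otimes\mathrm{Div}^0\otimes V_{k,k})_\Gamma\to\mathbf{MS}_\Gamma(L)_{(f)}^\vee$ are $\mathrm{pr}_f$ composed with $[(r-s)\otimes(x'-y')\otimes P]\mapsto\big(\mu\mapsto\int\log_p(\frac{t-x'}{t-y'})^\sigma P(t)\,d\mu\{r-s\}(t)\big)$, resp. with $\mathrm{ord}_\mathfrak{p}$ ($\mathrm{ord}_\mathfrak{p}(p)=1$) in place of $\log_p(\cdot)^\sigma$. Let $\mathcal{L}_\mathfrak{p}^\sigma$ be the (existing, unique) scalar with $\Phi_f^{\log,\sigma}\circ\delta=\mathcal{L}_\mathfrak{p}^\sigma\Phi_f^{\mathrm{ord}}\circ\delta$. Set $\mathbf{D}_{f,L}=\mathbf{MS}_\Gamma(L)_{(f)}^\vee\oplus\mathbf{MS}_\Gamma(L)_{(f)}^\vee$, $\mathrm{Fil}^{\frac{k+2}{2}}(\mathbf{D}_{f,L})=\{(-\mathcal{L}_\mathfrak{p}^\sigma y,y)\}$ ($=$ the image of $\Phi_f\circ\delta$), and $\Phi_f=-\Phi_f^{\log,\sigma}\oplus\Phi_f^{\mathrm{ord}}$. A $\mathfrak{p}$-adic Abel–Jacobi map is a homomorphism $\Phi^{\mathrm{AJ}}:(\Delta_0\otimes\mathrm{Div}(\mathcal{H}_\mathfrak{p}^{\mathrm{ur}})\otimes V_{k,k})_\Gamma\to\mathbf{D}_{f,L}/\mathrm{Fil}^{\frac{k+2}{2}}(\mathbf{D}_{f,L})$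 with $\Phi^{\mathrm{AJ}}\circ\partial_1=\Phi_f$ modulo $\mathrm{Fil}^{\frac{k+2}{2}}$. Let $\mathcal{O}$ be an $\mathcal{O}_F[1/\mathfrak{p}]$-order in $K$ of conductor prime to $\mathcal{D}_K\mathcal{N}$; $\Psi:K\hookrightarrow M_2(F)$ is optimal if $\Psi(K)\cap\mathcal{R}=\Psi(\mathcal{O})$. Attached: $\tau_\Psi\in\mathcal{H}_\mathfrak{p}^{\mathrm{ur}}\cap K$ a fixed point of $\Psi(K^\times)$; $P_\Psi=(cX^2+(a-d)X-b)(\bar c\bar X^2+(\bar a-\bar d)\bar X-\bar b)\in V_{2,2}$ for $\Psi(\delta_K)=\left(\begin{smallmatrix}a&b\\c&d\end{smallmatrix}\right)$; $\gamma_\Psi\in\Gamma$ the image of $\Psi(u)$, $u$ a generator of $\mathcal{O}_1^\times/\text{torsion}\cong\mathbb{Z}$ with $\mathcal{O}_1$ the norm-one elements of $\mathcal{O}$. Brackets denote classes in $\Gamma$-coinvariants. *)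

theory Defs
  imports
    "HOL-Analysis.Analysis"
    "HOL-Algebra.Free_Abelian_Groups"
    "HOL-Algebra.Ideal_Product"
    "HOL-Computational_Algebra.Polynomial"
begin

definition is_subfield :: "'a::field set \<Rightarrow> bool" where
  "is_subfield E \<longleftrightarrow> 0 \<in> E \<and> 1 \<in> E \<and> (\<forall>x\<in>E. \<forall>y\<in>E. x - y \<in> E \<and> x * y \<in> E) \<and> (\<forall>x\<in>E. inverse x \<in> E)"

definition quadratic_ext :: "'a::field set \<Rightarrow> 'a set \<Rightarrow> bool" where
  "quadratic_ext k E \<longleftrightarrow> is_subfield k \<and> is_subfield E \<and> k \<subseteq> E \<and>
     (\<exists>\<theta>\<in>E - k. E = {a + b * \<theta> | a b. a \<in> k \<and> b \<in> k})"

definition imaginary_quadratic :: "complex set \<Rightarrow> bool" where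
  "imaginary_quadratic F \<longleftrightarrow> quadratic_ext \<rat> F \<and> \<not> F \<subseteq> \<real>"

definition ints :: "complex set \<Rightarrow> complex set" where
  "ints E = {x \<in> E. algebraic_int x}"

definition ring_on :: "'a::comm_ring_1 set \<Rightarrow> 'a ring" where
  "ring_on A = \<lparr>carrier = A, monoid.mult = (*), one = 1, ring.zero = 0, ring.add = (+)\<rparr>"

definition class_number :: "complex set \<Rightarrow> nat" where
  "class_number E =
     (let Ids = {I. ideal I (ring_on (ints E)) \<and> I \<noteq> {0}} in
      card (Ids // {(I, J). I \<in> Ids \<and> J \<in> Ids \<and>
        (\<exists>a\<in>ints E - {0}. \<exists>b\<in>ints E - {0}. (*) a ` I = (*) b ` J)}))"

definition unramified_at :: "nat \<Rightarrow> complex set \<Rightarrow> bool" where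
  "unramified_at p E \<longleftrightarrow>
     (\<forall>q. primeideal q (ring_on (ints E)) \<longrightarrow> of_nat p \<notin> ideal_prod (ring_on (ints E)) q q)"

definition squarefree_ideal :: "complex set \<Rightarrow> complex set \<Rightarrow> bool" where
  "squarefree_ideal E I \<longleftrightarrow> ideal I (ring_on (ints E)) \<and>
     (\<forall>q. primeideal q (ring_on (ints E)) \<longrightarrow> \<not> I \<subseteq> ideal_prod (ring_on (ints E)) q q)"

definition coprime_ideals :: "'a::comm_ring_1 set \<Rightarrow> 'a set \<Rightarrow> 'a set \<Rightarrow> bool" where
  "coprime_ideals A I J \<longleftrightarrow> I <+>\<^bsub>ring_on A\<^esub> J = A"

definition inert_in :: "complex set \<Rightarrow> complex set \<Rightarrow> bool" where
  "inert_in q K \<longleftrightarrow> primeideal (genideal (ring_on (ints K)) q) (ring_on (ints K))"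

definition split_in :: "complex set \<Rightarrow> complex set \<Rightarrow> bool" where
  "split_in q K \<longleftrightarrow> (\<exists>Q1 Q2. primeideal Q1 (ring_on (ints K)) \<and> primeideal Q2 (ring_on (ints K)) \<and>
     Q1 \<noteq> Q2 \<and> genideal (ring_on (ints K)) q = ideal_prod (ring_on (ints K)) Q1 Q2)"

text \<open>The image of \<open>x\<close> under the non-trivial automorphism of a quadratic extension \<open>K/F\<close>.\<close>
definition rel_conj :: "'a::field set \<Rightarrow> 'a set \<Rightarrow> 'a \<Rightarrow> 'a" where
  "rel_conj F K x = (if x \<in> F then x else (THE y. y \<in> K \<and> x + y \<in> F \<and> x * y \<in> F))"

text \<open>The ideal generated by \<open>det(x\<^sub>i\<^sup>s)\<^sup>2\<close> for all pairs \<open>(x\<^sub>1, x\<^sub>2)\<close> of integers of \<open>K\<close>.\<close>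
definition rel_disc :: "complex set \<Rightarrow> complex set \<Rightarrow> complex set" where
  "rel_disc F K = genideal (ring_on (ints F))
     {(x * rel_conj F K y - y * rel_conj F K x)^2 | x y. x \<in> ints K \<and> y \<in> ints K}"

definition prime_elem_of :: "complex set \<Rightarrow> complex \<Rightarrow> bool" where
  "prime_elem_of F w \<longleftrightarrow> w \<in> ints F \<and> w \<noteq> 0 \<and>
     primeideal (cgenideal (ring_on (ints F)) w) (ring_on (ints F))"

definition residues_mod :: "complex set \<Rightarrow> complex \<Rightarrow> complex set" where
  "residues_mod F w = (SOME A. A \<subseteq> ints F \<and>
     (\<forall>x\<in>ints F. \<exists>!a. a \<in> A \<and> x - a \<in> cgenideal (ring_on (ints F)) w))"

definition mat2 :: "'a \<Rightarrow> 'a \<Rightarrow> 'a \<Rightarrow> 'a \<Rightarrow> 'a::zero^2^2" where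
  "mat2 a b c d = vector [vector [a, b], vector [c, d]]"

text \<open>
  The class number of \<open>F\<close> being one, an automorphic form of level \<open>U\<^sub>0(N)\<close> is determined by its
  restriction to \<open>GL\<^sub>2(\<complex>)\<close>, which is left invariant under \<open>\<Gamma>\<^sub>0(N) = U\<^sub>0(N) \<inter> GL\<^sub>2(F)\<close>. The weight
  being even, forms are normalised to have trivial central character, in accordance with the
  factor \<open>det\<^sup>-\<^sup>k\<^sup>/\<^sup>2\<close> in the action on \<open>V\<^sub>k\<close>: the Hecke eigenvalue at \<open>q\<close> is the usual one divided
  by the \<open>k/2\<close>-th power of the norm of \<open>q\<close>.  Values lie in \<open>V\<^sub>2\<^sub>k\<^sub>+\<^sub>2(\<complex>)\<close>, a polynomial
  \<open>p\<close> of degree at most \<open>n\<close> standing for the binary form \<open>Y\<^sup>n p(X/Y)\<close>.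
\<close>

definition Gamma0 :: "complex set \<Rightarrow> complex set \<Rightarrow> (complex^2^2) set" where
  "Gamma0 F N = {g. (\<forall>i j. g $ i $ j \<in> ints F) \<and> inverse (det g) \<in> ints F \<and> det g \<noteq> 0 \<and> g $ 2 $ 1 \<in> N}"

definition SU2 :: "(complex^2^2) set" where
  "SU2 = {u. u ** (\<chi> i j. cnj (u $ j $ i)) = mat 1 \<and> det u = 1}"

text \<open>\<open>(P|u)(v) = P(u v)\<close> on binary forms of degree \<open>n\<close>.\<close>
definition form_subst :: "nat \<Rightarrow> complex^2^2 \<Rightarrow> complex poly \<Rightarrow> complex poly" where
  "form_subst n u P = (\<Sum>i\<le>n. smult (coeff P i)
     ([:u $ 1 $ 2, u $ 1 $ 1:] ^ i * [:u $ 2 $ 2, u $ 2 $ 1:] ^ (n - i)))"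

text \<open>The left invariant vector field attached to \<open>X\<close>, and its components in
  \<open>gl\<^sub>2(\<complex>) \<otimes>\<^sub>\<real> \<complex> = gl\<^sub>2(\<complex>) \<oplus> gl\<^sub>2(\<complex>)\<close>: linear in \<open>X\<close> for \<open>s = 1\<close>, antilinear for \<open>s = -1\<close>.\<close>
definition lie_deriv :: "complex^2^2 \<Rightarrow> (complex^2^2 \<Rightarrow> complex) \<Rightarrow> complex^2^2 \<Rightarrow> complex" where
  "lie_deriv X h = (\<lambda>g. frechet_derivative h (at g) (g ** X))"

definition lie_part :: "complex \<Rightarrow> complex^2^2 \<Rightarrow> (complex^2^2 \<Rightarrow> complex) \<Rightarrow> complex^2^2 \<Rightarrow> complex" where
  "lie_part s X h = (\<lambda>g. (lie_deriv X h g - s * \<i> * lie_deriv (\<chi> i j. \<i> * X $ i $ j) h g) / 2)"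

definition casimir :: "complex \<Rightarrow> (complex^2^2 \<Rightarrow> complex) \<Rightarrow> complex^2^2 \<Rightarrow> complex" where
  "casimir s h = (let H = lie_part s (mat2 1 0 0 (-1)); X = lie_part s (mat2 0 1 0 0);
       Y = lie_part s (mat2 0 0 1 0)
     in (\<lambda>g. H (H h) g / 2 + X (Y h) g + Y (X h) g))"

definition smooth_on_set :: "'a::real_normed_vector set \<Rightarrow> ('a \<Rightarrow> complex) \<Rightarrow> bool" where
  "smooth_on_set U h \<longleftrightarrow> (\<exists>\<S>. h \<in> \<S> \<and> (\<forall>u\<in>\<S>. (\<forall>x\<in>U. u differentiable (at x)) \<and>
     (\<forall>v. (\<lambda>x. frechet_derivative u (at x) v) \<in> \<S>)))"

text \<open>Cuspidality is the vanishing, at every cusp, of the integral over a fundamental parallelogram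
  of the ideal \<open>N = \<nu>(\<int> + \<int>\<omega>)\<close>, whose translations lie in every conjugate of \<open>\<Gamma>\<^sub>0(N)\<close>.\<close>
definition bianchi_cusp_form ::
    "complex set \<Rightarrow> nat \<Rightarrow> complex set \<Rightarrow> (complex^2^2 \<Rightarrow> complex poly) \<Rightarrow> bool" where
  "bianchi_cusp_form F k N f \<longleftrightarrow>
     (\<forall>g. degree (f g) \<le> 2 * k + 2) \<and>
     (\<forall>\<gamma>\<in>Gamma0 F N. \<forall>g. det g \<noteq> 0 \<longrightarrow> f (\<gamma> ** g) = f g) \<and>
     (\<forall>z g. z \<noteq> 0 \<and> det g \<noteq> 0 \<longrightarrow> f (mat z ** g) = f g) \<and>
     (\<forall>u\<in>SU2. \<forall>g. det g \<noteq> 0 \<longrightarrow> f (g ** u) = form_subst (2 * k + 2) u (f g)) \<and>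
     (\<forall>i. smooth_on_set {g. det g \<noteq> 0} (\<lambda>g. coeff (f g) i)) \<and>
     (\<forall>i. \<forall>s\<in>{1, -1}. \<forall>g. det g \<noteq> 0 \<longrightarrow>
        casimir s (\<lambda>g. coeff (f g) i) g = (of_nat k ^ 2 / 2 + of_nat k) * coeff (f g) i) \<and>
     (\<exists>C m. \<forall>i g. det g = 1 \<longrightarrow> norm (coeff (f g) i) \<le> C * norm g ^ m) \<and>
     (\<forall>i \<nu> \<omega> \<gamma> g. N = cgenideal (ring_on (ints F)) \<nu> \<and> ints F = {of_int m + of_int n * \<omega> | m n. True} \<and>
        \<gamma> \<in> Gamma0 F (ints F) \<and> det \<gamma> = 1 \<and> det g \<noteq> 0 \<longrightarrow>
        integral (cbox (0, 0) (1, 1))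
          (\<lambda>(s, t). coeff (f (\<gamma> ** mat2 1 (\<nu> * (of_real s + of_real t * \<omega>)) 0 1 ** g)) i) = 0)"

text \<open>\<open>T\<^sub>w\<close> for \<open>w\<close> not dividing \<open>N\<close>, and \<open>U\<^sub>w\<close> otherwise.\<close>
definition hecke_form ::
    "complex set \<Rightarrow> complex set \<Rightarrow> complex \<Rightarrow> (complex^2^2 \<Rightarrow> complex poly) \<Rightarrow> complex^2^2 \<Rightarrow> complex poly" where
  "hecke_form F N w f g = (\<Sum>a\<in>residues_mod F w. f (mat2 1 a 0 w ** g)) +
     (if N \<subseteq> cgenideal (ring_on (ints F)) w then 0 else f (mat2 w 0 0 1 ** g))"

definition hecke_eigenform ::
    "complex set \<Rightarrow> nat \<Rightarrow> complex set \<Rightarrow> (complex^2^2 \<Rightarrow> complex poly) \<Rightarrow> bool" where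
  "hecke_eigenform F k N f \<longleftrightarrow> bianchi_cusp_form F k N f \<and> (\<exists>g. det g \<noteq> 0 \<and> f g \<noteq> 0) \<and>
     (\<forall>w. prime_elem_of F w \<longrightarrow>
        (\<exists>l. \<forall>g. det g \<noteq> 0 \<longrightarrow> hecke_form F N w f g = smult l (f g)))"

definition hecke_eigenvalue ::
    "complex set \<Rightarrow> complex set \<Rightarrow> (complex^2^2 \<Rightarrow> complex poly) \<Rightarrow> complex \<Rightarrow> complex" where
  "hecke_eigenvalue F N f w = (THE l. \<forall>g. det g \<noteq> 0 \<longrightarrow> hecke_form F N w f g = smult l (f g))"

text \<open>Hyperbolic three-space as the set of \<open>(z, t)\<close> with \<open>t > 0\<close>.\<close>
definition H3_act :: "complex^2^2 \<Rightarrow> complex \<times> real \<Rightarrow> complex \<times> real" where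
  "H3_act g = (\<lambda>(z, t).
     let a = g $ 1 $ 1; b = g $ 1 $ 2; c = g $ 2 $ 1; d = g $ 2 $ 2;
         r = (cmod (c * z + d))^2 + (cmod c)^2 * t^2
     in (((a * z + b) * cnj (c * z + d) + a * cnj c * of_real (t^2)) / of_real r, cmod (det g) * t / r))"

definition H3_fundamental_domain :: "(complex^2^2) set \<Rightarrow> (complex \<times> real) set \<Rightarrow> bool" where
  "H3_fundamental_domain \<Gamma> D \<longleftrightarrow> D \<in> sets borel \<and> D \<subseteq> {x. snd x > 0} \<and>
     (\<forall>x. snd x > 0 \<longrightarrow> (\<exists>\<gamma>\<in>\<Gamma>. H3_act \<gamma> x \<in> D)) \<and>
     (\<forall>\<gamma>\<in>\<Gamma>. (\<exists>z. \<gamma> = mat z) \<or> {x \<in> D. H3_act \<gamma> x \<in> D} \<in> null_sets lborel)"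

text \<open>The integrand is the \<open>SU\<^sub>2\<close>-invariant Hermitian form on \<open>V\<^sub>n(\<complex>)\<close>, \<open>n = 2k + 2\<close>; the measure
  \<open>dz dt / t\<^sup>3\<close> is the hyperbolic one.\<close>
definition petersson ::
    "nat \<Rightarrow> (complex \<times> real) set \<Rightarrow> (complex^2^2 \<Rightarrow> complex poly) \<Rightarrow> (complex^2^2 \<Rightarrow> complex poly) \<Rightarrow> complex" where
  "petersson k D f h = (LINT x:D|lborel.
     (let g = mat2 (of_real (snd x)) (fst x) 0 1 in
       (\<Sum>i\<le>2 * k + 2. coeff (f g) i * cnj (coeff (h g) i) / of_nat ((2 * k + 2) choose i)) / of_real (snd x ^ 3)))"

text \<open>Orthogonality to both degenerations of all forms of level \<open>M\<close>, for \<open>N = P M\<close>.\<close>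
definition new_at ::
    "complex set \<Rightarrow> nat \<Rightarrow> complex set \<Rightarrow> complex set \<Rightarrow> (complex^2^2 \<Rightarrow> complex poly) \<Rightarrow> bool" where
  "new_at F k P M f \<longleftrightarrow>
     (\<forall>h D w. bianchi_cusp_form F k M h \<and>
        H3_fundamental_domain (Gamma0 F (ideal_prod (ring_on (ints F)) P M)) D \<and>
        P = cgenideal (ring_on (ints F)) w \<longrightarrow>
        petersson k D f h = 0 \<and> petersson k D f (\<lambda>g. h (mat2 w 0 0 1 ** g)) = 0)"

text \<open>
  The type \<open>'c\<close> plays the role of \<open>\<complex>\<^sub>p\<close>: an algebraically closed field, complete for an absolute
  value extending the normalised one of \<open>\<rat>\<^sub>p\<close>.  All $p$-adic fields are subfields of it.
\<close>
definition pabs :: "'c::{zero, metric_space} \<Rightarrow> real" where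
  "pabs x = dist x 0"

definition padic_absolute_value :: "'c::{alg_closed_field, field_char_0, complete_space} itself \<Rightarrow> nat \<Rightarrow> bool" where
  "padic_absolute_value _ p \<longleftrightarrow> (\<forall>x y :: 'c. dist x y = pabs (x - y)) \<and>
     (\<forall>x y :: 'c. pabs (x * y) = pabs x * pabs y) \<and>
     (\<forall>x y :: 'c. pabs (x + y) \<le> max (pabs x) (pabs y)) \<and>
     pabs (of_nat p :: 'c) = 1 / real p"

definition Qp :: "'c::{field_char_0, metric_space} set" where
  "Qp = closure (range of_rat)"

definition finite_ext :: "'a::field set \<Rightarrow> 'a set \<Rightarrow> bool" where
  "finite_ext k E \<longleftrightarrow> is_subfield k \<and> is_subfield E \<and> k \<subseteq> E \<and>
     (\<exists>B. finite B \<and> E = {\<Sum>b\<in>B. q b * b | q. q \<in> B \<rightarrow> k} \<and> B \<subseteq> E)"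

definition Qp_ur :: "'c::{field_char_0, metric_space} set" where
  "Qp_ur = \<Union>{E. finite_ext Qp E \<and> pabs ` (E - {0}) = pabs ` (Qp - {0} :: 'c set)}"

definition field_embedding :: "'a::field set \<Rightarrow> 'a set \<Rightarrow> ('a \<Rightarrow> 'a) \<Rightarrow> bool" where
  "field_embedding k E s \<longleftrightarrow>
     (\<forall>x\<in>E. \<forall>y\<in>E. s (x + y) = s x + s y \<and> s (x * y) = s x * s y) \<and> (\<forall>x\<in>k. s x = x)"

definition embeds_algebraic_numbers :: "(complex \<Rightarrow> 'c::field) \<Rightarrow> bool" where
  "embeds_algebraic_numbers e \<longleftrightarrow> e 1 = 1 \<and>
     (\<forall>x y. algebraic x \<and> algebraic y \<longrightarrow> e (x + y) = e x + e y \<and> e (x * y) = e x * e y)"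

text \<open>The branch of the logarithm with \<open>log p = 0\<close>.\<close>
definition is_padic_log :: "nat \<Rightarrow> ('c::{field_char_0, metric_space} \<Rightarrow> 'c) \<Rightarrow> bool" where
  "is_padic_log p l \<longleftrightarrow> (\<forall>x y. x \<noteq> 0 \<and> y \<noteq> 0 \<longrightarrow> l (x * y) = l x + l y) \<and>
     (\<forall>x. pabs x < 1 \<longrightarrow> (\<lambda>n. (-1) ^ n * x ^ Suc n / of_nat (Suc n)) sums l (1 + x)) \<and>
     l (of_nat p) = 0"

text \<open>
  \<open>emb\<close> is an embedding of the algebraic numbers into \<open>\<complex>\<^sub>p\<close>; it induces the prime $\mathfrak p$ of
  \<open>F = base\<close> and identifies the algebraic Hecke eigenvalues with elements of \<open>L = coef\<close>.
  \<open>K = quad\<close>, \<open>M = tame\<close> is the prime-to-$\mathfrak p$ part of the level, \<open>plog\<close> is the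
  $p$-adic logarithm. The fixed embedding $\sigma$ of $F_{\mathfrak p}$ is applied to logarithms of
  elements of the maximal unramified extension, so \<open>sig\<close> is an extension of it to \<open>Qp_ur\<close>.
\<close>
record 'c sh_data =
  prm :: nat
  emb :: "complex \<Rightarrow> 'c"
  base :: "complex set"
  quad :: "complex set"
  wt :: nat
  tame :: "complex set"
  form :: "complex^2^2 \<Rightarrow> complex poly"
  coef :: "'c set"
  sig :: "'c \<Rightarrow> 'c"
  plog :: "'c \<Rightarrow> 'c"

definition OF :: "'c::{field_char_0, metric_space} sh_data \<Rightarrow> complex set" where
  "OF S = ints (base S)"

definition pp :: "'c::{field_char_0, metric_space} sh_data \<Rightarrow> complex set" where
  "pp S = {x \<in> OF S. pabs (emb S x) < 1}"

definition level :: "'c::{field_char_0, metric_space} sh_data \<Rightarrow> complex set" where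
  "level S = ideal_prod (ring_on (OF S)) (pp S) (tame S)"

definition p_inert :: "'c::{field_char_0, metric_space} sh_data \<Rightarrow> bool" where
  "p_inert S \<longleftrightarrow> primeideal (cgenideal (ring_on (OF S)) (of_nat (prm S))) (ring_on (OF S))"

text \<open>\<open>away S F\<close> and \<open>away S K\<close> are the rings of integers with $\mathfrak p$ inverted; recall that
  $\mathfrak p$ is principal.\<close>
definition away :: "'c::{field_char_0, metric_space} sh_data \<Rightarrow> complex set \<Rightarrow> complex set" where
  "away S E = {x \<in> E. \<exists>w n. pp S = cgenideal (ring_on (OF S)) w \<and> w ^ n * x \<in> ints E}"

definition OFp :: "'c::{field_char_0, metric_space} sh_data \<Rightarrow> complex set" where
  "OFp S = away S (base S)"

definition Fp :: "'c::{field_char_0, metric_space} sh_data \<Rightarrow> 'c set" where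
  "Fp S = closure (emb S ` base S)"

definition Kp :: "'c::{field_char_0, metric_space} sh_data \<Rightarrow> 'c set" where
  "Kp S = closure (emb S ` quad S)"

definition eigval :: "'c::{field_char_0, metric_space} sh_data \<Rightarrow> complex \<Rightarrow> 'c" where
  "eigval S w = emb S (hecke_eigenvalue (base S) (level S) (form S) w)"

definition RR :: "'c::{field_char_0, metric_space} sh_data \<Rightarrow> (complex^2^2) set" where
  "RR S = {g. (\<forall>i j. g $ i $ j \<in> OFp S) \<and> g $ 2 $ 1 \<in> genideal (ring_on (OFp S)) (tame S)}"

definition R1 :: "'c::{field_char_0, metric_space} sh_data \<Rightarrow> (complex^2^2) set" where
  "R1 S = {g \<in> RR S. det g = 1}"

definition GL2 :: "complex set \<Rightarrow> (complex^2^2) monoid" where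
  "GL2 F = \<lparr>carrier = {g. (\<forall>i j. g $ i $ j \<in> F) \<and> det g \<noteq> 0}, monoid.mult = (**), one = mat 1\<rparr>"

definition scalars :: "complex set \<Rightarrow> (complex^2^2) set" where
  "scalars F = {mat z | z. z \<in> F - {0}}"

definition pgl :: "complex set \<Rightarrow> complex^2^2 \<Rightarrow> (complex^2^2) set" where
  "pgl F g = scalars F #>\<^bsub>GL2 F\<^esub> g"

definition Gam :: "'c::{field_char_0, metric_space} sh_data \<Rightarrow> (complex^2^2) set monoid" where
  "Gam S = (GL2 (base S) Mod scalars (base S))\<lparr>carrier := pgl (base S) ` R1 S\<rparr>"

text \<open>All actions of matrices below are trivial on scalars, so that a class in \<open>PGL\<^sub>2\<close> acts through any
  representative.\<close>
definition rep :: "'m set \<Rightarrow> 'm" where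
  "rep \<gamma> = (SOME g. g \<in> \<gamma>)"

definition P1 :: "'a set \<Rightarrow> 'a option set" where
  "P1 E = insert None (Some ` E)"

definition moebius :: "complex^2^2 \<Rightarrow> complex option \<Rightarrow> complex option" where
  "moebius g x = (let a = g $ 1 $ 1; b = g $ 1 $ 2; c = g $ 2 $ 1; d = g $ 2 $ 2 in
     case x of None \<Rightarrow> (if c = 0 then None else Some (a / c))
     | Some z \<Rightarrow> (if c * z + d = 0 then None else Some ((a * z + b) / (c * z + d))))"

definition frag_deg :: "('a \<Rightarrow>\<^sub>0 int) \<Rightarrow> int" where
  "frag_deg D = (\<Sum>x\<in>Poly_Mapping.keys D. Poly_Mapping.lookup D x)"

definition Delta0 :: "'c::{field_char_0, metric_space} sh_data \<Rightarrow> (complex option \<Rightarrow>\<^sub>0 int) set" where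
  "Delta0 S = {D \<in> carrier (free_Abelian_group (P1 (base S))). frag_deg D = 0}"

definition cusp_act :: "complex^2^2 \<Rightarrow> (complex option \<Rightarrow>\<^sub>0 int) \<Rightarrow> (complex option \<Rightarrow>\<^sub>0 int)" where
  "cusp_act g = frag_extend (\<lambda>x. frag_of (moebius g x))"

text \<open>The point at infinity is $F_{\mathfrak p}$-rational, so no point at infinity is needed.\<close>
definition Hur :: "'c::{field_char_0, metric_space} sh_data \<Rightarrow> 'c set" where
  "Hur S = Qp_ur - Fp S"

definition DivH :: "'c::{field_char_0, metric_space} sh_data \<Rightarrow> ('c \<Rightarrow>\<^sub>0 int) set" where
  "DivH S = {E \<in> carrier (free_Abelian_group (Hur S)).
     \<forall>s. field_embedding (coef S \<inter> Qp_ur) Qp_ur s \<and> bij_betw s Qp_ur Qp_ur \<longrightarrow>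
       (\<forall>x\<in>Hur S. Poly_Mapping.lookup E (s x) = Poly_Mapping.lookup E x)}"

definition Div0H :: "'c::{field_char_0, metric_space} sh_data \<Rightarrow> ('c \<Rightarrow>\<^sub>0 int) set" where
  "Div0H S = {E \<in> DivH S. frag_deg E = 0}"

text \<open>
  The action on \<open>V\<^sub>k\<close> is by substituting \<open>x \<mapsto> (b + d x) / (a + c x)\<close>.  The compatible left action
  on the $p$-adic line (the one for which the function \<open>log((t - x)/(t - y)) P(t)\<close> is carried to
  \<open>log((t - \<gamma>x)/(t - \<gamma>y)) (\<gamma>P)(t)\<close> up to adding a multiple of \<open>\<gamma>P\<close>, and for which the fixed
  points of \<open>\<Psi>(K\<^sup>\<times>)\<close> are the roots of the first factor of \<open>P\<^sub>\<Psi>\<close>) is by the inverse of that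
  substitution. It is the usual one in the coordinate \<open>-x\<close>.
\<close>
definition Hp_moebius :: "'c::{field_char_0, metric_space} sh_data \<Rightarrow> complex^2^2 \<Rightarrow> 'c \<Rightarrow> 'c" where
  "Hp_moebius S g x = (emb S (g $ 1 $ 1) * x - emb S (g $ 1 $ 2)) / (emb S (g $ 2 $ 2) - emb S (g $ 2 $ 1) * x)"

definition Hp_act :: "'c::{field_char_0, metric_space} sh_data \<Rightarrow> complex^2^2 \<Rightarrow> ('c \<Rightarrow>\<^sub>0 int) \<Rightarrow> ('c \<Rightarrow>\<^sub>0 int)" where
  "Hp_act S g = frag_extend (\<lambda>x. frag_of (Hp_moebius S g x))"

text \<open>\<open>V\<^sub>k \<otimes>\<^sub>L V\<^sub>k\<close> as polynomials in two variables, of degree at most \<open>k\<close> in each.\<close>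
definition poly_X :: "'c::comm_ring_1 poly \<Rightarrow> 'c poly poly" where
  "poly_X q = [:q:]"

definition poly_Y :: "'c::comm_ring_1 poly \<Rightarrow> 'c poly poly" where
  "poly_Y q = map_poly (\<lambda>c. [:c:]) q"

definition bicoeff :: "'c::comm_ring_1 poly poly \<Rightarrow> nat \<Rightarrow> nat \<Rightarrow> 'c" where
  "bicoeff P i j = coeff (coeff P j) i"

definition bieval :: "'c::comm_ring_1 poly poly \<Rightarrow> 'c \<Rightarrow> 'c \<Rightarrow> 'c" where
  "bieval P x y = poly (poly P [:y:]) x"

definition Vkk :: "'c::{field_char_0, metric_space} sh_data \<Rightarrow> 'c poly poly set" where
  "Vkk S = {P. \<forall>i j. bicoeff P i j \<in> coef S \<and> (bicoeff P i j \<noteq> 0 \<longrightarrow> i \<le> wt S \<and> j \<le> wt S)}"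

definition emb2 :: "'c sh_data \<Rightarrow> complex \<Rightarrow> 'c" where
  "emb2 S z = emb S (cnj z)"

definition det_factor :: "'c::{field_char_0, metric_space} sh_data \<Rightarrow> complex^2^2 \<Rightarrow> 'c" where
  "det_factor S g = (emb S (det g) * emb2 S (det g)) ^ (wt S div 2)"

definition V_act :: "'c::{field_char_0, metric_space} sh_data \<Rightarrow> complex^2^2 \<Rightarrow> 'c poly poly \<Rightarrow> 'c poly poly" where
  "V_act S g P = (let a = g $ 1 $ 1; b = g $ 1 $ 2; c = g $ 2 $ 1; d = g $ 2 $ 2; k = wt S in
     \<Sum>i\<le>k. \<Sum>j\<le>k. smult [:bicoeff P i j / det_factor S g:]
       (poly_X ([:emb S b, emb S d:] ^ i * [:emb S a, emb S c:] ^ (k - i)) *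
        poly_Y ([:emb2 S b, emb2 S d:] ^ j * [:emb2 S a, emb2 S c:] ^ (k - j))))"

text \<open>The map between quotients induced by \<open>\<phi>\<close>, with target \<open>G' Mod H'\<close>.\<close>
definition quot_map :: "('b, 'm) monoid_scheme \<Rightarrow> 'b set \<Rightarrow> ('a \<Rightarrow> 'b) \<Rightarrow> 'a set \<Rightarrow> 'b set" where
  "quot_map G' H' \<phi> X = the_elem ((\<lambda>x. H' #>\<^bsub>G'\<^esub> \<phi> x) ` X)"

definition rel2 :: "'a::ab_group_add set \<Rightarrow> 'b::ab_group_add set \<Rightarrow> ('a \<times> 'b \<Rightarrow>\<^sub>0 int) set" where
  "rel2 A B = generate (free_Abelian_group (A \<times> B))
     ({frag_of (a + a', b) - frag_of (a, b) - frag_of (a', b) | a a' b. a \<in> A \<and> a' \<in> A \<and> b \<in> B} \<union>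
      {frag_of (a, b + b') - frag_of (a, b) - frag_of (a, b') | a b b'. a \<in> A \<and> b \<in> B \<and> b' \<in> B})"

definition tensor2 :: "'a::ab_group_add set \<Rightarrow> 'b::ab_group_add set \<Rightarrow> ('a \<times> 'b \<Rightarrow>\<^sub>0 int) set monoid" where
  "tensor2 A B = free_Abelian_group (A \<times> B) Mod rel2 A B"

definition rel3 :: "'a::ab_group_add set \<Rightarrow> 'b::ab_group_add set \<Rightarrow> 'd::ab_group_add set
    \<Rightarrow> ('a \<times> 'b \<times> 'd \<Rightarrow>\<^sub>0 int) set" where
  "rel3 A B C = generate (free_Abelian_group (A \<times> B \<times> C))
     ({frag_of (a + a', b, c) - frag_of (a, b, c) - frag_of (a', b, c) | a a' b c.
         a \<in> A \<and> a' \<in> A \<and> b \<in> B \<and> c \<in> C} \<union>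
      {frag_of (a, b + b', c) - frag_of (a, b, c) - frag_of (a, b', c) | a b b' c.
         a \<in> A \<and> b \<in> B \<and> b' \<in> B \<and> c \<in> C} \<union>
      {frag_of (a, b, c + c') - frag_of (a, b, c) - frag_of (a, b, c') | a b c c'.
         a \<in> A \<and> b \<in> B \<and> c \<in> C \<and> c' \<in> C})"

definition tensor3 :: "'a::ab_group_add set \<Rightarrow> 'b::ab_group_add set \<Rightarrow> 'd::ab_group_add set
    \<Rightarrow> ('a \<times> 'b \<times> 'd \<Rightarrow>\<^sub>0 int) set monoid" where
  "tensor3 A B C = free_Abelian_group (A \<times> B \<times> C) Mod rel3 A B C"

definition coinv_sub :: "('g, 'n) monoid_scheme \<Rightarrow> ('g \<Rightarrow> 'a \<Rightarrow> 'a) \<Rightarrow> ('a, 'm) monoid_scheme \<Rightarrow> 'a set" where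
  "coinv_sub G act M = generate M {act g m \<otimes>\<^bsub>M\<^esub> inv\<^bsub>M\<^esub> m | g m. g \<in> carrier G \<and> m \<in> carrier M}"

definition coinv :: "('g, 'n) monoid_scheme \<Rightarrow> ('g \<Rightarrow> 'a \<Rightarrow> 'a) \<Rightarrow> ('a, 'm) monoid_scheme \<Rightarrow> 'a set monoid" where
  "coinv G act M = M Mod coinv_sub G act M"

text \<open>First homology with coefficients in a left module, by inhomogeneous chains
  \<open>M \<otimes> \<int>[G\<^sup>n]\<close>, the module being turned into a right one by inversion: \<open>d(m[g]) = g\<inverse>m - m\<close> and
  \<open>d(m[g,h]) = g\<inverse>m[h] - m[gh] + m[g]\<close>.\<close>
definition chains1 :: "('g, 'n) monoid_scheme \<Rightarrow> ('a, 'm) monoid_scheme \<Rightarrow> ('g \<Rightarrow> 'a) monoid" where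
  "chains1 G M = sum_group (carrier G) (\<lambda>_. M)"

definition chain1 :: "('g, 'n) monoid_scheme \<Rightarrow> ('a, 'm) monoid_scheme \<Rightarrow> 'g \<Rightarrow> 'a \<Rightarrow> 'g \<Rightarrow> 'a" where
  "chain1 G M g m = (\<lambda>h\<in>carrier G. if h = g then m else \<one>\<^bsub>M\<^esub>)"

definition bdry1 :: "('g, 'n) monoid_scheme \<Rightarrow> ('g \<Rightarrow> 'a \<Rightarrow> 'a) \<Rightarrow> ('a, 'm) monoid_scheme \<Rightarrow> ('g \<Rightarrow> 'a) \<Rightarrow> 'a" where
  "bdry1 G act M c = gfinprod M (\<lambda>g. act (inv\<^bsub>G\<^esub> g) (c g) \<otimes>\<^bsub>M\<^esub> inv\<^bsub>M\<^esub> (c g)) (carrier G)"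

definition cycles1 :: "('g, 'n) monoid_scheme \<Rightarrow> ('g \<Rightarrow> 'a \<Rightarrow> 'a) \<Rightarrow> ('a, 'm) monoid_scheme \<Rightarrow> ('g \<Rightarrow> 'a) set" where
  "cycles1 G act M = {c \<in> carrier (chains1 G M). bdry1 G act M c = \<one>\<^bsub>M\<^esub>}"

definition boundaries1 :: "('g, 'n) monoid_scheme \<Rightarrow> ('g \<Rightarrow> 'a \<Rightarrow> 'a) \<Rightarrow> ('a, 'm) monoid_scheme \<Rightarrow> ('g \<Rightarrow> 'a) set" where
  "boundaries1 G act M = generate (chains1 G M)
     {chain1 G M h (act (inv\<^bsub>G\<^esub> g) m) \<otimes>\<^bsub>chains1 G M\<^esub>
        (inv\<^bsub>chains1 G M\<^esub> chain1 G M (g \<otimes>\<^bsub>G\<^esub> h) m) \<otimes>\<^bsub>chains1 G M\<^esub> chain1 G M g m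
      | g h m. g \<in> carrier G \<and> h \<in> carrier G \<and> m \<in> carrier M}"

definition homology1 :: "('g, 'n) monoid_scheme \<Rightarrow> ('g \<Rightarrow> 'a \<Rightarrow> 'a) \<Rightarrow> ('a, 'm) monoid_scheme \<Rightarrow> ('g \<Rightarrow> 'a) set monoid" where
  "homology1 G act M = (chains1 G M)\<lparr>carrier := cycles1 G act M\<rparr> Mod boundaries1 G act M"

type_synonym 'c triple = "(complex option \<Rightarrow>\<^sub>0 int) \<times> ('c \<Rightarrow>\<^sub>0 int) \<times> 'c poly poly"

definition T2 :: "'c::{field_char_0, metric_space} sh_data \<Rightarrow> ((complex option \<Rightarrow>\<^sub>0 int) \<times> 'c poly poly \<Rightarrow>\<^sub>0 int) set monoid" where
  "T2 S = tensor2 (Delta0 S) (Vkk S)"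

definition T3 :: "'c::{field_char_0, metric_space} sh_data \<Rightarrow> ('c \<Rightarrow>\<^sub>0 int) set \<Rightarrow> ('c triple \<Rightarrow>\<^sub>0 int) set monoid" where
  "T3 S B = tensor3 (Delta0 S) B (Vkk S)"

definition act2 :: "'c::{field_char_0, metric_space} sh_data \<Rightarrow> (complex^2^2) set
    \<Rightarrow> ((complex option \<Rightarrow>\<^sub>0 int) \<times> 'c poly poly \<Rightarrow>\<^sub>0 int) set \<Rightarrow> ((complex option \<Rightarrow>\<^sub>0 int) \<times> 'c poly poly \<Rightarrow>\<^sub>0 int) set" where
  "act2 S \<gamma> = quot_map (free_Abelian_group (Delta0 S \<times> Vkk S)) (rel2 (Delta0 S) (Vkk S))
     (frag_extend (\<lambda>(D, P). frag_of (cusp_act (rep \<gamma>) D, V_act S (rep \<gamma>) P)))"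

definition act3 :: "'c::{field_char_0, metric_space} sh_data \<Rightarrow> ('c \<Rightarrow>\<^sub>0 int) set \<Rightarrow> (complex^2^2) set
    \<Rightarrow> ('c triple \<Rightarrow>\<^sub>0 int) set \<Rightarrow> ('c triple \<Rightarrow>\<^sub>0 int) set" where
  "act3 S B \<gamma> = quot_map (free_Abelian_group (Delta0 S \<times> B \<times> Vkk S)) (rel3 (Delta0 S) B (Vkk S))
     (frag_extend (\<lambda>(D, E, P). frag_of (cusp_act (rep \<gamma>) D, Hp_act S (rep \<gamma>) E, V_act S (rep \<gamma>) P)))"

definition Coinv3 :: "'c::{field_char_0, metric_space} sh_data \<Rightarrow> ('c \<Rightarrow>\<^sub>0 int) set \<Rightarrow> ('c triple \<Rightarrow>\<^sub>0 int) set set monoid" where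
  "Coinv3 S B = coinv (Gam S) (act3 S B) (T3 S B)"

definition coinv_class :: "'c::{field_char_0, metric_space} sh_data \<Rightarrow> ('c \<Rightarrow>\<^sub>0 int) set
    \<Rightarrow> ('c triple \<Rightarrow>\<^sub>0 int) set \<Rightarrow> ('c triple \<Rightarrow>\<^sub>0 int) set set" where
  "coinv_class S B X = coinv_sub (Gam S) (act3 S B) (T3 S B) #>\<^bsub>T3 S B\<^esub> X"

definition pure3 :: "'c::{field_char_0, metric_space} sh_data \<Rightarrow> ('c \<Rightarrow>\<^sub>0 int) set
    \<Rightarrow> (complex option \<Rightarrow>\<^sub>0 int) \<Rightarrow> ('c \<Rightarrow>\<^sub>0 int) \<Rightarrow> 'c poly poly \<Rightarrow> ('c triple \<Rightarrow>\<^sub>0 int) set set" where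
  "pure3 S B D E P = coinv_class S B
     (rel3 (Delta0 S) B (Vkk S) #>\<^bsub>free_Abelian_group (Delta0 S \<times> B \<times> Vkk S)\<^esub> frag_of (D, E, P))"

definition incl3 :: "'c::{field_char_0, metric_space} sh_data \<Rightarrow> ('c triple \<Rightarrow>\<^sub>0 int) set \<Rightarrow> ('c triple \<Rightarrow>\<^sub>0 int) set" where
  "incl3 S = quot_map (free_Abelian_group (Delta0 S \<times> DivH S \<times> Vkk S)) (rel3 (Delta0 S) (DivH S) (Vkk S)) (\<lambda>c. c)"

definition partial1 :: "'c::{field_char_0, metric_space} sh_data \<Rightarrow> ('c triple \<Rightarrow>\<^sub>0 int) set set \<Rightarrow> ('c triple \<Rightarrow>\<^sub>0 int) set set" where
  "partial1 S = quot_map (T3 S (DivH S)) (coinv_sub (Gam S) (act3 S (DivH S)) (T3 S (DivH S))) (incl3 S)"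

definition deg3 :: "'c::{field_char_0, metric_space} sh_data \<Rightarrow> ('c triple \<Rightarrow>\<^sub>0 int) set
    \<Rightarrow> ((complex option \<Rightarrow>\<^sub>0 int) \<times> 'c poly poly \<Rightarrow>\<^sub>0 int) set" where
  "deg3 S = quot_map (free_Abelian_group (Delta0 S \<times> Vkk S)) (rel2 (Delta0 S) (Vkk S))
     (frag_extend (\<lambda>(D, E, P). frag_cmul (frag_deg E) (frag_of (D, P))))"

definition H1 :: "'c::{field_char_0, metric_space} sh_data
    \<Rightarrow> ((complex^2^2) set \<Rightarrow> ((complex option \<Rightarrow>\<^sub>0 int) \<times> 'c poly poly \<Rightarrow>\<^sub>0 int) set) set monoid" where
  "H1 S = homology1 (Gam S) (act2 S) (T2 S)"

text \<open>The connecting map: lift a cycle along the degree map, take its boundary.\<close>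
definition conn :: "'c::{field_char_0, metric_space} sh_data
    \<Rightarrow> ((complex^2^2) set \<Rightarrow> ((complex option \<Rightarrow>\<^sub>0 int) \<times> 'c poly poly \<Rightarrow>\<^sub>0 int) set) set
    \<Rightarrow> ('c triple \<Rightarrow>\<^sub>0 int) set set" where
  "conn S z = (THE w. \<exists>c\<in>z. \<exists>c'\<in>carrier (chains1 (Gam S) (T3 S (DivH S))).
     (\<forall>\<gamma>\<in>carrier (Gam S). deg3 S (c' \<gamma>) = c \<gamma>) \<and>
     (\<exists>e\<in>carrier (T3 S (Div0H S)).
        incl3 S e = bdry1 (Gam S) (act3 S (DivH S)) (T3 S (DivH S)) c' \<and> w = coinv_class S (Div0H S) e))"

text \<open>
  Test functions live on the closure of \<open>F\<close> in its product of conjugate embeddings, that is on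
  \<open>F \<otimes> \<rat>\<^sub>p\<close>: for $p$ inert this is the graph of conjugation on $F_{\mathfrak p}$, so that
  a test function is a function on $F_{\mathfrak p}$, written in terms of \<open>t\<close> and its conjugate; for $p$
  split it is \<open>\<rat>\<^sub>p \<times> \<rat>\<^sub>p\<close>, and a test function is polynomial in the second variable
  (a polynomial function on \<open>\<int>\<^sub>p\<close> being identified with its extension to \<open>\<rat>\<^sub>p\<close>).
  A function on the projective line with a pole of order at most \<open>k\<close> at infinity is determined by its
  restriction to the affine line.
\<close>
definition XX :: "'c::{field_char_0, metric_space} sh_data \<Rightarrow> ('c \<times> 'c) set" where
  "XX S = closure ((\<lambda>z. (emb S z, emb2 S z)) ` base S)"

definition OX :: "'c::{field_char_0, metric_space} sh_data \<Rightarrow> ('c \<times> 'c) set" where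
  "OX S = {z \<in> XX S. pabs (fst z) \<le> 1 \<and> pabs (snd z) \<le> 1}"

definition adm_coeffs :: "'c::{field_char_0, metric_space} sh_data \<Rightarrow> real \<Rightarrow> (nat \<times> nat \<Rightarrow> 'c) \<Rightarrow> bool" where
  "adm_coeffs S B c \<longleftrightarrow> (\<forall>x. c x \<in> coef S \<and> pabs (c x) \<le> B) \<and> ((\<lambda>x. pabs (c x)) \<longlongrightarrow> 0) cofinite"

text \<open>Functions that are analytic on all discs of radius \<open>p\<^sup>-\<^sup>n\<close> of the projective line, with power
  series coefficients (on discs of radius one) bounded by \<open>B\<close>.\<close>
definition loc_an :: "'c::{field_char_0, metric_space} sh_data \<Rightarrow> nat \<Rightarrow> real \<Rightarrow> ('c \<times> 'c \<Rightarrow> 'c) \<Rightarrow> bool" where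
  "loc_an S n B f \<longleftrightarrow> (\<forall>z. z \<notin> XX S \<longrightarrow> f z = 0) \<and>
     (let q = of_nat (prm S) ^ n; k = wt S in
      if p_inert S then
        \<forall>a\<in>OX S.
          (\<exists>c. adm_coeffs S B c \<and> (\<forall>z\<in>OX S.
             ((\<lambda>(i, j). c (i, j) * fst z ^ i * snd z ^ j) has_sum
                f (fst a + q * fst z, snd a + q * snd z)) UNIV)) \<and>
          (\<exists>c. adm_coeffs S B c \<and> (\<forall>z\<in>OX S.
             let u = fst a + q * fst z; v = snd a + q * snd z in u \<noteq> 0 \<longrightarrow>
             ((\<lambda>(i, j). c (i, j) * fst z ^ i * snd z ^ j) has_sum u ^ k * v ^ k * f (1 / u, 1 / v)) UNIV))
      else
        \<forall>a\<in>Fp S. pabs a \<le> 1 \<longrightarrow>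
          (\<exists>c. adm_coeffs S B c \<and> (\<forall>i j. j > k \<longrightarrow> c (i, j) = 0) \<and>
             (\<forall>z\<in>Fp S. \<forall>s\<in>Fp S. pabs z \<le> 1 \<longrightarrow>
               ((\<lambda>(i, j). c (i, j) * z ^ i * s ^ j) has_sum f (a + q * z, s)) (UNIV \<times> {..k}))) \<and>
          (\<exists>c. adm_coeffs S B c \<and> (\<forall>i j. j > k \<longrightarrow> c (i, j) = 0) \<and>
             (\<forall>z\<in>Fp S. \<forall>s\<in>Fp S. pabs z \<le> 1 \<longrightarrow>
               (let u = a + q * z in u \<noteq> 0 \<longrightarrow>
               ((\<lambda>(i, j). c (i, j) * z ^ i * s ^ j) has_sum u ^ k * f (1 / u, s)) (UNIV \<times> {..k})))))"

definition AA :: "'c::{field_char_0, metric_space} sh_data \<Rightarrow> ('c \<times> 'c \<Rightarrow> 'c) set" where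
  "AA S = {f. \<exists>n B. loc_an S n B f}"

text \<open>The weight \<open>k\<close> action; the defining formula determines the result by continuity.\<close>
definition A_act :: "'c::{field_char_0, metric_space} sh_data \<Rightarrow> complex^2^2 \<Rightarrow> ('c \<times> 'c \<Rightarrow> 'c) \<Rightarrow> ('c \<times> 'c \<Rightarrow> 'c)" where
  "A_act S g f = (THE h. h \<in> AA S \<and>
     (\<forall>(t, s)\<in>XX S.
        let u = emb S (g $ 1 $ 1) + emb S (g $ 2 $ 1) * t; v = emb2 S (g $ 1 $ 1) + emb2 S (g $ 2 $ 1) * s in
        u \<noteq> 0 \<and> v \<noteq> 0 \<longrightarrow> h (t, s) = u ^ wt S * v ^ wt S / det_factor S g *
          f ((emb S (g $ 1 $ 2) + emb S (g $ 2 $ 2) * t) / u, (emb2 S (g $ 1 $ 2) + emb2 S (g $ 2 $ 2) * s) / v)))"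

text \<open>Continuity for the inductive limit topology is boundedness on each of the Banach spaces.\<close>
definition DD :: "'c::{field_char_0, metric_space} sh_data \<Rightarrow> (('c \<times> 'c \<Rightarrow> 'c) \<Rightarrow> 'c) set" where
  "DD S = {\<nu> \<in> AA S \<rightarrow>\<^sub>E coef S.
     (\<forall>f\<in>AA S. \<forall>h\<in>AA S. \<nu> (\<lambda>x. f x + h x) = \<nu> f + \<nu> h) \<and>
     (\<forall>f\<in>AA S. \<forall>c\<in>coef S. \<nu> (\<lambda>x. c * f x) = c * \<nu> f) \<and>
     (\<forall>n. \<exists>C. \<forall>B f. loc_an S n B f \<longrightarrow> pabs (\<nu> f) \<le> C * B)}"

type_synonym 'c msymb = "(complex option \<Rightarrow>\<^sub>0 int) \<Rightarrow> ('c \<times> 'c \<Rightarrow> 'c) \<Rightarrow> 'c"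

definition ms_slash :: "'c::{field_char_0, metric_space} sh_data \<Rightarrow> 'c msymb \<Rightarrow> complex^2^2 \<Rightarrow> 'c msymb" where
  "ms_slash S \<mu> g = (\<lambda>D\<in>Delta0 S. \<lambda>f\<in>AA S. \<mu> (cusp_act g D) (A_act S g f))"

definition ms_add :: "'c::{field_char_0, metric_space} sh_data \<Rightarrow> 'c msymb \<Rightarrow> 'c msymb \<Rightarrow> 'c msymb" where
  "ms_add S \<mu> \<mu>' = (\<lambda>D\<in>Delta0 S. \<lambda>f\<in>AA S. \<mu> D f + \<mu>' D f)"

definition ms_scale :: "'c::{field_char_0, metric_space} sh_data \<Rightarrow> 'c \<Rightarrow> 'c msymb \<Rightarrow> 'c msymb" where
  "ms_scale S c \<mu> = (\<lambda>D\<in>Delta0 S. \<lambda>f\<in>AA S. c * \<mu> D f)"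

definition MS :: "'c::{field_char_0, metric_space} sh_data \<Rightarrow> 'c msymb set" where
  "MS S = {\<mu> \<in> Delta0 S \<rightarrow>\<^sub>E DD S.
     (\<forall>D\<in>Delta0 S. \<forall>D'\<in>Delta0 S. \<forall>f\<in>AA S. \<mu> (D + D') f = \<mu> D f + \<mu> D' f) \<and>
     (\<forall>g\<in>R1 S. ms_slash S \<mu> g = \<mu>)}"

text \<open>Away from $\mathfrak p$ these are the usual operators.  At $\mathfrak p$ the matrix \<open>diag(1, w)\<close>
  normalises \<open>\<Gamma>\<close>, whose double coset is a single one; on the restriction of \<open>\<mu>\<close> to the disc of integers
  a \<open>diag(1, w)\<close>-eigenvector becomes an eigenvector of \<open>U\<^sub>w\<close> with the same eigenvalue.\<close>
definition hecke_ms :: "'c::{field_char_0, metric_space} sh_data \<Rightarrow> complex \<Rightarrow> 'c msymb \<Rightarrow> 'c msymb" where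
  "hecke_ms S w \<mu> =
     (if w \<in> pp S then ms_slash S \<mu> (mat2 1 0 0 w)
      else (\<lambda>D\<in>Delta0 S. \<lambda>f\<in>AA S. (\<Sum>a\<in>residues_mod (base S) w. ms_slash S \<mu> (mat2 1 a 0 w) D f) +
        (if tame S \<subseteq> cgenideal (ring_on (OF S)) w then 0 else ms_slash S \<mu> (mat2 w 0 0 1) D f)))"

definition MSf :: "'c::{field_char_0, metric_space} sh_data \<Rightarrow> 'c msymb set" where
  "MSf S = {\<mu> \<in> MS S. \<forall>w. prime_elem_of (base S) w \<longrightarrow> hecke_ms S w \<mu> = ms_scale S (eigval S w) \<mu>}"

definition MSf_dual :: "'c::{field_char_0, metric_space} sh_data \<Rightarrow> ('c msymb \<Rightarrow> 'c) monoid" where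
  "MSf_dual S = \<lparr>carrier = {y \<in> MSf S \<rightarrow>\<^sub>E coef S.
       (\<forall>\<mu>\<in>MSf S. \<forall>\<mu>'\<in>MSf S. y (ms_add S \<mu> \<mu>') = y \<mu> + y \<mu>') \<and>
       (\<forall>\<mu>\<in>MSf S. \<forall>c\<in>coef S. y (ms_scale S c \<mu>) = c * y \<mu>)},
     monoid.mult = (\<lambda>y y'. \<lambda>\<mu>\<in>MSf S. y \<mu> + y' \<mu>), one = (\<lambda>\<mu>\<in>MSf S. 0)\<rparr>"

definition dual_scale :: "'c::{field_char_0, metric_space} sh_data \<Rightarrow> 'c \<Rightarrow> ('c msymb \<Rightarrow> 'c) \<Rightarrow> 'c msymb \<Rightarrow> 'c" where
  "dual_scale S c y = (\<lambda>\<mu>\<in>MSf S. c * y \<mu>)"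

text \<open>For a divisor \<open>E = x - y\<close>, the function \<open>\<kappa>((t - x)/(t - y)) P(t)\<close>.\<close>
definition integrand :: "'c::{field_char_0, metric_space} sh_data \<Rightarrow> ('c \<Rightarrow> 'c) \<Rightarrow> ('c \<Rightarrow>\<^sub>0 int) \<Rightarrow> 'c poly poly
    \<Rightarrow> 'c \<times> 'c \<Rightarrow> 'c" where
  "integrand S \<kappa> E P = (\<lambda>(t, s). if (t, s) \<in> XX S
     then \<kappa> (\<Prod>x\<in>Poly_Mapping.keys E. (t - x) powi Poly_Mapping.lookup E x) * bieval P t s else 0)"

text \<open>The value on a class in the coinvariants is computed on any representative; restricting a
  functional to \<open>MSf\<close> is the projection of duals.\<close>
definition Phi :: "'c::{field_char_0, metric_space} sh_data \<Rightarrow> ('c \<Rightarrow> 'c) \<Rightarrow> ('c triple \<Rightarrow>\<^sub>0 int) set set \<Rightarrow> 'c msymb \<Rightarrow> 'c" where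
  "Phi S \<kappa> Z = (\<lambda>\<mu>\<in>MSf S. the_elem ((\<lambda>X. the_elem ((\<lambda>c.
     \<Sum>x\<in>Poly_Mapping.keys c. of_int (Poly_Mapping.lookup c x) *
       (case x of (D, E, P) \<Rightarrow> \<mu> D (integrand S \<kappa> E P))) ` X)) ` Z))"

definition ordp :: "nat \<Rightarrow> 'c::{field_char_0, metric_space} \<Rightarrow> int" where
  "ordp p x = (THE n. pabs x = real p powi (- n))"

definition Phi_log :: "'c::{field_char_0, metric_space} sh_data \<Rightarrow> ('c triple \<Rightarrow>\<^sub>0 int) set set \<Rightarrow> 'c msymb \<Rightarrow> 'c" where
  "Phi_log S = Phi S (\<lambda>z. plog S (sig S z))"

definition Phi_ord :: "'c::{field_char_0, metric_space} sh_data \<Rightarrow> ('c triple \<Rightarrow>\<^sub>0 int) set set \<Rightarrow> 'c msymb \<Rightarrow> 'c" where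
  "Phi_ord S = Phi S (\<lambda>z. of_int (ordp (prm S) z))"

definition is_L_invariant :: "'c::{field_char_0, metric_space} sh_data \<Rightarrow> 'c \<Rightarrow> bool" where
  "is_L_invariant S \<L> \<longleftrightarrow> \<L> \<in> coef S \<and>
     (\<forall>z\<in>carrier (H1 S). Phi_log S (conn S z) = dual_scale S \<L> (Phi_ord S (conn S z)))"

definition DfL :: "'c::{field_char_0, metric_space} sh_data \<Rightarrow> (('c msymb \<Rightarrow> 'c) \<times> ('c msymb \<Rightarrow> 'c)) monoid" where
  "DfL S = MSf_dual S \<times>\<times> MSf_dual S"

definition Fil :: "'c::{field_char_0, metric_space} sh_data \<Rightarrow> 'c \<Rightarrow> (('c msymb \<Rightarrow> 'c) \<times> ('c msymb \<Rightarrow> 'c)) set" where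
  "Fil S \<L> = {(dual_scale S (- \<L>) y, y) | y. y \<in> carrier (MSf_dual S)}"

definition Phi_f :: "'c::{field_char_0, metric_space} sh_data \<Rightarrow> ('c triple \<Rightarrow>\<^sub>0 int) set set
    \<Rightarrow> ('c msymb \<Rightarrow> 'c) \<times> ('c msymb \<Rightarrow> 'c)" where
  "Phi_f S Z = (dual_scale S (-1) (Phi_log S Z), Phi_ord S Z)"

definition abel_jacobi_map :: "'c::{field_char_0, metric_space} sh_data \<Rightarrow> 'c
    \<Rightarrow> (('c triple \<Rightarrow>\<^sub>0 int) set set \<Rightarrow> (('c msymb \<Rightarrow> 'c) \<times> ('c msymb \<Rightarrow> 'c)) set) \<Rightarrow> bool" where
  "abel_jacobi_map S \<L> \<Phi> \<longleftrightarrow> \<Phi> \<in> hom (Coinv3 S (DivH S)) (DfL S Mod Fil S \<L>) \<and>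
     (\<forall>Z\<in>carrier (Coinv3 S (Div0H S)). \<Phi> (partial1 S Z) = Fil S \<L> #>\<^bsub>DfL S\<^esub> Phi_f S Z)"

definition is_order :: "complex set \<Rightarrow> complex set \<Rightarrow> complex set \<Rightarrow> bool" where
  "is_order A K \<O> \<longleftrightarrow> A \<subseteq> \<O> \<and> \<O> \<subseteq> K \<and> (\<forall>x\<in>\<O>. \<forall>y\<in>\<O>. x - y \<in> \<O> \<and> x * y \<in> \<O>) \<and>
     (\<exists>B. finite B \<and> B \<subseteq> \<O> \<and> \<O> = {\<Sum>b\<in>B. q b * b | q. q \<in> B \<rightarrow> A}) \<and>
     (\<forall>x\<in>K. \<exists>a\<in>A - {0}. a * x \<in> \<O>)"

definition conductor :: "'c::{field_char_0, metric_space} sh_data \<Rightarrow> complex set \<Rightarrow> complex set" where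
  "conductor S \<O> = {x \<in> OFp S. \<forall>y\<in>away S (quad S). x * y \<in> \<O>}"

definition optimal_embedding :: "'c::{field_char_0, metric_space} sh_data \<Rightarrow> complex set \<Rightarrow> (complex \<Rightarrow> complex^2^2) \<Rightarrow> bool" where
  "optimal_embedding S \<O> \<Psi> \<longleftrightarrow>
     (\<forall>x\<in>quad S. \<forall>i j. \<Psi> x $ i $ j \<in> base S) \<and>
     (\<forall>x\<in>quad S. \<forall>y\<in>quad S. \<Psi> (x + y) = \<Psi> x + \<Psi> y \<and> \<Psi> (x * y) = \<Psi> x ** \<Psi> y) \<and>
     (\<forall>x\<in>base S. \<Psi> x = mat x) \<and> inj_on \<Psi> (quad S) \<and>
     \<Psi> ` quad S \<inter> RR S = \<Psi> ` \<O>"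

definition norm_one :: "'c::{field_char_0, metric_space} sh_data \<Rightarrow> complex set \<Rightarrow> complex set" where
  "norm_one S \<O> = {x \<in> \<O>. x * rel_conj (base S) (quad S) x = 1}"

definition generator_mod_torsion :: "complex set \<Rightarrow> complex \<Rightarrow> bool" where
  "generator_mod_torsion U u \<longleftrightarrow> u \<in> U \<and>
     (\<forall>v\<in>U. \<exists>\<zeta>\<in>U. \<exists>n. v = \<zeta> * u powi n \<and> (\<exists>m>0. \<zeta> ^ m = 1))"

text \<open>Either of the two fixed points of \<open>\<Psi>(K\<^sup>\<times>)\<close> may serve as \<open>\<tau>\<^sub>\<Psi>\<close>.\<close>
definition is_tau :: "'c::{field_char_0, metric_space} sh_data \<Rightarrow> (complex \<Rightarrow> complex^2^2) \<Rightarrow> 'c \<Rightarrow> bool" where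
  "is_tau S \<Psi> \<tau> \<longleftrightarrow> \<tau> \<in> Hur S \<inter> emb S ` quad S \<and> (\<forall>x\<in>quad S - {0}. Hp_moebius S (\<Psi> x) \<tau> = \<tau>)"

definition P_Psi :: "'c::{field_char_0, metric_space} sh_data \<Rightarrow> complex \<Rightarrow> (complex \<Rightarrow> complex^2^2) \<Rightarrow> 'c poly poly" where
  "P_Psi S \<delta> \<Psi> = (let g = \<Psi> \<delta>; a = g $ 1 $ 1; b = g $ 1 $ 2; c = g $ 2 $ 1; d = g $ 2 $ 2 in
     poly_X [:- emb S b, emb S (a - d), emb S c:] * poly_Y [:- emb2 S b, emb2 S (a - d), emb2 S c:])"

definition stark_heegner_cycle :: "'c::{field_char_0, metric_space} sh_data \<Rightarrow> complex \<Rightarrow> complex option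
    \<Rightarrow> (complex \<Rightarrow> complex^2^2) \<Rightarrow> 'c \<Rightarrow> (complex^2^2) set \<Rightarrow> ('c triple \<Rightarrow>\<^sub>0 int) set set" where
  "stark_heegner_cycle S \<delta> x \<Psi> \<tau> \<gamma> = pure3 S (DivH S)
     (frag_of (moebius (rep \<gamma>) x) - frag_of x) (frag_of \<tau>)
     (smult [:inverse (emb S \<delta>) ^ (wt S div 2):] (P_Psi S \<delta> \<Psi> ^ (wt S div 2)))"

end

(*
  The difference of two Abel-Jacobi maps vanishes on the image of degree zero divisors. Hence the divisor
  tau may be moved by Gamma, and the difference at (c' - c) (x) tau (x) P, composed with a functional mu and
  a Q-linear map to the reals, is a Gamma-invariant modular symbol m(c, c'; X) for P = P_X^(k/2), where
  X = Psi(delta_K). Extended to all complex matrices X it is continuous and even in X, and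
  m(g c, g c'; g X g^-1) = m(c, c'; X) for g in Gamma. One has to show that the period m(x, gamma x; X) is
  zero for gamma commuting with X.

  Invariance under the p-arithmetic group Gamma, and not just under a subgroup Gamma_0(M) of SL_2(O_F), gives
  an action of the Hecke correspondence at p, regarded as a random walk on Gamma_0(M)\ SL_2(C). Its bounded
  uniformly continuous harmonic functions are constant: the walk is recurrent, the height in the cusps being
  a Lyapunov function, and Gamma is dense in SL_2(C). The symbol m is the coboundary of a function F on
  SL_2(C) up to a compactly supported error, and averaging along the walk turns the errors into constants
  d(h, X) with d(gamma, X) = m(x, gamma x; X). An element w with w X = - X w and w gamma = gamma^-1 w shows
  d(gamma, X) = 0.

  Since p is inert in K, the norm one element u has integral trace, so a power of gamma = Psi(u) lies in
  Gamma_0(M).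
*)
theory Submission
  imports Defs
begin

section \<open>Two by two matrices\<close>

text \<open>An Abel-Jacobi map is a bare homomorphism, so nothing p-adic can be said about the
  difference of two of them, and the argument becomes archimedean. This works since additive
  functions on F, of dimension two over Q, extend to R-linear ones on C. Under Gamma_0(M) alone such
  periods are non-zero in general, as for a cusp form, so the density of Gamma has to be exploited
  although the symbol has no invariant primitive: F only obeys a cocycle relation. What is
  invariant, with compact support modulo Gamma_0(M), is the right difference g -> F(gh) - F(g), both
  terms taken at g X g^-1. It is compatible with averaging once the average of F is corrected by the
  symbol, and at g = 1, h = gamma its value is the period for every F, so averaging does not lose
  the period. Since the relation for F is available for Gamma_0(M) only, a power of gamma has to lie
  there. The means are limits of Cesaro averages along a filter; such a limit is bounded and
  harmonic. A step of the walk is a product of two Hecke representatives, because its determinant is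
  a square and it can be scaled to determinant one.\<close>

lemma mat2_sel [simp]:
  "mat2 a b c d $ 1 $ 1 = a" "mat2 a b c d $ 1 $ 2 = b"
  "mat2 a b c d $ 2 $ 1 = c" "mat2 a b c d $ 2 $ 2 = d"
  by (simp_all add: mat2_def)

lemma mat2_eq_iff: "g = h \<longleftrightarrow> g $ 1 $ 1 = h $ 1 $ 1 \<and> g $ 1 $ 2 = h $ 1 $ 2 \<and>
    g $ 2 $ 1 = h $ 2 $ 1 \<and> g $ 2 $ 2 = (h :: 'a::zero^2^2) $ 2 $ 2"
  by (auto simp: vec_eq_iff forall_2)

lemma mat2_mult_sel:
  fixes g h :: "'a::comm_ring_1^2^2"
  shows "(g ** h) $ i $ j = g $ i $ 1 * h $ 1 $ j + g $ i $ 2 * h $ 2 $ j"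
  by (simp add: matrix_matrix_mult_def sum_2)

lemma mat_sel: "(mat z :: 'a::comm_ring_1^2^2) $ 1 $ 1 = z" "(mat z :: 'a^2^2) $ 2 $ 2 = z"
  "(mat z :: 'a^2^2) $ 1 $ 2 = 0" "(mat z :: 'a^2^2) $ 2 $ 1 = 0"
  by (simp_all add: mat_def)

definition adj2 :: "'a::comm_ring_1^2^2 \<Rightarrow> 'a^2^2" where
  "adj2 g = mat2 (g $ 2 $ 2) (- g $ 1 $ 2) (- g $ 2 $ 1) (g $ 1 $ 1)"

lemma adj2_sel [simp]:
  "adj2 g $ 1 $ 1 = g $ 2 $ 2" "adj2 g $ 1 $ 2 = - g $ 1 $ 2"
  "adj2 g $ 2 $ 1 = - g $ 2 $ 1" "adj2 g $ 2 $ 2 = g $ 1 $ 1"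
  by (simp_all add: adj2_def)

lemma adj2_adj2 [simp]: "adj2 (adj2 g) = g"
  by (simp add: mat2_eq_iff)

lemma adj2_mult: "adj2 (g ** h) = adj2 h ** adj2 (g :: 'a::comm_ring_1^2^2)"
  by (simp add: mat2_eq_iff mat2_mult_sel algebra_simps)

lemma det_adj2 [simp]: "det (adj2 g) = det (g :: 'a::comm_ring_1^2^2)"
  by (simp add: det_2 algebra_simps)

lemma mult_adj2: "g ** adj2 g = mat (det (g :: 'a::comm_ring_1^2^2))"
  by (simp add: mat2_eq_iff mat2_mult_sel det_2 mat_sel algebra_simps)

lemma adj2_mult_self: "adj2 g ** g = mat (det (g :: 'a::comm_ring_1^2^2))"
  by (simp add: mat2_eq_iff mat2_mult_sel det_2 mat_sel algebra_simps)

lemma vec2_eq_iff: "u = v \<longleftrightarrow> u $ 1 = v $ 1 \<and> u $ 2 = (v :: 'a^2) $ 2"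
  by (auto simp: vec_eq_iff forall_2)

lemma mat2_vec_sel:
  fixes g :: "'a::comm_ring_1^2^2"
  shows "(g *v v) $ i = g $ i $ 1 * v $ 1 + g $ i $ 2 * v $ 2"
  by (simp add: matrix_vector_mult_def sum_2)

lemma norm_vec2: "norm (v :: complex^2) ^ 2 = cmod (v $ 1) ^ 2 + cmod (v $ 2) ^ 2"
  by (simp add: norm_vec_def L2_set_def sum_2)

section \<open>Area and hermitian product in the plane\<close>

definition wedge :: "complex^2 \<Rightarrow> complex^2 \<Rightarrow> complex" where
  "wedge u v = u $ 1 * v $ 2 - u $ 2 * v $ 1"

definition herm :: "complex^2 \<Rightarrow> complex^2 \<Rightarrow> complex" where
  "herm u v = cnj (u $ 1) * v $ 1 + cnj (u $ 2) * v $ 2"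

text \<open>Over the complex numbers both sides are polynomials in the coordinates and their
  conjugates, once a squared modulus is written as \<open>z * cnj z\<close>; hence the detour
  through \<open>complex_of_real\<close>.\<close>

lemma lagrange_identity: "norm u ^ 2 * norm v ^ 2 = cmod (wedge u v) ^ 2 + cmod (herm u v) ^ 2"
proof -
  have "complex_of_real (norm u ^ 2 * norm v ^ 2) =
      (u $ 1 * cnj (u $ 1) + u $ 2 * cnj (u $ 2)) * (v $ 1 * cnj (v $ 1) + v $ 2 * cnj (v $ 2))"
    by (simp only: norm_vec2 complex_norm_square of_real_mult of_real_add)
  also have "\<dots> = wedge u v * cnj (wedge u v) + herm u v * cnj (herm u v)"
    by (simp add: wedge_def herm_def algebra_simps)
  also have "\<dots> = complex_of_real (cmod (wedge u v) ^ 2 + cmod (herm u v) ^ 2)"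
    by (simp only: complex_norm_square of_real_add)
  finally show ?thesis using of_real_eq_iff by blast
qed

lemma wedge_le: "cmod (wedge u v) \<le> norm u * norm v"
proof -
  have "cmod (wedge u v) ^ 2 \<le> (norm u * norm v) ^ 2"
    using lagrange_identity[of u v] by (simp add: power_mult_distrib)
  then show ?thesis by (rule power2_le_imp_le) simp
qed

lemma wedge_mult: "wedge (g *v u) (g *v v) = det g * wedge u v"
  by (simp add: wedge_def mat2_vec_sel det_2 algebra_simps)

lemma norm_vec2_le: "norm (v :: complex^2) \<le> cmod (v $ 1) + cmod (v $ 2)"
  by (simp add: norm_vec_def L2_set_def sum_2 sqrt_sum_squares_le_sum)

lemma norm_mat2_entry: "cmod (g $ i $ j) \<le> norm (g :: complex^2^2)"
  by (rule order_trans[OF Finite_Cartesian_Product.norm_nth_le Finite_Cartesian_Product.norm_nth_le])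

lemma norm_mat2_le: "norm (g :: complex^2^2) \<le>
    cmod (g $ 1 $ 1) + cmod (g $ 1 $ 2) + cmod (g $ 2 $ 1) + cmod (g $ 2 $ 2)"
proof -
  have "norm g \<le> norm (g $ 1) + norm (g $ 2)"
    by (simp add: norm_vec_def [of g] L2_set_def sum_2 sqrt_sum_squares_le_sum)
  then show ?thesis using norm_vec2_le[of "g $ 1"] norm_vec2_le[of "g $ 2"] by linarith
qed

text \<open>The factor 4, like the 8 in \<open>norm_mat2_mult_le\<close>, comes from bounding every
  entry by the norm; only the existence of some constant matters for the estimates.\<close>

lemma norm_mat2_vec_le: "norm (g *v v) \<le> 4 * norm (g :: complex^2^2) * norm v"
proof -
  have e: "cmod ((g *v v) $ i) \<le> 2 * norm g * norm v" for i
  proof -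
    have "cmod ((g *v v) $ i) \<le> cmod (g $ i $ 1) * cmod (v $ 1) + cmod (g $ i $ 2) * cmod (v $ 2)"
      unfolding mat2_vec_sel by (rule norm_triangle_le) (simp add: norm_mult)
    also have "\<dots> \<le> norm g * norm v + norm g * norm v"
      by (intro add_mono mult_mono norm_mat2_entry Finite_Cartesian_Product.norm_nth_le) auto
    finally show ?thesis by (simp add: algebra_simps)
  qed
  show ?thesis using norm_vec2_le[of "g *v v"] e[of 1] e[of 2] by linarith
qed

lemma norm_adj2_le: "norm (adj2 g) \<le> 4 * norm (g :: complex^2^2)"
  using norm_mat2_le[of "adj2 g"] norm_mat2_entry[of g 1 1] norm_mat2_entry[of g 1 2]
    norm_mat2_entry[of g 2 1] norm_mat2_entry[of g 2 2] by simp

section \<open>Continuity of the matrix operations\<close>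

lemma continuous_on_mat2 [continuous_intros]:
  fixes a b c d :: "'x::topological_space \<Rightarrow> complex"
  assumes "continuous_on A a" "continuous_on A b" "continuous_on A c" "continuous_on A d"
  shows "continuous_on A (\<lambda>x. mat2 (a x) (b x) (c x) (d x))"
proof -
  have eq: "mat2 (a x) (b x) (c x) (d x) =
      (\<chi> i j. if i = 1 then (if j = 1 then a x else b x) else (if j = 1 then c x else d x))" for x
    by (simp add: mat2_eq_iff)
  have "continuous_on A (\<lambda>x. if i = (1::2) then (if j = (1::2) then a x else b x)
      else (if j = 1 then c x else d x))" for i j
    using assms by (cases "i = 1"; cases "j = 1") auto
  then show ?thesis unfolding eq by (intro continuous_intros)
qed

lemma continuous_on_sel [continuous_intros]:
  fixes f :: "'x::topological_space \<Rightarrow> complex^2^2"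
  assumes "continuous_on A f" shows "continuous_on A (\<lambda>x. f x $ i $ j)"
  using assms by (intro continuous_on_component)

lemma continuous_on_adj2 [continuous_intros]:
  fixes f :: "'x::topological_space \<Rightarrow> complex^2^2"
  assumes "continuous_on A f" shows "continuous_on A (\<lambda>x. adj2 (f x))"
  unfolding adj2_def by (intro continuous_intros assms)

lemma continuous_on_mat2_mult [continuous_intros]:
  fixes f h :: "'x::topological_space \<Rightarrow> complex^2^2"
  assumes "continuous_on A f" "continuous_on A h" shows "continuous_on A (\<lambda>x. f x ** h x)"
proof -
  have eq: "f x ** h x = mat2 (f x $ 1 $ 1 * h x $ 1 $ 1 + f x $ 1 $ 2 * h x $ 2 $ 1)
      (f x $ 1 $ 1 * h x $ 1 $ 2 + f x $ 1 $ 2 * h x $ 2 $ 2)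
      (f x $ 2 $ 1 * h x $ 1 $ 1 + f x $ 2 $ 2 * h x $ 2 $ 1)
      (f x $ 2 $ 1 * h x $ 1 $ 2 + f x $ 2 $ 2 * h x $ 2 $ 2)" for x
    by (simp add: mat2_eq_iff mat2_mult_sel)
  show ?thesis unfolding eq by (intro continuous_intros assms)
qed

lemma continuous_on_mat2_vec [continuous_intros]:
  fixes f :: "'x::topological_space \<Rightarrow> complex^2^2"
  assumes "continuous_on A f" shows "continuous_on A (\<lambda>x. f x *v v)"
  unfolding matrix_vector_mult_def sum_2 by (intro continuous_intros assms)

lemma continuous_on_det2 [continuous_intros]:
  fixes f :: "'x::topological_space \<Rightarrow> complex^2^2"
  assumes "continuous_on A f" shows "continuous_on A (\<lambda>x. det (f x))"
  unfolding det_2 by (intro continuous_intros assms)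

definition SL2C :: "(complex^2^2) set" where "SL2C = {g. det g = 1}"

lemma SL2C_mult: "g \<in> SL2C \<Longrightarrow> h \<in> SL2C \<Longrightarrow> g ** h \<in> SL2C"
  by (simp add: SL2C_def det_mul)

lemma SL2C_adj2: "g \<in> SL2C \<Longrightarrow> adj2 g \<in> SL2C"
  by (simp add: SL2C_def)

lemma SL2C_one: "mat 1 \<in> SL2C"
  by (simp add: SL2C_def)

lemma SL2C_cancel:
  assumes "g \<in> SL2C"
  shows "g ** adj2 g = mat 1" "adj2 g ** g = mat 1" "g ** (adj2 g ** h) = h" "adj2 g ** (g ** h) = h"
    "h ** g ** adj2 g = h" "h ** adj2 g ** g = h"
proof -
  show a: "g ** adj2 g = mat 1" and b: "adj2 g ** g = mat 1"
    using assms mult_adj2[of g] adj2_mult_self[of g] by (simp_all add: SL2C_def)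
  show "g ** (adj2 g ** h) = h" "adj2 g ** (g ** h) = h"
    by (simp_all only: matrix_mul_assoc a b matrix_mul_lid)
  show "h ** g ** adj2 g = h" "h ** adj2 g ** g = h"
    by (simp_all only: matrix_mul_assoc [symmetric] a b matrix_mul_rid)
qed

lemma compact_SL2C_ball: "compact {g \<in> SL2C. norm g \<le> C}"
proof -
  have "{g \<in> SL2C. norm g \<le> C} = (\<lambda>g. det g) -` {1} \<inter> cball 0 C"
    by (auto simp: SL2C_def)
  moreover have "closed ((\<lambda>g::complex^2^2. det g) -` {1})"
    by (intro closed_vimage closed_singleton continuous_on_det2 continuous_on_id)
  ultimately show ?thesis
    by (simp add: closed_Int_compact)
qed

section \<open>Discrete subrings of the complex numbers\<close>

text \<open>What is used of the ring of integers of an imaginary quadratic field as a subset of the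
  complex numbers: it is discrete, since non-zero elements have modulus at least 1, and cocompact,
  since it contains 1 and a non-real number.\<close>

locale int_lattice =
  fixes R :: "complex set"
  assumes zero [simp]: "0 \<in> R" and one [simp]: "1 \<in> R"
    and add: "x \<in> R \<Longrightarrow> y \<in> R \<Longrightarrow> x + y \<in> R"
    and mult: "x \<in> R \<Longrightarrow> y \<in> R \<Longrightarrow> x * y \<in> R"
    and uminus: "x \<in> R \<Longrightarrow> - x \<in> R"
    and norm_ge_1: "x \<in> R \<Longrightarrow> x \<noteq> 0 \<Longrightarrow> 1 \<le> cmod x"
    and nonreal: "\<exists>\<omega>\<in>R. Im \<omega> \<noteq> 0"
begin

lemma diff: "x \<in> R \<Longrightarrow> y \<in> R \<Longrightarrow> x - y \<in> R"
  using add[of x "- y"] uminus by simp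

lemma of_nat_R: "of_nat n \<in> R"
  by (induction n) (auto intro: add)

lemma of_int_R: "of_int n \<in> R"
  by (cases n) (auto intro: of_nat_R uminus diff simp del: of_nat_Suc)

end

text \<open>\<open>bezout\<close> is the form in which class number one enters; it makes all cusps
  of SL_2(R) equivalent. \<open>B\<close> represents the residue classes modulo \<pi>. For a number
  ring there are \<open>cmod \<pi> ^ 2\<close> of them; the weaker bound \<open>B_card\<close> is
  exactly what makes the height decrease on average.\<close>

locale bianchi_lattice = int_lattice +
  fixes \<pi> :: complex and B :: "complex set"
  assumes bezout: "a \<in> R \<Longrightarrow> b \<in> R \<Longrightarrow> a \<noteq> 0 \<or> b \<noteq> 0 \<Longrightarrow>
      \<exists>d\<in>R. \<exists>a'\<in>R. \<exists>b'\<in>R. \<exists>s\<in>R. \<exists>t\<in>R. a = d * a' \<and> b = d * b' \<and> s * a' + t * b' = 1"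
    and pi_R: "\<pi> \<in> R" and norm_pi: "1 < cmod \<pi>"
    and pi_prime: "x \<in> R \<Longrightarrow> y \<in> R \<Longrightarrow> x * y \<in> (*) \<pi> ` R \<Longrightarrow> x \<in> (*) \<pi> ` R \<or> y \<in> (*) \<pi> ` R"
    and B_fin: "finite B" and B0: "0 \<in> B" and B_R: "B \<subseteq> R"
    and B_rep: "x \<in> R \<Longrightarrow> \<exists>!b. b \<in> B \<and> x - b \<in> (*) \<pi> ` R"
    and B_card: "cmod \<pi> < real (card B)"
begin

definition Lam :: "(complex^2) set" where
  "Lam = {v. v $ 1 \<in> R \<and> v $ 2 \<in> R \<and> v \<noteq> 0}"

definition GamL :: "complex set \<Rightarrow> (complex^2^2) set" where
  "GamL M = {g. (\<forall>i j. g $ i $ j \<in> R) \<and> det g = 1 \<and> g $ 2 $ 1 \<in> M}"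

text \<open>A non-zero ideal comaximal with \<pi>; the last clause keeps the level intact when \<pi>
  is divided out, see \<open>level_div_pi\<close>.\<close>

definition is_level :: "complex set \<Rightarrow> bool" where
  "is_level M \<longleftrightarrow> M \<subseteq> R \<and> (\<forall>x\<in>M. \<forall>y\<in>M. x + y \<in> M) \<and> (\<forall>x\<in>M. \<forall>r\<in>R. r * x \<in> M) \<and>
     (\<exists>n\<in>M. n \<noteq> 0) \<and> (\<exists>\<mu>\<in>M. \<exists>y\<in>R. \<mu> + y * \<pi> = 1)"

lemma is_levelD:
  assumes "is_level M"
  shows "x \<in> M \<Longrightarrow> x \<in> R" "x \<in> M \<Longrightarrow> y \<in> M \<Longrightarrow> x + y \<in> M" "x \<in> M \<Longrightarrow> r \<in> R \<Longrightarrow> r * x \<in> M"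
    "\<exists>n\<in>M. n \<noteq> 0" "\<exists>\<mu>\<in>M. \<exists>y\<in>R. \<mu> + y * \<pi> = 1"
  using assms unfolding is_level_def by blast+

lemma is_level_R: "is_level R"
proof -
  have "\<exists>\<mu>\<in>R. \<exists>y\<in>R. \<mu> + y * \<pi> = 1" "\<exists>n\<in>R. n \<noteq> 0"
    by (rule bexI[of _ 1], rule bexI[of _ 0]) (auto intro: bexI[of _ 1])
  then show ?thesis unfolding is_level_def
    using add mult by (intro conjI ballI subset_refl)
qed

lemma pi_nz [simp]: "\<pi> \<noteq> 0" using norm_pi by auto

lemma GamL_SL2C: "\<gamma> \<in> GamL M \<Longrightarrow> \<gamma> \<in> SL2C"
  by (simp add: GamL_def SL2C_def)

lemma GamL_entry: "\<gamma> \<in> GamL M \<Longrightarrow> \<gamma> $ i $ j \<in> R"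
  by (simp add: GamL_def)

lemma GamL_mono: "is_level M \<Longrightarrow> \<gamma> \<in> GamL M \<Longrightarrow> \<gamma> \<in> GamL R"
  by (auto simp: GamL_def)

lemma GamL_mult:
  assumes "is_level M" "\<gamma> \<in> GamL M" "\<gamma>' \<in> GamL M" shows "\<gamma> ** \<gamma>' \<in> GamL M"
proof -
  have e: "\<gamma> $ i $ j \<in> R" "\<gamma>' $ i $ j \<in> R" for i j using assms by (auto simp: GamL_def)
  have "\<gamma>' $ 1 $ 1 * \<gamma> $ 2 $ 1 \<in> M" "\<gamma> $ 2 $ 2 * \<gamma>' $ 2 $ 1 \<in> M"
    using assms e by (auto simp: is_level_def GamL_def)
  then have "\<gamma> $ 2 $ 1 * \<gamma>' $ 1 $ 1 + \<gamma> $ 2 $ 2 * \<gamma>' $ 2 $ 1 \<in> M"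
    using assms(1) by (auto simp: is_level_def mult.commute)
  then show ?thesis using assms e
    by (auto simp: GamL_def mat2_mult_sel det_mul intro!: add mult)
qed

lemma GamL_adj2:
  assumes "is_level M" "\<gamma> \<in> GamL M" shows "adj2 \<gamma> \<in> GamL M"
proof -
  have e: "\<gamma> $ i $ j \<in> R" for i j using assms by (auto simp: GamL_def)
  have "(-1) * \<gamma> $ 2 $ 1 \<in> M" using assms uminus[OF one] by (fastforce simp: is_level_def GamL_def)
  then show ?thesis using assms e by (auto simp: GamL_def forall_2 uminus)
qed

lemma GamL_Lam:
  assumes "\<gamma> \<in> GamL R" "e \<in> Lam" shows "\<gamma> *v e \<in> Lam"
proof -
  have "\<gamma> *v e \<noteq> 0"
  proof
    assume "\<gamma> *v e = 0"
    then have "adj2 \<gamma> *v (\<gamma> *v e) = 0" by simp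
    then have "e = 0" using assms SL2C_cancel(2)[OF GamL_SL2C]
      by (metis matrix_vector_mul_assoc matrix_vector_mul_lid)
    then show False using assms by (simp add: Lam_def)
  qed
  then show ?thesis using assms by (auto simp: Lam_def GamL_def mat2_vec_sel intro!: add mult)
qed

end

lemma norm_mat2_mult_le: "norm (g ** h) \<le> 8 * norm (g :: complex^2^2) * norm (h :: complex^2^2)"
proof -
  have e: "cmod ((g ** h) $ i $ j) \<le> 2 * norm g * norm h" for i j
  proof -
    have "cmod ((g ** h) $ i $ j) \<le> cmod (g $ i $ 1) * cmod (h $ 1 $ j) + cmod (g $ i $ 2) * cmod (h $ 2 $ j)"
      unfolding mat2_mult_sel by (rule norm_triangle_le) (simp add: norm_mult)
    also have "\<dots> \<le> norm g * norm h + norm g * norm h"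
      by (intro add_mono mult_mono norm_mat2_entry) auto
    finally show ?thesis by (simp add: algebra_simps)
  qed
  show ?thesis using norm_mat2_le[of "g ** h"] e[of 1 1] e[of 1 2] e[of 2 1] e[of 2 2] by linarith
qed

lemma norm_smult_vec2: "norm (c *s (v :: complex^2)) = cmod c * norm v"
proof -
  have "norm (c *s v) ^ 2 = (cmod c * norm v) ^ 2"
    by (simp add: norm_vec2 norm_mult power_mult_distrib algebra_simps)
  then show ?thesis by (simp add: power2_eq_iff_nonneg)
qed

text \<open>Gram-Schmidt: \<open>w\<close> is the part of \<open>v\<close> orthogonal to
  \<open>u\<close>. The area spanned by \<open>u\<close> and \<open>v\<close> is that of
  \<open>u\<close> and \<open>w\<close>, and for orthogonal vectors it is the product of the
  lengths.\<close>

lemma orth_decomp: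
  assumes "wedge u v = 1" "u \<noteq> 0"
  obtains \<alpha> w where "v = \<alpha> *s u + w" "norm u * norm w = 1"
proof -
  define \<alpha> where "\<alpha> = herm u v / of_real (norm u ^ 2)"
  define w where "w = v - \<alpha> *s u"
  have nu: "complex_of_real (norm u ^ 2) = cnj (u $ 1) * u $ 1 + cnj (u $ 2) * u $ 2"
    by (simp only: norm_vec2 complex_norm_square of_real_add) (simp add: mult.commute)
  have "herm u w = herm u v - \<alpha> * of_real (norm u ^ 2)"
    unfolding nu by (simp add: w_def herm_def algebra_simps)
  also have "\<dots> = 0" using assms by (simp add: \<alpha>_def)
  finally have "herm u w = 0" .
  moreover have "wedge u w = 1" using assms(1) by (simp add: w_def wedge_def algebra_simps)
  ultimately have "(norm u * norm w) ^ 2 = 1 ^ 2"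
    using lagrange_identity[of u w] by (simp add: power_mult_distrib)
  then have "norm u * norm w = 1"
    by (simp only: power2_eq_iff_nonneg norm_ge_zero mult_nonneg_nonneg zero_le_one)
  then show thesis using that[of \<alpha> w] by (simp add: w_def)
qed

lemma mat2_vec_cols:
  fixes g :: "'a::comm_ring_1^2^2"
  shows "g *v w = w $ 1 *s (g *v vector [1, 0]) + w $ 2 *s (g *v vector [0, 1])"
  by (simp add: vec2_eq_iff mat2_vec_sel mult.commute)

lemma complex_coords:
  assumes "Im \<omega> \<noteq> 0"
  shows "z = of_real (Re z - Im z / Im \<omega> * Re \<omega>) + of_real (Im z / Im \<omega>) * \<omega>"
  using assms by (simp add: complex_eq_iff)

text \<open>Pigeonhole principle: with \<open>n\<close> the ceiling of \<open>t\<close> there are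
  \<open>(n + 1)^2\<close> multipliers \<open>c + d * \<omega>\<close> with coordinates in 0..n, and
  \<open>n^2\<close> boxes for the fractional parts of the coordinates of their products with
  \<alpha>. The factor 2 comes from \<open>n \<le> 2 * t\<close>.\<close>

lemma dirichlet_approx:
  fixes \<alpha> \<omega> :: complex and t :: real
  assumes im: "Im \<omega> \<noteq> 0" and t: "1 \<le> t"
  obtains a b c d :: int where "(c, d) \<noteq> (0, 0)" "cmod (of_int c + of_int d * \<omega>) \<le> 2 * t * (1 + cmod \<omega>)"
    "cmod ((of_int a + of_int b * \<omega>) + (of_int c + of_int d * \<omega>) * \<alpha>) \<le> (1 + cmod \<omega>) / t"
proof -
  define n where "n = nat \<lceil>t\<rceil>"
  have n: "1 \<le> n" "t \<le> real n" "real n \<le> 2 * t" using t by (auto simp: n_def) linarith+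
  define Q where "Q x = Im ((of_int (fst x) + of_int (snd x) * \<omega>) * \<alpha>) / Im \<omega>" for x :: "int \<times> int"
  define P where "P x = Re ((of_int (fst x) + of_int (snd x) * \<omega>) * \<alpha>) - Q x * Re \<omega>" for x :: "int \<times> int"
  have PQ: "(of_int (fst x) + of_int (snd x) * \<omega>) * \<alpha> = of_real (P x) + of_real (Q x) * \<omega>" for x
    using complex_coords[OF im, of "(of_int (fst x) + of_int (snd x) * \<omega>) * \<alpha>"]
    unfolding P_def Q_def by simp
  define A where "A = {0..int n} \<times> {0..int n}"
  define f where "f x = (\<lfloor>real n * frac (P x)\<rfloor>, \<lfloor>real n * frac (Q x)\<rfloor>)" for x
  have fl: "\<lfloor>real n * frac y\<rfloor> \<in> {0..<int n}" for y
  proof -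
    have "real n * frac y < real n" "0 \<le> real n * frac y"
      using frac_lt_1[of y] frac_ge_0[of y] n by auto
    then show ?thesis by (simp add: floor_less_iff)
  qed
  have "card (f ` A) \<le> card ({0..<int n} \<times> {0..<int n})"
    by (intro card_mono) (auto simp: f_def fl[simplified])
  also have "\<dots> < card A" by (simp add: A_def card_cartesian_product) (intro mult_strict_mono; simp)
  finally have "\<not> inj_on f A" by (rule pigeonhole)
  then obtain x y where xy: "x \<in> A" "y \<in> A" "x \<noteq> y" "f x = f y" by (auto simp: inj_on_def)
  have fr: "\<bar>frac u - frac v\<bar> \<le> 1 / real n" if "\<lfloor>real n * frac u\<rfloor> = \<lfloor>real n * frac v\<rfloor>" for u v
  proof -
    have "\<bar>real n * frac u - real n * frac v\<bar> < 1" using that by linarith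
    then have "real n * \<bar>frac u - frac v\<bar> < 1"
      by (simp add: abs_mult right_diff_distrib[symmetric])
    then show ?thesis using n by (simp add: field_simps)
  qed
  define c d where "c = fst x - fst y" and "d = snd x - snd y"
  define a b where "a = \<lfloor>P y\<rfloor> - \<lfloor>P x\<rfloor>" and "b = \<lfloor>Q y\<rfloor> - \<lfloor>Q x\<rfloor>"
  have 1: "(c, d) \<noteq> (0, 0)" using xy(3) by (auto simp: c_def d_def prod_eq_iff)
  have cd: "\<bar>c\<bar> \<le> int n" "\<bar>d\<bar> \<le> int n" using xy by (auto simp: c_def d_def A_def)
  have "cmod (of_int c + of_int d * \<omega>) \<le> \<bar>real_of_int c\<bar> + \<bar>real_of_int d\<bar> * cmod \<omega>"
    by (rule norm_triangle_le) (simp add: norm_mult)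
  also have "\<dots> \<le> real n + real n * cmod \<omega>"
    using cd by (intro add_mono mult_right_mono norm_ge_zero) linarith+
  also have "\<dots> = real n * (1 + cmod \<omega>)" by (simp add: algebra_simps)
  also have "\<dots> \<le> 2 * t * (1 + cmod \<omega>)" using n by (intro mult_right_mono) auto
  finally have 2: "cmod (of_int c + of_int d * \<omega>) \<le> 2 * t * (1 + cmod \<omega>)" .
  have "(of_int c + of_int d * \<omega>) * \<alpha> = of_real (P x - P y) + of_real (Q x - Q y) * \<omega>"
    using PQ[of x] PQ[of y] by (simp add: c_def d_def algebra_simps)
  then have "(of_int a + of_int b * \<omega>) + (of_int c + of_int d * \<omega>) * \<alpha>
      = of_real (frac (P x) - frac (P y)) + of_real (frac (Q x) - frac (Q y)) * \<omega>"
    by (simp add: a_def b_def frac_def algebra_simps)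
  also have "cmod \<dots> \<le> \<bar>frac (P x) - frac (P y)\<bar> + \<bar>frac (Q x) - frac (Q y)\<bar> * cmod \<omega>"
    by (rule norm_triangle_le) (simp add: norm_mult del: of_real_diff)
  also have "\<dots> \<le> 1 / real n + 1 / real n * cmod \<omega>"
    using xy(4) by (intro add_mono mult_right_mono fr) (auto simp: f_def)
  also have "\<dots> = (1 + cmod \<omega>) / real n" by (simp add: add_divide_distrib)
  also have "\<dots> \<le> (1 + cmod \<omega>) / t"
    using n t by (intro divide_left_mono) (auto intro!: mult_pos_pos add_nonneg_nonneg)
  finally show thesis using that 1 2 by blast
qed

section \<open>Lattice points: covering radius, discreteness, residue classes\<close>

context int_lattice
begin

lemma covering: "\<exists>\<rho>>0. \<forall>\<alpha>. \<exists>r\<in>R. cmod (\<alpha> + r) \<le> \<rho>"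
proof -
  obtain \<omega> where w: "\<omega> \<in> R" "Im \<omega> \<noteq> 0" using nonreal by blast
  have "\<exists>r\<in>R. cmod (\<alpha> + r) \<le> 1 + cmod \<omega>" for \<alpha>
  proof -
    obtain p q where pq: "\<alpha> = of_real p + of_real q * \<omega>" using complex_coords[OF w(2), of \<alpha>] by blast
    have "- (of_int \<lfloor>p\<rfloor> + of_int \<lfloor>q\<rfloor> * \<omega>) \<in> R" (is "?r \<in> R") using w by (intro uminus add mult of_int_R)
    moreover have "\<alpha> + ?r = of_real (frac p) + of_real (frac q) * \<omega>"
      by (simp add: pq frac_def algebra_simps)
    moreover have "cmod (of_real (frac p) + of_real (frac q) * \<omega>) \<le> 1 + 1 * cmod \<omega>"
      using frac_lt_1[of p] frac_lt_1[of q] frac_ge_0[of p] frac_ge_0[of q]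
      by (intro norm_triangle_mono) (auto simp: norm_mult intro!: mult_right_mono mult_left_le_one_le)
    ultimately show ?thesis by (metis mult_1)
  qed
  moreover have "0 < 1 + cmod \<omega>" by (simp add: add_pos_nonneg)
  ultimately show ?thesis by blast
qed

text \<open>A limit point would give two distinct elements of \<open>R\<close> at distance less than
  1.\<close>

lemma finite_ball: "finite {x \<in> R. cmod x \<le> C}"
proof (rule ccontr)
  let ?T = "{x \<in> R. cmod x \<le> C}"
  assume inf: "infinite ?T"
  have "?T \<subseteq> cball 0 C" by auto
  then obtain l where l: "l islimpt ?T"
    using compact_cball[of "0::complex" C] inf unfolding compact_eq_Bolzano_Weierstrass by blast
  then obtain x where x: "x \<in> ?T" "x \<noteq> l" "dist x l < 1/2" by (meson islimpt_approachable half_gt_zero zero_less_one)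
  then have "0 < dist x l" by simp
  then obtain y where y: "y \<in> ?T" "y \<noteq> l" "dist y l < min (1/2) (dist x l)"
    using l unfolding islimpt_approachable by (metis min_less_iff_conj half_gt_zero zero_less_one)
  have "x \<noteq> y" using y by auto
  then have "1 \<le> dist x y" using norm_ge_1[of "x - y"] x y diff by (auto simp: dist_norm)
  moreover have "dist x y < 1" using x y dist_triangle2[of x y l] by simp
  ultimately show False by simp
qed

text \<open>Every class modulo \<open>n\<close> meets the disc of radius
  \<open>\<rho> * cmod n\<close>, which contains finitely many lattice points. The classifying map
  \<open>f\<close> separates classes but may take several values on one class; this is enough for
  the pigeonhole arguments that use it.\<close>

lemma finite_residues:
  assumes n: "n \<in> R" "n \<noteq> 0"
  obtains f :: "complex \<Rightarrow> complex" and D where "finite D" "\<And>x. x \<in> R \<Longrightarrow> f x \<in> D" "\<And>x y. x \<in> R \<Longrightarrow> y \<in> R \<Longrightarrow> f x = f y \<Longrightarrow> x - y \<in> (*) n ` R"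
proof -
  obtain \<rho> where \<rho>: "\<And>\<alpha>. \<exists>r\<in>R. cmod (\<alpha> + r) \<le> \<rho>" using covering by blast
  define D where "D = {x \<in> R. cmod x \<le> \<rho> * cmod n}"
  have "\<exists>r\<in>R. x + n * r \<in> D" if x: "x \<in> R" for x
  proof -
    obtain r where r: "r \<in> R" "cmod (x / n + r) \<le> \<rho>" using \<rho> by blast
    have "cmod (x + n * r) = cmod (x / n + r) * cmod n"
      unfolding norm_mult[symmetric] using n by (simp add: distrib_right distrib_left mult.commute)
    also have "\<dots> \<le> \<rho> * cmod n" using r by (intro mult_right_mono) auto
    finally show ?thesis using r x n by (auto simp: D_def intro!: bexI[of _ r] add mult)
  qed
  then obtain r where r: "\<And>x. x \<in> R \<Longrightarrow> r x \<in> R \<and> x + n * r x \<in> D" by metis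
  show thesis
  proof (rule that[of D "\<lambda>x. x + n * r x"])
    show "finite D" unfolding D_def by (rule finite_ball)
    show "x \<in> R \<Longrightarrow> x + n * r x \<in> D" for x using r by blast
    fix x y assume xy: "x \<in> R" "y \<in> R" "x + n * r x = y + n * r y"
    then have "x - y = n * (r y - r x)" by (simp add: algebra_simps)
    then show "x - y \<in> (*) n ` R" using r xy diff by blast
  qed
qed

end

section \<open>Reduction theory for SL_2(R) and Gamma_0(M)\<close>

context bianchi_lattice
begin

lemma Lam_e1: "vector [1, 0] \<in> Lam"
  by (auto simp: Lam_def vec2_eq_iff)

text \<open>Minkowski's bound with an elementary proof. The lattice g^-1 R^2 is spanned by
  \<open>u\<close> and \<open>v = \<alpha> *s u + z\<close> with \<open>norm z = 1 / norm u\<close>.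
  Approximating \<alpha> by a quotient with denominator \<open>y\<close> of size
  \<open>norm u\<close> makes both components of \<open>x *s u + y *s v\<close> bounded; the two
  bounds, 1 and 2 times \<open>1 + cmod \<omega>\<close>, add up to \<open>C\<close>.\<close>

lemma short_vector: "\<exists>C>0. \<forall>g\<in>SL2C. \<exists>e\<in>Lam. norm (adj2 g *v e) \<le> C"
proof -
  obtain \<omega> where w: "\<omega> \<in> R" "Im \<omega> \<noteq> 0" using nonreal by blast
  define C where "C = 3 * (1 + cmod \<omega>)"
  have "\<exists>e\<in>Lam. norm (adj2 g *v e) \<le> C" if g: "g \<in> SL2C" for g
  proof -
    define h where "h = adj2 g"
    define u v where "u = h *v vector [1, 0]" and "v = h *v vector [0, 1]"
    have wd: "wedge u v = 1" using g by (simp add: u_def v_def wedge_mult h_def SL2C_def) (simp add: wedge_def)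
    show ?thesis
    \<comment> \<open>Dirichlet's theorem is applied with \<open>t = norm u\<close>, which has to be
      at least 1; a shorter \<open>u\<close> is itself the image of a lattice vector.\<close>
    proof (cases "norm u \<le> 1")
      case True
      moreover have "1 + 0 \<le> 1 + (2 + 3 * cmod \<omega>)" by (intro add_left_mono add_nonneg_nonneg) simp_all
      then have "1 \<le> C" by (simp add: C_def)
      ultimately have "norm (adj2 g *v vector [1, 0]) \<le> C" by (simp add: u_def h_def)
      then show ?thesis using Lam_e1 by blast
    next
      case False
      then have u0: "u \<noteq> 0" and u1: "1 \<le> norm u" by auto
      obtain \<alpha> z where z: "v = \<alpha> *s u + z" "norm u * norm z = 1" using orth_decomp[OF wd u0] .
      obtain a b c d where abcd: "(c, d) \<noteq> (0, 0 :: int)"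
        "cmod (of_int c + of_int d * \<omega>) \<le> 2 * norm u * (1 + cmod \<omega>)"
        "cmod ((of_int a + of_int b * \<omega>) + (of_int c + of_int d * \<omega>) * \<alpha>) \<le> (1 + cmod \<omega>) / norm u"
        by (rule dirichlet_approx[OF w(2) u1])
      define x y where "x = of_int a + of_int b * \<omega>" and "y = of_int c + of_int d * \<omega>"
      have xyR: "x \<in> R" "y \<in> R" using w by (auto simp: x_def y_def intro!: add mult of_int_R)
      have y0: "y \<noteq> 0"
      proof
        assume y0: "y = 0"
        then have "Im y = 0" by simp
        then have "d = 0" using w by (simp add: y_def)
        then show False using y0 abcd(1) by (simp add: y_def)
      qed
      define e :: "complex^2" where "e = vector [x, y]"
      have e: "e \<in> Lam" using xyR y0 by (auto simp: e_def Lam_def vec2_eq_iff)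
      have "h *v e = x *s u + y *s v" by (subst mat2_vec_cols) (simp add: e_def u_def v_def)
      also have "\<dots> = (x + y * \<alpha>) *s u + y *s z" by (simp add: z vec2_eq_iff algebra_simps)
      finally have "norm (h *v e) \<le> cmod (x + y * \<alpha>) * norm u + cmod y * norm z"
        using norm_triangle_ineq[of "(x + y * \<alpha>) *s u" "y *s z"] by (simp only: norm_smult_vec2)
      also have "\<dots> \<le> (1 + cmod \<omega>) / norm u * norm u + (2 * norm u * (1 + cmod \<omega>)) * norm z"
        using abcd by (intro add_mono mult_right_mono) (auto simp: x_def y_def)
      also have "\<dots> = (1 + cmod \<omega>) + 2 * (1 + cmod \<omega>) * (norm u * norm z)"
        using u0 by simp
      also have "\<dots> = C" by (simp add: z C_def algebra_simps)
      finally show ?thesis using e by (auto simp: h_def)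
    qed
  qed
  moreover have "0 < C" by (simp add: C_def add_pos_nonneg)
  ultimately show ?thesis by blast
qed

lemma finite_Lam_ball: "finite {e \<in> Lam. norm e \<le> C}"
proof -
  have "{e \<in> Lam. norm e \<le> C} \<subseteq> (\<lambda>(x, y). vector [x, y]) ` ({x \<in> R. cmod x \<le> C} \<times> {x \<in> R. cmod x \<le> C})"
  proof
    fix e assume e: "e \<in> {e \<in> Lam. norm e \<le> C}"
    have "e = vector [e $ 1, e $ 2]" by (simp add: vec2_eq_iff)
    moreover have "cmod (e $ i) \<le> C" for i
      using e Finite_Cartesian_Product.norm_nth_le[of e i] by auto
    ultimately show "e \<in> (\<lambda>(x, y). vector [x, y]) ` ({x \<in> R. cmod x \<le> C} \<times> {x \<in> R. cmod x \<le> C})"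
      using e by (intro image_eqI[where x = "(e $ 1, e $ 2)"]) (auto simp: Lam_def)
  qed
  then show ?thesis by (rule finite_subset) (intro finite_imageI finite_cartesian_product finite_ball)
qed

text \<open>A coset \<open>\<tau> ** GamL M\<close> is determined by the first column modulo a
  non-zero element \<open>n\<close> of \<open>M\<close>: the lower left entry of
  \<open>adj2 \<tau> ** \<gamma>\<close> is the determinant formed by the two first columns.\<close>

lemma finite_index:
  assumes M: "is_level M"
  obtains T where "finite T" "T \<subseteq> GamL R" "\<And>\<gamma>. \<gamma> \<in> GamL R \<Longrightarrow> \<exists>\<tau>\<in>T. adj2 \<tau> ** \<gamma> \<in> GamL M"
proof -
  obtain n where n: "n \<in> M" "n \<noteq> 0" using is_levelD(4)[OF M] by blast
  then have nR: "n \<in> R" using is_levelD(1)[OF M] by blast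
  obtain f :: "complex \<Rightarrow> complex" and D where f: "finite D" "\<And>x. x \<in> R \<Longrightarrow> f x \<in> D"
    "\<And>x y. x \<in> R \<Longrightarrow> y \<in> R \<Longrightarrow> f x = f y \<Longrightarrow> x - y \<in> (*) n ` R"
    by (rule finite_residues[OF nR n(2)]) (rule that, assumption+)
  define F where "F \<gamma> = (f (\<gamma> $ 1 $ 1), f (\<gamma> $ 2 $ 1))" for \<gamma> :: "complex^2^2"
  have "F ` GamL R \<subseteq> D \<times> D" using f(2) by (auto simp: F_def GamL_def)
  then have fin: "finite (F ` GamL R)" using f(1) by (meson finite_SigmaI finite_subset)
  define T where "T = inv_into (GamL R) F ` (F ` GamL R)"
  show thesis
  proof (rule that[of T])
    show "finite T" using fin by (simp add: T_def)
    show "T \<subseteq> GamL R" by (auto simp: T_def intro: inv_into_into)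
    fix \<gamma> assume g: "\<gamma> \<in> GamL R"
    define \<tau> where "\<tau> = inv_into (GamL R) F (F \<gamma>)"
    have t: "\<tau> \<in> GamL R" "F \<tau> = F \<gamma>" "\<tau> \<in> T"
      using g by (auto simp: \<tau>_def T_def inv_into_into f_inv_into_f)
    then obtain x y where x: "x \<in> R" "\<gamma> $ 1 $ 1 - \<tau> $ 1 $ 1 = n * x" and y: "y \<in> R" "\<gamma> $ 2 $ 1 - \<tau> $ 2 $ 1 = n * y"
      using f(3)[of "\<gamma> $ 1 $ 1" "\<tau> $ 1 $ 1"] f(3)[of "\<gamma> $ 2 $ 1" "\<tau> $ 2 $ 1"] g by (auto simp: F_def GamL_def)
    have "(adj2 \<tau> ** \<gamma>) $ 2 $ 1 = \<tau> $ 1 $ 1 * (\<gamma> $ 2 $ 1 - \<tau> $ 2 $ 1) - \<tau> $ 2 $ 1 * (\<gamma> $ 1 $ 1 - \<tau> $ 1 $ 1)"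
      by (simp add: mat2_mult_sel algebra_simps)
    also have "\<dots> = (\<tau> $ 1 $ 1 * y - \<tau> $ 2 $ 1 * x) * n" by (simp add: x y algebra_simps)
    finally have "(adj2 \<tau> ** \<gamma>) $ 2 $ 1 = (\<tau> $ 1 $ 1 * y - \<tau> $ 2 $ 1 * x) * n" .
    moreover have "\<tau> $ 1 $ 1 * y - \<tau> $ 2 $ 1 * x \<in> R" using t x y by (auto simp: GamL_def intro!: diff mult)
    ultimately have "(adj2 \<tau> ** \<gamma>) $ 2 $ 1 \<in> M" using is_levelD(3)[OF M n(1)] by simp
    moreover have "adj2 \<tau> ** \<gamma> \<in> GamL R" using t g GamL_mult GamL_adj2 is_level_R by blast
    ultimately show "\<exists>\<tau>\<in>T. adj2 \<tau> ** \<gamma> \<in> GamL M" using t(3) by (auto simp: GamL_def)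
  qed
qed

text \<open>This is the single class of cusps: after division by a common divisor the coordinates
  are coprime, and a Bezout relation completes them to a matrix.\<close>

lemma primitive:
  assumes e: "e \<in> Lam"
  obtains \<gamma> d where "\<gamma> \<in> GamL R" "d \<in> R" "d \<noteq> 0" "e = d *s (\<gamma> *v vector [1, 0])"
proof -
  obtain d a' b' s t where *: "d \<in> R" "a' \<in> R" "b' \<in> R" "s \<in> R" "t \<in> R" "e $ 1 = d * a'" "e $ 2 = d * b'"
    "s * a' + t * b' = 1"
    using bezout[of "e $ 1" "e $ 2"] e by (auto simp: Lam_def vec2_eq_iff)
  have "mat2 a' (- t) b' s \<in> GamL R"
    using * by (auto simp: GamL_def forall_2 det_2 uminus algebra_simps)
  moreover have "d \<noteq> 0" using * e by (auto simp: Lam_def vec2_eq_iff)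
  moreover have "e = d *s (mat2 a' (- t) b' s *v vector [1, 0])"
    using * by (simp add: vec2_eq_iff mat2_vec_sel)
  ultimately show thesis using that * by blast
qed

text \<open>Siegel domains: the short vector, made primitive, becomes the first basis vector
  \<open>u\<close>, of length between \<eta> and \<open>C0\<close>. An upper unipotent matrix makes
  the component of the second vector along \<open>u\<close> bounded, and its orthogonal component
  has length \<open>1 / norm u \<le> 1 / \<eta>\<close>.\<close>

lemma reduction_R:
  assumes \<eta>: "0 < \<eta>"
  obtains C where "\<And>g. g \<in> SL2C \<Longrightarrow> (\<And>e. e \<in> Lam \<Longrightarrow> \<eta> \<le> norm (adj2 g *v e)) \<Longrightarrow> \<exists>\<gamma>\<in>GamL R. norm (\<gamma> ** g) \<le> C"
proof -
  obtain C0 where C0: "0 < C0" "\<And>g. g \<in> SL2C \<Longrightarrow> \<exists>e\<in>Lam. norm (adj2 g *v e) \<le> C0" using short_vector by blast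
  obtain \<rho> where \<rho>: "0 < \<rho>" "\<And>\<alpha>. \<exists>r\<in>R. cmod (\<alpha> + r) \<le> \<rho>" using covering by blast
  define C where "C = 4 * (2 * C0 + 2 * (\<rho> * C0 + 1 / \<eta>))"
  show thesis
  proof (rule that)
    fix g assume g: "g \<in> SL2C" and ge: "\<And>e. e \<in> Lam \<Longrightarrow> \<eta> \<le> norm (adj2 g *v e)"
    obtain e where e: "e \<in> Lam" "norm (adj2 g *v e) \<le> C0" using C0 g by blast
    obtain \<gamma> d where \<gamma>: "\<gamma> \<in> GamL R" "d \<in> R" "d \<noteq> 0" "e = d *s (\<gamma> *v vector [1, 0])" using primitive[OF e(1)] .
    define h where "h = adj2 g ** \<gamma>"
    have h: "h \<in> SL2C" using g GamL_SL2C[OF \<gamma>(1)] by (auto simp: h_def intro!: SL2C_mult SL2C_adj2)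
    define u v where "u = h *v vector [1, 0]" and "v = h *v vector [0, 1]"
    have uv: "h $ 1 $ 1 = u $ 1" "h $ 2 $ 1 = u $ 2" "h $ 1 $ 2 = v $ 1" "h $ 2 $ 2 = v $ 2"
      by (simp_all add: u_def v_def mat2_vec_sel)
    have "adj2 g *v e = d *s u"
      by (simp add: \<gamma> u_def h_def matrix_vector_mul_assoc[symmetric] vec2_eq_iff mat2_vec_sel algebra_simps)
    then have "cmod d * norm u \<le> C0" using e by (simp add: norm_smult_vec2)
    moreover have "1 * norm u \<le> cmod d * norm u" using norm_ge_1 \<gamma> by (intro mult_right_mono) auto
    ultimately have u1: "norm u \<le> C0" by simp
    have u2: "\<eta> \<le> norm u"
      using ge[OF GamL_Lam[OF \<gamma>(1) Lam_e1]] by (simp add: u_def h_def matrix_vector_mul_assoc)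
    then have u0: "u \<noteq> 0" using \<eta> by auto
    have wd: "wedge u v = 1" using h by (simp add: u_def v_def wedge_mult SL2C_def) (simp add: wedge_def)
    obtain \<alpha> w where w: "v = \<alpha> *s u + w" "norm u * norm w = 1" using orth_decomp[OF wd u0] .
    obtain r where r: "r \<in> R" "cmod (\<alpha> + r) \<le> \<rho>" using \<rho> by blast
    have "norm w = 1 / norm u" using w(2) u0 by (simp add: field_simps)
    also have "\<dots> \<le> 1 / \<eta>" using u2 \<eta> u0 by (intro divide_left_mono) auto
    finally have w1: "norm w \<le> 1 / \<eta>" .
    have "v + r *s u = (\<alpha> + r) *s u + w" by (simp add: w vec2_eq_iff algebra_simps)
    then have "norm (v + r *s u) \<le> cmod (\<alpha> + r) * norm u + norm w"
      using norm_triangle_ineq[of "(\<alpha> + r) *s u" w] by (simp only: norm_smult_vec2)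
    also have "\<dots> \<le> \<rho> * C0 + 1 / \<eta>" using r u1 w1 \<rho> by (intro add_mono mult_mono) auto
    finally have v1: "norm (v + r *s u) \<le> \<rho> * C0 + 1 / \<eta>" .
    define \<gamma>1 where "\<gamma>1 = mat2 1 r 0 1"
    have \<gamma>1: "\<gamma>1 \<in> GamL R" using r by (auto simp: \<gamma>1_def GamL_def forall_2 det_2)
    have "norm (h ** \<gamma>1) \<le> cmod (u $ 1) + cmod ((v + r *s u) $ 1) + cmod (u $ 2) + cmod ((v + r *s u) $ 2)"
      using norm_mat2_le[of "h ** \<gamma>1"] by (simp add: mat2_mult_sel \<gamma>1_def uv algebra_simps)
    also have "\<dots> \<le> norm u + norm (v + r *s u) + norm u + norm (v + r *s u)"
      by (intro add_mono Finite_Cartesian_Product.norm_nth_le)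
    also have "\<dots> \<le> 2 * C0 + 2 * (\<rho> * C0 + 1 / \<eta>)" using u1 v1 by simp
    finally have hb: "norm (h ** \<gamma>1) \<le> 2 * C0 + 2 * (\<rho> * C0 + 1 / \<eta>)" .
    have "adj2 (\<gamma> ** \<gamma>1) ** g = adj2 (h ** \<gamma>1)" by (simp add: h_def adj2_mult matrix_mul_assoc)
    then have "norm (adj2 (\<gamma> ** \<gamma>1) ** g) \<le> C" using hb norm_adj2_le[of "h ** \<gamma>1"] by (simp add: C_def)
    moreover have "adj2 (\<gamma> ** \<gamma>1) \<in> GamL R" using \<gamma> \<gamma>1 GamL_mult GamL_adj2 is_level_R by blast
    ultimately show "\<exists>\<gamma>\<in>GamL R. norm (\<gamma> ** g) \<le> C" by blast
  qed
qed

text \<open>Mahler's compactness criterion. Passing from \<open>R\<close> to \<open>M\<close> costs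
  the finitely many representatives of \<open>finite_index\<close>.\<close>

lemma reduction:
  assumes \<eta>: "0 < \<eta>" and M: "is_level M"
  shows "\<exists>C. \<forall>g\<in>SL2C. (\<forall>e\<in>Lam. \<eta> \<le> norm (adj2 g *v e)) \<longrightarrow> (\<exists>\<gamma>\<in>GamL M. norm (\<gamma> ** g) \<le> C)"
proof -
  obtain C where C: "\<And>g. g \<in> SL2C \<Longrightarrow> (\<And>e. e \<in> Lam \<Longrightarrow> \<eta> \<le> norm (adj2 g *v e)) \<Longrightarrow> \<exists>\<gamma>\<in>GamL R. norm (\<gamma> ** g) \<le> C"
    using reduction_R[OF \<eta>] by blast
  obtain T where T: "finite T" "T \<subseteq> GamL R" "\<And>\<gamma>. \<gamma> \<in> GamL R \<Longrightarrow> \<exists>\<tau>\<in>T. adj2 \<tau> ** \<gamma> \<in> GamL M"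
    using finite_index[OF M] by blast
  define K where "K = (\<Sum>\<tau>\<in>T. norm (adj2 \<tau>))"
  have K: "norm (adj2 \<tau>) \<le> K" if "\<tau> \<in> T" for \<tau>
    unfolding K_def using that T(1) by (intro member_le_sum) auto
  show ?thesis
  proof (intro exI[of _ "8 * K * C"] ballI impI)
    fix g assume g: "g \<in> SL2C" "\<forall>e\<in>Lam. \<eta> \<le> norm (adj2 g *v e)"
    then obtain \<gamma> where \<gamma>: "\<gamma> \<in> GamL R" "norm (\<gamma> ** g) \<le> C" using C by blast
    then obtain \<tau> where \<tau>: "\<tau> \<in> T" "adj2 \<tau> ** \<gamma> \<in> GamL M" using T by blast
    have "norm ((adj2 \<tau> ** \<gamma>) ** g) \<le> 8 * norm (adj2 \<tau>) * norm (\<gamma> ** g)"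
      using norm_mat2_mult_le[of "adj2 \<tau>" "\<gamma> ** g"] by (simp add: matrix_mul_assoc)
    also have "\<dots> \<le> 8 * K * C" using K[OF \<tau>(1)] \<gamma>(2)
      by (intro mult_mono) (auto intro: order_trans[OF norm_ge_zero])
    finally show "\<exists>\<gamma>\<in>GamL M. norm (\<gamma> ** g) \<le> 8 * K * C" using \<tau>(2) by blast
  qed
qed

end

lemma det_mat_2: "det (mat c :: 'a::comm_ring_1^2^2) = c ^ 2"
  by (simp add: det_2 mat_sel power2_eq_square)

section \<open>The Hecke correspondence and reduction theory\<close>

context bianchi_lattice
begin

text \<open>The common divisor \<open>d\<close> of \<open>a\<close> and \<pi> is a unit: \<pi>
  divides \<open>d * b' = \<pi>\<close> but not \<open>d\<close>, so it divides the cofactor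
  \<open>b'\<close>.\<close>

lemma inv_mod_pi:
  assumes a: "a \<in> R" "a \<notin> (*) \<pi> ` R"
  obtains i z where "i \<in> R" "z \<in> R" "a * i + \<pi> * z = 1"
proof -
  obtain d a' b' s t where *: "d \<in> R" "a' \<in> R" "b' \<in> R" "s \<in> R" "t \<in> R" "a = d * a'" "\<pi> = d * b'"
    "s * a' + t * b' = 1"
    using bezout[OF a(1) pi_R] by auto
  have "d * b' \<in> (*) \<pi> ` R" using *(7) by (auto intro!: image_eqI[of _ _ 1])
  moreover have "d \<notin> (*) \<pi> ` R"
  proof
    assume "d \<in> (*) \<pi> ` R"
    then obtain x where x: "x \<in> R" "d = \<pi> * x" by blast
    then have "a = \<pi> * (x * a')" using *(6) by (metis mult.assoc)
    then show False using a(2) mult[OF x(1) *(2)] by blast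
  qed
  ultimately obtain c where c: "c \<in> R" "b' = \<pi> * c" using pi_prime * by blast
  have "\<pi> * (d * c) = \<pi> * 1" using *(7) c by (simp add: algebra_simps)
  then have dc: "d * c = 1" by (simp only: mult_cancel_left pi_nz simp_thms)
  have "a * (s * c) + \<pi> * (t * c) = s * a' * (d * c) + t * b'" by (simp add: *(6) c algebra_simps)
  then have "a * (s * c) + \<pi> * (t * c) = 1" using dc *(8) by simp
  then show thesis using that[of "s * c" "t * c"] * c mult by blast
qed

text \<open>Representatives of \<open>SL\<^sub>2(R)\<close>-cosets of integral matrices of determinant \<open>\<pi>\<close>, that is of the Hecke
  correspondence at \<open>\<pi>\<close>.\<close>
definition hk :: "(complex^2^2) set" where
  "hk = insert (mat2 \<pi> 0 0 1) ((\<lambda>b. mat2 1 b 0 \<pi>) ` B)"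

lemma hk_fin: "finite hk" by (simp add: hk_def B_fin)

lemma hk_sum: "(\<Sum>r\<in>hk. f r) = f (mat2 \<pi> 0 0 1) + (\<Sum>b\<in>B. f (mat2 1 b 0 \<pi>))"
proof -
  have "mat2 \<pi> 0 0 1 \<notin> (\<lambda>b. mat2 1 b 0 \<pi>) ` B" using norm_pi by (auto simp: mat2_eq_iff)
  moreover have "inj_on (\<lambda>b. mat2 1 b 0 \<pi>) B" by (auto simp: inj_on_def mat2_eq_iff)
  ultimately show ?thesis by (simp add: hk_def B_fin sum.reindex)
qed

lemma hk_cases:
  assumes "r \<in> hk"
  obtains "r = mat2 \<pi> 0 0 1" | b where "b \<in> B" "r = mat2 1 b 0 \<pi>"
  using assms by (auto simp: hk_def)

lemma hk_det: "r \<in> hk \<Longrightarrow> det r = \<pi>"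
  by (erule hk_cases) (auto simp: det_2)

lemma hk_R: "r \<in> hk \<Longrightarrow> r $ i $ j \<in> R"
  using exhaust_2[of i] exhaust_2[of j] pi_R B_R by (elim hk_cases) auto

lemma hk_21: "r \<in> hk \<Longrightarrow> r $ 2 $ 1 = 0"
  by (elim hk_cases) auto

lemma level_div_pi:
  assumes M: "is_level M" and y: "y \<in> R" "\<pi> * y \<in> M"
  shows "y \<in> M"
proof -
  obtain \<mu> z where m: "\<mu> \<in> M" "z \<in> R" "\<mu> + z * \<pi> = 1" using is_levelD(5)[OF M] by blast
  have "y = y * (\<mu> + z * \<pi>)" by (simp add: m)
  also have "\<dots> = y * \<mu> + z * (\<pi> * y)" by (simp add: algebra_simps)
  finally have "y = y * \<mu> + z * (\<pi> * y)" .
  moreover have "y * \<mu> + z * (\<pi> * y) \<in> M"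
    using is_levelD(2,3)[OF M] m y by simp
  ultimately show ?thesis by simp
qed

text \<open>Hermite normal form. Modulo \<pi> the columns of \<open>X\<close> are proportional. If
  the first one vanishes, \<pi> is taken out of it, which respects the level by
  \<open>level_div_pi\<close>; otherwise the second is \<beta> times the first, and \<open>b\<close>
  is the representative of \<beta>.\<close>

lemma hermite_exists:
  assumes X: "\<And>i j. X $ i $ j \<in> R" "det X = \<pi>" "X $ 2 $ 1 \<in> M" and M: "is_level M"
  shows "\<exists>r\<in>hk. \<exists>\<gamma>\<in>GamL M. X = \<gamma> ** r"
proof -
  let ?P = "(*) \<pi> ` R"
  have dX: "X $ 1 $ 1 * X $ 2 $ 2 - X $ 1 $ 2 * X $ 2 $ 1 = \<pi>" using X(2) by (simp add: det_2)
  show ?thesis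
  proof (cases "X $ 1 $ 1 \<in> ?P \<and> X $ 2 $ 1 \<in> ?P")
    case True
    then obtain a c where ac: "a \<in> R" "X $ 1 $ 1 = \<pi> * a" "c \<in> R" "X $ 2 $ 1 = \<pi> * c" by auto
    have "c \<in> M" using level_div_pi[OF M ac(3)] X(3) ac by simp
    moreover have "\<pi> * (a * X $ 2 $ 2 - X $ 1 $ 2 * c) = \<pi> * 1"
      using dX ac by (simp add: algebra_simps)
    then have "a * X $ 2 $ 2 - X $ 1 $ 2 * c = 1" by (simp only: mult_cancel_left pi_nz simp_thms)
    ultimately have "mat2 a (X $ 1 $ 2) c (X $ 2 $ 2) \<in> GamL M"
      using X ac by (auto simp: GamL_def forall_2 det_2)
    moreover have "X = mat2 a (X $ 1 $ 2) c (X $ 2 $ 2) ** mat2 \<pi> 0 0 1"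
      using ac by (simp add: mat2_eq_iff mat2_mult_sel mult.commute)
    ultimately show ?thesis by (auto simp: hk_def)
  next
    case False
    have "\<exists>\<beta>\<in>R. X $ 1 $ 2 - X $ 1 $ 1 * \<beta> \<in> ?P \<and> X $ 2 $ 2 - X $ 2 $ 1 * \<beta> \<in> ?P"
    proof -
      \<comment> \<open>\<beta> is \<open>v / u\<close> modulo \<pi>; the vanishing determinant
        gives the same quotient in the other row. The entry invertible modulo \<pi> may be in either
        row, whence the general form.\<close>
      have solve: "\<exists>\<beta>\<in>R. v - u * \<beta> \<in> ?P \<and> v' - u' * \<beta> \<in> ?P"
        if uv: "u \<in> R" "u' \<in> R" "v \<in> R" "v' \<in> R" "u * v' - u' * v \<in> ?P" "u \<notin> ?P" for u u' v v'
      proof -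
        obtain i z where i: "i \<in> R" "z \<in> R" "u * i + \<pi> * z = 1" using inv_mod_pi[OF uv(1,6)] .
        obtain w where w: "w \<in> R" "u * v' - u' * v = \<pi> * w" using uv(5) by blast
        have iz: "u * i = 1 - \<pi> * z" using i(3) by (simp add: algebra_simps)
        have "v - u * (i * v) = (1 - u * i) * v" by (simp add: algebra_simps)
        also have "\<dots> = \<pi> * (z * v)" by (simp add: iz)
        finally have 1: "v - u * (i * v) = \<pi> * (z * v)" .
        have "v' - u' * (i * v) = (1 - u * i) * v' + i * (u * v' - u' * v)" by (simp add: algebra_simps)
        also have "\<dots> = \<pi> * z * v' + i * (\<pi> * w)" by (simp add: iz w(2))
        also have "\<dots> = \<pi> * (z * v' + i * w)" by (simp add: algebra_simps)
        finally have 2: "v' - u' * (i * v) = \<pi> * (z * v' + i * w)" .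
        have "z * v \<in> R" "z * v' + i * w \<in> R" "i * v \<in> R" using i w uv add mult by auto
        then show ?thesis using 1 2 by (intro bexI[of _ "i * v"]) auto
      qed
      have "X $ 1 $ 1 * X $ 2 $ 2 - X $ 2 $ 1 * X $ 1 $ 2 = \<pi> * 1"
        "X $ 2 $ 1 * X $ 1 $ 2 - X $ 1 $ 1 * X $ 2 $ 2 = \<pi> * (- 1)"
        using dX by (simp_all add: algebra_simps)
      then have "X $ 1 $ 1 * X $ 2 $ 2 - X $ 2 $ 1 * X $ 1 $ 2 \<in> ?P"
        "X $ 2 $ 1 * X $ 1 $ 2 - X $ 1 $ 1 * X $ 2 $ 2 \<in> ?P" using uminus[OF one] one by blast+
      then show ?thesis using False solve X(1) by blast
    qed
    then obtain \<beta> where \<beta>: "\<beta> \<in> R" "X $ 1 $ 2 - X $ 1 $ 1 * \<beta> \<in> ?P" "X $ 2 $ 2 - X $ 2 $ 1 * \<beta> \<in> ?P" by blast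
    obtain b y where b: "b \<in> B" "y \<in> R" "\<beta> - b = \<pi> * y" using B_rep[OF \<beta>(1)] by blast
    obtain p where p: "p \<in> R" "X $ 1 $ 2 - X $ 1 $ 1 * \<beta> = \<pi> * p" using \<beta>(2) by blast
    obtain q where q: "q \<in> R" "X $ 2 $ 2 - X $ 2 $ 1 * \<beta> = \<pi> * q" using \<beta>(3) by blast
    define p' q' where "p' = p + X $ 1 $ 1 * y" and "q' = q + X $ 2 $ 1 * y"
    have b': "\<beta> = b + \<pi> * y" using b(3) by (simp add: algebra_simps)
    have pq: "p' \<in> R" "q' \<in> R" using p q X b by (auto simp: p'_def q'_def intro!: add mult)
    have X12: "X $ 1 $ 2 = X $ 1 $ 1 * b + p' * \<pi>" "X $ 2 $ 2 = X $ 2 $ 1 * b + q' * \<pi>"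
      using p(2) q(2) by (simp_all add: p'_def q'_def b' algebra_simps)
    have "\<pi> * (X $ 1 $ 1 * q' - p' * X $ 2 $ 1) = \<pi> * 1"
      using dX by (simp add: X12 algebra_simps)
    then have "X $ 1 $ 1 * q' - p' * X $ 2 $ 1 = 1" by (simp only: mult_cancel_left pi_nz simp_thms)
    then have "mat2 (X $ 1 $ 1) p' (X $ 2 $ 1) q' \<in> GamL M"
      using X pq by (auto simp: GamL_def forall_2 det_2)
    moreover have "X = mat2 (X $ 1 $ 1) p' (X $ 2 $ 1) q' ** mat2 1 b 0 \<pi>"
      using X12 by (simp add: mat2_eq_iff mat2_mult_sel)
    ultimately show ?thesis using b(1) by (auto simp: hk_def)
  qed
qed

text \<open>The two shapes of the diagonal cannot be exchanged, as \<pi> is not invertible in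
  \<open>R\<close> by its modulus; the entry \<open>b\<close> is then unique as a residue.\<close>

lemma hermite_unique:
  assumes r: "r \<in> hk" "r' \<in> hk" and g: "\<gamma> \<in> GamL R" and eq: "r = \<gamma> ** r'"
  shows "r = r'"
proof -
  have e: "r $ i $ j = \<gamma> $ i $ 1 * r' $ 1 $ j + \<gamma> $ i $ 2 * r' $ 2 $ j" for i j
    by (simp add: eq mat2_mult_sel)
  have gR: "\<gamma> $ i $ j \<in> R" for i j using g by (rule GamL_entry)
  have npi: "x * \<pi> \<noteq> 1" "\<pi> * x \<noteq> 1" if "x \<in> R" for x
  proof -
    have "cmod (x * \<pi>) \<noteq> 1"
    proof (cases "x = 0")
      case False
      then have "1 * cmod \<pi> \<le> cmod x * cmod \<pi>" using norm_ge_1[OF that] by (intro mult_right_mono) auto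
      then have "1 < cmod x * cmod \<pi>" using norm_pi by linarith
      then show ?thesis by (simp add: norm_mult)
    qed simp
    then show "x * \<pi> \<noteq> 1" "\<pi> * x \<noteq> 1" by (auto simp: mult.commute)
  qed
  show ?thesis
  proof (cases rule: hk_cases[OF r(1)])
    case 1
    note r1 = 1
    show ?thesis
    proof (cases rule: hk_cases[OF r(2)])
      case 1 then show ?thesis using r1 by simp
    next
      case (2 b')
      have "\<gamma> $ 2 $ 1 = 0" using e[of 2 1] r1 2 by simp
      then have "\<gamma> $ 2 $ 2 * \<pi> = 1" using e[of 2 2] r1 2 by simp
      then show ?thesis using npi gR by blast
    qed
  next
    case (2 b)
    note r2 = 2
    show ?thesis
    proof (cases rule: hk_cases[OF r(2)])
      case 1
      have "\<gamma> $ 1 $ 1 * \<pi> = 1" using e[of 1 1] r2 1 by simp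
      then show ?thesis using npi gR by blast
    next
      case (2 b')
      have "\<gamma> $ 1 $ 1 = 1" using e[of 1 1] r2 2 by simp
      then have "b - b' = \<pi> * \<gamma> $ 1 $ 2" using e[of 1 2] r2 2 by simp
      then have "b - b' \<in> (*) \<pi> ` R" using gR by blast
      moreover have "b - b \<in> (*) \<pi> ` R" by (auto intro!: image_eqI[of _ _ 0])
      ultimately have "b = b'" using B_rep[of b] r2 2 B_R by blast
      then show ?thesis using r2 2 by simp
    qed
  qed
qed

text \<open>The integral matrices of determinant \<pi> with lower left entry in \<open>M\<close> are
  the union of the cosets \<open>GamL M ** r\<close> for \<open>r\<close> in \<open>hk\<close>, and
  they are stable under right multiplication by \<open>GamL M\<close>. Injectivity of \<sigma> is
  the uniqueness of the normal form, surjectivity then follows from finiteness.\<close>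

lemma hk_perm:
  assumes M: "is_level M" and g: "\<gamma> \<in> GamL M"
  obtains \<sigma> where "bij_betw \<sigma> hk hk" "\<And>r. r \<in> hk \<Longrightarrow> \<exists>\<gamma>'\<in>GamL M. r ** \<gamma> = \<gamma>' ** \<sigma> r"
proof -
  have "\<exists>s\<in>hk. \<exists>\<gamma>'\<in>GamL M. r ** \<gamma> = \<gamma>' ** s" if r: "r \<in> hk" for r
  proof (rule hermite_exists[OF _ _ _ M])
    have gR: "\<gamma> $ i $ j \<in> R" for i j using g by (rule GamL_entry)
    show "(r ** \<gamma>) $ i $ j \<in> R" for i j
      using hk_R[OF r] gR by (auto simp: mat2_mult_sel intro!: add mult)
    show "det (r ** \<gamma>) = \<pi>" using g by (simp add: det_mul hk_det[OF r] GamL_def)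
    have "\<gamma> $ 2 $ 1 \<in> M" using g by (simp add: GamL_def)
    then show "(r ** \<gamma>) $ 2 $ 1 \<in> M"
      using is_levelD(3)[OF M] hk_R[OF r] by (simp add: mat2_mult_sel hk_21[OF r])
  qed
  then obtain \<sigma> where \<sigma>: "\<And>r. r \<in> hk \<Longrightarrow> \<sigma> r \<in> hk \<and> (\<exists>\<gamma>'\<in>GamL M. r ** \<gamma> = \<gamma>' ** \<sigma> r)" by metis
  have "inj_on \<sigma> hk"
  proof (rule inj_onI)
    fix r s assume rs: "r \<in> hk" "s \<in> hk" "\<sigma> r = \<sigma> s"
    obtain \<gamma>1 where 1: "\<gamma>1 \<in> GamL M" "r ** \<gamma> = \<gamma>1 ** \<sigma> r" using \<sigma> rs by blast
    obtain \<gamma>2 where 2: "\<gamma>2 \<in> GamL M" "s ** \<gamma> = \<gamma>2 ** \<sigma> s" using \<sigma> rs by blast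
    have "r ** \<gamma> = (\<gamma>1 ** adj2 \<gamma>2) ** (\<gamma>2 ** \<sigma> s)"
      by (simp add: 1 rs(3) matrix_mul_assoc[symmetric] SL2C_cancel[OF GamL_SL2C[OF 2(1)]])
    also have "\<dots> = ((\<gamma>1 ** adj2 \<gamma>2) ** s) ** \<gamma>" by (simp add: 2(2)[symmetric] matrix_mul_assoc)
    finally have "r ** \<gamma> ** adj2 \<gamma> = ((\<gamma>1 ** adj2 \<gamma>2) ** s) ** \<gamma> ** adj2 \<gamma>" by simp
    then have "r = (\<gamma>1 ** adj2 \<gamma>2) ** s"
      by (simp only: SL2C_cancel[OF GamL_SL2C[OF g]])
    moreover have "\<gamma>1 ** adj2 \<gamma>2 \<in> GamL R"
      using 1 2 M GamL_mono GamL_mult GamL_adj2 by blast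
    ultimately show "r = s" using hermite_unique rs by blast
  qed
  moreover have "\<sigma> ` hk = hk"
    using \<sigma> \<open>inj_on \<sigma> hk\<close> by (intro endo_inj_surj[OF hk_fin]) auto
  ultimately show thesis using \<sigma> by (intro that[of \<sigma>]) (auto simp: bij_betw_def)
qed

text \<open>A product of two Hecke representatives has square determinant and is scaled into \<open>SL\<^sub>2\<close>.\<close>
definition rho :: "(complex^2^2) \<times> (complex^2^2) \<Rightarrow> complex^2^2" where
  "rho p = mat (inverse \<pi>) ** fst p ** snd p"

lemma rho_SL2C: "p \<in> hk \<times> hk \<Longrightarrow> rho p \<in> SL2C"
  by (auto simp: rho_def SL2C_def det_mul hk_det det_mat_2 power2_eq_square field_simps)

lemma rho_perm:
  assumes M: "is_level M" and g: "\<gamma> \<in> GamL M"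
  obtains \<sigma> where "bij_betw \<sigma> (hk \<times> hk) (hk \<times> hk)"
    "\<And>p. p \<in> hk \<times> hk \<Longrightarrow> \<exists>\<gamma>'\<in>GamL M. rho p ** \<gamma> = \<gamma>' ** rho (\<sigma> p)"
proof -
  obtain s where s: "bij_betw s hk hk" "\<And>r. r \<in> hk \<Longrightarrow> \<exists>\<gamma>'\<in>GamL M. r ** \<gamma> = \<gamma>' ** s r"
    by (rule hk_perm[OF M g]) (rule that, assumption+)
  have "\<forall>r\<in>hk. \<exists>c. c \<in> GamL M \<and> r ** \<gamma> = c ** s r" using s(2) by blast
  from bchoice[OF this] obtain c where c: "\<And>r. r \<in> hk \<Longrightarrow> c r \<in> GamL M \<and> r ** \<gamma> = c r ** s r" by blast
  have "\<exists>t. bij_betw t hk hk \<and> (\<forall>r\<in>hk. \<exists>\<gamma>'\<in>GamL M. r ** c q = \<gamma>' ** t r)" if q: "q \<in> hk" for q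
  proof -
    have cq: "c q \<in> GamL M" using c[OF q] by blast
    obtain t where "bij_betw t hk hk" "\<And>r. r \<in> hk \<Longrightarrow> \<exists>\<gamma>'\<in>GamL M. r ** c q = \<gamma>' ** t r"
      by (rule hk_perm[OF M cq]) (rule that, assumption+)
    then show ?thesis by blast
  qed
  then have "\<forall>q\<in>hk. \<exists>t. bij_betw t hk hk \<and> (\<forall>r\<in>hk. \<exists>\<gamma>'\<in>GamL M. r ** c q = \<gamma>' ** t r)" by blast
  from bchoice[OF this] obtain t where t: "\<And>q. q \<in> hk \<Longrightarrow> bij_betw (t q) hk hk"
    "\<And>q r. q \<in> hk \<Longrightarrow> r \<in> hk \<Longrightarrow> \<exists>\<gamma>'\<in>GamL M. r ** c q = \<gamma>' ** t q r" by blast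
  \<comment> \<open>\<gamma> first passes the second factor and becomes \<open>c (snd p)\<close>,
    which then passes the first one; so the permutation of the first factors depends on the second
    factor.\<close>
  define \<sigma> where "\<sigma> p = (t (snd p) (fst p), s (snd p))" for p
  have ts: "t q r \<in> hk" "s q \<in> hk" if "q \<in> hk" "r \<in> hk" for q r
    using t(1)[OF that(1)] s(1) that by (auto simp: bij_betw_def)
  have "inj_on \<sigma> (hk \<times> hk)"
    using s(1) t(1) by (auto simp: inj_on_def \<sigma>_def bij_betw_def)
  moreover have "\<sigma> ` (hk \<times> hk) = hk \<times> hk"
    using ts calculation by (intro endo_inj_surj) (auto simp: \<sigma>_def hk_fin)
  moreover have "\<exists>\<gamma>'\<in>GamL M. rho p ** \<gamma> = \<gamma>' ** rho (\<sigma> p)" if p: "p \<in> hk \<times> hk" for p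
  proof -
    obtain \<gamma>' where g': "\<gamma>' \<in> GamL M" "fst p ** c (snd p) = \<gamma>' ** t (snd p) (fst p)"
      using t(2)[of "snd p" "fst p"] p by auto
    have comm: "mat z ** X = X ** mat z" for z and X :: "complex^2^2"
      by (simp add: mat2_eq_iff mat2_mult_sel mat_sel mult.commute)
    have "rho p ** \<gamma> = mat (inverse \<pi>) ** (fst p ** (snd p ** \<gamma>))"
      by (simp add: rho_def matrix_mul_assoc)
    also have "snd p ** \<gamma> = c (snd p) ** s (snd p)" using c p by auto
    also have "fst p ** (c (snd p) ** s (snd p)) = \<gamma>' ** t (snd p) (fst p) ** s (snd p)"
      by (simp add: g'(2) matrix_mul_assoc)
    also have "mat (inverse \<pi>) ** (\<gamma>' ** t (snd p) (fst p) ** s (snd p)) = \<gamma>' ** rho (\<sigma> p)"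
      by (simp add: rho_def \<sigma>_def matrix_mul_assoc comm[of _ \<gamma>'])
    finally show ?thesis using g' by blast
  qed
  ultimately show thesis by (intro that[of \<sigma>]) (auto simp: bij_betw_def)
qed

text \<open>The height of \<open>g\<close> in the cusp, the inverse square of the shortest vector of the lattice
  \<open>g\<^sup>-\<^sup>1 R\<^sup>2\<close>. It is a Lyapunov function of the Hecke random walk, by \<open>W_rho_avg\<close>.\<close>
definition W :: "complex^2^2 \<Rightarrow> real" where
  "W g = cmod (det g) / (norm (adj2 g *v arg_min (\<lambda>e. norm (adj2 g *v e)) (\<lambda>e. e \<in> Lam))) ^ 2"

section \<open>Drift of the height under the Hecke correspondence\<close>

lemma norm_le_adj2_vec:
  assumes "det g \<noteq> 0"
  shows "norm e \<le> 4 * norm g / cmod (det g) * norm (adj2 g *v e)"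
proof -
  have "g *v (adj2 g *v e) = det g *s e"
    by (simp add: vec2_eq_iff mat2_vec_sel det_2 algebra_simps)
  then have "cmod (det g) * norm e \<le> 4 * norm g * norm (adj2 g *v e)"
    using norm_mat2_vec_le[of g "adj2 g *v e"] by (simp add: norm_smult_vec2)
  then show ?thesis using assms by (simp add: field_simps)
qed

lemma min_vector:
  assumes g: "det g \<noteq> 0"
  obtains e where "e \<in> Lam" "\<And>e'. e' \<in> Lam \<Longrightarrow> norm (adj2 g *v e) \<le> norm (adj2 g *v e')"
    "W g = cmod (det g) / norm (adj2 g *v e) ^ 2" "norm (adj2 g *v e) > 0"
proof -
  let ?f = "\<lambda>e. norm (adj2 g *v e)"
  define C where "C = 4 * norm g / cmod (det g) * ?f (vector [1, 0])"
  let ?S = "{e \<in> Lam. norm e \<le> C}"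
  have S: "finite ?S" "vector [1, 0] \<in> ?S"
    using finite_Lam_ball Lam_e1 norm_le_adj2_vec[OF g] by (auto simp: C_def)
  then obtain e where e: "e \<in> ?S" "\<And>e'. e' \<in> ?S \<Longrightarrow> ?f e \<le> ?f e'"
    using arg_min_if_finite(1)[of ?S ?f] arg_min_least[of ?S _ ?f] by blast
  have min: "?f e \<le> ?f e'" if "e' \<in> Lam" for e'
  proof (cases "norm e' \<le> C")
    case True then show ?thesis using e that by auto
  next
    case False
    then have "C < 4 * norm g / cmod (det g) * ?f e'" using norm_le_adj2_vec[OF g, of e'] by linarith
    moreover have "0 \<le> 4 * norm g / cmod (det g)" by simp
    ultimately have "?f (vector [1, 0]) \<le> ?f e'" unfolding C_def
      by (meson linorder_not_less mult_left_mono order_less_imp_le)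
    then show ?thesis using e(2)[OF S(2)] by linarith
  qed
  have am: "is_arg_min ?f (\<lambda>e. e \<in> Lam) e" using e min by (auto simp: is_arg_min_linorder)
  then have "is_arg_min ?f (\<lambda>e. e \<in> Lam) (arg_min ?f (\<lambda>e. e \<in> Lam))"
    unfolding arg_min_def by (rule someI)
  then have "?f (arg_min ?f (\<lambda>e. e \<in> Lam)) = ?f e"
    using am by (auto simp: is_arg_min_linorder intro: antisym)
  moreover have "?f e > 0"
  proof -
    have "e \<noteq> 0" using e by (auto simp: Lam_def)
    then show ?thesis using norm_le_adj2_vec[OF g, of e] by (cases "?f e = 0") auto
  qed
  ultimately show thesis using that[of e] e min by (auto simp: W_def)
qed

lemma W_ge:
  assumes g: "det g \<noteq> 0" and e: "e \<in> Lam"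
  shows "cmod (det g) / norm (adj2 g *v e) ^ 2 \<le> W g"
proof -
  obtain e0 where e0: "e0 \<in> Lam" "\<And>e'. e' \<in> Lam \<Longrightarrow> norm (adj2 g *v e0) \<le> norm (adj2 g *v e')"
    "W g = cmod (det g) / norm (adj2 g *v e0) ^ 2" "norm (adj2 g *v e0) > 0"
    by (rule min_vector[OF g]) (rule that, assumption+)
  show ?thesis unfolding e0(3) using e0(2)[OF e] e0(4)
    by (intro divide_left_mono power_mono mult_pos_pos zero_less_power) auto
qed

lemma W_pos: "det g \<noteq> 0 \<Longrightarrow> 0 < W g"
  by (rule min_vector) auto

lemma W_inv:
  assumes g: "det g \<noteq> 0" and \<gamma>: "\<gamma> \<in> GamL R"
  shows "W (\<gamma> ** g) = W g"
proof -
  have le: "W (\<gamma> ** g) \<le> W g" if gd: "det g \<noteq> 0" "\<gamma> \<in> GamL R" for g \<gamma>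
  proof -
    have d: "det (\<gamma> ** g) = det g" using gd by (simp add: det_mul GamL_def)
    obtain e where e: "e \<in> Lam" "W (\<gamma> ** g) = cmod (det (\<gamma> ** g)) / norm (adj2 (\<gamma> ** g) *v e) ^ 2"
      by (rule min_vector[of "\<gamma> ** g"]) (use gd d in simp, rule that, assumption+)
    have "adj2 \<gamma> *v e \<in> Lam" using GamL_Lam GamL_adj2[OF is_level_R] gd e by blast
    from W_ge[OF gd(1) this] show ?thesis
      by (simp add: e(2) d adj2_mult matrix_vector_mul_assoc)
  qed
  have "W g = W (adj2 \<gamma> ** (\<gamma> ** g))" by (simp add: SL2C_cancel[OF GamL_SL2C[OF \<gamma>]])
  also have "\<dots> \<le> W (\<gamma> ** g)"
    using g \<gamma> by (intro le GamL_adj2 is_level_R) (auto simp: det_mul GamL_def)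
  finally show ?thesis using le[OF g \<gamma>] by simp
qed

lemma W_scale:
  assumes g: "det g \<noteq> 0" and c: "c \<noteq> 0"
  shows "W (mat c ** g) = W g"
proof -
  have le: "W (mat c ** g) \<le> W g" if g: "det g \<noteq> 0" and c: "c \<noteq> 0" for g c
  proof -
    have d: "det (mat c ** g) = c ^ 2 * det g" by (simp add: det_mul det_mat_2)
    have a: "adj2 (mat c ** g) *v e = c *s (adj2 g *v e)" for e
      by (simp add: vec2_eq_iff mat2_vec_sel mat2_mult_sel mat_sel algebra_simps)
    obtain e where e: "e \<in> Lam" "W (mat c ** g) = cmod (det (mat c ** g)) / norm (adj2 (mat c ** g) *v e) ^ 2"
      by (rule min_vector[of "mat c ** g"]) (use g c d in simp, rule that, assumption+)
    have "W (mat c ** g) = cmod (det g) / norm (adj2 g *v e) ^ 2"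
      using c by (simp add: e(2) d a norm_smult_vec2 norm_mult norm_power power_mult_distrib)
    then show ?thesis using W_ge[OF g e(1)] by simp
  qed
  have "W g = W (mat (inverse c) ** (mat c ** g))"
  proof -
    have "mat (inverse c) ** (mat c ** g) = g" using c by (simp add: mat2_eq_iff mat2_mult_sel mat_sel)
    then show ?thesis by simp
  qed
  also have "\<dots> \<le> W (mat c ** g)"
    using g c by (intro le) (auto simp: det_mul det_mat_2)
  finally show ?thesis using le[OF g c] by simp
qed

text \<open>The matrix \<open>r\<close> carries a shortest vector \<open>e\<close> to a lattice
  vector whose length for \<open>r ** g\<close> is \<open>cmod \<pi>\<close> times the old one,
  while the determinant gains only one factor \<open>cmod \<pi>\<close> against the square of the
  length.\<close>

lemma W_hk_ge:
  assumes g: "det g \<noteq> 0" and r: "r \<in> hk"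
  shows "W g / cmod \<pi> \<le> W (r ** g)"
proof -
  obtain e where e: "e \<in> Lam" "W g = cmod (det g) / norm (adj2 g *v e) ^ 2" "norm (adj2 g *v e) > 0"
    by (rule min_vector[OF g]) (rule that, assumption+)
  have d: "det (r ** g) = \<pi> * det g" by (simp add: det_mul hk_det[OF r])
  have "adj2 (r ** g) *v (r *v e) = \<pi> *s (adj2 g *v e)"
  proof -
    have "adj2 (r ** g) *v (r *v e) = adj2 g *v ((adj2 r ** r) *v e)"
      by (simp add: adj2_mult matrix_vector_mul_assoc matrix_mul_assoc)
    also have "\<dots> = \<pi> *s (adj2 g *v e)"
      by (simp add: adj2_mult_self hk_det[OF r] vec2_eq_iff mat2_vec_sel mat_sel algebra_simps)
    finally show ?thesis .
  qed
  moreover have "r *v e \<in> Lam"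
  proof -
    have "r *v e \<noteq> 0"
    proof
      assume "r *v e = 0"
      then have "\<pi> *s (adj2 g *v e) = 0" using calculation by simp
      then show False using e(3) by (simp add: vec2_eq_iff)
    qed
    moreover have "r $ i $ j \<in> R" for i j by (rule hk_R[OF r])
    ultimately show ?thesis using e(1) by (auto simp: Lam_def mat2_vec_sel intro!: add mult)
  qed
  ultimately have "cmod (\<pi> * det g) / norm (\<pi> *s (adj2 g *v e)) ^ 2 \<le> W (r ** g)"
    using W_ge[of "r ** g" "r *v e"] g by (simp add: d)
  then show ?thesis by (simp add: e(2) norm_smult_vec2 norm_mult power_mult_distrib power2_eq_square mult_ac)
qed

text \<open>High in the cusp only the multiples of (1, 0) are short: any other lattice vector spans
  with it an area of at least \<open>cmod (det g)\<close>, which contributes the term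
  \<open>cmod \<pi> / W g\<close>. On (1, 0) one representative multiplies the height by
  \<open>cmod \<pi>\<close> and the \<open>card B\<close> others divide by it.\<close>

lemma W_hk_upper:
  assumes g: "det g \<noteq> 0" and We: "W g = cmod (det g) / norm (adj2 g *v vector [1, 0]) ^ 2"
    and W: "cmod \<pi> \<le> W g"
  shows "W (mat2 \<pi> 0 0 1 ** g) \<le> cmod \<pi> * W g" "b \<in> B \<Longrightarrow> W (mat2 1 b 0 \<pi> ** g) \<le> W g / cmod \<pi>"
proof -
  let ?q = "cmod \<pi>" and ?u = "adj2 g *v vector [1, 0]"
  have W1: "1 \<le> W g" using W norm_pi by linarith
  have u0: "0 < norm ?u" using We W1 by (cases "norm ?u = 0") auto
  have main: "W (r ** g) \<le> max (cmod (\<pi> * det g) / norm (adj2 g *v (adj2 r *v vector [1, 0])) ^ 2) (?q / W g)"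
    if r: "r \<in> hk" for r
  proof -
    have d: "det (r ** g) = \<pi> * det g" by (simp add: det_mul hk_det[OF r])
    obtain e where e: "e \<in> Lam" "W (r ** g) = cmod (det (r ** g)) / norm (adj2 (r ** g) *v e) ^ 2"
      "norm (adj2 (r ** g) *v e) > 0"
      by (rule min_vector[of "r ** g"]) (use g d in simp, rule that, assumption+)
    have eR: "e $ 1 \<in> R" "e $ 2 \<in> R" using e by (auto simp: Lam_def)
    define v where "v = adj2 r *v e"
    have v: "adj2 (r ** g) *v e = adj2 g *v v" by (simp add: v_def adj2_mult matrix_vector_mul_assoc)
    have v2: "v $ 2 = r $ 1 $ 1 * e $ 2" by (simp add: v_def mat2_vec_sel hk_21[OF r])
    have vR: "v $ 2 \<in> R" unfolding v2 by (intro mult hk_R[OF r] eR)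
    have r11: "r $ 1 $ 1 \<noteq> 0" by (rule hk_cases[OF r]) simp_all
    show ?thesis
    proof (cases "v $ 2 = 0")
      case True
      then have "e $ 2 = 0" using v2 r11 by simp
      then have ev: "e = e $ 1 *s vector [1, 0]" by (simp add: vec2_eq_iff)
      have "e $ 1 \<noteq> 0" using e \<open>e $ 2 = 0\<close> by (auto simp: Lam_def vec2_eq_iff)
      then have n1: "1 \<le> cmod (e $ 1)" using norm_ge_1 eR by blast
      have "adj2 g *v v = e $ 1 *s (adj2 g *v (adj2 r *v vector [1, 0]))"
        unfolding v_def by (subst ev) (simp add: vec2_eq_iff mat2_vec_sel algebra_simps)
      then have nv: "norm (adj2 g *v v) = cmod (e $ 1) * norm (adj2 g *v (adj2 r *v vector [1, 0]))"
        by (simp add: norm_smult_vec2)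
      let ?n = "norm (adj2 g *v (adj2 r *v vector [1, 0]))"
      have "0 < ?n" using e(3) v nv by (cases "?n = 0") auto
      moreover have "?n \<le> norm (adj2 g *v v)" unfolding nv using n1 mult_right_mono[of 1 "cmod (e $ 1)" ?n] by simp
      ultimately have "W (r ** g) \<le> cmod (\<pi> * det g) / ?n ^ 2"
        unfolding e(2) d v by (intro divide_left_mono power_mono mult_pos_pos zero_less_power) auto
      then show ?thesis by simp
    next
      case False
      then have "1 \<le> cmod (v $ 2)" using norm_ge_1 vR by blast
      moreover have "wedge (vector [1, 0]) v = v $ 2" by (simp add: wedge_def)
      ultimately have "cmod (det g) * 1 \<le> cmod (det g) * cmod (wedge (vector [1, 0]) v)"
        by (intro mult_left_mono) simp_all
      then have "cmod (det g) \<le> norm ?u * norm (adj2 g *v v)"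
        using wedge_le[of ?u "adj2 g *v v"] by (simp add: wedge_mult norm_mult)
      then have "cmod (det g) ^ 2 \<le> (norm ?u * norm (adj2 g *v v)) ^ 2"
        by (rule power_mono) simp
      then have "cmod (det g) ^ 2 \<le> norm ?u ^ 2 * norm (adj2 g *v v) ^ 2"
        by (simp only: power_mult_distrib)
      then have "cmod (det g) * W g \<le> norm (adj2 g *v v) ^ 2"
        using u0 by (simp add: We power2_eq_square field_simps)
      moreover have p: "0 < cmod (det g) * W g" using g W1 by (intro mult_pos_pos) auto
      ultimately have "0 < norm (adj2 g *v v) ^ 2" by linarith
      then have *: "cmod (\<pi> * det g) / norm (adj2 g *v v) ^ 2 \<le> cmod (\<pi> * det g) / (cmod (det g) * W g)"
        by (intro divide_left_mono[OF \<open>cmod (det g) * W g \<le> norm (adj2 g *v v) ^ 2\<close>] mult_pos_pos p norm_ge_zero)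
      have **: "cmod (\<pi> * det g) / (cmod (det g) * W g) = ?q / W g" using g by (simp add: norm_mult)
      show ?thesis unfolding e(2) d v
        by (rule order_trans[OF *[unfolded **] max.cobounded2])
    qed
  qed
  have WW: "?q * ?q \<le> W g * W g" using W W1 by (intro mult_mono) auto
  have 1: "adj2 (mat2 \<pi> 0 0 1) *v vector [1, 0] = vector [1, 0]"
    by (simp add: vec2_eq_iff mat2_vec_sel)
  have "?q / W g \<le> ?q * W g" using W1 norm_pi mult_mono[of 1 "W g" 1 "W g"] by (simp add: field_simps)
  then show "W (mat2 \<pi> 0 0 1 ** g) \<le> ?q * W g"
    using main[of "mat2 \<pi> 0 0 1"] by (simp add: 1 hk_def We norm_mult)
  assume b: "b \<in> B"
  have 2: "adj2 (mat2 1 b 0 \<pi>) *v vector [1, 0] = \<pi> *s vector [1, 0]"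
    by (simp add: vec2_eq_iff mat2_vec_sel)
  have 3: "adj2 g *v (\<pi> *s vector [1, 0]) = \<pi> *s ?u"
    by (simp add: vec2_eq_iff mat2_vec_sel)
  have 4: "cmod (\<pi> * det g) / norm (\<pi> *s ?u) ^ 2 = W g / ?q"
    by (simp add: We norm_smult_vec2 norm_mult power_mult_distrib power2_eq_square)
  have "?q / W g \<le> W g / ?q" using WW W1 norm_pi by (simp add: field_simps)
  then show "W (mat2 1 b 0 \<pi> ** g) \<le> W g / ?q"
    using main[of "mat2 1 b 0 \<pi>"] b by (simp add: 2 3 4 hk_def del: vector_smult_assoc)
qed

text \<open>By invariance under \<open>GamL R\<close>, which permutes \<open>hk\<close> up to left
  factors, the shortest vector may be moved to (1, 0); then the bounds of \<open>W_hk_upper\<close>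
  add up.\<close>

lemma W_hk_sum:
  assumes g: "det g \<noteq> 0" and W: "cmod \<pi> \<le> W g"
  shows "(\<Sum>r\<in>hk. W (r ** g)) \<le> (cmod \<pi> + real (card B) / cmod \<pi>) * W g"
proof -
  obtain e where e: "e \<in> Lam" "\<And>e'. e' \<in> Lam \<Longrightarrow> norm (adj2 g *v e) \<le> norm (adj2 g *v e')"
    "W g = cmod (det g) / norm (adj2 g *v e) ^ 2" "norm (adj2 g *v e) > 0"
    by (rule min_vector[OF g]) (rule that, assumption+)
  obtain \<gamma> d where \<gamma>: "\<gamma> \<in> GamL R" "d \<in> R" "d \<noteq> 0" "e = d *s (\<gamma> *v vector [1, 0])" using primitive[OF e(1)] .
  define g' where "g' = adj2 \<gamma> ** g"
  have gg': "g = \<gamma> ** g'" by (simp add: g'_def SL2C_cancel[OF GamL_SL2C[OF \<gamma>(1)]])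
  have g'0: "det g' \<noteq> 0" using g by (simp add: gg' det_mul)
  have WW: "W g' = W g" by (simp add: gg' W_inv[OF g'0 \<gamma>(1)])
  have dd: "det g' = det g" using \<gamma>(1) by (simp add: gg' det_mul GamL_def)
  have ag: "adj2 g' *v vector [1, 0] = adj2 g *v (\<gamma> *v vector [1, 0])"
    by (simp add: g'_def adj2_mult matrix_vector_mul_assoc)
  \<comment> \<open>\<open>e\<close> is minimal and \<open>d\<close> has modulus at least 1, so the
    primitive vector below \<open>e\<close> is equally short.\<close>
  have "adj2 g *v e = d *s (adj2 g' *v vector [1, 0])"
    unfolding ag by (simp add: \<gamma>(4) vec2_eq_iff mat2_vec_sel algebra_simps)
  then have "norm (adj2 g *v e) = cmod d * norm (adj2 g' *v vector [1, 0])" by (simp add: norm_smult_vec2)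
  moreover have "1 \<le> cmod d" using norm_ge_1 \<gamma> by blast
  ultimately have "norm (adj2 g' *v vector [1, 0]) \<le> norm (adj2 g *v e)"
    using mult_right_mono[of 1 "cmod d" "norm (adj2 g' *v vector [1, 0])"] by simp
  moreover have "norm (adj2 g *v e) \<le> norm (adj2 g' *v vector [1, 0])"
    unfolding ag by (intro e(2) GamL_Lam \<gamma>(1) Lam_e1)
  ultimately have We: "W g' = cmod (det g') / norm (adj2 g' *v vector [1, 0]) ^ 2"
    using e(3) WW dd by simp
  obtain \<sigma> where \<sigma>: "bij_betw \<sigma> hk hk" "\<And>r. r \<in> hk \<Longrightarrow> \<exists>\<gamma>'\<in>GamL R. r ** \<gamma> = \<gamma>' ** \<sigma> r"
    by (rule hk_perm[OF is_level_R \<gamma>(1)]) (rule that, assumption+)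
  have "W (r ** g) = W (\<sigma> r ** g')" if r: "r \<in> hk" for r
  proof -
    obtain \<gamma>' where \<gamma>': "\<gamma>' \<in> GamL R" "r ** \<gamma> = \<gamma>' ** \<sigma> r" using \<sigma>(2)[OF r] by blast
    have sr: "\<sigma> r \<in> hk" using \<sigma>(1) r by (auto simp: bij_betw_def)
    have "r ** g = \<gamma>' ** (\<sigma> r ** g')" by (simp add: gg' matrix_mul_assoc \<gamma>'(2))
    then show ?thesis using W_inv[OF _ \<gamma>'(1), of "\<sigma> r ** g'"] g'0 by (simp add: det_mul hk_det[OF sr])
  qed
  then have "(\<Sum>r\<in>hk. W (r ** g)) = (\<Sum>r\<in>hk. W (\<sigma> r ** g'))" by (intro sum.cong) auto
  also have "\<dots> = (\<Sum>r\<in>hk. W (r ** g'))" by (rule sum.reindex_bij_betw[OF \<sigma>(1)])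
  also have "\<dots> = W (mat2 \<pi> 0 0 1 ** g') + (\<Sum>b\<in>B. W (mat2 1 b 0 \<pi> ** g'))" by (rule hk_sum)
  also have "\<dots> \<le> cmod \<pi> * W g' + (\<Sum>b\<in>B. W g' / cmod \<pi>)"
    using W_hk_upper[OF g'0 We] W WW by (intro add_mono sum_mono) auto
  also have "\<dots> = (cmod \<pi> + real (card B) / cmod \<pi>) * W g" by (simp add: WW algebra_simps)
  finally show ?thesis .
qed

lemma card_hk: "card hk = Suc (card B)"
  using hk_sum[of "\<lambda>_. 1 :: nat"] by simp

definition lam :: real where
  "lam = ((cmod \<pi> + real (card B) / cmod \<pi>) / real (card hk)) ^ 2"

text \<open>The square in \<open>lam\<close> stands for the two factors in \<open>rho\<close>. After
  clearing denominators \<open>lam < 1\<close> amounts to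
  \<open>0 < (cmod \<pi> - 1) * (card B - cmod \<pi>)\<close>.\<close>

lemma lam: "0 \<le> lam" "lam < 1"
proof -
  let ?q = "cmod \<pi>" and ?n = "real (card B)"
  have "0 < (?q - 1) * (?n - ?q)" using norm_pi B_card by simp
  then have "?q * ?q + ?n < ?q * (?n + 1)" by (simp add: algebra_simps)
  then have "(?q * ?q + ?n) / ?q < ?n + 1" using norm_pi by (simp add: field_simps)
  then have "?q + ?n / ?q < ?n + 1" using norm_pi by (simp add: add_divide_distrib)
  moreover have "0 \<le> ?q + ?n / ?q" by simp
  ultimately have "0 \<le> (?q + ?n / ?q) / real (card hk)" "(?q + ?n / ?q) / real (card hk) < 1"
    by (simp_all add: card_hk)
  then show "0 \<le> lam" "lam < 1"
    unfolding lam_def by (simp_all only: abs_square_less_1 zero_le_power2 abs_of_nonneg)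
qed

text \<open>The threshold is \<open>cmod \<pi> ^ 2\<close> because the first step may divide the
  height by \<open>cmod \<pi>\<close>, and the second step still requires height
  \<open>cmod \<pi>\<close>.\<close>

lemma W_rho_avg:
  assumes g: "det g \<noteq> 0" and W: "cmod \<pi> ^ 2 \<le> W g"
  shows "(\<Sum>p\<in>hk \<times> hk. W (rho p ** g)) / real (card (hk \<times> hk)) \<le> lam * W g"
proof -
  let ?s = "cmod \<pi> + real (card B) / cmod \<pi>"
  have "cmod \<pi> * 1 \<le> cmod \<pi> * cmod \<pi>" using norm_pi by (intro mult_left_mono) auto
  then have Wq: "cmod \<pi> \<le> W g" using W unfolding power2_eq_square by linarith
  have Wr: "cmod \<pi> \<le> W (r ** g)" if "r \<in> hk" for r
  proof -
    have "cmod \<pi> \<le> W g / cmod \<pi>" using W norm_pi by (simp add: field_simps power2_eq_square)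
    then show ?thesis using W_hk_ge[OF g that] by linarith
  qed
  have "W (rho (r, s) ** g) = W (r ** (s ** g))" if "r \<in> hk" "s \<in> hk" for r s
    using that g W_scale[of "r ** (s ** g)" "inverse \<pi>"]
    by (simp add: rho_def matrix_mul_assoc det_mul hk_det)
  then have "(\<Sum>p\<in>hk \<times> hk. W (rho p ** g)) = (\<Sum>s\<in>hk. \<Sum>r\<in>hk. W (r ** (s ** g)))"
  proof -
    assume W: "\<And>r s. r \<in> hk \<Longrightarrow> s \<in> hk \<Longrightarrow> W (rho (r, s) ** g) = W (r ** (s ** g))"
    have "(\<Sum>p\<in>hk \<times> hk. W (rho p ** g)) = (\<Sum>r\<in>hk. \<Sum>s\<in>hk. W (rho (r, s) ** g))"
      by (subst sum.cartesian_product) (simp add: split_beta')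
    also have "\<dots> = (\<Sum>r\<in>hk. \<Sum>s\<in>hk. W (r ** (s ** g)))" by (intro sum.cong refl W)
    also have "\<dots> = (\<Sum>s\<in>hk. \<Sum>r\<in>hk. W (r ** (s ** g)))" by (rule sum.swap)
    finally show ?thesis .
  qed
  also have "\<dots> \<le> (\<Sum>s\<in>hk. ?s * W (s ** g))"
    using Wr g by (intro sum_mono W_hk_sum) (auto simp: det_mul hk_det)
  also have "\<dots> = ?s * (\<Sum>s\<in>hk. W (s ** g))" by (simp add: sum_distrib_left)
  also have "\<dots> \<le> ?s * (?s * W g)"
    by (intro mult_left_mono W_hk_sum g Wq) simp
  finally have "(\<Sum>p\<in>hk \<times> hk. W (rho p ** g)) \<le> ?s ^ 2 * W g" by (simp add: power2_eq_square mult.assoc)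
  moreover have "0 < card (hk \<times> hk)" by (simp add: card_cartesian_product card_hk)
  ultimately have "(\<Sum>p\<in>hk \<times> hk. W (rho p ** g)) / real (card (hk \<times> hk)) \<le> ?s ^ 2 * W g / real (card (hk \<times> hk))"
    by (intro divide_right_mono) auto
  also have "\<dots> = lam * W g"
    by (simp add: lam_def card_cartesian_product power_divide power2_eq_square)
  finally show ?thesis .
qed

end

section \<open>Harmonic functions\<close>

definition up :: "complex \<Rightarrow> complex^2^2" where "up x = mat2 1 x 0 1"
definition lo :: "complex \<Rightarrow> complex^2^2" where "lo x = mat2 1 0 x 1"

lemma up_SL2C: "up x \<in> SL2C" and lo_SL2C: "lo x \<in> SL2C"
  by (simp_all add: up_def lo_def SL2C_def det_2)

text \<open>With a non-zero lower left entry a matrix is a product \<open>up ** lo ** up\<close>;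
  multiplication by \<open>lo 1\<close> provides such an entry. \<open>H\<close> is only a semigroup
  because the set to which this is applied in \<open>liouville\<close> is not visibly closed under
  inverses.\<close>

lemma SL2C_elementary:
  assumes mult: "\<And>a b. a \<in> H \<Longrightarrow> b \<in> H \<Longrightarrow> a ** b \<in> H"
    and up: "\<And>x. up x \<in> H" and lo: "\<And>x. lo x \<in> H" and g: "g \<in> SL2C"
  shows "g \<in> H"
proof -
  have c: "g \<in> H" if g: "g \<in> SL2C" and c: "g $ 2 $ 1 \<noteq> 0" for g
  proof -
    let ?a = "g $ 1 $ 1" and ?b = "g $ 1 $ 2" and ?c = "g $ 2 $ 1" and ?d = "g $ 2 $ 2"
    have "?a * ?d - ?b * ?c = 1" using g by (simp add: SL2C_def det_2)
    then have b: "?b = (?a * ?d - 1) / ?c" using c by (simp add: field_simps)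
    have "g = up ((?a - 1) / ?c) ** lo ?c ** up ((?d - 1) / ?c)"
      using c by (simp add: mat2_eq_iff mat2_mult_sel up_def lo_def b) (simp add: field_simps)
    moreover have "up ((?a - 1) / ?c) ** lo ?c ** up ((?d - 1) / ?c) \<in> H" by (intro mult up lo)
    ultimately show ?thesis by (simp only:)
  qed
  show ?thesis
  proof (cases "g $ 2 $ 1 = 0")
    case False then show ?thesis using c g by blast
  next
    case True
    have "g $ 1 $ 1 * g $ 2 $ 2 = 1" using g True by (simp add: SL2C_def det_2)
    then have "g $ 2 $ 2 \<noteq> 0" by auto
    then have "(g ** lo 1) $ 2 $ 1 \<noteq> 0" using True by (simp add: mat2_mult_sel lo_def)
    then have "g ** lo 1 \<in> H" using c SL2C_mult[OF g lo_SL2C] by blast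
    then have "(g ** lo 1) ** lo (- 1) \<in> H" using mult lo by blast
    also have "(g ** lo 1) ** lo (- 1) = g" by (simp add: mat2_eq_iff mat2_mult_sel lo_def)
    finally show ?thesis .
  qed
qed

text \<open>Uniform continuity with respect to right translations. These commute with averages over
  left translations, so that one modulus of continuity serves all iterates and their pointwise
  limits.\<close>

definition ruc :: "(complex^2^2 \<Rightarrow> real) \<Rightarrow> bool" where
  "ruc \<phi> \<longleftrightarrow> (\<forall>\<epsilon>>0. \<exists>\<delta>>0. \<forall>k\<in>SL2C. norm (k - mat 1) < \<delta> \<longrightarrow> (\<forall>g\<in>SL2C. \<bar>\<phi> (g ** k) - \<phi> g\<bar> \<le> \<epsilon>))"

lemma mat_mult_diff:
  fixes a b c :: "'a::comm_ring_1^2^2"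
  shows "a ** b - a ** c = a ** (b - c)"
  by (simp add: mat2_eq_iff mat2_mult_sel algebra_simps)

lemma ruc_continuous_on:
  assumes "ruc \<phi>" shows "continuous_on SL2C \<phi>"
  unfolding continuous_on_iff
proof (intro ballI allI impI)
  fix g :: "complex^2^2" and e :: real assume g: "g \<in> SL2C" and e: "0 < e"
  have "0 < e / 2" using e by simp
  then have "\<exists>\<delta>>0. \<forall>k\<in>SL2C. norm (k - mat 1) < \<delta> \<longrightarrow> (\<forall>g\<in>SL2C. \<bar>\<phi> (g ** k) - \<phi> g\<bar> \<le> e / 2)"
    using assms unfolding ruc_def by (simp only:)
  then obtain \<delta> where \<delta>: "0 < \<delta>" "\<And>k. k \<in> SL2C \<Longrightarrow> norm (k - mat 1) < \<delta> \<Longrightarrow> \<forall>g\<in>SL2C. \<bar>\<phi> (g ** k) - \<phi> g\<bar> \<le> e / 2"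
    by (elim exE conjE) blast
  define d where "d = \<delta> / (8 * norm (adj2 g) + 1)"
  have p: "0 < 8 * norm (adj2 g) + 1" using norm_ge_zero[of "adj2 g"] by linarith
  have "0 < d" using \<delta>(1) p by (simp add: d_def)
  moreover have "dist (\<phi> x) (\<phi> g) < e" if x: "x \<in> SL2C" "dist x g < d" for x
  proof -
    let ?k = "adj2 g ** x"
    have "?k - mat 1 = adj2 g ** (x - g)"
      using mat_mult_diff[of "adj2 g" x g] SL2C_cancel(2)[OF g] by simp
    then have "norm (?k - mat 1) \<le> 8 * norm (adj2 g) * norm (x - g)" by (simp only: norm_mat2_mult_le)
    also have "\<dots> \<le> (8 * norm (adj2 g) + 1) * norm (x - g)" by (intro mult_right_mono) auto
    also have "\<dots> < (8 * norm (adj2 g) + 1) * d" using x p by (intro mult_strict_left_mono) (auto simp: dist_norm)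
    also have "\<dots> = \<delta>" using p by (simp add: d_def)
    finally have "\<bar>\<phi> (g ** ?k) - \<phi> g\<bar> \<le> e / 2"
      by (rule bspec[OF \<delta>(2)[OF SL2C_mult[OF SL2C_adj2[OF g] x(1)]] g])
    then show ?thesis using e by (simp add: SL2C_cancel[OF g] dist_real_def)
  qed
  ultimately show "\<exists>d>0. \<forall>x'\<in>SL2C. dist x' g < d \<longrightarrow> dist (\<phi> x') (\<phi> g) < e" by blast
qed

section \<open>The averaging operator and its bounded harmonic functions\<close>

context bianchi_lattice
begin

definition avg :: "(complex^2^2 \<Rightarrow> real) \<Rightarrow> complex^2^2 \<Rightarrow> real" where
  "avg \<phi> g = (\<Sum>p\<in>hk \<times> hk. \<phi> (rho p ** g)) / real (card (hk \<times> hk))"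

definition ginv :: "complex set \<Rightarrow> (complex^2^2 \<Rightarrow> real) \<Rightarrow> bool" where
  "ginv M \<phi> \<longleftrightarrow> (\<forall>\<gamma>\<in>GamL M. \<forall>g\<in>SL2C. \<phi> (\<gamma> ** g) = \<phi> g)"

lemma card_hk2: "0 < card (hk \<times> hk)" "finite (hk \<times> hk)"
  by (simp_all add: card_cartesian_product card_hk hk_fin)

lemma rho_mult_SL2C: "p \<in> hk \<times> hk \<Longrightarrow> g \<in> SL2C \<Longrightarrow> rho p ** g \<in> SL2C"
  using rho_SL2C SL2C_mult by blast

lemma avg_diff_le:
  assumes "\<And>p. p \<in> hk \<times> hk \<Longrightarrow> \<bar>\<phi> (rho p ** g) - \<psi> (rho p ** h)\<bar> \<le> C"
  shows "\<bar>avg \<phi> g - avg \<psi> h\<bar> \<le> C"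
proof -
  have "\<bar>\<Sum>p\<in>hk \<times> hk. \<phi> (rho p ** g) - \<psi> (rho p ** h)\<bar> \<le> (\<Sum>p\<in>hk \<times> hk. C)"
    using assms by (intro order_trans[OF sum_abs] sum_mono)
  then have "\<bar>\<Sum>p\<in>hk \<times> hk. \<phi> (rho p ** g) - \<psi> (rho p ** h)\<bar> / real (card (hk \<times> hk)) \<le> C"
    using card_hk2 by (simp add: divide_le_eq mult.commute)
  then show ?thesis
    by (simp add: avg_def diff_divide_distrib[symmetric] sum_subtractf[symmetric] abs_divide)
qed

lemma avg_mono:
  assumes "\<And>p. p \<in> hk \<times> hk \<Longrightarrow> \<phi> (rho p ** g) \<le> C"
  shows "avg \<phi> g \<le> C"
proof -
  have "(\<Sum>p\<in>hk \<times> hk. \<phi> (rho p ** g)) \<le> (\<Sum>p\<in>hk \<times> hk. C)" using assms by (intro sum_mono)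
  then show ?thesis using card_hk2 by (simp add: avg_def divide_le_eq mult.commute)
qed

lemma avg_bdd:
  assumes "\<And>g. g \<in> SL2C \<Longrightarrow> \<bar>\<phi> g\<bar> \<le> C" "g \<in> SL2C" shows "\<bar>avg \<phi> g\<bar> \<le> C"
proof -
  have "avg (\<lambda>_. 0) g = 0" by (simp add: avg_def)
  then show ?thesis using avg_diff_le[of \<phi> g "\<lambda>_. 0" g C] assms rho_mult_SL2C by simp
qed

lemma avg_ginv:
  assumes M: "is_level M" and \<phi>: "ginv M \<phi>" shows "ginv M (avg \<phi>)"
  unfolding ginv_def
proof (intro ballI)
  fix \<gamma> g assume \<gamma>: "\<gamma> \<in> GamL M" and g: "g \<in> SL2C"
  obtain \<sigma> where \<sigma>: "bij_betw \<sigma> (hk \<times> hk) (hk \<times> hk)"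
    "\<And>p. p \<in> hk \<times> hk \<Longrightarrow> \<exists>\<gamma>'\<in>GamL M. rho p ** \<gamma> = \<gamma>' ** rho (\<sigma> p)"
    by (rule rho_perm[OF M \<gamma>]) (rule that, assumption+)
  have eq: "\<phi> (rho p ** (\<gamma> ** g)) = \<phi> (rho (\<sigma> p) ** g)" if p: "p \<in> hk \<times> hk" for p
  proof -
    obtain \<gamma>' where g': "\<gamma>' \<in> GamL M" "rho p ** \<gamma> = \<gamma>' ** rho (\<sigma> p)" using \<sigma>(2)[OF p] by blast
    have sg: "rho (\<sigma> p) ** g \<in> SL2C" by (rule rho_mult_SL2C[OF bij_betw_apply[OF \<sigma>(1) p] g])
    have "\<phi> (rho p ** (\<gamma> ** g)) = \<phi> (\<gamma>' ** (rho (\<sigma> p) ** g))" by (simp only: matrix_mul_assoc g'(2))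
    also have "\<dots> = \<phi> (rho (\<sigma> p) ** g)"
      by (rule bspec[OF bspec[OF \<phi>[unfolded ginv_def] g'(1)] sg])
    finally show ?thesis .
  qed
  have "(\<Sum>p\<in>hk \<times> hk. \<phi> (rho p ** (\<gamma> ** g))) = (\<Sum>p\<in>hk \<times> hk. \<phi> (rho (\<sigma> p) ** g))"
    by (rule sum.cong[OF refl eq])
  also have "\<dots> = (\<Sum>p\<in>hk \<times> hk. \<phi> (rho p ** g))" by (rule sum.reindex_bij_betw[OF \<sigma>(1)])
  finally show "avg \<phi> (\<gamma> ** g) = avg \<phi> g" unfolding avg_def by (simp only:)
qed

text \<open>Height at most \<open>T\<close> means that no vector is shorter than
  \<open>1 / sqrt T\<close>, and \<open>reduction\<close> applies. \<open>C\<close> is enlarged so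
  as to admit the identity, which keeps the compact sets built from it non-empty.\<close>

lemma W_le_reduction:
  assumes M: "is_level M"
  obtains C where "norm (mat 1 :: complex^2^2) \<le> C" "\<And>g. g \<in> SL2C \<Longrightarrow> W g \<le> T \<Longrightarrow> \<exists>\<gamma>\<in>GamL M. norm (\<gamma> ** g) \<le> C"
proof -
  define \<eta> where "\<eta> = 1 / sqrt (max T 1)"
  have \<eta>: "0 < \<eta>" by (simp add: \<eta>_def)
  obtain C where C: "\<forall>g\<in>SL2C. (\<forall>e\<in>Lam. \<eta> \<le> norm (adj2 g *v e)) \<longrightarrow> (\<exists>\<gamma>\<in>GamL M. norm (\<gamma> ** g) \<le> C)"
    using reduction[OF \<eta> M] by (elim exE)
  show thesis
  proof (rule that[of "max C (norm (mat 1 :: complex^2^2))"])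
    fix g assume g: "g \<in> SL2C" "W g \<le> T"
    have d: "det g = 1" using g by (simp add: SL2C_def)
    have "\<eta> \<le> norm (adj2 g *v e)" if e: "e \<in> Lam" for e
    proof -
      let ?n = "norm (adj2 g *v e)"
      have "1 / ?n ^ 2 \<le> max T 1" using W_ge[of g e] d e g by simp
      moreover have n: "?n > 0"
        using norm_le_adj2_vec[of g e] d e by (cases "?n = 0") (auto simp: Lam_def)
      ultimately have "1 / max T 1 \<le> ?n ^ 2" by (simp add: field_simps)
      then have "\<eta> ^ 2 \<le> ?n ^ 2" by (simp add: \<eta>_def power_divide)
      then show ?thesis by (rule power2_le_imp_le) simp
    qed
    then have "\<forall>e\<in>Lam. \<eta> \<le> norm (adj2 g *v e)" by (rule ballI)
    then have "\<exists>\<gamma>\<in>GamL M. norm (\<gamma> ** g) \<le> C" by (rule mp[OF bspec[OF C g(1)]])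
    then obtain \<gamma> where "\<gamma> \<in> GamL M" "norm (\<gamma> ** g) \<le> C" by (elim bexE)
    then show "\<exists>\<gamma>\<in>GamL M. norm (\<gamma> ** g) \<le> max C (norm (mat 1 :: complex^2^2))"
      by (intro bexI[of _ \<gamma>]) linarith
  qed simp
qed

text \<open>A Phragmen-Lindelof argument replaces compactness of the quotient. Where
  \<open>W g\<close> exceeds \<open>T = cmod \<pi> ^ 2\<close>, the function
  \<open>\<phi> - \<epsilon> * W\<close> lies at least
  \<open>c = \<epsilon> * ((1 - lam) * T)\<close> below its supremum \<open>t\<close>, so that
  \<open>t \<le> max S (t - c)\<close> and hence \<open>t \<le> S\<close>, attained or not. Then
  \<epsilon> tends to 0.\<close>

lemma max_principle:
  assumes bdd: "\<And>g. g \<in> SL2C \<Longrightarrow> \<bar>\<phi> g\<bar> \<le> C" and harm: "\<And>g. g \<in> SL2C \<Longrightarrow> avg \<phi> g = \<phi> g"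
    and S: "\<And>g. g \<in> SL2C \<Longrightarrow> W g \<le> cmod \<pi> ^ 2 \<Longrightarrow> \<phi> g \<le> S" and g: "g \<in> SL2C"
  shows "\<phi> g \<le> S"
proof -
  define T where "T = cmod \<pi> ^ 2"
  have T: "0 < T" by (simp add: T_def)
  have main: "\<phi> g - \<epsilon> * W g \<le> S" if e: "0 < \<epsilon>" and g: "g \<in> SL2C" for g \<epsilon>
  proof -
    let ?f = "\<lambda>g. \<phi> g - \<epsilon> * W g"
    define t where "t = (SUP g\<in>SL2C. ?f g)"
    have Wp: "0 < W g" if "g \<in> SL2C" for g using W_pos[of g] that by (simp add: SL2C_def)
    have "?f g \<le> C" if "g \<in> SL2C" for g
    proof -
      have "0 \<le> \<epsilon> * W g" using Wp[OF that] e by simp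
      then show ?thesis using bdd[OF that] by linarith
    qed
    then have bd: "bdd_above (?f ` SL2C)" by (intro bdd_aboveI[of _ C]) auto
    have ft: "?f g \<le> t" if "g \<in> SL2C" for g unfolding t_def using bd that by (rule cSUP_upper2) simp
    define c where "c = \<epsilon> * ((1 - lam) * T)"
    have c: "0 < c" using e T lam by (simp add: c_def)
    have step: "?f g \<le> max S (t - c)" if g: "g \<in> SL2C" for g
    proof (cases "W g \<le> T")
      case True
      have "0 \<le> \<epsilon> * W g" using Wp[OF g] e by simp
      then show ?thesis using S[OF g] True by (simp add: T_def)
    next
      case False
      have d: "det g \<noteq> 0" using g by (simp add: SL2C_def)
      have "avg W g \<le> lam * W g" using W_rho_avg[OF d] False by (simp add: avg_def T_def)
      then have 1: "\<epsilon> * avg W g \<le> \<epsilon> * (lam * W g)" using e by simp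
      have 2: "c \<le> \<epsilon> * ((1 - lam) * W g)" unfolding c_def
        using False e lam by (intro mult_left_mono) auto
      have "avg ?f g \<le> t" using ft rho_mult_SL2C[OF _ g] by (intro avg_mono) blast
      moreover have "avg ?f g = avg \<phi> g - \<epsilon> * avg W g"
        by (simp add: avg_def sum_subtractf sum_distrib_left[symmetric] diff_divide_distrib)
      ultimately have "\<phi> g \<le> t + \<epsilon> * avg W g" using harm[OF g] by linarith
      also have "\<dots> \<le> t + \<epsilon> * (lam * W g)" using 1 by simp
      finally have "?f g \<le> t - \<epsilon> * ((1 - lam) * W g)" by (simp add: algebra_simps)
      then show ?thesis using 2 by linarith
    qed
    have "(SUP g\<in>SL2C. ?f g) \<le> max S (t - c)"
      using SL2C_one step by (intro cSUP_least) blast+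
    then have "t \<le> max S (t - c)" by (simp only: t_def)
    then have "t \<le> S" using c by linarith
    then show ?thesis using ft[OF g] by linarith
  qed
  show ?thesis
  proof (rule field_le_epsilon)
    fix e :: real assume e: "0 < e"
    have Wg: "0 < W g" using W_pos[of g] g by (simp add: SL2C_def)
    have "\<phi> g - e / W g * W g \<le> S" using main[of "e / W g" g] e Wg g by simp
    then show "\<phi> g \<le> S + e" using Wg by simp
  qed
qed

lemma scaled_lattice_dense:
  assumes n: "n \<in> R" "n \<noteq> 0" and e: "0 < e"
  obtains r j where "r \<in> R" "cmod (n * r / (\<pi> ^ 2) ^ j - z) < e"
proof -
  obtain \<rho> where \<rho>: "0 < \<rho>" "\<And>\<alpha>. \<exists>r\<in>R. cmod (\<alpha> + r) \<le> \<rho>" using covering by blast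
  define q where "q = cmod \<pi> ^ 2"
  have q: "1 < q" using norm_pi by (simp add: q_def one_less_power)
  obtain j where j: "cmod n * \<rho> / e < q ^ j" using real_arch_pow[OF q] by blast
  obtain r where r: "r \<in> R" "cmod (- z * (\<pi> ^ 2) ^ j / n + r) \<le> \<rho>" using \<rho>(2) by blast
  have "n * r / (\<pi> ^ 2) ^ j - z = n / (\<pi> ^ 2) ^ j * (- z * (\<pi> ^ 2) ^ j / n + r)"
    using n by (simp add: field_simps)
  then have "cmod (n * r / (\<pi> ^ 2) ^ j - z) = cmod n / q ^ j * cmod (- z * (\<pi> ^ 2) ^ j / n + r)"
    by (simp add: norm_mult norm_divide norm_power q_def)
  also have "\<dots> \<le> cmod n / q ^ j * \<rho>" using r q by (intro mult_left_mono) auto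
  also have "\<dots> < e" using j e q by (simp add: field_simps)
  finally show thesis using that r(1) by blast
qed

text \<open>\<open>rho\<close> takes the values \<open>t = diag(\<pi>, 1/\<pi>)\<close> and its
  inverse \<open>t'\<close>, and conjugation by them divides unipotent parameters by
  \<open>\<pi> ^ 2\<close>. So \<open>H\<close> contains unipotents with parameters in
  \<open>R\<close> and in \<open>M\<close> divided by powers of \<open>\<pi> ^ 2\<close>, which are
  dense in the complex numbers. Closedness is asked for only along the two families of
  unipotents.\<close>

lemma dense_generation:
  assumes M: "is_level M"
    and mult: "\<And>a b. a \<in> H \<Longrightarrow> b \<in> H \<Longrightarrow> a ** b \<in> H"
    and G: "GamL M \<subseteq> H" and rh: "rho ` (hk \<times> hk) \<subseteq> H"
    and up_closed: "\<And>z. (\<And>e. 0 < e \<Longrightarrow> \<exists>x. cmod (x - z) < e \<and> up x \<in> H) \<Longrightarrow> up z \<in> H"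
    and lo_closed: "\<And>z. (\<And>e. 0 < e \<Longrightarrow> \<exists>x. cmod (x - z) < e \<and> lo x \<in> H) \<Longrightarrow> lo z \<in> H"
    and g: "g \<in> SL2C"
  shows "g \<in> H"
proof -
  define t t' where "t = mat2 \<pi> 0 0 (inverse \<pi>)" and "t' = mat2 (inverse \<pi>) 0 0 \<pi>"
  have "t = rho (mat2 \<pi> 0 0 1, mat2 \<pi> 0 0 1)" "t' = rho (mat2 1 0 0 \<pi>, mat2 1 0 0 \<pi>)"
    by (simp_all add: t_def t'_def rho_def mat2_eq_iff mat2_mult_sel mat_sel)
  moreover have "mat2 \<pi> 0 0 1 \<in> hk" "mat2 1 0 0 \<pi> \<in> hk" using B0 by (auto simp: hk_def)
  ultimately have tH: "t \<in> H" "t' \<in> H" using rh by auto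
  have up1: "up (x / \<pi> ^ 2) \<in> H" if "up x \<in> H" for x
  proof -
    have "t' ** up x ** t = up (x / \<pi> ^ 2)"
      by (simp add: mat2_eq_iff mat2_mult_sel t_def t'_def up_def power2_eq_square field_simps)
    moreover have "t' ** up x ** t \<in> H" by (intro mult tH that)
    ultimately show ?thesis by (simp only:)
  qed
  have lo1: "lo (x / \<pi> ^ 2) \<in> H" if "lo x \<in> H" for x
  proof -
    have "t ** lo x ** t' = lo (x / \<pi> ^ 2)"
      by (simp add: mat2_eq_iff mat2_mult_sel t_def t'_def lo_def power2_eq_square field_simps)
    moreover have "t ** lo x ** t' \<in> H" by (intro mult tH that)
    ultimately show ?thesis by (simp only:)
  qed
  have upj: "up (x / (\<pi> ^ 2) ^ j) \<in> H" if "x \<in> R" for x j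
  proof (induction j)
    case 0
    have "x / (\<pi> ^ 2) ^ 0 = x" by simp
    moreover have "up x \<in> GamL M"
    proof -
      obtain n where "n \<in> M" using is_levelD(4)[OF M] by blast
      then have "0 * n \<in> M" using is_levelD(3)[OF M] zero by blast
      then show ?thesis using that by (auto simp: GamL_def up_def forall_2 det_2)
    qed
    ultimately show ?case using G by auto
  next
    case (Suc j)
    have "x / (\<pi> ^ 2) ^ Suc j = x / (\<pi> ^ 2) ^ j / \<pi> ^ 2" by (simp only: power_Suc2 divide_divide_eq_left)
    then show ?case using up1[OF Suc] by (simp only:)
  qed
  have loj: "lo (x / (\<pi> ^ 2) ^ j) \<in> H" if "x \<in> M" for x j
  proof (induction j)
    case 0
    have "x / (\<pi> ^ 2) ^ 0 = x" by simp
    moreover have "lo x \<in> GamL M"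
      using that is_levelD(1)[OF M] by (auto simp: GamL_def lo_def forall_2 det_2)
    ultimately show ?case using G by auto
  next
    case (Suc j)
    have "x / (\<pi> ^ 2) ^ Suc j = x / (\<pi> ^ 2) ^ j / \<pi> ^ 2" by (simp only: power_Suc2 divide_divide_eq_left)
    then show ?case using lo1[OF Suc] by (simp only:)
  qed
  have UP: "up z \<in> H" for z
  proof (rule up_closed)
    fix e :: real assume "0 < e"
    then obtain r j where r: "r \<in> R" "cmod (1 * r / (\<pi> ^ 2) ^ j - z) < e"
      by (rule scaled_lattice_dense[OF one one_neq_zero]) (rule that, assumption+)
    then show "\<exists>x. cmod (x - z) < e \<and> up x \<in> H" using upj[OF r(1)] by auto
  qed
  have LO: "lo z \<in> H" for z
  proof (rule lo_closed)
    fix e :: real assume e: "0 < e"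
    obtain n where n: "n \<in> M" "n \<noteq> 0" using is_levelD(4)[OF M] by blast
    have nR: "n \<in> R" using n is_levelD(1)[OF M] by blast
    obtain r j where r: "r \<in> R" "cmod (n * r / (\<pi> ^ 2) ^ j - z) < e"
      by (rule scaled_lattice_dense[OF nR n(2) e]) (rule that, assumption+)
    have "n * r \<in> M" using is_levelD(3)[OF M n(1) r(1)] by (simp add: mult.commute)
    then show "\<exists>x. cmod (x - z) < e \<and> lo x \<in> H" using loj r(2) by auto
  qed
  show ?thesis by (rule SL2C_elementary[OF mult UP LO g])
qed

text \<open>By \<open>max_principle\<close> the maximum over a compact set is a global maximum
  \<open>S\<close>. If \<phi> equals \<open>S\<close> at \<open>g\<close>, it does so at every
  \<open>rho p ** g\<close>, because values at most \<open>S\<close> have average \<open>S\<close>.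
  Thus \<open>H\<close> contains \<open>rho\<close> and \<open>GamL M\<close>, and continuity makes
  it closed along the unipotents.\<close>

lemma liouville:
  assumes M: "is_level M" and inv: "ginv M \<phi>" and bdd: "\<And>g. g \<in> SL2C \<Longrightarrow> \<bar>\<phi> g\<bar> \<le> C"
    and ruc: "ruc \<phi>" and harm: "\<And>g. g \<in> SL2C \<Longrightarrow> avg \<phi> g = \<phi> g"
  shows "\<exists>c. \<forall>g\<in>SL2C. \<phi> g = c"
proof -
  have cont: "continuous_on SL2C \<phi>" by (rule ruc_continuous_on[OF ruc])
  obtain C' where C': "norm (mat 1 :: complex^2^2) \<le> C'"
    "\<And>g. g \<in> SL2C \<Longrightarrow> W g \<le> cmod \<pi> ^ 2 \<Longrightarrow> \<exists>\<gamma>\<in>GamL M. norm (\<gamma> ** g) \<le> C'"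
    by (rule W_le_reduction[OF M]) (rule that, assumption+)
  let ?K = "{g \<in> SL2C. norm g \<le> C'}"
  have "compact ?K" by (rule compact_SL2C_ball)
  moreover have "?K \<noteq> {}" using SL2C_one C'(1) by auto
  moreover have "continuous_on ?K \<phi>" by (rule continuous_on_subset[OF cont]) auto
  ultimately obtain g0 where g0: "g0 \<in> ?K" "\<And>g. g \<in> ?K \<Longrightarrow> \<phi> g \<le> \<phi> g0"
    using continuous_attains_sup[of ?K \<phi>] by blast
  define S where "S = \<phi> g0"
  have g0S: "g0 \<in> SL2C" using g0 by simp
  have Sle: "\<phi> g \<le> S" if g: "g \<in> SL2C" "W g \<le> cmod \<pi> ^ 2" for g
  proof -
    obtain \<gamma> where \<gamma>: "\<gamma> \<in> GamL M" "norm (\<gamma> ** g) \<le> C'" using C'(2)[OF g] by blast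
    have "\<phi> (\<gamma> ** g) \<le> S" unfolding S_def using \<gamma> g GamL_SL2C SL2C_mult by (intro g0) auto
    then show ?thesis using inv \<gamma> g by (simp add: ginv_def)
  qed
  have max: "\<phi> g \<le> S" if "g \<in> SL2C" for g
    by (rule max_principle[OF bdd harm Sle that])
  define H where "H = {a \<in> SL2C. \<forall>g\<in>SL2C. \<phi> g = S \<longrightarrow> \<phi> (a ** g) = S}"
  have Hcl: "f z \<in> H" if f: "\<And>x. f x \<in> SL2C" "continuous_on UNIV f"
      and z: "\<And>e. 0 < e \<Longrightarrow> \<exists>x. cmod (x - z) < e \<and> f x \<in> H" for f :: "complex \<Rightarrow> complex^2^2" and z
  proof -
    have "\<phi> (f z ** g) = S" if g: "g \<in> SL2C" "\<phi> g = S" for g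
    proof (rule ccontr)
      assume ne: "\<phi> (f z ** g) \<noteq> S"
      have "continuous_on UNIV (\<lambda>x. \<phi> (f x ** g))"
        by (rule continuous_on_compose2[OF cont]) (auto intro!: continuous_intros f SL2C_mult g)
      then have "\<exists>d>0. \<forall>x. dist x z < d \<longrightarrow> dist (\<phi> (f x ** g)) (\<phi> (f z ** g)) < \<bar>\<phi> (f z ** g) - S\<bar>"
        unfolding continuous_on_iff using ne by auto
      then obtain d where d: "0 < d" "\<And>x. dist x z < d \<Longrightarrow> dist (\<phi> (f x ** g)) (\<phi> (f z ** g)) < \<bar>\<phi> (f z ** g) - S\<bar>" by blast
      obtain x where x: "cmod (x - z) < d" "f x \<in> H" using z[OF d(1)] by blast
      have "\<phi> (f x ** g) = S" using x(2) g by (simp add: H_def)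
      then show False using d(2)[of x] x(1) by (simp add: dist_norm dist_real_def)
    qed
    then show ?thesis using f(1) by (simp add: H_def)
  qed
  have "a \<in> H" if a: "a \<in> SL2C" for a
  proof (rule dense_generation[OF M _ _ _ _ _ a])
    show "a ** b \<in> H" if "a \<in> H" "b \<in> H" for a b
      using that SL2C_mult by (auto simp: H_def matrix_mul_assoc[symmetric])
    show "GamL M \<subseteq> H" using inv GamL_SL2C by (auto simp: H_def ginv_def)
    show "rho ` (hk \<times> hk) \<subseteq> H"
    proof (rule image_subsetI)
      fix p assume p: "p \<in> hk \<times> hk"
      have "\<phi> (rho p ** g) = S" if g: "g \<in> SL2C" "\<phi> g = S" for g
      proof -
        have "(\<Sum>p\<in>hk \<times> hk. \<phi> (rho p ** g)) = real (card (hk \<times> hk)) * S"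
        proof -
          have "real (card (hk \<times> hk)) \<noteq> 0" using card_hk2(1) by linarith
          then show ?thesis using harm[OF g(1)] g(2) by (simp add: avg_def divide_eq_eq mult.commute)
        qed
        then have s0: "(\<Sum>p\<in>hk \<times> hk. S - \<phi> (rho p ** g)) = 0" by (simp add: sum_subtractf)
        have "0 \<le> S - \<phi> (rho p ** g)" if "p \<in> hk \<times> hk" for p
          using max[OF rho_mult_SL2C[OF that g(1)]] by simp
        then have "\<forall>p\<in>hk \<times> hk. S - \<phi> (rho p ** g) = 0"
          using s0 sum_nonneg_eq_0_iff[OF card_hk2(2), of "\<lambda>p. S - \<phi> (rho p ** g)"] by blast
        from bspec[OF this p] show ?thesis by simp
      qed
      then show "rho p \<in> H" using rho_SL2C[OF p] by (simp add: H_def)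
    qed
    show "up z \<in> H" if "\<And>e. 0 < e \<Longrightarrow> \<exists>x. cmod (x - z) < e \<and> up x \<in> H" for z
      using that by (intro Hcl up_SL2C) (auto simp: up_def intro!: continuous_intros)
    show "lo z \<in> H" if "\<And>e. 0 < e \<Longrightarrow> \<exists>x. cmod (x - z) < e \<and> lo x \<in> H" for z
      using that by (intro Hcl lo_SL2C) (auto simp: lo_def intro!: continuous_intros)
  qed
  then have "\<phi> (a ** g0) = S" if "a \<in> SL2C" for a using g0S that by (auto simp: H_def S_def)
  from this[OF SL2C_mult[OF _ SL2C_adj2[OF g0S]]] have "\<phi> g = S" if g: "g \<in> SL2C" for g
    using g by (simp add: SL2C_cancel(6)[OF g0S])
  then show ?thesis by (intro exI[of _ S] ballI)
qed

end

section \<open>Mean values\<close>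

lemma compact_PiE_UNIV:
  fixes S :: "'i \<Rightarrow> real set"
  assumes "\<And>i. compact (S i)"
  shows "compact (PiE UNIV S)"
proof -
  have "compactin (product_topology (\<lambda>_. euclidean) UNIV) (PiE UNIV S)"
    using assms by (subst compactin_PiE) auto
  then show ?thesis by (simp only: euclidean_product_topology compactin_euclidean_iff)
qed

lemma pointwise_limit_filter:
  fixes x :: "nat \<Rightarrow> 'i \<Rightarrow> real" and b :: "'i \<Rightarrow> real"
  assumes b: "\<And>n i. \<bar>x n i\<bar> \<le> b i"
  obtains G l where "G \<noteq> bot" "G \<le> sequentially" "\<And>i. ((\<lambda>n. x n i) \<longlongrightarrow> l i) G"
proof -
  let ?U = "PiE UNIV (\<lambda>i. {- b i..b i})"
  let ?F = "filtermap x sequentially"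
  have "compact ?U" by (rule compact_PiE_UNIV) simp
  moreover have "x n \<in> ?U" for n using b[of n] by (auto simp: abs_le_iff minus_le_iff)
  then have "eventually (\<lambda>u. u \<in> ?U) ?F" by (simp add: eventually_filtermap)
  moreover have "?F \<noteq> bot" by (simp add: filtermap_bot_iff)
  ultimately obtain l where l: "inf (nhds l) ?F \<noteq> bot" unfolding compact_filter by blast
  define G where "G = inf sequentially (filtercomap x (nhds l))"
  have "G \<noteq> bot"
  proof
    assume "G = bot"
    then have "eventually (\<lambda>_. False) (inf sequentially (filtercomap x (nhds l)))" by (simp add: G_def)
    then obtain P Q where PQ: "eventually P sequentially" "eventually Q (filtercomap x (nhds l))"
      "\<And>n. P n \<Longrightarrow> Q n \<Longrightarrow> False"
      unfolding eventually_inf by blast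
    obtain Q' where Q': "eventually Q' (nhds l)" "\<And>n. Q' (x n) \<Longrightarrow> Q n"
      using PQ(2) unfolding eventually_filtercomap by blast
    have "eventually (\<lambda>n. \<not> Q' (x n)) sequentially"
      using PQ(1) by (rule eventually_mono) (use PQ(3) Q'(2) in blast)
    then have "eventually (\<lambda>u. \<not> Q' u) ?F" by (simp add: eventually_filtermap)
    then have "eventually (\<lambda>_. False) (inf (nhds l) ?F)"
      unfolding eventually_inf using Q'(1) by blast
    then show False using l by (simp add: eventually_False)
  qed
  moreover have "G \<le> sequentially" by (simp add: G_def)
  moreover have "((\<lambda>n. x n i) \<longlongrightarrow> l i) G" for i
  proof -
    have "filterlim x (nhds l) G" by (simp add: filterlim_iff_le_filtercomap G_def)
    from continuous_on_tendsto_compose[OF continuous_on_product_coordinates this] show ?thesis by simp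
  qed
  ultimately show thesis using that by blast
qed

section \<open>Cesaro means of functions of compact support\<close>

context bianchi_lattice
begin

text \<open>Continuous functions of compact support modulo \<open>GamL M\<close>: by
  \<open>W_le_reduction\<close> a set of bounded height is covered by the translates of a compact
  set.\<close>

definition CC :: "complex set \<Rightarrow> (complex^2^2 \<Rightarrow> real) set" where
  "CC M = {\<phi>. ginv M \<phi> \<and> continuous_on SL2C \<phi> \<and> (\<exists>T. \<forall>g\<in>SL2C. T < W g \<longrightarrow> \<phi> g = 0)}"

lemma CC_bdd:
  assumes M: "is_level M" and \<phi>: "\<phi> \<in> CC M"
  obtains C where "\<And>g. g \<in> SL2C \<Longrightarrow> \<bar>\<phi> g\<bar> \<le> C"
proof -
  obtain T where T: "\<forall>g\<in>SL2C. T < W g \<longrightarrow> \<phi> g = 0" using \<phi> by (auto simp: CC_def)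
  obtain C' where C': "norm (mat 1 :: complex^2^2) \<le> C'"
    "\<And>g. g \<in> SL2C \<Longrightarrow> W g \<le> T \<Longrightarrow> \<exists>\<gamma>\<in>GamL M. norm (\<gamma> ** g) \<le> C'"
    by (rule W_le_reduction[OF M]) (rule that, assumption+)
  let ?K = "{g \<in> SL2C. norm g \<le> C'}"
  have "continuous_on SL2C \<phi>" using \<phi> by (simp add: CC_def)
  then have "continuous_on ?K \<phi>" by (rule continuous_on_subset) blast
  then have "bounded (\<phi> ` ?K)" by (intro compact_imp_bounded compact_continuous_image compact_SL2C_ball)
  then obtain C where C: "\<And>g. g \<in> ?K \<Longrightarrow> \<bar>\<phi> g\<bar> \<le> C" unfolding bounded_iff by fastforce
  have C0: "0 \<le> C" using C[of "mat 1"] SL2C_one C'(1) by fastforce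
  have "\<bar>\<phi> g\<bar> \<le> C" if g: "g \<in> SL2C" for g
  proof (cases "W g \<le> T")
    case True
    obtain \<gamma> where \<gamma>: "\<gamma> \<in> GamL M" "norm (\<gamma> ** g) \<le> C'" using C'(2)[OF g True] by blast
    have "\<bar>\<phi> (\<gamma> ** g)\<bar> \<le> C" using \<gamma> GamL_SL2C[OF \<gamma>(1)] SL2C_mult g by (intro C) blast
    moreover have "\<phi> (\<gamma> ** g) = \<phi> g" using \<phi> \<gamma>(1) g unfolding CC_def ginv_def by blast
    ultimately show ?thesis by (simp only:)
  next
    case False then show ?thesis using T g C0 by simp
  qed
  then show thesis using that by blast
qed

text \<open>A shortest vector for \<open>g ** k\<close> has its length multiplied by at most
  \<open>4 * norm k\<close> when measured by \<open>g\<close>; the height is an inverse square,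
  whence 16.\<close>

lemma W_mult_le:
  assumes g: "g \<in> SL2C" and k: "k \<in> SL2C"
  shows "W (g ** k) \<le> 16 * norm k ^ 2 * W g"
proof -
  have d: "det g = 1" "det (g ** k) = 1" using g k by (simp_all add: SL2C_def det_mul)
  then have nz: "det (g ** k) \<noteq> 0" "det g \<noteq> 0" by auto
  obtain e where e: "e \<in> Lam" "W (g ** k) = cmod (det (g ** k)) / norm (adj2 (g ** k) *v e) ^ 2"
    "norm (adj2 (g ** k) *v e) > 0"
    by (rule min_vector[OF nz(1)]) (rule that, assumption+)
  have "adj2 g *v e = k *v (adj2 (g ** k) *v e)"
    by (simp add: adj2_mult matrix_vector_mul_assoc matrix_mul_assoc SL2C_cancel(1)[OF k])
  then have n: "norm (adj2 g *v e) \<le> 4 * norm k * norm (adj2 (g ** k) *v e)"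
    using norm_mat2_vec_le by (simp only:)
  have "norm e \<le> 4 * norm g / cmod (det g) * norm (adj2 g *v e)" by (rule norm_le_adj2_vec[OF nz(2)])
  moreover have "0 < norm e" using e by (auto simp: Lam_def)
  ultimately have p: "0 < norm (adj2 g *v e)" by (cases "norm (adj2 g *v e) = 0") auto
  have "norm (adj2 g *v e) ^ 2 \<le> (4 * norm k * norm (adj2 (g ** k) *v e)) ^ 2"
    using n by (intro power_mono) auto
  then have "norm (adj2 g *v e) ^ 2 \<le> 16 * norm k ^ 2 * norm (adj2 (g ** k) *v e) ^ 2"
    by (simp add: power_mult_distrib)
  then have "1 / norm (adj2 (g ** k) *v e) ^ 2 \<le> 16 * norm k ^ 2 * (1 / norm (adj2 g *v e) ^ 2)"
    using p e(3) by (simp add: field_simps)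
  also have "1 / norm (adj2 g *v e) ^ 2 \<le> W g" using W_ge[OF nz(2) e(1)] d by simp
  finally show ?thesis using e(2) d by (simp add: mult_left_mono)
qed

text \<open>At bounded height uniform continuity on a compact set is transported by
  \<open>GamL M\<close>; at greater height both \<open>g\<close> and \<open>g ** k\<close> lie
  outside the support.\<close>

lemma CC_ruc:
  assumes M: "is_level M" and \<phi>: "\<phi> \<in> CC M"
  shows "ruc \<phi>"
  unfolding ruc_def
proof (intro allI impI)
  fix \<epsilon> :: real assume \<epsilon>: "0 < \<epsilon>"
  obtain T0 where T0: "\<forall>g\<in>SL2C. T0 < W g \<longrightarrow> \<phi> g = 0" using \<phi> by (auto simp: CC_def)
  define T where "T = max T0 1"
  have T: "\<phi> g = 0" if "g \<in> SL2C" "T < W g" for g using T0 that by (auto simp: T_def)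
  define c0 where "c0 = norm (mat 1 :: complex^2^2) + 1"
  \<comment> \<open>\<open>c0\<close> bounds \<open>norm k\<close> near the identity and
    \<open>4 * c0\<close> bounds the norm of its inverse, so the height changes by a factor of at
    most \<open>16 * (4 * c0)^2 = 256 * c0^2\<close>.\<close>
  define T1 where "T1 = 256 * c0 ^ 2 * T"
  have c0: "1 \<le> c0" by (simp add: c0_def)
  have "1 \<le> c0 ^ 2" using c0 by (rule one_le_power)
  then have "1 * T \<le> (256 * c0 ^ 2) * T" by (intro mult_right_mono) (auto simp: T_def)
  then have TT1: "T \<le> T1" by (simp add: T1_def)
  obtain C where C: "norm (mat 1 :: complex^2^2) \<le> C"
    "\<And>g. g \<in> SL2C \<Longrightarrow> W g \<le> T1 \<Longrightarrow> \<exists>\<gamma>\<in>GamL M. norm (\<gamma> ** g) \<le> C"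
    by (rule W_le_reduction[OF M]) (rule that, assumption+)
  have C0: "0 \<le> C" using C(1) norm_ge_zero order_trans by blast
  let ?K = "{g \<in> SL2C. norm g \<le> 8 * C * c0 + C}"
  have "continuous_on SL2C \<phi>" using \<phi> by (simp add: CC_def)
  then have "continuous_on ?K \<phi>" by (rule continuous_on_subset) blast
  then have "uniformly_continuous_on ?K \<phi>" by (intro compact_uniformly_continuous compact_SL2C_ball)
  then obtain \<delta> where \<delta>: "0 < \<delta>" "\<And>x y. x \<in> ?K \<Longrightarrow> y \<in> ?K \<Longrightarrow> dist y x < \<delta> \<Longrightarrow> dist (\<phi> y) (\<phi> x) < \<epsilon>"
    unfolding uniformly_continuous_on_def using \<epsilon> by meson
  define \<delta>' where "\<delta>' = min 1 (\<delta> / (8 * C + 1))"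
  have "0 < \<delta>'" using \<delta>(1) C0 by (simp add: \<delta>'_def)
  moreover have "\<bar>\<phi> (g ** k) - \<phi> g\<bar> \<le> \<epsilon>" if k: "k \<in> SL2C" "norm (k - mat 1) < \<delta>'" and g: "g \<in> SL2C" for k g
  proof (cases "W g \<le> T1")
    case True
    obtain \<gamma> where \<gamma>: "\<gamma> \<in> GamL M" "norm (\<gamma> ** g) \<le> C" using C(2)[OF g True] by blast
    define c where "c = \<gamma> ** g"
    have c: "c \<in> SL2C" "norm c \<le> C" using \<gamma> GamL_SL2C[OF \<gamma>(1)] SL2C_mult g by (auto simp: c_def)
    have nk: "norm k \<le> c0"
      using k(2) norm_triangle_ineq[of "k - mat 1" "mat 1"] by (simp add: \<delta>'_def c0_def)
    have "norm (c ** k) \<le> 8 * norm c * norm k" by (rule norm_mat2_mult_le)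
    also have "\<dots> \<le> 8 * C * c0" using c(2) nk C0 by (intro mult_mono) auto
    finally have "c ** k \<in> ?K" using SL2C_mult[OF c(1) k(1)] C0 by simp
    moreover have "c \<in> ?K" using c C0 c0 by (simp add: add_increasing)
    moreover have "dist (c ** k) c < \<delta>"
    proof -
      have "c ** k - c = c ** (k - mat 1)" using mat_mult_diff[of c k "mat 1"] by simp
      then have "norm (c ** k - c) \<le> 8 * norm c * norm (k - mat 1)" by (simp only: norm_mat2_mult_le)
      also have "\<dots> \<le> (8 * C + 1) * norm (k - mat 1)" using c(2) by (intro mult_right_mono) auto
      also have "\<dots> < (8 * C + 1) * \<delta>'" using k(2) C0 by (intro mult_strict_left_mono) auto
      also have "\<dots> \<le> (8 * C + 1) * (\<delta> / (8 * C + 1))" using C0 by (intro mult_left_mono) (auto simp: \<delta>'_def)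
      also have "\<dots> = \<delta>" using C0 by simp
      finally show ?thesis by (simp add: dist_norm)
    qed
    ultimately have "dist (\<phi> (c ** k)) (\<phi> c) < \<epsilon>" using \<delta>(2) by blast
    moreover have "\<phi> c = \<phi> g" using \<phi> \<gamma>(1) g unfolding CC_def ginv_def c_def by blast
    moreover have "\<phi> (\<gamma> ** (g ** k)) = \<phi> (g ** k)"
      using \<phi> \<gamma>(1) SL2C_mult[OF g k(1)] unfolding CC_def ginv_def by blast
    ultimately show ?thesis by (simp add: c_def matrix_mul_assoc dist_real_def)
  next
    case False
    have nk: "norm k \<le> c0"
      using k(2) norm_triangle_ineq[of "k - mat 1" "mat 1"] by (simp add: \<delta>'_def c0_def)
    have gk: "g ** k \<in> SL2C" by (rule SL2C_mult[OF g k(1)])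
    have "W g = W ((g ** k) ** adj2 k)" by (simp add: SL2C_cancel[OF k(1)])
    also have "\<dots> \<le> 16 * norm (adj2 k) ^ 2 * W (g ** k)" by (rule W_mult_le[OF gk SL2C_adj2[OF k(1)]])
    also have "\<dots> \<le> 16 * (4 * c0) ^ 2 * W (g ** k)"
    proof -
      have "norm (adj2 k) \<le> 4 * c0" using norm_adj2_le[of k] nk by linarith
      then have "norm (adj2 k) ^ 2 \<le> (4 * c0) ^ 2" by (intro power_mono) auto
      moreover have "0 \<le> W (g ** k)" using W_pos[of "g ** k"] gk by (simp add: SL2C_def)
      ultimately show ?thesis by (intro mult_right_mono mult_left_mono) auto
    qed
    finally have "256 * c0 ^ 2 * T < 256 * c0 ^ 2 * W (g ** k)" using False by (simp add: T1_def power_mult_distrib)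
    then have "T < W (g ** k)" using c0 by (simp add: mult_less_cancel_left)
    then have "\<phi> (g ** k) = 0" using T gk by blast
    moreover have "\<phi> g = 0" using T[OF g] False TT1 by linarith
    ultimately show ?thesis using \<epsilon> by simp
  qed
  ultimately show "\<exists>\<delta>>0. \<forall>k\<in>SL2C. norm (k - mat 1) < \<delta> \<longrightarrow> (\<forall>g\<in>SL2C. \<bar>\<phi> (g ** k) - \<phi> g\<bar> \<le> \<epsilon>)"
    by (intro exI[of _ \<delta>'] conjI ballI impI)
qed

definition cesaro :: "nat \<Rightarrow> (complex^2^2 \<Rightarrow> real) \<Rightarrow> complex^2^2 \<Rightarrow> real" where
  "cesaro n \<phi> g = (\<Sum>j<n. (avg ^^ j) \<phi> g) / real n"

lemma avg_pow_bdd: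
  assumes "\<And>g. g \<in> SL2C \<Longrightarrow> \<bar>\<phi> g\<bar> \<le> C" "g \<in> SL2C"
  shows "\<bar>(avg ^^ j) \<phi> g\<bar> \<le> C"
  using assms(2)
proof (induction j arbitrary: g)
  case 0 then show ?case using assms(1) by simp
next
  case (Suc j)
  have "\<bar>avg ((avg ^^ j) \<phi>) g\<bar> \<le> C" by (rule avg_bdd[OF Suc.IH Suc.prems])
  then show ?case by simp
qed

lemma avg_pow_diff:
  assumes "\<And>g. g \<in> SL2C \<Longrightarrow> \<bar>\<phi> (g ** k) - \<phi> g\<bar> \<le> C" "g \<in> SL2C"
  shows "\<bar>(avg ^^ j) \<phi> (g ** k) - (avg ^^ j) \<phi> g\<bar> \<le> C"
  using assms(2)
proof (induction j arbitrary: g)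
  case 0 then show ?case using assms(1) by simp
next
  case (Suc j)
  have "\<bar>avg ((avg ^^ j) \<phi>) (g ** k) - avg ((avg ^^ j) \<phi>) g\<bar> \<le> C"
  proof (rule avg_diff_le)
    fix p assume p: "p \<in> hk \<times> hk"
    show "\<bar>(avg ^^ j) \<phi> (rho p ** (g ** k)) - (avg ^^ j) \<phi> (rho p ** g)\<bar> \<le> C"
      using Suc.IH[OF rho_mult_SL2C[OF p Suc.prems]] by (simp only: matrix_mul_assoc)
  qed
  then show ?case by simp
qed

lemma avg_pow_ginv: "is_level M \<Longrightarrow> ginv M \<phi> \<Longrightarrow> ginv M ((avg ^^ j) \<phi>)"
  by (induction j) (auto intro: avg_ginv)

lemma cesaro_abs_le:
  assumes "\<And>j. \<bar>(avg ^^ j) \<phi> g - (avg ^^ j) \<psi> h\<bar> \<le> C"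
  shows "\<bar>cesaro n \<phi> g - cesaro n \<psi> h\<bar> \<le> C"
proof (cases "n = 0")
  \<comment> \<open>For \<open>n = 0\<close> division by zero makes both means 0, and
    \<open>C\<close> is non-negative by the bound for \<open>j = 0\<close>.\<close>
  case True
  then show ?thesis using assms[of 0] by (simp add: cesaro_def)
next
  case False
  have "\<bar>\<Sum>j<n. (avg ^^ j) \<phi> g - (avg ^^ j) \<psi> h\<bar> \<le> (\<Sum>j<n. C)"
    using assms by (intro order_trans[OF sum_abs] sum_mono)
  then have "\<bar>\<Sum>j<n. (avg ^^ j) \<phi> g - (avg ^^ j) \<psi> h\<bar> / real n \<le> C"
    using False by (simp add: divide_le_eq mult.commute)
  then show ?thesis
    by (simp add: cesaro_def diff_divide_distrib[symmetric] sum_subtractf[symmetric] abs_divide)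
qed

lemma avg_pow_zero: "(avg ^^ j) (\<lambda>_. 0) = (\<lambda>_. 0)"
  by (induction j) (auto simp: avg_def fun_eq_iff)

lemma cesaro_bdd:
  assumes "\<And>g. g \<in> SL2C \<Longrightarrow> \<bar>\<phi> g\<bar> \<le> C" "g \<in> SL2C"
  shows "\<bar>cesaro n \<phi> g\<bar> \<le> C"
proof -
  have "\<bar>cesaro n \<phi> g - cesaro n (\<lambda>_. 0) g\<bar> \<le> C"
  proof (rule cesaro_abs_le)
    show "\<bar>(avg ^^ j) \<phi> g - (avg ^^ j) (\<lambda>_. 0) g\<bar> \<le> C" for j
      using avg_pow_bdd[of \<phi> C g j, OF assms] by (simp add: avg_pow_zero)
  qed
  then show ?thesis by (simp add: cesaro_def avg_pow_zero)
qed

text \<open>Telescoping. For bounded functions the last term tends to 0, which makes limits of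
  Cesaro means harmonic.\<close>

lemma avg_cesaro: "avg (cesaro n \<phi>) g = cesaro n \<phi> g + ((avg ^^ n) \<phi> g - \<phi> g) / real n"
proof -
  have "avg (cesaro n \<phi>) g = (\<Sum>j<n. (avg ^^ Suc j) \<phi> g) / real n"
  proof -
    have "(\<Sum>p\<in>hk \<times> hk. cesaro n \<phi> (rho p ** g)) = (\<Sum>j<n. \<Sum>p\<in>hk \<times> hk. (avg ^^ j) \<phi> (rho p ** g)) / real n"
      unfolding cesaro_def sum_divide_distrib[symmetric] by (subst sum.swap) (rule refl)
    then have "avg (cesaro n \<phi>) g = (\<Sum>j<n. \<Sum>p\<in>hk \<times> hk. (avg ^^ j) \<phi> (rho p ** g)) / real n / real (card (hk \<times> hk))"
      unfolding avg_def[of "cesaro n \<phi>"] by (simp only:)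
    also have "\<dots> = (\<Sum>j<n. (\<Sum>p\<in>hk \<times> hk. (avg ^^ j) \<phi> (rho p ** g)) / real (card (hk \<times> hk))) / real n"
      unfolding sum_divide_distrib[symmetric] by (simp only: divide_divide_eq_left mult.commute)
    also have "\<dots> = (\<Sum>j<n. (avg ^^ Suc j) \<phi> g) / real n"
      by (simp only: funpow.simps comp_def avg_def[symmetric])
    finally show ?thesis .
  qed
  also have "(\<Sum>j<n. (avg ^^ Suc j) \<phi> g) = (\<Sum>j<n. (avg ^^ j) \<phi> g) + ((avg ^^ n) \<phi> g - \<phi> g)"
    by (induction n) simp_all
  finally show ?thesis by (simp only: cesaro_def[of n \<phi> g] add_divide_distrib)
qed

lemma tendsto_abs_le:
  fixes f :: "'a \<Rightarrow> real"
  assumes "(f \<longlongrightarrow> l) G" "G \<noteq> bot" "\<And>n. \<bar>f n\<bar> \<le> C" shows "\<bar>l\<bar> \<le> C"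
  by (rule tendsto_upperbound[OF tendsto_rabs[OF assms(1)] _ assms(2)]) (simp add: assms(3))

text \<open>The filter comes from Tychonoff's theorem; a limit of Cesaro means is harmonic, hence constant by
  \<open>liouville\<close>.\<close>
lemma mean_exists:
  assumes M: "is_level M"
  obtains G mean where "G \<noteq> bot" "G \<le> sequentially" "\<And>\<phi> g. \<phi> \<in> CC M \<Longrightarrow> g \<in> SL2C \<Longrightarrow> ((\<lambda>n. cesaro n \<phi> g) \<longlongrightarrow> mean \<phi>) G"
proof -
  have "\<exists>C. \<forall>g\<in>SL2C. \<bar>\<phi> g\<bar> \<le> C" if "\<phi> \<in> CC M" for \<phi>
    by (rule CC_bdd[OF M that]) blast
  then have "\<forall>\<phi>\<in>CC M. \<exists>C. \<forall>g\<in>SL2C. \<bar>\<phi> g\<bar> \<le> C" by blast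
  from bchoice[OF this] obtain b where b: "\<forall>\<phi>\<in>CC M. \<forall>g\<in>SL2C. \<bar>\<phi> g\<bar> \<le> b \<phi>" by blast
  \<comment> \<open>The index is a pair of a function and a point, so that one filter serves all of
    them; the value 0 elsewhere keeps every coordinate bounded.\<close>
  define x where "x n i = (if fst i \<in> CC M \<and> snd i \<in> SL2C then cesaro n (fst i) (snd i) else 0)"
    for n and i :: "(complex^2^2 \<Rightarrow> real) \<times> (complex^2^2)"
  have xb: "\<bar>x n i\<bar> \<le> (if fst i \<in> CC M \<and> snd i \<in> SL2C then b (fst i) else 0)" for n i
  proof (cases "fst i \<in> CC M \<and> snd i \<in> SL2C")
    case True
    then have "\<bar>cesaro n (fst i) (snd i)\<bar> \<le> b (fst i)" using b by (intro cesaro_bdd) blast+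
    then show ?thesis using True by (simp add: x_def)
  next
    case False
    then have "x n i = 0" by (simp only: x_def if_False)
    then show ?thesis using False by (simp only: if_False abs_zero order_refl)
  qed
  obtain G l where G: "G \<noteq> bot" "G \<le> sequentially" and l: "\<And>i. ((\<lambda>n. x n i) \<longlongrightarrow> l i) G"
    by (rule pointwise_limit_filter[of x, OF xb]) (rule that, assumption+)
  have lim: "((\<lambda>n. cesaro n \<phi> g) \<longlongrightarrow> l (\<phi>, g)) G" if "\<phi> \<in> CC M" "g \<in> SL2C" for \<phi> g
    using l[of "(\<phi>, g)"] that by (simp add: x_def)
  have const: "\<exists>c. \<forall>g\<in>SL2C. l (\<phi>, g) = c" if \<phi>: "\<phi> \<in> CC M" for \<phi>
  proof -
    let ?L = "\<lambda>g. l (\<phi>, g)"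
    have inv: "ginv M \<phi>" using \<phi> by (simp add: CC_def)
    have gi: "ginv M ?L"
      unfolding ginv_def
    proof (intro ballI)
      fix \<gamma> g assume \<gamma>: "\<gamma> \<in> GamL M" and g: "g \<in> SL2C"
      have "(avg ^^ j) \<phi> (\<gamma> ** g) = (avg ^^ j) \<phi> g" for j
        using avg_pow_ginv[OF M inv, of j] \<gamma> g unfolding ginv_def by blast
      then have "cesaro n \<phi> (\<gamma> ** g) = cesaro n \<phi> g" for n unfolding cesaro_def by (simp only:)
      then have "((\<lambda>n. cesaro n \<phi> g) \<longlongrightarrow> l (\<phi>, \<gamma> ** g)) G"
        using lim[OF \<phi> SL2C_mult[OF GamL_SL2C[OF \<gamma>] g]] by (simp only:)
      then show "l (\<phi>, \<gamma> ** g) = l (\<phi>, g)" using tendsto_unique[OF G(1)] lim[OF \<phi> g] by blast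
    qed
    have bd: "\<bar>?L g\<bar> \<le> b \<phi>" if g: "g \<in> SL2C" for g
      using b \<phi> g by (intro tendsto_abs_le[OF lim[OF \<phi> g] G(1)] cesaro_bdd) blast+
    have ru: "ruc ?L"
      unfolding ruc_def
    proof (intro allI impI)
      fix \<epsilon> :: real assume "0 < \<epsilon>"
      then obtain \<delta> where \<delta>: "0 < \<delta>" "\<forall>k\<in>SL2C. norm (k - mat 1) < \<delta> \<longrightarrow> (\<forall>g\<in>SL2C. \<bar>\<phi> (g ** k) - \<phi> g\<bar> \<le> \<epsilon>)"
        using CC_ruc[OF M \<phi>] unfolding ruc_def by blast
      have "\<bar>?L (g ** k) - ?L g\<bar> \<le> \<epsilon>" if k: "k \<in> SL2C" "norm (k - mat 1) < \<delta>" and g: "g \<in> SL2C" for k g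
      proof (rule tendsto_abs_le[OF tendsto_diff[OF lim[OF \<phi> SL2C_mult[OF g k(1)]] lim[OF \<phi> g]] G(1)])
        have *: "\<bar>\<phi> (g ** k) - \<phi> g\<bar> \<le> \<epsilon>" if "g \<in> SL2C" for g using \<delta>(2) k that by blast
        show "\<bar>cesaro n \<phi> (g ** k) - cesaro n \<phi> g\<bar> \<le> \<epsilon>" for n
          by (rule cesaro_abs_le) (rule avg_pow_diff[of \<phi> k \<epsilon>, OF * g])
      qed
      then show "\<exists>\<delta>>0. \<forall>k\<in>SL2C. norm (k - mat 1) < \<delta> \<longrightarrow> (\<forall>g\<in>SL2C. \<bar>?L (g ** k) - ?L g\<bar> \<le> \<epsilon>)"
        using \<delta>(1) by (intro exI[of _ \<delta>] conjI ballI impI)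
    qed
    have harm: "avg ?L g = ?L g" if g: "g \<in> SL2C" for g
    proof (rule tendsto_unique[OF G(1)])
      show "((\<lambda>n. avg (cesaro n \<phi>) g) \<longlongrightarrow> avg ?L g) G"
        unfolding avg_def by (intro tendsto_divide tendsto_sum tendsto_const lim[OF \<phi>] rho_mult_SL2C[OF _ g])
          (use card_hk2 in auto)
      have z: "((\<lambda>n. ((avg ^^ n) \<phi> g - \<phi> g) / real n) \<longlongrightarrow> 0) sequentially"
      proof (rule Lim_null_comparison)
        show "\<forall>\<^sub>F n in sequentially. norm (((avg ^^ n) \<phi> g - \<phi> g) / real n) \<le> 2 * b \<phi> / real n"
        proof (rule always_eventually, rule allI)
          fix n
          have "\<bar>(avg ^^ n) \<phi> g\<bar> \<le> b \<phi>" "\<bar>\<phi> g\<bar> \<le> b \<phi>" using b \<phi> g by (intro avg_pow_bdd, blast+)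
          then have "\<bar>(avg ^^ n) \<phi> g - \<phi> g\<bar> \<le> 2 * b \<phi>" by linarith
          then show "norm (((avg ^^ n) \<phi> g - \<phi> g) / real n) \<le> 2 * b \<phi> / real n"
            by (simp add: abs_divide divide_right_mono)
        qed
        show "((\<lambda>n. 2 * b \<phi> / real n) \<longlongrightarrow> 0) sequentially" by (rule lim_const_over_n)
      qed
      have "((\<lambda>n. cesaro n \<phi> g + ((avg ^^ n) \<phi> g - \<phi> g) / real n) \<longlongrightarrow> ?L g + 0) G"
        by (intro tendsto_add lim[OF \<phi> g] tendsto_mono[OF G(2) z])
      then show "((\<lambda>n. avg (cesaro n \<phi>) g) \<longlongrightarrow> ?L g) G" by (simp only: avg_cesaro add_0_right)
    qed
    show ?thesis by (rule liouville[OF M gi bd ru harm])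
  qed
  then have "\<forall>\<phi>\<in>CC M. \<exists>c. \<forall>g\<in>SL2C. l (\<phi>, g) = c" by blast
  from bchoice[OF this] obtain mean where mean: "\<forall>\<phi>\<in>CC M. \<forall>g\<in>SL2C. l (\<phi>, g) = mean \<phi>" by blast
  show thesis
  proof (rule that[OF G])
    fix \<phi> g assume "\<phi> \<in> CC M" "g \<in> SL2C"
    then show "((\<lambda>n. cesaro n \<phi> g) \<longlongrightarrow> mean \<phi>) G" using lim[of \<phi> g] mean by simp
  qed
qed

end

section \<open>Modular symbols\<close>

definition cusp :: "complex^2 \<Rightarrow> complex option" where
  "cusp e = (if e $ 2 = 0 then None else Some (e $ 1 / e $ 2))"

lemma moebius_cusp:
  assumes "e \<noteq> 0" shows "moebius g (cusp e) = cusp (g *v e)"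
proof (cases "e $ 2 = 0")
  case True
  then have "e $ 1 \<noteq> 0" using assms by (simp add: vec2_eq_iff)
  then show ?thesis using True by (simp add: cusp_def moebius_def Let_def mat2_vec_sel)
next
  case False
  have "g $ 2 $ 1 * (e $ 1 / e $ 2) + g $ 2 $ 2 = (g $ 2 $ 1 * e $ 1 + g $ 2 $ 2 * e $ 2) / e $ 2"
    "g $ 1 $ 1 * (e $ 1 / e $ 2) + g $ 1 $ 2 = (g $ 1 $ 1 * e $ 1 + g $ 1 $ 2 * e $ 2) / e $ 2"
    using False by (simp_all add: add_divide_distrib)
  then show ?thesis using False by (simp add: cusp_def moebius_def Let_def mat2_vec_sel del: times_divide_eq_right)
qed

lemma cusp_surj: "\<exists>e. e \<noteq> 0 \<and> cusp e = c"
proof (cases c)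
  case None
  have "(vector [1, 0] :: complex^2) \<noteq> 0" "cusp (vector [1, 0]) = c"
    by (simp_all add: None cusp_def vec2_eq_iff)
  then show ?thesis by blast
next
  case (Some z)
  have "(vector [z, 1] :: complex^2) \<noteq> 0" "cusp (vector [z, 1]) = c"
    by (simp_all add: Some cusp_def vec2_eq_iff)
  then show ?thesis by blast
qed

lemma mat2_vec_nonzero:
  assumes "det g \<noteq> 0" "e \<noteq> 0" shows "g *v e \<noteq> (0 :: complex^2)"
proof
  assume "g *v e = 0"
  then have "adj2 g *v (g *v e) = 0" by simp
  then have "(adj2 g ** g) *v e = 0" by (simp only: matrix_vector_mul_assoc)
  then have "det g *s e = 0" by (simp add: adj2_mult_self vec2_eq_iff mat2_vec_sel mat_sel)
  then show False using assms by (simp add: vec2_eq_iff)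
qed

text \<open>Lifting points to non-zero vectors replaces the case distinctions at infinity by
  associativity of the matrix product.\<close>

lemma moebius_mult:
  assumes "det h \<noteq> 0" shows "moebius (g ** h) c = moebius g (moebius h c)"
proof -
  obtain e where e: "e \<noteq> 0" "cusp e = c" using cusp_surj by blast
  have "moebius (g ** h) c = cusp ((g ** h) *v e)" using moebius_cusp[OF e(1)] e(2) by simp
  also have "\<dots> = cusp (g *v (h *v e))" by (simp only: matrix_vector_mul_assoc)
  also have "\<dots> = moebius g (cusp (h *v e))" using moebius_cusp[OF mat2_vec_nonzero[OF assms e(1)]] by simp
  also have "\<dots> = moebius g (moebius h c)" using moebius_cusp[OF e(1)] e(2) by simp
  finally show ?thesis .
qed

lemma cusp_eq_of_wedge:
  assumes "wedge u v = 0" "u \<noteq> 0" "v \<noteq> 0" shows "cusp u = cusp v"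
proof -
  have *: "u $ 1 * v $ 2 = u $ 2 * v $ 1" using assms(1) by (simp add: wedge_def)
  show ?thesis
  proof (cases "u $ 2 = 0")
    case True
    then have "u $ 1 \<noteq> 0" using assms(2) by (simp add: vec2_eq_iff)
    then have "v $ 2 = 0" using * True by simp
    then show ?thesis using True by (simp add: cusp_def)
  next
    case False
    have "v $ 2 \<noteq> 0"
    proof
      assume "v $ 2 = 0"
      then have "v $ 1 = 0" using * False by simp
      then show False using \<open>v $ 2 = 0\<close> assms(3) by (simp add: vec2_eq_iff)
    qed
    then show ?thesis using False * by (simp add: cusp_def field_simps)
  qed
qed

text \<open>Conjugation, for determinant one. The adjugate instead of the inverse makes it
  polynomial in \<open>g\<close>, hence continuous on all matrices.\<close>

definition cj :: "complex^2^2 \<Rightarrow> complex^2^2 \<Rightarrow> complex^2^2" where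
  "cj g X = g ** X ** adj2 g"

lemma cj_mult: "cj (g ** h) X = cj g (cj h X)"
  by (simp add: cj_def adj2_mult matrix_mul_assoc)

lemma cj_one [simp]: "cj (mat 1) X = X"
  by (simp add: cj_def mat2_eq_iff mat2_mult_sel mat_sel)

lemma cj_minus: "cj g (- X) = - cj g X"
  by (simp add: cj_def mat2_eq_iff mat2_mult_sel algebra_simps)

lemma cj_cancel: "g \<in> SL2C \<Longrightarrow> cj (adj2 g) (cj g X) = X" "g \<in> SL2C \<Longrightarrow> cj g (cj (adj2 g) X) = X"
  by (simp_all add: cj_mult[symmetric] SL2C_cancel)

lemma continuous_on_cj [continuous_intros]:
  assumes "continuous_on A f" shows "continuous_on A (\<lambda>x. cj (f x) X)"
  unfolding cj_def by (intro continuous_intros assms)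

lemma continuous_on_SL2C_local:
  assumes "\<And>B. continuous_on (SL2C \<inter> ball 0 B) f" shows "continuous_on SL2C f"
  unfolding continuous_on_eq_continuous_within
proof
  fix g :: "complex^2^2" assume g: "g \<in> SL2C"
  have gb: "g \<in> ball 0 (norm g + 1)" by simp
  have "at g within SL2C = at g within (SL2C \<inter> ball 0 (norm g + 1))"
    by (rule at_within_nhd[OF gb open_ball]) blast
  moreover have "continuous (at g within (SL2C \<inter> ball 0 (norm g + 1))) f"
    using assms[of "norm g + 1"] g gb unfolding continuous_on_eq_continuous_within by blast
  ultimately show "continuous (at g within SL2C) f" by (simp only:)
qed

text \<open>What the difference of two Abel-Jacobi maps provides. The matrix argument is an
  arbitrary complex matrix, with continuity in it, because functions on SL_2(C) are formed by
  inserting \<open>cj g X\<close> for all \<open>g\<close>. Equivariance is asked for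
  \<open>GamL M\<close> and for the steps of the walk.\<close>

locale modular_symbol = bianchi_lattice +
  fixes M :: "complex set" and P :: "complex option set"
    and m :: "complex option \<Rightarrow> complex option \<Rightarrow> complex^2^2 \<Rightarrow> real" and x :: "complex option"
  assumes level: "is_level M"
    and cusp_P: "e \<in> Lam \<Longrightarrow> cusp e \<in> P"
    and moebius_P: "\<gamma> \<in> GamL M \<union> rho ` (hk \<times> hk) \<Longrightarrow> c \<in> P \<Longrightarrow> moebius \<gamma> c \<in> P"
    and additive: "c \<in> P \<Longrightarrow> c' \<in> P \<Longrightarrow> c'' \<in> P \<Longrightarrow> m c c'' X = m c c' X + m c' c'' X"
    and equivariant: "\<gamma> \<in> GamL M \<union> rho ` (hk \<times> hk) \<Longrightarrow> c \<in> P \<Longrightarrow> c' \<in> P \<Longrightarrow>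
      m (moebius \<gamma> c) (moebius \<gamma> c') (cj \<gamma> X) = m c c' X"
    and m_cont: "c \<in> P \<Longrightarrow> c' \<in> P \<Longrightarrow> continuous_on UNIV (m c c')"
    and m_even: "c \<in> P \<Longrightarrow> c' \<in> P \<Longrightarrow> m c c' (- X) = m c c' X"
    and x_P: "x \<in> P"
begin

section \<open>A continuous primitive of the symbol and its averages\<close>

lemma Gam_det: "\<gamma> \<in> GamL M \<union> rho ` (hk \<times> hk) \<Longrightarrow> det \<gamma> \<noteq> 0"
  using rho_SL2C GamL_SL2C by (auto simp: SL2C_def)

text \<open>The added 1 gives some lattice vector a weight \<open>wt1\<close> of at least 1, so that
  the denominator of \<open>F0\<close> is positive.\<close>

definition Rc :: real where
  "Rc = (SOME C. \<forall>g\<in>SL2C. \<exists>e\<in>Lam. norm (adj2 g *v e) \<le> C) + 1"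

lemma Rc: "g \<in> SL2C \<Longrightarrow> \<exists>e\<in>Lam. norm (adj2 g *v e) \<le> Rc - 1" "0 \<le> Rc"
proof -
  have "\<exists>C. \<forall>g\<in>SL2C. \<exists>e\<in>Lam. norm (adj2 g *v e) \<le> C" using short_vector by blast
  from someI_ex[OF this] have *: "\<forall>g\<in>SL2C. \<exists>e\<in>Lam. norm (adj2 g *v e) \<le> Rc - 1"
    unfolding Rc_def add_diff_cancel_right' .
  then show "g \<in> SL2C \<Longrightarrow> \<exists>e\<in>Lam. norm (adj2 g *v e) \<le> Rc - 1" by blast
  obtain e where "norm (adj2 (mat 1 :: complex^2^2) *v e) \<le> Rc - 1" using * SL2C_one by blast
  then show "0 \<le> Rc" using norm_ge_zero[of "adj2 (mat 1 :: complex^2^2) *v e"] by linarith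
qed

definition wt1 :: "complex^2^2 \<Rightarrow> complex^2 \<Rightarrow> real" where
  "wt1 g e = max 0 (Rc - norm (adj2 g *v e))"

definition E1 :: "complex^2^2 \<Rightarrow> (complex^2) set" where
  "E1 g = {e \<in> Lam. norm (adj2 g *v e) < Rc}"

text \<open>A continuous partition of unity over the short vectors of \<open>g\<^sup>-\<^sup>1 R\<^sup>2\<close>. High in a cusp all short
  vectors are proportional, so that \<open>F0\<close> is then the value of \<open>m\<close> at this cusp and \<open>dF F0 h X\<close> vanishes.\<close>
definition F0 :: "complex^2^2 \<Rightarrow> complex^2^2 \<Rightarrow> real" where
  "F0 g Y = (\<Sum>e\<in>E1 g. wt1 g e * m x (cusp e) Y) / (\<Sum>e\<in>E1 g. wt1 g e)"

lemma E1_subset: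
  assumes "g \<in> SL2C" "norm g \<le> C" shows "E1 g \<subseteq> {e \<in> Lam. norm e \<le> 4 * C * Rc}"
proof
  fix e assume e: "e \<in> E1 g"
  have "det g = 1" using assms by (simp add: SL2C_def)
  then have "norm e \<le> 4 * norm g * norm (adj2 g *v e)" using norm_le_adj2_vec[of g e] by simp
  also have "\<dots> \<le> 4 * C * Rc"
  proof (intro mult_mono)
    have "0 \<le> norm g" by simp
    then show "norm g \<le> C" "0 \<le> 4 * C" using assms(2) by linarith+
    show "norm (adj2 g *v e) \<le> Rc" using e by (simp add: E1_def)
  qed simp_all
  finally show "e \<in> {e \<in> Lam. norm e \<le> 4 * C * Rc}" using e by (simp add: E1_def)
qed

lemma E1_finite: "g \<in> SL2C \<Longrightarrow> finite (E1 g)"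
  by (rule finite_subset[OF E1_subset[OF _ order_refl] finite_Lam_ball])

lemma wt_sum_pos:
  assumes g: "g \<in> SL2C" shows "0 < (\<Sum>e\<in>E1 g. wt1 g e)"
proof -
  obtain e where e: "e \<in> Lam" "norm (adj2 g *v e) \<le> Rc - 1" using Rc(1)[OF g] by blast
  have "e \<in> E1 g" "0 < wt1 g e" using e by (auto simp: E1_def wt1_def)
  moreover have "0 \<le> wt1 g e" for e by (simp add: wt1_def)
  ultimately show ?thesis using E1_finite[OF g] by (intro sum_pos2[of _ e]) auto
qed

lemma wt_sum_continuous:
  assumes a: "\<And>e. e \<in> Lam \<Longrightarrow> continuous_on SL2C (a e)"
  shows "continuous_on SL2C (\<lambda>g. \<Sum>e\<in>E1 g. wt1 g e * a e g)"
proof (rule continuous_on_SL2C_local)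
  fix B
  define E where "E = {e \<in> Lam. norm e \<le> 4 * B * Rc}"
  have fin: "finite E" unfolding E_def by (rule finite_Lam_ball)
  have eq: "(\<Sum>e\<in>E1 g. wt1 g e * a e g) = (\<Sum>e\<in>E. wt1 g e * a e g)" if g: "g \<in> SL2C \<inter> ball 0 B" for g
  proof (rule sum.mono_neutral_left[OF fin])
    show "E1 g \<subseteq> E" unfolding E_def using g by (intro E1_subset) auto
    show "\<forall>e\<in>E - E1 g. wt1 g e * a e g = 0" by (auto simp: E_def E1_def wt1_def)
  qed
  have "continuous_on (SL2C \<inter> ball 0 B) (\<lambda>g. \<Sum>e\<in>E. wt1 g e * a e g)"
  proof (intro continuous_on_sum continuous_on_mult)
    fix e assume "e \<in> E"
    then show "continuous_on (SL2C \<inter> ball 0 B) (a e)"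
      using a by (intro continuous_on_subset[OF a]) (auto simp: E_def)
    show "continuous_on (SL2C \<inter> ball 0 B) (\<lambda>g. wt1 g e)"
      unfolding wt1_def by (intro continuous_intros)
  qed
  then show "continuous_on (SL2C \<inter> ball 0 B) (\<lambda>g. \<Sum>e\<in>E1 g. wt1 g e * a e g)"
    using eq by (subst continuous_on_cong[OF refl eq])
qed

lemma F0_continuous: "continuous_on SL2C (\<lambda>g. F0 g (cj (g ** k) X))"
  unfolding F0_def
proof (intro continuous_on_divide)
  have mc: "continuous_on SL2C (\<lambda>g. m x (cusp e) (cj (g ** k) X))" if "e \<in> Lam" for e
    by (rule continuous_on_compose2[OF m_cont[OF x_P cusp_P[OF that]]]) (auto intro!: continuous_intros)
  show "continuous_on SL2C (\<lambda>g. \<Sum>e\<in>E1 g. wt1 g e * m x (cusp e) (cj (g ** k) X))"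
    by (rule wt_sum_continuous[OF mc])
  show "continuous_on SL2C (\<lambda>g. \<Sum>e\<in>E1 g. wt1 g e)"
    using wt_sum_continuous[of "\<lambda>_ _. 1"] by simp
  show "\<forall>g\<in>SL2C. (\<Sum>e\<in>E1 g. wt1 g e) \<noteq> 0"
  proof
    fix g :: "complex^2^2" assume "g \<in> SL2C"
    from wt_sum_pos[OF this] show "(\<Sum>e\<in>E1 g. wt1 g e) \<noteq> 0" by linarith
  qed
qed

lemma F0_const:
  assumes g: "g \<in> SL2C" and c: "\<And>e. e \<in> E1 g \<Longrightarrow> cusp e = c"
  shows "F0 g Y = m x c Y"
proof -
  have "(\<Sum>e\<in>E1 g. wt1 g e * m x (cusp e) Y) = (\<Sum>e\<in>E1 g. wt1 g e) * m x c Y"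
    unfolding sum_distrib_right using c by (intro sum.cong) auto
  then show ?thesis using wt_sum_pos[OF g] by (simp add: F0_def)
qed

lemma F0_even: "F0 g (- Y) = F0 g Y"
proof -
  have "(\<Sum>e\<in>E1 g. wt1 g e * m x (cusp e) (- Y)) = (\<Sum>e\<in>E1 g. wt1 g e * m x (cusp e) Y)"
    by (intro sum.cong refl) (simp add: E1_def m_even[OF x_P cusp_P])
  then show ?thesis by (simp only: F0_def)
qed

text \<open>\<open>F g Y\<close> behaves like the integral of the symbol from \<open>x\<close> to a
  base point moving with \<open>g\<close>; moving that point by \<gamma> adds the path from
  \<open>x\<close> to \<open>moebius \<gamma> x\<close>.\<close>

definition equi :: "(complex^2^2 \<Rightarrow> complex^2^2 \<Rightarrow> real) \<Rightarrow> bool" where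
  "equi F \<longleftrightarrow> (\<forall>\<gamma>\<in>GamL M. \<forall>g\<in>SL2C. \<forall>Y. F (\<gamma> ** g) (cj \<gamma> Y) = F g Y + m x (moebius \<gamma> x) (cj \<gamma> Y))"

text \<open>\<gamma> maps the short vectors for \<open>g\<close> bijectively to those for
  \<open>\<gamma> ** g\<close>, with equal weights. The weights being normalised, the constant split
  off from the value at each cusp comes out of the mean unchanged.\<close>

lemma equi_F0: "equi F0"
  unfolding equi_def
proof (intro ballI allI)
  fix \<gamma> g Y assume \<gamma>: "\<gamma> \<in> GamL M" and g: "g \<in> SL2C"
  have \<gamma>R: "\<gamma> \<in> GamL R" by (rule GamL_mono[OF level \<gamma>])
  have \<gamma>S: "\<gamma> \<in> SL2C" by (rule GamL_SL2C[OF \<gamma>])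
  have ad: "adj2 (\<gamma> ** g) *v (\<gamma> *v e) = adj2 g *v e" for e
  proof -
    have "adj2 (\<gamma> ** g) *v (\<gamma> *v e) = (adj2 g ** (adj2 \<gamma> ** \<gamma>)) *v e"
      by (simp only: adj2_mult matrix_vector_mul_assoc matrix_mul_assoc)
    then show ?thesis by (simp only: SL2C_cancel(2)[OF \<gamma>S] matrix_mul_rid)
  qed
  have bij: "bij_betw (\<lambda>e. \<gamma> *v e) (E1 g) (E1 (\<gamma> ** g))"
  proof (rule bij_betwI[where g = "\<lambda>e. adj2 \<gamma> *v e"])
    show "(\<lambda>e. \<gamma> *v e) \<in> E1 g \<rightarrow> E1 (\<gamma> ** g)" using GamL_Lam[OF \<gamma>R] by (auto simp: E1_def ad)
    show "(\<lambda>e. adj2 \<gamma> *v e) \<in> E1 (\<gamma> ** g) \<rightarrow> E1 g"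
      using GamL_Lam[OF GamL_adj2[OF is_level_R \<gamma>R]] by (auto simp: E1_def adj2_mult matrix_vector_mul_assoc)
    show "adj2 \<gamma> *v (\<gamma> *v e) = e" for e
      by (simp only: matrix_vector_mul_assoc SL2C_cancel(2)[OF \<gamma>S] matrix_vector_mul_lid)
    show "\<gamma> *v (adj2 \<gamma> *v e) = e" for e
      by (simp only: matrix_vector_mul_assoc SL2C_cancel(1)[OF \<gamma>S] matrix_vector_mul_lid)
  qed
  have w: "wt1 (\<gamma> ** g) (\<gamma> *v e) = wt1 g e" for e by (simp only: wt1_def ad)
  have den: "(\<Sum>e\<in>E1 (\<gamma> ** g). wt1 (\<gamma> ** g) e) = (\<Sum>e\<in>E1 g. wt1 g e)"
    by (subst sum.reindex_bij_betw[OF bij, symmetric]) (simp only: w)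
  let ?c = "m x (moebius \<gamma> x) (cj \<gamma> Y)"
  have cu: "m x (cusp (\<gamma> *v e)) (cj \<gamma> Y) = ?c + m x (cusp e) Y" if e: "e \<in> E1 g" for e
  proof -
    have eL: "e \<in> Lam" "e \<noteq> 0" using e by (auto simp: E1_def Lam_def)
    have "m x (cusp (\<gamma> *v e)) (cj \<gamma> Y) = m x (moebius \<gamma> (cusp e)) (cj \<gamma> Y)"
      by (simp only: moebius_cusp[OF eL(2)])
    also have "\<dots> = ?c + m (moebius \<gamma> x) (moebius \<gamma> (cusp e)) (cj \<gamma> Y)"
      using \<gamma> x_P cusp_P[OF eL(1)] by (intro additive moebius_P) auto
    also have "m (moebius \<gamma> x) (moebius \<gamma> (cusp e)) (cj \<gamma> Y) = m x (cusp e) Y"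
      using \<gamma> x_P cusp_P[OF eL(1)] by (intro equivariant) auto
    finally show ?thesis .
  qed
  have "(\<Sum>e\<in>E1 (\<gamma> ** g). wt1 (\<gamma> ** g) e * m x (cusp e) (cj \<gamma> Y))
      = (\<Sum>e\<in>E1 g. wt1 g e * m x (cusp (\<gamma> *v e)) (cj \<gamma> Y))"
    by (subst sum.reindex_bij_betw[OF bij, symmetric]) (simp only: w)
  also have "\<dots> = (\<Sum>e\<in>E1 g. wt1 g e * ?c + wt1 g e * m x (cusp e) Y)"
    by (intro sum.cong refl) (simp only: cu distrib_left)
  also have "\<dots> = (\<Sum>e\<in>E1 g. wt1 g e) * ?c + (\<Sum>e\<in>E1 g. wt1 g e * m x (cusp e) Y)"
    by (simp only: sum.distrib sum_distrib_right)
  finally show "F0 (\<gamma> ** g) (cj \<gamma> Y) = F0 g Y + ?c"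
    using wt_sum_pos[OF g] by (simp add: F0_def den add_divide_distrib)
qed

text \<open>The average over the Hecke correspondence, corrected such that \<open>equi\<close> is preserved.\<close>
definition Aop :: "(complex^2^2 \<Rightarrow> complex^2^2 \<Rightarrow> real) \<Rightarrow> complex^2^2 \<Rightarrow> complex^2^2 \<Rightarrow> real" where
  "Aop F g Y = (\<Sum>p\<in>hk \<times> hk. F (rho p ** g) (cj (rho p) Y) - m x (moebius (rho p) x) (cj (rho p) Y)) / real (card (hk \<times> hk))"

text \<open>By \<open>rho_perm\<close> one has
  \<open>rho p ** \<gamma> = \<gamma>' ** rho (\<sigma> p)\<close>. Splitting the path from
  \<open>x\<close> to the common image of \<open>x\<close> once at
  \<open>moebius \<gamma>' x\<close> and once at \<open>moebius (rho p) x\<close> shows that the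
  corrections differ by the required constant.\<close>

lemma equi_Aop:
  assumes F: "equi F" shows "equi (Aop F)"
  unfolding equi_def
proof (intro ballI allI)
  fix \<gamma> g Y assume \<gamma>: "\<gamma> \<in> GamL M" and g: "g \<in> SL2C"
  let ?c = "m x (moebius \<gamma> x) (cj \<gamma> Y)"
  let ?f = "\<lambda>p. F (rho p ** g) (cj (rho p) Y) - m x (moebius (rho p) x) (cj (rho p) Y)"
  obtain \<sigma> where \<sigma>: "bij_betw \<sigma> (hk \<times> hk) (hk \<times> hk)"
    "\<And>p. p \<in> hk \<times> hk \<Longrightarrow> \<exists>\<gamma>'\<in>GamL M. rho p ** \<gamma> = \<gamma>' ** rho (\<sigma> p)"
    by (rule rho_perm[OF level \<gamma>]) (rule that, assumption+)
  have step: "F (rho p ** (\<gamma> ** g)) (cj (rho p) (cj \<gamma> Y)) - m x (moebius (rho p) x) (cj (rho p) (cj \<gamma> Y))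
      = ?f (\<sigma> p) + ?c" if p: "p \<in> hk \<times> hk" for p
  proof -
    obtain \<gamma>' where g': "\<gamma>' \<in> GamL M" "rho p ** \<gamma> = \<gamma>' ** rho (\<sigma> p)" using \<sigma>(2)[OF p] by blast
    have sp: "\<sigma> p \<in> hk \<times> hk" by (rule bij_betw_apply[OF \<sigma>(1) p])
    define s Z where "s = rho (\<sigma> p)" and "Z = cj (rho p) (cj \<gamma> Y)"
    have s: "s \<in> GamL M \<union> rho ` (hk \<times> hk)" using sp by (auto simp: s_def)
    have rp: "rho p \<in> GamL M \<union> rho ` (hk \<times> hk)" using p by blast
    have g'u: "\<gamma>' \<in> GamL M \<union> rho ` (hk \<times> hk)" and gu: "\<gamma> \<in> GamL M \<union> rho ` (hk \<times> hk)"
      using g'(1) \<gamma> by blast+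
    have Z: "Z = cj \<gamma>' (cj s Y)" by (simp only: Z_def s_def cj_mult[symmetric] g'(2))
    have rg: "rho p ** (\<gamma> ** g) = \<gamma>' ** (s ** g)" by (simp only: matrix_mul_assoc g'(2) s_def)
    have sg: "s ** g \<in> SL2C" unfolding s_def by (rule rho_mult_SL2C[OF sp g])
    have F1: "F (\<gamma>' ** (s ** g)) (cj \<gamma>' (cj s Y)) = F (s ** g) (cj s Y) + m x (moebius \<gamma>' x) (cj \<gamma>' (cj s Y))"
      using F g'(1) sg unfolding equi_def by blast
    have P1: "moebius \<gamma>' x \<in> P" "moebius s x \<in> P" "moebius (rho p) x \<in> P" "moebius \<gamma> x \<in> P"
      by (intro moebius_P[OF g'u x_P] moebius_P[OF s x_P] moebius_P[OF rp x_P] moebius_P[OF gu x_P])+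
    have P2: "moebius \<gamma>' (moebius s x) \<in> P" "moebius (rho p) (moebius \<gamma> x) \<in> P"
      by (intro moebius_P[OF g'u P1(2)] moebius_P[OF rp P1(4)])+
    have "moebius \<gamma>' (moebius s x) = moebius (\<gamma>' ** s) x"
      by (rule moebius_mult[OF Gam_det[OF s], symmetric])
    also have "\<dots> = moebius (rho p ** \<gamma>) x" by (simp only: g'(2) s_def)
    also have "\<dots> = moebius (rho p) (moebius \<gamma> x)" by (rule moebius_mult[OF Gam_det[OF gu]])
    finally have eq: "moebius \<gamma>' (moebius s x) = moebius (rho p) (moebius \<gamma> x)" .
    have a1: "m x (moebius \<gamma>' (moebius s x)) Z = m x (moebius \<gamma>' x) Z + m (moebius \<gamma>' x) (moebius \<gamma>' (moebius s x)) Z"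
      by (rule additive[OF x_P P1(1) P2(1)])
    have a2: "m (moebius \<gamma>' x) (moebius \<gamma>' (moebius s x)) Z = m x (moebius s x) (cj s Y)"
      unfolding Z by (rule equivariant[OF g'u x_P P1(2)])
    have a3: "m x (moebius (rho p) (moebius \<gamma> x)) Z = m x (moebius (rho p) x) Z + m (moebius (rho p) x) (moebius (rho p) (moebius \<gamma> x)) Z"
      by (rule additive[OF x_P P1(3) P2(2)])
    have a4: "m (moebius (rho p) x) (moebius (rho p) (moebius \<gamma> x)) Z = ?c"
      unfolding Z_def by (rule equivariant[OF rp x_P P1(4)])
    have "F (rho p ** (\<gamma> ** g)) Z - m x (moebius (rho p) x) Z = F (s ** g) (cj s Y) - m x (moebius s x) (cj s Y) + ?c"
      using F1[folded Z] a1 a2 a3 a4 unfolding rg eq by linarith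
    then show ?thesis by (simp only: Z_def s_def)
  qed
  have "(\<Sum>p\<in>hk \<times> hk. F (rho p ** (\<gamma> ** g)) (cj (rho p) (cj \<gamma> Y)) - m x (moebius (rho p) x) (cj (rho p) (cj \<gamma> Y)))
      = (\<Sum>p\<in>hk \<times> hk. ?f (\<sigma> p) + ?c)" by (rule sum.cong[OF refl step])
  also have "\<dots> = (\<Sum>p\<in>hk \<times> hk. ?f (\<sigma> p)) + real (card (hk \<times> hk)) * ?c"
    by (simp only: sum.distrib sum_constant)
  also have "(\<Sum>p\<in>hk \<times> hk. ?f (\<sigma> p)) = (\<Sum>p\<in>hk \<times> hk. ?f p)" by (rule sum.reindex_bij_betw[OF \<sigma>(1)])
  finally have S: "(\<Sum>p\<in>hk \<times> hk. F (rho p ** (\<gamma> ** g)) (cj (rho p) (cj \<gamma> Y)) - m x (moebius (rho p) x) (cj (rho p) (cj \<gamma> Y)))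
      = (\<Sum>p\<in>hk \<times> hk. ?f p) + real (card (hk \<times> hk)) * ?c" .
  have "real (card (hk \<times> hk)) \<noteq> 0" using card_hk2(1) by linarith
  then have "real (card (hk \<times> hk)) * ?c / real (card (hk \<times> hk)) = ?c" by (rule nonzero_mult_div_cancel_left)
  then show "Aop F (\<gamma> ** g) (cj \<gamma> Y) = Aop F g Y + ?c"
    unfolding Aop_def S by (simp only: add_divide_distrib)
qed

text \<open>The first argument moves by \<open>h\<close> while the matrix stays
  \<open>cj g X\<close>. Both terms therefore receive the same constant from \<open>equi\<close>,
  and the difference is invariant under \<open>GamL M\<close>; the corrections in \<open>Aop\<close>
  cancel likewise.\<close>

definition dF :: "(complex^2^2 \<Rightarrow> complex^2^2 \<Rightarrow> real) \<Rightarrow> complex^2^2 \<Rightarrow> complex^2^2 \<Rightarrow> complex^2^2 \<Rightarrow> real" where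
  "dF F h X g = F (g ** h) (cj g X) - F g (cj g X)"

lemma dF_Aop: "dF (Aop F) h X = avg (dF F h X)"
proof
  fix g
  have "Aop F (g ** h) (cj g X) - Aop F g (cj g X)
     = (\<Sum>p\<in>hk \<times> hk. F (rho p ** (g ** h)) (cj (rho p) (cj g X)) - F (rho p ** g) (cj (rho p) (cj g X))) / real (card (hk \<times> hk))"
    unfolding Aop_def by (simp only: diff_divide_distrib[symmetric] sum_subtractf[symmetric]) (simp add: sum_subtractf)
  also have "\<dots> = avg (dF F h X) g"
    unfolding avg_def dF_def by (simp only: cj_mult matrix_mul_assoc)
  finally show "dF (Aop F) h X g = avg (dF F h X) g" by (simp only: dF_def)
qed

lemma avg_pow_dF: "(avg ^^ j) (dF F h X) = dF ((Aop ^^ j) F) h X"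
  by (induction j) (simp_all add: dF_Aop)

lemma equi_Aop_pow: "equi F \<Longrightarrow> equi ((Aop ^^ j) F)"
  by (induction j) (auto intro: equi_Aop)

text \<open>The right translation of the identity by \<gamma> is also a left translation, and
  \<gamma> fixes \<open>X\<close>. The value depends on \<open>equi\<close> alone, so it survives
  any number of averagings.\<close>

lemma dF_at_one:
  assumes F: "equi F" and \<gamma>: "\<gamma> \<in> GamL M" "cj \<gamma> X = X"
  shows "dF F \<gamma> X (mat 1) = m x (moebius \<gamma> x) X"
proof -
  have "F (\<gamma> ** mat 1) (cj \<gamma> X) = F (mat 1) X + m x (moebius \<gamma> x) (cj \<gamma> X)"
    using F \<gamma>(1) SL2C_one unfolding equi_def by blast
  then show ?thesis unfolding dF_def \<gamma>(2) by simp
qed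

text \<open>For the support: above height \<open>R2 ^ 2\<close> every lattice vector of length at
  most \<open>R2\<close> is proportional to the shortest one, since areas of lattice vectors lie in
  \<open>R\<close> and are 0 or at least 1 in modulus. \<open>R2\<close> is chosen to cover the
  short vectors for \<open>g ** h\<close> too, so both values of \<open>F0\<close> are those of one
  cusp.\<close>

lemma dF0_CC:
  assumes h: "h \<in> SL2C" shows "dF F0 h X \<in> CC M"
proof -
  have "ginv M (dF F0 h X)"
    unfolding ginv_def
  proof (intro ballI)
    fix \<gamma> g assume \<gamma>: "\<gamma> \<in> GamL M" and g: "g \<in> SL2C"
    have "F0 (\<gamma> ** (g ** h)) (cj \<gamma> (cj g X)) = F0 (g ** h) (cj g X) + m x (moebius \<gamma> x) (cj \<gamma> (cj g X))"
      "F0 (\<gamma> ** g) (cj \<gamma> (cj g X)) = F0 g (cj g X) + m x (moebius \<gamma> x) (cj \<gamma> (cj g X))"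
      using equi_F0 \<gamma> g SL2C_mult[OF g h] unfolding equi_def by blast+
    then show "dF F0 h X (\<gamma> ** g) = dF F0 h X g"
      unfolding dF_def by (simp add: cj_mult matrix_mul_assoc)
  qed
  moreover have "continuous_on SL2C (dF F0 h X)"
  proof -
    have "continuous_on SL2C (\<lambda>g. F0 (g ** h) (cj ((g ** h) ** adj2 h) X))"
      by (rule continuous_on_compose2[OF F0_continuous]) (auto intro!: continuous_intros SL2C_mult h)
    moreover have "continuous_on SL2C (\<lambda>g. F0 g (cj (g ** mat 1) X))" by (rule F0_continuous)
    ultimately have "continuous_on SL2C (\<lambda>g. F0 (g ** h) (cj ((g ** h) ** adj2 h) X) - F0 g (cj (g ** mat 1) X))"
      by (rule continuous_on_diff)
    then show ?thesis unfolding dF_def[abs_def] by (simp only: SL2C_cancel(5)[OF h] matrix_mul_rid)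
  qed
  moreover have "\<exists>T. \<forall>g\<in>SL2C. T < W g \<longrightarrow> dF F0 h X g = 0"
  proof (intro exI ballI impI)
    define R2 where "R2 = max Rc (4 * norm h * Rc)"
    fix g assume g: "g \<in> SL2C" and W: "R2 ^ 2 < W g"
    have d: "det g = 1" using g by (simp add: SL2C_def)
    then have nz: "det g \<noteq> 0" by simp
    obtain e0 where e0: "e0 \<in> Lam" "W g = cmod (det g) / norm (adj2 g *v e0) ^ 2" "norm (adj2 g *v e0) > 0"
      by (rule min_vector[OF nz]) (rule that, assumption+)
    have key: "cusp e = cusp e0" if e: "e \<in> Lam" "norm (adj2 g *v e) \<le> R2" for e
    proof (rule ccontr)
      assume "cusp e \<noteq> cusp e0"
      then have "wedge e0 e \<noteq> 0" using cusp_eq_of_wedge[of e0 e] e e0(1) by (auto simp: Lam_def)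
      moreover have "wedge e0 e \<in> R" using e e0(1) by (auto simp: wedge_def Lam_def intro!: diff mult)
      ultimately have "1 \<le> cmod (wedge e0 e)" by (intro norm_ge_1)
      also have "\<dots> = cmod (wedge (adj2 g *v e0) (adj2 g *v e))" by (simp add: wedge_mult d)
      also have "\<dots> \<le> norm (adj2 g *v e0) * norm (adj2 g *v e)" by (rule wedge_le)
      also have "\<dots> \<le> norm (adj2 g *v e0) * R2" using e(2) by (intro mult_left_mono) auto
      finally have "1 / norm (adj2 g *v e0) \<le> R2" using e0(3) by (simp add: field_simps)
      then have "(1 / norm (adj2 g *v e0)) ^ 2 \<le> R2 ^ 2" using e0(3) by (intro power_mono) auto
      then show False using W e0(2) d by (simp add: power_divide)
    qed
    have "F0 g (cj g X) = m x (cusp e0) (cj g X)"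
      by (rule F0_const[OF g], rule key) (auto simp: E1_def R2_def)
    moreover have "F0 (g ** h) (cj g X) = m x (cusp e0) (cj g X)"
    proof (rule F0_const[OF SL2C_mult[OF g h]], rule key)
      fix e assume e: "e \<in> E1 (g ** h)"
      then show "e \<in> Lam" by (simp add: E1_def)
      have "adj2 g *v e = h *v (adj2 (g ** h) *v e)"
        by (simp add: adj2_mult matrix_vector_mul_assoc matrix_mul_assoc SL2C_cancel(1)[OF h])
      then have "norm (adj2 g *v e) \<le> 4 * norm h * norm (adj2 (g ** h) *v e)"
        using norm_mat2_vec_le by (simp only:)
      also have "\<dots> \<le> 4 * norm h * Rc" using e by (intro mult_left_mono) (auto simp: E1_def)
      finally show "norm (adj2 g *v e) \<le> R2" by (simp add: R2_def)
    qed
    ultimately show "dF F0 h X g = 0" by (simp add: dF_def)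
  qed
  ultimately show ?thesis by (simp add: CC_def)
qed

lemma avg_pow_add:
  assumes "\<And>g. \<phi> g = \<psi> (g ** h) + \<theta> g"
  shows "(avg ^^ j) \<phi> g = (avg ^^ j) \<psi> (g ** h) + (avg ^^ j) \<theta> g"
proof (induction j arbitrary: g)
  case 0 then show ?case using assms by simp
next
  case (Suc j)
  have "avg ((avg ^^ j) \<phi>) g = avg ((avg ^^ j) \<psi>) (g ** h) + avg ((avg ^^ j) \<theta>) g"
    unfolding avg_def[of "(avg ^^ j) \<phi>"] avg_def[of "(avg ^^ j) \<psi>"] avg_def[of "(avg ^^ j) \<theta>"]
    by (simp only: Suc.IH sum.distrib add_divide_distrib matrix_mul_assoc)
  then show ?case by simp
qed

lemma cesaro_add:
  assumes "\<And>g. \<phi> g = \<psi> (g ** h) + \<theta> g"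
  shows "cesaro n \<phi> g = cesaro n \<psi> (g ** h) + cesaro n \<theta> g"
  unfolding cesaro_def by (simp only: avg_pow_add[of \<phi> \<psi> h \<theta>, OF assms] sum.distrib add_divide_distrib)

lemma dF_cocycle:
  assumes h: "h \<in> SL2C"
  shows "dF F (h ** h') X g = dF F h' (cj (adj2 h) X) (g ** h) + dF F h X g"
  unfolding dF_def cj_mult[of g h] cj_cancel(2)[OF h] by (simp add: matrix_mul_assoc)

text \<open>The mean \<open>d(h, X)\<close> of \<open>dF F0 h X\<close> is a cocycle, \<open>d(h h', X) = d(h, X) + d(h', h\<^sup>-\<^sup>1 X h)\<close>, is even in
  \<open>X\<close>, and \<open>d(\<gamma>, X)\<close> is the period. Conjugating by \<open>w\<close> gives \<open>d(\<gamma>, X) = d(\<gamma>\<^sup>-\<^sup>1, X) = - d(\<gamma>, X)\<close>.\<close>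
lemma torus_period_zero:
  assumes \<gamma>: "\<gamma> \<in> GamL M" "\<gamma> ** X = X ** \<gamma>" and w: "w \<in> SL2C" "w ** X = - (X ** w)" "w ** \<gamma> = adj2 \<gamma> ** w"
  shows "m x (moebius \<gamma> x) X = 0"
proof -
  obtain G mean where G: "G \<noteq> bot" "G \<le> sequentially"
    and mean: "\<And>\<phi> g. \<phi> \<in> CC M \<Longrightarrow> g \<in> SL2C \<Longrightarrow> ((\<lambda>n. cesaro n \<phi> g) \<longlongrightarrow> mean \<phi>) G"
    by (rule mean_exists[OF level]) (rule that, assumption+)
  define d where "d h Y = mean (dF F0 h Y)" for h Y
  have lim: "((\<lambda>n. cesaro n (dF F0 h Y) g) \<longlongrightarrow> d h Y) G" if "h \<in> SL2C" "g \<in> SL2C" for h Y g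
    unfolding d_def by (rule mean[OF dF0_CC[OF that(1)] that(2)])
  have coc: "d (h ** h') Y = d h' (cj (adj2 h) Y) + d h Y" if h: "h \<in> SL2C" "h' \<in> SL2C" for h h' Y
  proof (rule tendsto_unique[OF G(1) lim[OF SL2C_mult[OF h] SL2C_one]])
    \<comment> \<open>The first mean on the right is taken at \<open>h\<close> instead of the
      identity; its limit is the same, since the means do not depend on the point.\<close>
    have eq: "cesaro n (dF F0 (h ** h') Y) (mat 1) =
        cesaro n (dF F0 h' (cj (adj2 h) Y)) (mat 1 ** h) + cesaro n (dF F0 h Y) (mat 1)" for n
      by (rule cesaro_add) (rule dF_cocycle[OF h(1)])
    show "((\<lambda>n. cesaro n (dF F0 (h ** h') Y) (mat 1)) \<longlongrightarrow> d h' (cj (adj2 h) Y) + d h Y) G"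
      unfolding eq by (intro tendsto_add lim h SL2C_one SL2C_mult[OF SL2C_one h(1)])
  qed
  have even: "d h (- Y) = d h Y" for h Y
  proof -
    have "dF F0 h (- Y) = dF F0 h Y" by (rule ext) (simp only: dF_def cj_minus F0_even)
    then show ?thesis by (simp only: d_def)
  qed
  have \<gamma>S: "\<gamma> \<in> SL2C" by (rule GamL_SL2C[OF \<gamma>(1)])
  have cg: "cj \<gamma> X = X" by (simp only: cj_def \<gamma>(2) SL2C_cancel(5)[OF \<gamma>S])
  then have cg': "cj (adj2 \<gamma>) X = X" using cj_cancel(1)[OF \<gamma>S, of X] by simp
  have "cj w X = - X"
  proof -
    have "cj w X = - (X ** w) ** adj2 w" by (simp only: cj_def w(2))
    also have "\<dots> = - (X ** w ** adj2 w)" by (simp add: mat2_eq_iff mat2_mult_sel algebra_simps)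
    finally show ?thesis by (simp only: SL2C_cancel(5)[OF w(1)])
  qed
  then have "cj (adj2 w) (- X) = X" using cj_cancel(1)[OF w(1), of X] by simp
  then have cw: "cj (adj2 w) X = - X" by (simp add: cj_minus minus_equation_iff)
  \<comment> \<open>Both sides of \<open>w ** \<gamma> = adj2 \<gamma> ** w\<close> are expanded by
    the cocycle relation.\<close>
  have "d \<gamma> (- X) + d w X = d (w ** \<gamma>) X" using coc[OF w(1) \<gamma>S, of X] by (simp only: cw)
  also have "\<dots> = d (adj2 \<gamma> ** w) X" by (simp only: w(3))
  also have "\<dots> = d w X + d (adj2 \<gamma>) X" using coc[OF SL2C_adj2[OF \<gamma>S] w(1), of X] by (simp only: adj2_adj2 cg)
  finally have 1: "d \<gamma> X = d (adj2 \<gamma>) X" by (simp only: even)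
  have "adj2 (mat 1 :: complex^2^2) = mat 1" by (simp add: mat2_eq_iff mat_sel)
  then have "d (mat 1) X = d (mat 1) X + d (mat 1) X"
    using coc[OF SL2C_one SL2C_one, of X] by (simp only: matrix_mul_rid cj_one)
  then have "d (\<gamma> ** adj2 \<gamma>) X = 0" by (simp add: SL2C_cancel(1)[OF \<gamma>S])
  then have "d (adj2 \<gamma>) X + d \<gamma> X = 0" using coc[OF \<gamma>S SL2C_adj2[OF \<gamma>S], of X] by (simp only: cg')
  then have d0: "d \<gamma> X = 0" using 1 by linarith
  have "(avg ^^ j) (dF F0 \<gamma> X) (mat 1) = m x (moebius \<gamma> x) X" for j
    unfolding avg_pow_dF by (rule dF_at_one[OF equi_Aop_pow[OF equi_F0] \<gamma>(1) cg])
  \<comment> \<open>Every iterate has the period as its value at the identity, hence so does every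
    Cesaro mean with \<open>n > 0\<close>, and the limit \<open>d \<gamma> X\<close> is the
    period.\<close>
  then have ce: "cesaro n (dF F0 \<gamma> X) (mat 1) = m x (moebius \<gamma> x) X" if "0 < n" for n
    using that by (simp add: cesaro_def)
  have "eventually (\<lambda>n. cesaro n (dF F0 \<gamma> X) (mat 1) = m x (moebius \<gamma> x) X) sequentially"
    using eventually_gt_at_top[of 0] by (rule eventually_mono) (rule ce)
  then have "eventually (\<lambda>n. cesaro n (dF F0 \<gamma> X) (mat 1) = m x (moebius \<gamma> x) X) G"
    using G(2) by (rule filter_leD[rotated])
  then have "((\<lambda>n. cesaro n (dF F0 \<gamma> X) (mat 1)) \<longlongrightarrow> m x (moebius \<gamma> x) X) G"
    by (rule tendsto_eventually)
  then show ?thesis using tendsto_unique[OF G(1) _ lim[OF \<gamma>S SL2C_one]] d0 by simp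
qed

end

section \<open>Imaginary quadratic fields of class number one\<close>

lemma ring_on_simps [simp]:
  "carrier (ring_on A) = A" "x \<otimes>\<^bsub>ring_on A\<^esub> y = x * y" "\<one>\<^bsub>ring_on A\<^esub> = 1"
  "\<zero>\<^bsub>ring_on A\<^esub> = 0" "x \<oplus>\<^bsub>ring_on A\<^esub> y = x + y"
  by (simp_all add: ring_on_def)

lemma ring_on_closed:
  assumes "ring (ring_on A)"
  shows "0 \<in> A" "1 \<in> A" "x \<in> A \<Longrightarrow> y \<in> A \<Longrightarrow> x + y \<in> A" "x \<in> A \<Longrightarrow> y \<in> A \<Longrightarrow> x * y \<in> A"
    "x \<in> A \<Longrightarrow> - x \<in> A" "x \<in> A \<Longrightarrow> y \<in> A \<Longrightarrow> x - y \<in> A"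
proof -
  interpret ring "ring_on A" by fact
  show "0 \<in> A" using zero_closed by simp
  show "1 \<in> A" using one_closed by simp
  show add: "x \<in> A \<Longrightarrow> y \<in> A \<Longrightarrow> x + y \<in> A" for x y using a_closed[of x y] by simp
  show "x \<in> A \<Longrightarrow> y \<in> A \<Longrightarrow> x * y \<in> A" using m_closed[of x y] by simp
  show neg: "x \<in> A \<Longrightarrow> - x \<in> A" for x
  proof -
    assume x: "x \<in> A"
    then have "\<ominus>\<^bsub>ring_on A\<^esub> x \<in> A" "x + \<ominus>\<^bsub>ring_on A\<^esub> x = 0" using a_inv_closed[of x] r_neg[of x] by simp_all
    then show ?thesis by (metis add_eq_0_iff)
  qed
  show "x \<in> A \<Longrightarrow> y \<in> A \<Longrightarrow> x - y \<in> A" using add[OF _ neg, of x y] by simp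
qed

lemma ideal_ring_onD:
  assumes "ideal I (ring_on A)"
  shows "ring (ring_on A)" "I \<subseteq> A" "0 \<in> I" "x \<in> I \<Longrightarrow> y \<in> I \<Longrightarrow> x + y \<in> I" "x \<in> I \<Longrightarrow> a \<in> A \<Longrightarrow> a * x \<in> I"
proof -
  interpret ideal I "ring_on A" by fact
  show "ring (ring_on A)" by (rule ring_axioms)
  show "I \<subseteq> A" using a_subset by simp
  show "0 \<in> I" using additive_subgroup.zero_closed[OF additive_subgroup_axioms] by simp
  show "x \<in> I \<Longrightarrow> y \<in> I \<Longrightarrow> x + y \<in> I" using additive_subgroup.a_closed[OF additive_subgroup_axioms, of x y] by simp
  show "x \<in> I \<Longrightarrow> a \<in> A \<Longrightarrow> a * x \<in> I" using I_l_closed[of x a] by simp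
qed

lemma ideal_ring_onI:
  assumes R: "ring (ring_on A)" and I: "I \<subseteq> A" "0 \<in> I" "\<And>x y. x \<in> I \<Longrightarrow> y \<in> I \<Longrightarrow> x + y \<in> I"
    "\<And>x a. x \<in> I \<Longrightarrow> a \<in> A \<Longrightarrow> a * x \<in> I"
  shows "ideal I (ring_on A)"
proof (rule idealI)
  show "ring (ring_on A)" by fact
  interpret ring "ring_on A" by fact
  have neg: "- x \<in> I" if "x \<in> I" for x
    using I(4)[OF that ring_on_closed(5)[OF R ring_on_closed(2)[OF R]]] by simp
  show "subgroup I (add_monoid (ring_on A))"
  proof (rule group.subgroupI[OF a_group])
    show "I \<subseteq> carrier (add_monoid (ring_on A))" using I(1) by simp
    show "I \<noteq> {}" using I(2) by blast
    show "inv\<^bsub>add_monoid (ring_on A)\<^esub> x \<in> I" if x: "x \<in> I" for x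
    proof -
      have "- x = \<ominus>\<^bsub>ring_on A\<^esub> x"
        using x I(1) neg[OF x] by (intro minus_equality[symmetric]) auto
      then show ?thesis using neg[OF x] by (simp add: a_inv_def)
    qed
    show "x \<otimes>\<^bsub>add_monoid (ring_on A)\<^esub> y \<in> I" if "x \<in> I" "y \<in> I" for x y
      using I(3)[OF that] by simp
  qed
  show "a \<in> I \<Longrightarrow> x \<in> carrier (ring_on A) \<Longrightarrow> x \<otimes>\<^bsub>ring_on A\<^esub> a \<in> I" for a x using I(4) by simp
  show "a \<in> I \<Longrightarrow> x \<in> carrier (ring_on A) \<Longrightarrow> a \<otimes>\<^bsub>ring_on A\<^esub> x \<in> I" for a x using I(4) by (simp add: mult.commute)
qed

lemma cgenideal_ring_on: "cgenideal (ring_on A) w = (*) w ` A"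
  by (auto simp: cgenideal_def mult.commute)

lemma subfieldD:
  assumes "is_subfield E"
  shows "0 \<in> E" "1 \<in> E" "x \<in> E \<Longrightarrow> y \<in> E \<Longrightarrow> x - y \<in> E" "x \<in> E \<Longrightarrow> y \<in> E \<Longrightarrow> x * y \<in> E"
    "x \<in> E \<Longrightarrow> inverse x \<in> E" "x \<in> E \<Longrightarrow> - x \<in> E" "x \<in> E \<Longrightarrow> y \<in> E \<Longrightarrow> x + y \<in> E"
    "x \<in> E \<Longrightarrow> y \<in> E \<Longrightarrow> x / y \<in> E" "x \<in> E \<Longrightarrow> x ^ n \<in> E" "of_nat n \<in> E" "of_int i \<in> E"
proof -
  show z: "0 \<in> E" and o: "1 \<in> E" and d: "x \<in> E \<Longrightarrow> y \<in> E \<Longrightarrow> x - y \<in> E" for x y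
    using assms by (auto simp: is_subfield_def)
  show m: "x \<in> E \<Longrightarrow> y \<in> E \<Longrightarrow> x * y \<in> E" and i: "x \<in> E \<Longrightarrow> inverse x \<in> E" for x y
    using assms by (auto simp: is_subfield_def)
  show n: "x \<in> E \<Longrightarrow> - x \<in> E" for x using d[OF z] by simp
  show a: "x \<in> E \<Longrightarrow> y \<in> E \<Longrightarrow> x + y \<in> E" for x y using d[OF _ n, of x y] by simp
  show "x \<in> E \<Longrightarrow> y \<in> E \<Longrightarrow> x / y \<in> E" using m i by (simp add: divide_inverse)
  show "x \<in> E \<Longrightarrow> x ^ n \<in> E" by (induction n) (auto intro: m o)
  show on: "of_nat n \<in> E" for n by (induction n) (auto intro: a z o)
  show "of_int i \<in> E" by (cases i) (auto intro: on n d o a simp del: of_nat_Suc)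
qed

lemma subfield_of_rat: "is_subfield E \<Longrightarrow> (of_rat q :: 'a::field_char_0) \<in> E"
  by (cases q) (simp add: of_rat_rat subfieldD)

lemma Rats_complex_real:
  fixes q :: complex
  assumes "q \<in> \<rat>" shows "cnj q = q" "Im q = 0" "q \<in> \<real>"
proof -
  obtain r where r: "q = of_rat r" using assms by (auto simp: Rats_def)
  obtain a b where "r = Fract a b" "b > 0" by (cases r) (rule that, assumption+)
  then have q: "q = of_int a / of_int b" using r by (simp add: of_rat_rat)
  show "cnj q = q" by (simp add: q)
  then show "Im q = 0" by (simp add: complex_eq_iff)
  then show "q \<in> \<real>" by (simp add: complex_is_Real_iff)
qed

lemma algebraic_quadratic:
  fixes x :: complex
  assumes "x ^ 2 = t * x - n" "t \<in> \<rat>" "n \<in> \<rat>"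
  shows "algebraic x"
  unfolding algebraic_altdef
proof (intro exI[of _ "[:n, - t, 1:]"] conjI allI)
  show "coeff [:n, - t, 1:] i \<in> \<rat>" for i
    using assms by (auto simp: coeff_pCons split: nat.splits)
  show "poly [:n, - t, 1:] x = 0" using assms(1) by (simp add: power2_eq_square algebra_simps)
qed simp

lemma algebraic_int_quadratic:
  fixes x :: complex
  assumes "x ^ 2 = t * x - n" "t \<in> \<int>" "n \<in> \<int>"
  shows "algebraic_int x"
  unfolding algebraic_int.simps
proof (intro exI[of _ "[:n, - t, 1:]"] exI[of _ x] conjI allI refl)
  show "coeff [:n, - t, 1:] i \<in> \<int>" for i
    using assms by (auto simp: coeff_pCons split: nat.splits)
  show "poly [:n, - t, 1:] x = 0" using assms(1) by (simp add: power2_eq_square algebra_simps)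
qed simp

locale quad_setting =
  fixes S :: "'c::{alg_closed_field, field_char_0, complete_space} sh_data"
  assumes prm: "prime (prm S)"
    and pav: "padic_absolute_value TYPE('c) (prm S)"
    and emb: "embeds_algebraic_numbers (emb S)"
    and iq: "imaginary_quadratic (base S)"
    and cn: "class_number (base S) = 1"
    and unr: "unramified_at (prm S) (base S)"
    and tame_ideal: "ideal (tame S) (ring_on (OF S))"
    and tame_pp: "\<not> tame S \<subseteq> pp S"
begin

abbreviation "F \<equiv> base S"
abbreviation "p \<equiv> prm S"

section \<open>The p-adic absolute value on integers\<close>

lemma dist_pabs: "dist x y = pabs (x - y :: 'c)"
  and pabs_mult: "pabs (x * y :: 'c) = pabs x * pabs y"
  and pabs_add: "pabs (x + y :: 'c) \<le> max (pabs x) (pabs y)"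
  and pabs_p: "pabs (of_nat p :: 'c) = 1 / real p"
  using pav unfolding padic_absolute_value_def by blast+

lemma pabs_0 [simp]: "pabs (0 :: 'c) = 0" by (simp add: pabs_def)
lemma pabs_nonneg [simp]: "0 \<le> pabs (x :: 'c)" by (simp add: pabs_def)
lemma pabs_eq_0 [simp]: "pabs (x :: 'c) = 0 \<longleftrightarrow> x = 0" by (simp add: pabs_def)
lemma pabs_pos [simp]: "0 < pabs (x :: 'c) \<longleftrightarrow> x \<noteq> 0" using pabs_eq_0[of x] pabs_nonneg[of x] by linarith

lemma pabs_1 [simp]: "pabs (1 :: 'c) = 1"
proof -
  have "pabs (1 :: 'c) * pabs (1 :: 'c) = pabs (1 :: 'c) * 1" using pabs_mult[of 1 1] by simp
  then show ?thesis by (simp only: mult_cancel_left pabs_eq_0) simp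
qed

lemma pabs_minus [simp]: "pabs (- x :: 'c) = pabs x"
proof -
  have "pabs (-1 :: 'c) * pabs (-1 :: 'c) = 1" using pabs_mult[of "-1" "-1"] by simp
  then have "pabs (-1 :: 'c) ^ 2 = 1 ^ 2" by (simp add: power2_eq_square)
  then have "pabs (-1 :: 'c) = 1" by (simp only: power2_eq_iff_nonneg pabs_nonneg zero_le_one)
  then show ?thesis using pabs_mult[of "-1" x] by simp
qed

lemma pabs_diff: "pabs (x - y :: 'c) \<le> max (pabs x) (pabs y)"
  using pabs_add[of x "- y"] by simp

lemma pabs_inverse: "pabs (inverse x :: 'c) = inverse (pabs x)"
proof (cases "x = 0")
  case False
  then have "pabs x * pabs (inverse x) = 1" using pabs_mult[of x "inverse x"] by simp
  then show ?thesis using False by (simp add: field_simps)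
qed simp

lemma pabs_divide: "pabs (x / y :: 'c) = pabs x / pabs y"
  by (simp add: divide_inverse pabs_mult pabs_inverse)

lemma pabs_add_eq: "pabs x < pabs y \<Longrightarrow> pabs (x + y :: 'c) = pabs y"
  using pabs_add[of x y] pabs_diff[of "x + y" x] by (auto simp: max_def split: if_splits)

lemma pabs_of_nat: "pabs (of_nat n :: 'c) \<le> 1"
proof (induction n)
  case (Suc n)
  then show ?case using pabs_add[of 1 "of_nat n"] by simp
qed simp

lemma pabs_of_int: "pabs (of_int n :: 'c) \<le> 1"
  by (cases n) (use pabs_of_nat in \<open>auto simp del: of_nat_Suc\<close>)

lemma p_gt_1: "1 < p" using prm prime_gt_1_nat by blast

lemma pabs_p_less: "pabs (of_nat p :: 'c) < 1" using pabs_p p_gt_1 by simp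

text \<open>If \<open>p\<close> did not divide \<open>n\<close>, a Bezout relation
  \<open>a * p + b * n = 1\<close> would contradict the ultrametric inequality.\<close>

lemma pabs_int_less: "pabs (of_int n :: 'c) < 1 \<longleftrightarrow> int p dvd n"
proof
  assume "int p dvd n"
  then obtain k where "n = int p * k" by blast
  then have "pabs (of_int n :: 'c) = pabs (of_nat p :: 'c) * pabs (of_int k :: 'c)" by (simp add: pabs_mult)
  also have "\<dots> \<le> pabs (of_nat p :: 'c) * 1" by (intro mult_left_mono pabs_of_int pabs_nonneg)
  finally show "pabs (of_int n :: 'c) < 1" using pabs_p_less by linarith
next
  assume l: "pabs (of_int n :: 'c) < 1"
  show "int p dvd n"
  proof (rule ccontr)
    assume nd: "\<not> int p dvd n"
    have "prime (int p)" using prm by simp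
    then have "coprime (int p) n" using nd prime_imp_coprime by blast
    then obtain a b where ab: "a * int p + b * n = 1" using bezout_int[of "int p" n] by (auto simp: coprime_iff_gcd_eq_1)
    have "(of_int (a * int p + b * n) :: 'c) = of_int a * of_nat p + of_int b * of_int n" by simp
    then have "(1 :: 'c) = of_int a * of_nat p + of_int b * of_int n" by (simp only: ab of_int_1)
    then have "1 \<le> max (pabs (of_int a * of_nat p :: 'c)) (pabs (of_int b * of_int n :: 'c))"
      using pabs_add[of "of_int a * of_nat p" "of_int b * of_int n"] by (metis pabs_1)
    moreover have "pabs (of_int a * of_nat p :: 'c) \<le> 1 * pabs (of_nat p :: 'c)" "pabs (of_int b * of_int n :: 'c) \<le> 1 * pabs (of_int n :: 'c)"
      unfolding pabs_mult by (intro mult_right_mono pabs_of_int pabs_nonneg)+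
    ultimately show False using l pabs_p_less by linarith
  qed
qed

section \<open>Arithmetic of the imaginary quadratic field\<close>

lemma F_subfield: "is_subfield F"
  using iq by (simp add: imaginary_quadratic_def quadratic_ext_def)

lemma F_structure:
  obtains \<theta> r s where "\<theta> \<in> F" "Im \<theta> \<noteq> 0" "r \<in> \<rat>" "s \<in> \<rat>" "\<theta> ^ 2 = s * \<theta> - r" "cnj \<theta> = s - \<theta>"
    "F = {a + b * \<theta> | a b. a \<in> \<rat> \<and> b \<in> \<rat>}"
proof -
  obtain \<theta> where \<theta>: "\<theta> \<in> F" "F = {a + b * \<theta> | a b. a \<in> \<rat> \<and> b \<in> \<rat>}"
    using iq unfolding imaginary_quadratic_def quadratic_ext_def by blast
  have im: "Im \<theta> \<noteq> 0"
  proof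
    assume "Im \<theta> = 0"
    then have "\<theta> \<in> \<real>" by (simp add: complex_is_Real_iff)
    moreover have "\<rat> \<subseteq> (\<real> :: complex set)" using Rats_complex_real(3) by blast
    ultimately have "F \<subseteq> \<real>" unfolding \<theta>(2) by (auto intro!: Reals_add Reals_mult)
    then show False using iq by (simp add: imaginary_quadratic_def)
  qed
  have "\<theta> ^ 2 \<in> F" using \<theta>(1) F_subfield by (simp add: subfieldD)
  then obtain a b where ab: "\<theta> ^ 2 = a + b * \<theta>" "a \<in> \<rat>" "b \<in> \<rat>" using \<theta>(2) by blast
  have cr: "cnj q = q" if "q \<in> \<rat>" for q using that by (rule Rats_complex_real)
  have "cnj (\<theta> ^ 2) = cnj (a + b * \<theta>)" by (simp only: ab)
  then have "cnj \<theta> ^ 2 = a + b * cnj \<theta>" by (simp only: complex_cnj_power complex_cnj_add complex_cnj_mult cr[OF ab(2)] cr[OF ab(3)])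
  then have "(\<theta> - cnj \<theta>) * (\<theta> + cnj \<theta> - b) = 0" using ab(1) by (simp add: power2_eq_square algebra_simps)
  moreover have "\<theta> - cnj \<theta> \<noteq> 0" using im by (simp add: complex_eq_iff)
  ultimately have "\<theta> + cnj \<theta> - b = 0" by (metis mult_eq_0_iff)
  then have "cnj \<theta> = b - \<theta>" by (simp add: algebra_simps)
  then show thesis using that[of \<theta> "- a" b] \<theta> im ab by (simp add: algebra_simps)
qed

lemma cnj_F:
  assumes "x \<in> F"
  shows "cnj x \<in> F" "x + cnj x \<in> \<rat>" "x * cnj x \<in> \<rat>"
proof -
  obtain \<theta> r s where \<theta>: "\<theta> \<in> F" "r \<in> \<rat>" "s \<in> \<rat>" "\<theta> ^ 2 = s * \<theta> - r" "cnj \<theta> = s - \<theta>"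
    "F = {a + b * \<theta> | a b. a \<in> \<rat> \<and> b \<in> \<rat>}" by (rule F_structure) (rule that, assumption+)
  obtain a b where ab: "x = a + b * \<theta>" "a \<in> \<rat>" "b \<in> \<rat>" using assms \<theta>(6) by blast
  have cr: "cnj q = q" if "q \<in> \<rat>" for q using that by (rule Rats_complex_real)
  have "cnj x = cnj a + cnj b * cnj \<theta>" by (simp add: ab(1))
  then have "cnj x = a + b * (s - \<theta>)" by (simp only: cr[OF ab(2)] cr[OF ab(3)] \<theta>(5))
  then have c: "cnj x = (a + b * s) + (- b) * \<theta>" by (simp add: algebra_simps)
  have "a + b * s \<in> \<rat>" "- b \<in> \<rat>" using ab \<theta> by simp_all
  then show "cnj x \<in> F" unfolding c \<theta>(6) by blast
  have "x + cnj x = 2 * a + b * s" unfolding c unfolding ab(1) by (simp add: algebra_simps)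
  then show "x + cnj x \<in> \<rat>" using ab(2,3) \<theta>(2,3) by simp
  have "x * cnj x = a * a + a * b * s + b * b * (s * \<theta> - \<theta> ^ 2)"
    unfolding c unfolding ab(1) by (simp add: algebra_simps power2_eq_square)
  also have "\<dots> = a * a + a * b * s + b * b * r" by (simp add: \<theta>(4))
  finally show "x * cnj x \<in> \<rat>" using ab(2,3) \<theta>(2,3) by simp
qed

lemma F_quadratic: "x ^ 2 = (x + cnj x) * x - x * cnj (x :: complex)"
  by (simp add: power2_eq_square algebra_simps)

lemma F_algebraic: "x \<in> F \<Longrightarrow> algebraic x"
  using algebraic_quadratic[OF F_quadratic] cnj_F by blast

lemma emb_add: "x \<in> F \<Longrightarrow> y \<in> F \<Longrightarrow> emb S (x + y) = emb S x + emb S y"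
  and emb_mult: "x \<in> F \<Longrightarrow> y \<in> F \<Longrightarrow> emb S (x * y) = emb S x * emb S y"
  and emb_1: "emb S 1 = 1"
  using emb F_algebraic unfolding embeds_algebraic_numbers_def by blast+

lemma emb_0: "emb S 0 = 0"
  using emb_add[of 0 0] subfieldD(1)[OF F_subfield] by simp

lemma emb_minus: "x \<in> F \<Longrightarrow> emb S (- x) = - emb S x"
  using emb_add[of x "- x"] subfieldD(6)[OF F_subfield, of x] by (simp add: emb_0 eq_neg_iff_add_eq_0 add.commute)

lemma emb_diff: "x \<in> F \<Longrightarrow> y \<in> F \<Longrightarrow> emb S (x - y) = emb S x - emb S y"
  using emb_add[of x "- y"] subfieldD(6)[OF F_subfield, of y] by (simp add: emb_minus)

lemma emb_eq_0: "x \<in> F \<Longrightarrow> emb S x = 0 \<longleftrightarrow> x = 0"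
  using emb_mult[of x "inverse x"] subfieldD(5)[OF F_subfield, of x] by (cases "x = 0") (auto simp: emb_0 emb_1)

lemma emb_of_int: "emb S (of_int n) = of_int n"
proof -
  have nat: "emb S (of_nat n) = of_nat n" for n
    by (induction n) (simp_all add: emb_0 emb_1 emb_add subfieldD[OF F_subfield])
  show ?thesis
  proof (cases n)
    case (nonneg k) then show ?thesis using nat[of k] by simp
  next
    case (neg k)
    then show ?thesis using nat[of "Suc k"] emb_minus[OF subfieldD(10)[OF F_subfield], of "Suc k"]
      by (simp del: of_nat_Suc)
  qed
qed

lemma emb_of_rat: "emb S (of_rat q) = of_rat q"
proof (cases q)
  case (Fract a b)
  have "emb S (of_int a / of_int b * of_int b) = emb S (of_int a / of_int b) * emb S (of_int b)"
    by (intro emb_mult subfieldD[OF F_subfield])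
  then have "of_int a = emb S (of_int a / of_int b) * of_int b" using Fract by (simp add: emb_of_int)
  then show ?thesis using Fract by (simp add: of_rat_rat field_simps)
qed

lemma OF_ring: "ring (ring_on (OF S))" by (rule ideal_ring_onD(1)[OF tame_ideal])

lemmas OF_closed = ring_on_closed[OF OF_ring]

lemma OF_F: "x \<in> OF S \<Longrightarrow> x \<in> F" by (simp add: OF_def ints_def)

lemma cnj_OF: "x \<in> OF S \<Longrightarrow> cnj x \<in> OF S"
  using cnj_F by (simp add: OF_def ints_def)

lemma OF_rat_int: "x \<in> OF S \<Longrightarrow> x \<in> \<rat> \<Longrightarrow> x \<in> \<int>"
  using rational_algebraic_int_is_int by (auto simp: OF_def ints_def)

lemma OF_trace_norm:
  assumes "x \<in> OF S" shows "x + cnj x \<in> \<int>" "x * cnj x \<in> \<int>"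
  using assms cnj_F[OF OF_F[OF assms]] cnj_OF[OF assms] OF_closed(3,4) by (blast intro: OF_rat_int)+

lemma OF_I: "x \<in> F \<Longrightarrow> x + cnj x \<in> \<int> \<Longrightarrow> x * cnj x \<in> \<int> \<Longrightarrow> x \<in> OF S"
  using algebraic_int_quadratic[OF F_quadratic] by (simp add: OF_def ints_def)

lemma OF_of_int: "of_int n \<in> OF S" by (simp add: OF_def ints_def subfieldD[OF F_subfield])

lemma OF_norm_ge_1:
  assumes "x \<in> OF S" "x \<noteq> 0" shows "1 \<le> cmod x"
proof -
  obtain n where n: "x * cnj x = of_int n" using OF_trace_norm(2)[OF assms(1)] by (auto elim: Ints_cases)
  have "complex_of_real (cmod x ^ 2) = of_int n" using n by (simp only: complex_norm_square)
  then have "cmod x ^ 2 = real_of_int n" by (metis of_real_eq_iff of_real_of_int_eq)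
  moreover have "0 < cmod x ^ 2" using assms by simp
  ultimately have "1 \<le> cmod x ^ 2" by simp
  then have "1 ^ 2 \<le> cmod x ^ 2" by simp
  then show ?thesis by (rule power2_le_imp_le) simp
qed

lemma OF_unit: "x \<in> OF S \<Longrightarrow> cmod x = 1 \<Longrightarrow> x * cnj x = 1"
  by (simp add: complex_norm_square[symmetric])

lemma OF_nonreal: "\<exists>\<omega>\<in>OF S. Im \<omega> \<noteq> 0"
proof -
  obtain \<theta> r s where \<theta>: "\<theta> \<in> F" "Im \<theta> \<noteq> 0" "r \<in> \<rat>" "s \<in> \<rat>" "\<theta> ^ 2 = s * \<theta> - r" "cnj \<theta> = s - \<theta>"
    by (rule F_structure) (rule that, assumption+)
  obtain r1 r2 where r: "r = of_int r1 / of_int r2" "r2 \<noteq> 0"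
    using \<theta>(3) by (metis Rats_cases' of_int_0_less_iff less_irrefl)
  obtain s1 s2 where s: "s = of_int s1 / of_int s2" "s2 \<noteq> 0"
    using \<theta>(4) by (metis Rats_cases' of_int_0_less_iff less_irrefl)
  define N where "N = r2 * s2"
  have N: "N \<noteq> 0" using r s by (simp add: N_def)
  have "of_int N * \<theta> \<in> OF S"
  proof (rule OF_I)
    show "of_int N * \<theta> \<in> F" using \<theta>(1) by (simp add: subfieldD[OF F_subfield])
    have "of_int N * \<theta> + cnj (of_int N * \<theta>) = of_int N * s" by (simp add: \<theta>(6) algebra_simps)
    also have "\<dots> = of_int (r2 * s1)" using s by (simp add: N_def)
    finally show "of_int N * \<theta> + cnj (of_int N * \<theta>) \<in> \<int>" by (simp only: Ints_of_int)
    have "of_int N * \<theta> * cnj (of_int N * \<theta>) = of_int N ^ 2 * (s * \<theta> - \<theta> ^ 2)"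
      by (simp add: \<theta>(6) power2_eq_square algebra_simps)
    also have "s * \<theta> - \<theta> ^ 2 = r" by (simp add: \<theta>(5))
    also have "of_int N ^ 2 * r = of_int (r1 * r2 * s2 ^ 2)" using r by (simp add: N_def power2_eq_square)
    finally show "of_int N * \<theta> * cnj (of_int N * \<theta>) \<in> \<int>" by (simp only: Ints_of_int)
  qed
  moreover have "Im (of_int N * \<theta>) \<noteq> 0" using N \<theta>(2) by simp
  ultimately show ?thesis by blast
qed

sublocale OL: int_lattice "OF S"
  using OF_closed OF_norm_ge_1 OF_nonreal by unfold_locales auto

lemma F_span:
  assumes w: "\<omega> \<in> F" "Im \<omega> \<noteq> 0" and x: "x \<in> F"
  obtains a b where "x = of_rat a + of_rat b * \<omega>"
proof -
  obtain \<theta> r s where \<theta>: "F = {a + b * \<theta> | a b. a \<in> \<rat> \<and> b \<in> \<rat>}" by (rule F_structure) (rule that, assumption+)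
  obtain c d where cd: "\<omega> = of_rat c + of_rat d * \<theta>" using w(1) \<theta> by (auto simp: Rats_def)
  obtain e f where ef: "x = of_rat e + of_rat f * \<theta>" using x \<theta> by (auto simp: Rats_def)
  have "d \<noteq> 0" using w(2) cd Rats_complex_real(2)[of "of_rat c"] by auto
  then have th: "\<theta> = (\<omega> - of_rat c) / of_rat d" using cd by simp
  then have "x = of_rat (e - f * c / d) + of_rat (f / d) * \<omega>"
    unfolding ef th using \<open>d \<noteq> 0\<close> by (simp add: of_rat_diff of_rat_mult of_rat_divide field_simps)
  then show thesis using that by blast
qed

text \<open>A quotient with one element makes \<open>I\<close> equivalent to the unit ideal, so that
  multiplying \<open>I\<close> by \<open>a\<close> gives the ideal of \<open>b\<close>; the
  generator is \<open>d = b / a\<close>, which lies in \<open>I\<close>.\<close>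

lemma OF_principal:
  assumes I: "ideal I (ring_on (OF S))" "I \<noteq> {0}"
  obtains d where "d \<in> I" "d \<noteq> 0" "I = (*) d ` OF S"
proof -
  define Ids where "Ids = {I. ideal I (ring_on (ints F)) \<and> I \<noteq> {0}}"
  define r where "r = {(I, J). I \<in> Ids \<and> J \<in> Ids \<and> (\<exists>a\<in>ints F - {0}. \<exists>b\<in>ints F - {0}. (*) a ` I = (*) b ` J)}"
  have c: "card (Ids // r) = 1" using cn unfolding class_number_def Ids_def r_def Let_def .
  have OI: "OF S \<in> Ids"
  proof -
    have "ideal (OF S) (ring_on (OF S))" by (rule ideal_ring_onI[OF OF_ring]) (auto intro: OF_closed)
    moreover have "OF S \<noteq> {0}" using OF_closed(2) by (metis singletonD zero_neq_one)
    ultimately show ?thesis by (simp add: Ids_def OF_def)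
  qed
  have II: "I \<in> Ids" using I by (simp add: Ids_def OF_def[symmetric])
  have one: "1 \<in> ints F - {0}" using OF_closed(2) by (simp add: OF_def)
  have "(OF S, OF S) \<in> r" unfolding r_def using OI by (auto intro!: bexI[OF _ one])
  obtain z where z: "Ids // r = {z}" using c by (auto simp: card_1_singleton_iff)
  have "r `` {I} \<in> Ids // r" "r `` {OF S} \<in> Ids // r" using II OI by (auto simp: quotient_def)
  then have "r `` {I} = r `` {OF S}" using z by simp
  then have "(I, OF S) \<in> r" using \<open>(OF S, OF S) \<in> r\<close> by blast
  then obtain a b where ab: "a \<in> OF S" "a \<noteq> 0" "b \<in> OF S" "b \<noteq> 0" "(*) a ` I = (*) b ` OF S"
    by (auto simp: r_def OF_def)
  have "b * 1 \<in> (*) a ` I" unfolding ab(5) by (intro imageI OF_closed)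
  then obtain d where d: "d \<in> I" "b = a * d" by auto
  have "I = (*) d ` OF S"
  proof
    show "(*) d ` OF S \<subseteq> I" using ideal_ring_onD(5)[OF I(1) d(1)] by (auto simp: mult.commute)
    show "I \<subseteq> (*) d ` OF S"
    proof
      fix x assume "x \<in> I"
      then have "a * x \<in> (*) b ` OF S" using ab(5) by blast
      then obtain y where y: "y \<in> OF S" "a * x = b * y" by blast
      then have "a * x = a * (d * y)" by (simp add: d)
      then have "x = d * y" using ab(2) by simp
      then show "x \<in> (*) d ` OF S" using y by blast
    qed
  qed
  then show thesis using that[of d] d ab(4) by auto
qed

lemma OF_bezout:
  assumes "a \<in> OF S" "b \<in> OF S" "a \<noteq> 0 \<or> b \<noteq> 0"
  shows "\<exists>d\<in>OF S. \<exists>a'\<in>OF S. \<exists>b'\<in>OF S. \<exists>s\<in>OF S. \<exists>t\<in>OF S. a = d * a' \<and> b = d * b' \<and> s * a' + t * b' = 1"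
proof -
  define I where "I = {s * a + t * b | s t. s \<in> OF S \<and> t \<in> OF S}"
  have "a = 1 * a + 0 * b" "b = 0 * a + 1 * b" by simp_all
  then have aI: "a \<in> I" "b \<in> I" unfolding I_def using OF_closed(1,2) by blast+
  have "ideal I (ring_on (OF S))"
  proof (rule ideal_ring_onI[OF OF_ring])
    show "I \<subseteq> OF S" using assms OF_closed(3,4) by (auto simp: I_def)
    have "0 = 0 * a + 0 * b" by simp
    then show "0 \<in> I" unfolding I_def using OF_closed(1) by blast
    fix x assume "x \<in> I"
    then obtain s t where x: "x = s * a + t * b" "s \<in> OF S" "t \<in> OF S" by (auto simp: I_def)
    show "c * x \<in> I" if "c \<in> OF S" for c
    proof -
      have "c * x = (c * s) * a + (c * t) * b" by (simp add: x algebra_simps)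
      then show ?thesis unfolding I_def using OF_closed(4) that x by blast
    qed
    show "x + y \<in> I" if yI: "y \<in> I" for y
    proof -
      obtain s' t' where y: "y = s' * a + t' * b" "s' \<in> OF S" "t' \<in> OF S" using yI unfolding I_def by blast
      have "x + y = (s + s') * a + (t + t') * b" by (simp add: x y algebra_simps)
      then show ?thesis unfolding I_def using OF_closed(3) y x by blast
    qed
  qed
  moreover have "I \<noteq> {0}" using aI assms(3) by blast
  ultimately obtain d where d: "d \<in> I" "d \<noteq> 0" "I = (*) d ` OF S" by (rule OF_principal) (rule that, assumption+)
  obtain a' where a': "a' \<in> OF S" "a = d * a'" using aI(1) d(3) by blast
  obtain b' where b': "b' \<in> OF S" "b = d * b'" using aI(2) d(3) by blast
  obtain s t where st: "d = s * a + t * b" "s \<in> OF S" "t \<in> OF S" using d(1) by (auto simp: I_def)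
  have "d * (s * a' + t * b') = d * 1" using st a' b' by (simp add: algebra_simps)
  then have "s * a' + t * b' = 1" by (simp only: mult_cancel_left d(2) simp_thms)
  moreover have "d \<in> OF S" using st assms OF_closed(3,4) by blast
  ultimately show ?thesis using a' b' st by blast
qed

text \<open>Trace and norm of \<open>x\<close> are rational integers. From
  \<open>x^2 = t * x - n\<close> an absolute value above 1 would be at least its own square.\<close>

lemma pabs_OF:
  assumes "x \<in> OF S" shows "pabs (emb S x) \<le> 1"
proof (rule ccontr)
  assume "\<not> pabs (emb S x) \<le> 1"
  then have g: "1 < pabs (emb S x)" by simp
  obtain t where t: "x + cnj x = of_int t" using OF_trace_norm(1)[OF assms] by (auto elim: Ints_cases)
  obtain n where n: "x * cnj x = of_int n" using OF_trace_norm(2)[OF assms] by (auto elim: Ints_cases)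
  have xF: "x \<in> F" by (rule OF_F[OF assms])
  have "x * x = of_int t * x - of_int n" using F_quadratic[of x] t n by (simp add: power2_eq_square)
  then have "emb S (x * x) = emb S (of_int t * x - of_int n)" by (simp only:)
  then have "emb S x * emb S x = of_int t * emb S x - of_int n"
    using xF by (simp add: emb_mult emb_diff emb_of_int subfieldD[OF F_subfield])
  then have "pabs (emb S x) * pabs (emb S x) \<le> max (pabs (of_int t * emb S x)) (pabs (of_int n :: 'c))"
    using pabs_diff[of "of_int t * emb S x" "of_int n"] by (simp add: pabs_mult[symmetric])
  also have "\<dots> \<le> max (1 * pabs (emb S x)) 1"
    unfolding pabs_mult by (intro max.mono mult_right_mono pabs_of_int pabs_nonneg)
  also have "\<dots> = pabs (emb S x)" using g by simp
  finally show False using mult_strict_right_mono[OF g, of "pabs (emb S x)"] g by linarith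
qed

section \<open>The prime above p and a generator of it\<close>

lemma pp_ideal: "ideal (pp S) (ring_on (OF S))"
proof (rule ideal_ring_onI[OF OF_ring])
  show "pp S \<subseteq> OF S" by (auto simp: pp_def)
  show "0 \<in> pp S" by (simp add: pp_def OF_closed emb_0)
  show "x + y \<in> pp S" if "x \<in> pp S" "y \<in> pp S" for x y
  proof -
    have "pabs (emb S x + emb S y) < 1" using that pabs_add[of "emb S x" "emb S y"] by (auto simp: pp_def)
    then show ?thesis using that OF_closed(3) by (auto simp: pp_def emb_add OF_F)
  qed
  show "a * x \<in> pp S" if "x \<in> pp S" "a \<in> OF S" for x a
  proof -
    have "pabs (emb S a) * pabs (emb S x) \<le> 1 * pabs (emb S x)" by (intro mult_right_mono pabs_OF that pabs_nonneg)
    then show ?thesis using that OF_closed(4) by (auto simp: pp_def emb_mult OF_F pabs_mult)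
  qed
qed

lemma p_pp: "of_nat p \<in> pp S"
  using OF_of_int[of "int p"] emb_of_int[of "int p"] pabs_p_less by (simp add: pp_def)

definition \<pi> :: complex where "\<pi> = (SOME d. d \<in> pp S \<and> d \<noteq> 0 \<and> pp S = (*) d ` OF S)"

lemma pi: "\<pi> \<in> pp S" "\<pi> \<noteq> 0" "pp S = (*) \<pi> ` OF S"
proof -
  have "pp S \<noteq> {0}"
  proof
    assume "pp S = {0}"
    then have "(of_nat p :: complex) = 0" using p_pp by blast
    then show False using p_gt_1 by simp
  qed
  then have "\<exists>d. d \<in> pp S \<and> d \<noteq> 0 \<and> pp S = (*) d ` OF S"
    by (rule OF_principal[OF pp_ideal]) (rule exI, intro conjI, assumption+)
  from someI_ex[OF this, folded \<pi>_def] show "\<pi> \<in> pp S" "\<pi> \<noteq> 0" "pp S = (*) \<pi> ` OF S" by simp_all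
qed

lemma pi_OF: "\<pi> \<in> OF S" using pi(1) by (simp add: pp_def)

lemma OF_unit_pabs: "x \<in> OF S \<Longrightarrow> cmod x = 1 \<Longrightarrow> pabs (emb S x) = 1"
proof -
  assume x: "x \<in> OF S" "cmod x = 1"
  have "emb S x * emb S (cnj x) = 1"
    using OF_unit[OF x] emb_mult[of x "cnj x"] x(1) cnj_OF OF_F by (simp add: emb_1)
  then have "pabs (emb S x) * pabs (emb S (cnj x)) = 1" by (simp add: pabs_mult[symmetric])
  moreover have "pabs (emb S x) * pabs (emb S (cnj x)) \<le> pabs (emb S x) * 1"
    by (intro mult_left_mono pabs_OF cnj_OF x pabs_nonneg)
  ultimately show ?thesis using pabs_OF[OF x(1)] by linarith
qed

lemma norm_pi: "1 < cmod \<pi>"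
proof -
  have "1 \<le> cmod \<pi>" by (rule OF_norm_ge_1[OF pi_OF pi(2)])
  moreover have "cmod \<pi> \<noteq> 1" using OF_unit_pabs[OF pi_OF] pi(1) by (auto simp: pp_def)
  ultimately show ?thesis by simp
qed

lemma pp_iff: "x \<in> OF S \<Longrightarrow> x \<in> (*) \<pi> ` OF S \<longleftrightarrow> pabs (emb S x) < 1"
  unfolding pi(3)[symmetric] by (simp add: pp_def)

lemma pi_prime:
  assumes "x \<in> OF S" "y \<in> OF S" "x * y \<in> (*) \<pi> ` OF S"
  shows "x \<in> (*) \<pi> ` OF S \<or> y \<in> (*) \<pi> ` OF S"
proof (rule ccontr)
  assume "\<not> ?thesis"
  then have "pabs (emb S x) = 1" "pabs (emb S y) = 1"
    using pp_iff assms pabs_OF by (auto simp: not_less intro: antisym)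
  then have "pabs (emb S (x * y)) = 1" using assms by (simp add: emb_mult OF_F pabs_mult)
  then show False using pp_iff[OF OF_closed(4)[OF assms(1,2)]] assms(3) by simp
qed

lemma int_pp: "of_int n \<in> (*) \<pi> ` OF S \<longleftrightarrow> int p dvd n"
  using pp_iff[OF OF_of_int] by (simp add: emb_of_int pabs_int_less)


text \<open>The choice depends only on the class of \<open>x\<close>, see
  \<open>residue_cong\<close>. The zero class is represented by 0, so that
  \<open>diag(1, \<pi>)\<close> is among the Hecke representatives, as
  \<open>dense_generation\<close> requires.\<close>

definition residue :: "complex \<Rightarrow> complex" where
  "residue x = (if x \<in> (*) \<pi> ` OF S then 0 else SOME y. y \<in> OF S \<and> x - y \<in> (*) \<pi> ` OF S)"

definition Res :: "complex set" where "Res = residue ` OF S"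

section \<open>Residue classes modulo the prime\<close>

lemma pi_mult_add: "x \<in> (*) \<pi> ` OF S \<Longrightarrow> y \<in> (*) \<pi> ` OF S \<Longrightarrow> x + y \<in> (*) \<pi> ` OF S"
  using ideal_ring_onD(4)[OF pp_ideal] by (simp only: pi(3))

lemma pi_mult_OF: "x \<in> (*) \<pi> ` OF S \<Longrightarrow> a \<in> OF S \<Longrightarrow> a * x \<in> (*) \<pi> ` OF S"
  using ideal_ring_onD(5)[OF pp_ideal] by (simp only: pi(3))

lemma pi_mult_minus: "x \<in> (*) \<pi> ` OF S \<Longrightarrow> - x \<in> (*) \<pi> ` OF S"
  using pi_mult_OF[OF _ OF_closed(5)[OF OF_closed(2)], of x] by simp

lemma pi_mult_diff: "x \<in> (*) \<pi> ` OF S \<Longrightarrow> y \<in> (*) \<pi> ` OF S \<Longrightarrow> x - y \<in> (*) \<pi> ` OF S"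
  using pi_mult_add[OF _ pi_mult_minus, of x y] by simp

lemma pi_mult_0: "0 \<in> (*) \<pi> ` OF S"
  using OF_closed(1) by (auto intro!: image_eqI[of _ _ 0])

lemma residue:
  assumes "x \<in> OF S"
  shows "residue x \<in> OF S" "x - residue x \<in> (*) \<pi> ` OF S"
proof -
  have "\<exists>y. y \<in> OF S \<and> x - y \<in> (*) \<pi> ` OF S" using assms pi_mult_0 by (intro exI[of _ x]) simp
  from someI_ex[OF this] show "residue x \<in> OF S" "x - residue x \<in> (*) \<pi> ` OF S"
    using OF_closed(1) by (simp_all add: residue_def)
qed

lemma residue_cong:
  assumes "x - y \<in> (*) \<pi> ` OF S" shows "residue x = residue y"
proof -
  have eq: "x - z \<in> (*) \<pi> ` OF S \<longleftrightarrow> y - z \<in> (*) \<pi> ` OF S" for z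
  proof
    assume "x - z \<in> (*) \<pi> ` OF S"
    from pi_mult_diff[OF this assms] show "y - z \<in> (*) \<pi> ` OF S" by simp
  next
    assume "y - z \<in> (*) \<pi> ` OF S"
    from pi_mult_add[OF this assms] show "x - z \<in> (*) \<pi> ` OF S" by simp
  qed
  have "x \<in> (*) \<pi> ` OF S \<longleftrightarrow> y \<in> (*) \<pi> ` OF S" using eq[of 0] by simp
  then show ?thesis by (simp only: residue_def eq)
qed

lemma Res_fin: "finite Res"
proof -
  obtain f :: "complex \<Rightarrow> complex" and D where f: "finite D" "\<And>x. x \<in> OF S \<Longrightarrow> f x \<in> D"
    "\<And>x y. x \<in> OF S \<Longrightarrow> y \<in> OF S \<Longrightarrow> f x = f y \<Longrightarrow> x - y \<in> (*) \<pi> ` OF S"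
    using OL.finite_residues[OF pi_OF pi(2)] by metis
  define g where "g d = residue (SOME x. x \<in> OF S \<and> f x = d)" for d
  have "Res \<subseteq> g ` D"
  proof
    fix r assume "r \<in> Res"
    then obtain x where x: "x \<in> OF S" "r = residue x" by (auto simp: Res_def)
    have "\<exists>y. y \<in> OF S \<and> f y = f x" using x by blast
    from someI_ex[OF this] have "residue x = g (f x)" unfolding g_def using x f(3) by (metis residue_cong)
    then show "r \<in> g ` D" using x f(2) by blast
  qed
  then show ?thesis using f(1) finite_surj by blast
qed

lemma Res_rep:
  assumes "x \<in> OF S" shows "\<exists>!b. b \<in> Res \<and> x - b \<in> (*) \<pi> ` OF S"
proof (rule ex1I[of _ "residue x"])
  show "residue x \<in> Res \<and> x - residue x \<in> (*) \<pi> ` OF S" using residue assms by (simp add: Res_def)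
  fix b assume b: "b \<in> Res \<and> x - b \<in> (*) \<pi> ` OF S"
  then obtain y where y: "y \<in> OF S" "b = residue y" by (auto simp: Res_def)
  have "y - b \<in> (*) \<pi> ` OF S" using residue(2)[OF y(1)] y(2) by simp
  from pi_mult_diff[OF conjunct2[OF b] this] have "x - y \<in> (*) \<pi> ` OF S" by simp
  then show "b = residue x" using residue_cong y(2) by metis
qed

lemma diff_cnj_norm:
  assumes "x \<in> OF S" "Im x \<noteq> 0" shows "1 \<le> 2 * \<bar>Im x\<bar>"
proof -
  have e: "x - cnj x = Complex 0 (2 * Im x)" by (simp add: complex_eq_iff)
  have "x - cnj x \<in> OF S" using assms(1) cnj_OF OF_closed(6) by blast
  moreover have "x - cnj x \<noteq> 0" using assms(2) by (simp add: e complex_eq_iff)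
  ultimately have "1 \<le> cmod (x - cnj x)" by (rule OF_norm_ge_1)
  also have "cmod (x - cnj x) = 2 * \<bar>Im x\<bar>" unfolding e by (simp add: cmod_def real_sqrt_mult)
  finally show ?thesis .
qed

lemma no_descent:
  fixes c :: real
  assumes "\<And>n. real p ^ n \<le> c" shows False
proof -
  obtain n where "c < real p ^ n" using real_arch_pow[of "real p" c] p_gt_1 by auto
  then show False using assms[of n] by simp
qed

text \<open>The residues of 0, ..., p - 1 are distinct and \<open>cmod \<pi> \<le> p\<close>, so
  failure of the bound forces \<pi> to be associated to \<open>p\<close> and every integer of
  \<open>F\<close> to be congruent to a rational integer modulo \<open>p\<close>. Then imaginary
  parts can be divided by \<open>p\<close> indefinitely, although non-zero ones are bounded below by
  \<open>diff_cnj_norm\<close>.\<close>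

lemma Res_card: "cmod \<pi> < real (card Res)"
proof (rule ccontr)
  assume "\<not> ?thesis"
  then have le: "real (card Res) \<le> cmod \<pi>" by simp
  have inj: "inj_on (\<lambda>n. residue (of_nat n)) {..<p}"
  proof (rule inj_onI)
    fix m n assume mn: "m \<in> {..<p}" "n \<in> {..<p}" "residue (of_nat m) = residue (of_nat n)"
    have O: "of_nat i \<in> OF S" for i using OF_of_int[of "int i"] by simp
    have "of_nat m - residue (of_nat m) - (of_nat n - residue (of_nat n)) \<in> (*) \<pi> ` OF S"
      by (intro pi_mult_diff residue O)
    then have "of_int (int m - int n) \<in> (*) \<pi> ` OF S" by (simp add: mn(3))
    then have "int p dvd int m - int n" by (simp only: int_pp)
    then have "int m mod int p = int n mod int p" by (simp add: mod_eq_dvd_iff)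
    then show "m = n" using mn by simp
  qed
  have sub: "(\<lambda>n. residue (of_nat n)) ` {..<p} \<subseteq> Res"
    unfolding Res_def using OF_of_int[of "int _"] by auto
  have ple: "p \<le> card Res" using card_inj_on_le[OF inj sub Res_fin] by simp
  obtain \<kappa> where \<kappa>: "\<kappa> \<in> OF S" "of_nat p = \<pi> * \<kappa>" using p_pp pi(3) by blast
  have \<kappa>0: "\<kappa> \<noteq> 0" using \<kappa>(2) p_gt_1 by auto
  have pk: "real p = cmod \<pi> * cmod \<kappa>" using arg_cong[OF \<kappa>(2), of cmod] by (simp add: norm_mult)
  have "cmod \<pi> * 1 \<le> cmod \<pi> * cmod \<kappa>" by (intro mult_left_mono OF_norm_ge_1 \<kappa> \<kappa>0 norm_ge_zero)
  then have eq: "cmod \<pi> = real p" "card Res = p" using pk le ple by linarith+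
  then have "cmod \<kappa> = 1" using pk norm_pi by auto
  then have "\<kappa> * cnj \<kappa> = 1" using OF_unit \<kappa>(1) by blast
  then have pik: "\<pi> = of_nat p * cnj \<kappa>" using \<kappa>(2) by (simp add: mult.assoc)
  have "card ((\<lambda>n. residue (of_nat n)) ` {..<p}) = p" using card_image[OF inj] by simp
  then have all: "(\<lambda>n. residue (of_nat n)) ` {..<p} = Res" using card_subset_eq[OF Res_fin sub] eq by simp
  have step: "\<exists>z\<in>OF S. Im x = real p * Im z" if x: "x \<in> OF S" for x
  proof -
    obtain n where n: "residue x = residue (of_nat n)" using all x by (auto simp: Res_def)
    have O: "of_nat n \<in> OF S" using OF_of_int[of "int n"] by simp
    have "x - residue x - (of_nat n - residue (of_nat n)) \<in> (*) \<pi> ` OF S"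
      by (intro pi_mult_diff residue O x)
    then have "x - of_nat n \<in> (*) \<pi> ` OF S" by (simp add: n)
    then obtain y where y: "y \<in> OF S" "x - of_nat n = \<pi> * y" by blast
    have "Im x = Im (x - of_nat n)" by simp
    also have "x - of_nat n = of_nat p * (cnj \<kappa> * y)" using y pik by (simp add: mult.assoc)
    also have "Im \<dots> = real p * Im (cnj \<kappa> * y)" by simp
    finally show ?thesis using OF_closed(4)[OF cnj_OF[OF \<kappa>(1)] y(1)] by blast
  qed
  obtain \<omega> where \<omega>: "\<omega> \<in> OF S" "Im \<omega> \<noteq> 0" using OF_nonreal by blast
  have desc: "\<exists>z\<in>OF S. Im \<omega> = real p ^ n * Im z" for n
  proof (induction n)
    case (Suc n)
    then obtain z where z: "z \<in> OF S" "Im \<omega> = real p ^ n * Im z" by blast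
    obtain z' where "z' \<in> OF S" "Im z = real p * Im z'" using step[OF z(1)] by blast
    then show ?case using z(2) by (intro bexI[of _ z']) simp_all
  qed (use \<omega> in auto)
  have "real p ^ n \<le> 2 * \<bar>Im \<omega>\<bar>" for n
  proof -
    obtain z where z: "z \<in> OF S" "Im \<omega> = real p ^ n * Im z" using desc by blast
    have "Im z \<noteq> 0" using \<omega>(2) z(2) by auto
    then have "real p ^ n * 1 \<le> real p ^ n * (2 * \<bar>Im z\<bar>)"
      by (intro mult_left_mono diff_cnj_norm z) simp_all
    also have "\<dots> = 2 * \<bar>Im \<omega>\<bar>" by (simp add: z(2) abs_mult)
    finally show ?thesis by simp
  qed
  then show False by (rule no_descent)
qed

sublocale BL: bianchi_lattice "OF S" \<pi> Res
proof
  show "0 \<in> Res" unfolding Res_def using OF_closed(1) pi_mult_0 by (intro image_eqI[of _ _ 0]) (simp_all add: residue_def)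
  show "Res \<subseteq> OF S" using residue by (auto simp: Res_def)
qed (use OF_bezout pi_OF norm_pi pi_prime Res_fin Res_rep Res_card in \<open>assumption | simp\<close>)+

lemma tame: "tame S \<subseteq> OF S" "0 \<in> tame S" "x \<in> tame S \<Longrightarrow> y \<in> tame S \<Longrightarrow> x + y \<in> tame S"
  "x \<in> tame S \<Longrightarrow> a \<in> OF S \<Longrightarrow> a * x \<in> tame S"
  using ideal_ring_onD[OF tame_ideal] by blast+

lemma is_level_tame: "BL.is_level (tame S)"
proof -
  obtain m where m: "m \<in> tame S" "m \<notin> (*) \<pi> ` OF S" using tame_pp pi(3) by blast
  have mO: "m \<in> OF S" using m tame(1) by blast
  have m0: "m \<noteq> 0" using m(2) pi_mult_0 by metis
  obtain i z where iz: "i \<in> OF S" "z \<in> OF S" "m * i + \<pi> * z = 1" using BL.inv_mod_pi[OF mO m(2)] by metis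
  have "i * m + z * \<pi> = 1" using iz(3) by (simp add: mult.commute)
  moreover have "i * m \<in> tame S" by (rule tame(4)[OF m(1) iz(1)])
  ultimately have "\<exists>\<mu>\<in>tame S. \<exists>y\<in>OF S. \<mu> + y * \<pi> = 1" using iz(2) by blast
  then show ?thesis unfolding BL.is_level_def using tame m(1) m0 by blast
qed

section \<open>Unramifiedness of p\<close>

lemma OF_cring: "cring (ring_on (OF S))"
  by (rule cring.intro[OF OF_ring], rule comm_monoid.intro[OF ring.is_monoid[OF OF_ring]], unfold_locales)
    (simp add: mult.commute)

text \<open>\<kappa> is prime to \<pi> by unramifiedness, and so is its conjugate, as conjugation is
  trivial modulo \<pi>; hence the norm of \<kappa> is prime to \<open>p\<close>. It divides
  \<open>p^2\<close>, the norm of \<open>p = \<pi> * \<kappa>\<close>, so \<kappa> is a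
  unit.\<close>

lemma p_not_ramified:
  assumes "\<And>x. x \<in> OF S \<Longrightarrow> x - cnj x \<in> (*) \<pi> ` OF S"
  shows "(*) \<pi> ` OF S = (*) (of_nat p) ` OF S"
proof -
  obtain \<kappa> where \<kappa>: "\<kappa> \<in> OF S" "of_nat p = \<pi> * \<kappa>" using p_pp pi(3) by blast
  have "\<kappa> \<notin> (*) \<pi> ` OF S"
  proof
    assume "\<kappa> \<in> (*) \<pi> ` OF S"
    then have pk: "\<pi> \<otimes>\<^bsub>ring_on (OF S)\<^esub> \<kappa> \<in> ideal_prod (ring_on (OF S)) (pp S) (pp S)"
      using pi by (intro ideal_prod.prod) simp_all
    have pr: "primeideal (pp S) (ring_on (OF S))"
    proof (rule primeidealI)
      show "ideal (pp S) (ring_on (OF S))" by (rule pp_ideal)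
      show "cring (ring_on (OF S))" by (rule OF_cring)
      have "1 \<notin> pp S" by (simp add: pp_def emb_1)
      then show "carrier (ring_on (OF S)) \<noteq> pp S" using OF_closed(2) by (simp only: ring_on_simps) blast
      fix a b assume "a \<in> carrier (ring_on (OF S))" "b \<in> carrier (ring_on (OF S))" "a \<otimes>\<^bsub>ring_on (OF S)\<^esub> b \<in> pp S"
      then show "a \<in> pp S \<or> b \<in> pp S" using pi_prime[of a b] by (simp only: pi(3) ring_on_simps)
    qed
    from pr have np: "of_nat p \<notin> ideal_prod (ring_on (OF S)) (pp S) (pp S)"
      using unr unfolding unramified_at_def OF_def[symmetric] by blast
    show False using np pk by (simp add: \<kappa>(2))
  qed
  then have k1: "\<not> pabs (emb S \<kappa>) < 1" using pp_iff[OF \<kappa>(1)] by simp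
  have "cnj \<kappa> \<notin> (*) \<pi> ` OF S"
    using pi_mult_add[OF assms[OF \<kappa>(1)], of "cnj \<kappa>"] \<open>\<kappa> \<notin> _\<close> by (simp only: diff_add_cancel) blast
  then have nk: "\<kappa> * cnj \<kappa> \<notin> (*) \<pi> ` OF S" using pi_prime[OF \<kappa>(1) cnj_OF[OF \<kappa>(1)]] \<open>\<kappa> \<notin> _\<close> by blast
  obtain n where n: "\<kappa> * cnj \<kappa> = of_int n" using OF_trace_norm(2)[OF \<kappa>(1)] by (auto elim: Ints_cases)
  obtain l where l: "\<pi> * cnj \<pi> = of_int l" using OF_trace_norm(2)[OF pi_OF] by (auto elim: Ints_cases)
  have "(of_int (int p ^ 2) :: complex) = of_nat p * cnj (of_nat p)" by (simp add: power2_eq_square)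
  also have "\<dots> = (\<pi> * cnj \<pi>) * (\<kappa> * cnj \<kappa>)" unfolding \<kappa>(2) by simp
  also have "\<dots> = of_int (l * n)" by (simp add: l n)
  finally have ln: "int p ^ 2 = l * n" by (simp only: of_int_eq_iff)
  have "\<not> int p dvd n" using nk n int_pp by simp
  then have "coprime (int p) n" using prm by (intro prime_imp_coprime) simp_all
  then have "coprime (int p ^ 2) n" by simp
  then have "is_unit n" by (rule coprime_common_divisor) (simp_all add: ln)
  then have "\<bar>n\<bar> = 1" by simp
  then have "cmod (\<kappa> * cnj \<kappa>) = 1" unfolding n by simp
  then have "cmod \<kappa> ^ 2 = 1 ^ 2" by (simp add: norm_mult power2_eq_square)
  then have "cmod \<kappa> = 1" by (rule power2_eq_imp_eq) simp_all
  then have kk: "\<kappa> * cnj \<kappa> = 1" using OF_unit \<kappa>(1) by blast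
  then have pik: "\<pi> = of_nat p * cnj \<kappa>" using \<kappa>(2) by (simp add: mult.assoc)
  show ?thesis
  proof
    show "(*) \<pi> ` OF S \<subseteq> (*) (of_nat p) ` OF S" unfolding pik
      using OF_closed(4)[OF cnj_OF[OF \<kappa>(1)]] by (auto simp: mult.assoc)
    show "(*) (of_nat p) ` OF S \<subseteq> (*) \<pi> ` OF S" unfolding \<kappa>(2)
      using OF_closed(4)[OF \<kappa>(1)] by (auto simp: mult.assoc)
  qed
qed

text \<open>Otherwise conjugation is trivial modulo \<open>\<pi>\<close> and \<open>\<pi>\<close> is associated to \<open>p\<close>; then every purely
  imaginary integer is \<open>p\<close> times another one.\<close>
lemma unramified_generator: "\<exists>\<omega>\<in>OF S. pabs (emb S (\<omega> - cnj \<omega>)) = 1"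
proof (rule ccontr)
  assume no: "\<not> ?thesis"
  have all: "x - cnj x \<in> (*) \<pi> ` OF S" if x: "x \<in> OF S" for x
  proof -
    have O: "x - cnj x \<in> OF S" using x cnj_OF OF_closed(6) by blast
    have "pabs (emb S (x - cnj x)) \<noteq> 1" using no x by blast
    then show ?thesis using pp_iff[OF O] pabs_OF[OF O] by simp
  qed
  note P = p_not_ramified[OF all]
  have imag: "y \<in> (*) \<pi> ` OF S" if y: "y \<in> OF S" "cnj y = - y" for y
  proof (cases "p = 2")
    case False
    have "\<not> int p dvd 2" using False p_gt_1 by (auto dest: zdvd_imp_le)
    then have n2: "2 \<notin> (*) \<pi> ` OF S" using int_pp[of 2] by simp
    have "2 * y \<in> (*) \<pi> ` OF S" using all[OF y(1)] y(2) by simp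
    then show ?thesis using pi_prime[of 2 y] y(1) OF_of_int[of 2] n2 by simp
  next
    case True
    obtain N where N: "y * cnj y = of_int N" using OF_trace_norm(2)[OF y(1)] by (auto elim: Ints_cases)
    then have yy: "y * y = of_int (- N)" using y(2) by (simp add: minus_equation_iff eq_commute)
    show ?thesis
    proof (cases "even N")
      case ev: True
      then have "y * y \<in> (*) \<pi> ` OF S" unfolding yy int_pp using \<open>p = 2\<close> by simp
      then show ?thesis using pi_prime y(1) by blast
    next
      \<comment> \<open>Here \<open>(1 + y)^2\<close> is divisible by \<pi>, which is associated to
        2; so \<open>z = (1 + y) / 2\<close> is an integer, and
        \<open>y = z - cnj z\<close>.\<close>
      case od: False
      have y1: "1 + y \<in> OF S" using y(1) OF_closed by blast
      have "of_int (1 - N) \<in> (*) \<pi> ` OF S" unfolding int_pp using \<open>p = 2\<close> od by simp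
      moreover have "2 * y \<in> (*) \<pi> ` OF S" using all[OF y(1)] y(2) by simp
      moreover have "(1 + y) * (1 + y) = 2 * y + of_int (1 - N)" by (simp add: algebra_simps yy)
      ultimately have "(1 + y) * (1 + y) \<in> (*) \<pi> ` OF S" using pi_mult_add by metis
      then have "1 + y \<in> (*) \<pi> ` OF S" using pi_prime y1 by blast
      then have "1 + y \<in> (*) (of_nat p) ` OF S" by (simp only: P)
      then obtain z where z: "z \<in> OF S" "1 + y = 2 * z" using \<open>p = 2\<close> by auto
      have "2 * (z - cnj z) = (1 + y) - cnj (1 + y)" unfolding z(2) by simp
      also have "\<dots> = 2 * y" using y(2) by simp
      finally have "z - cnj z = y" by (simp only: mult_cancel_left) simp
      then show ?thesis using all[OF z(1)] by simp
    qed
  qed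
  obtain \<omega> where \<omega>: "\<omega> \<in> OF S" "Im \<omega> \<noteq> 0" using OF_nonreal by blast
  define \<eta> where "\<eta> = \<omega> - cnj \<omega>"
  have \<eta>: "\<eta> \<in> OF S" "cnj \<eta> = - \<eta>" "\<eta> \<noteq> 0"
    using \<omega> cnj_OF OF_closed(6) by (auto simp: \<eta>_def complex_eq_iff)
  have desc: "\<exists>z\<in>OF S. cnj z = - z \<and> \<eta> = of_nat p ^ n * z" for n
  proof (induction n)
    case (Suc n)
    then obtain z where z: "z \<in> OF S" "cnj z = - z" "\<eta> = of_nat p ^ n * z" by blast
    have "z \<in> (*) (of_nat p) ` OF S" using imag[OF z(1,2)] by (simp only: P)
    then obtain y where y: "y \<in> OF S" "z = of_nat p * y" by blast
    have "of_nat p * cnj y = of_nat p * (- y)" using z(2) unfolding y(2) by simp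
    then have "cnj y = - y" using p_gt_1 by (simp only: mult_cancel_left) auto
    then show ?case using y z(3) by (intro bexI[of _ y]) (simp_all add: mult.assoc)
  qed (use \<eta> in auto)
  have "real p ^ n \<le> cmod \<eta>" for n
  proof -
    obtain z where z: "z \<in> OF S" "\<eta> = of_nat p ^ n * z" using desc by blast
    have "z \<noteq> 0" using \<eta>(3) z(2) by auto
    then have "real p ^ n * 1 \<le> real p ^ n * cmod z" by (intro mult_left_mono OF_norm_ge_1 z) simp_all
    then show ?thesis by (simp add: z(2) norm_mult norm_power)
  qed
  then show False by (rule no_descent)
qed

end

section \<open>Unramified extensions\<close>

lemma finite_ext_subfield: "finite_ext k E \<Longrightarrow> is_subfield k" "finite_ext k E \<Longrightarrow> is_subfield E" "finite_ext k E \<Longrightarrow> k \<subseteq> E"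
  by (simp_all add: finite_ext_def)

lemma finite_ext_refl:
  assumes k: "is_subfield k" shows "finite_ext k k"
proof -
  have "k = {\<Sum>b\<in>{1}. q b * b | q. q \<in> {1} \<rightarrow> k}"
  proof (intro equalityI subsetI)
    fix x assume "x \<in> k"
    then show "x \<in> {\<Sum>b\<in>{1}. q b * b | q. q \<in> {1} \<rightarrow> k}" by (auto intro!: exI[of _ "\<lambda>_. x"])
  next
    fix x assume "x \<in> {\<Sum>b\<in>{1}. q b * b | q. q \<in> {1} \<rightarrow> k}"
    then show "x \<in> k" by auto
  qed
  moreover have "finite {1 :: 'a}" "{1} \<subseteq> k" using subfieldD(2)[OF k] by auto
  ultimately show ?thesis unfolding finite_ext_def using k by blast
qed

lemma adjoin_quadratic_subfield:
  fixes \<theta> :: "'a::field"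
  assumes E: "is_subfield E" and th: "\<theta> \<notin> E" "s \<in> E" "n \<in> E" "\<theta> ^ 2 = s * \<theta> - n"
  shows "is_subfield {a + b * \<theta> | a b. a \<in> E \<and> b \<in> E}" (is "is_subfield ?E")
proof -
  have I: "x \<in> ?E" if "x = a + b * \<theta>" "a \<in> E" "b \<in> E" for x a b using that by blast
  have sq: "\<theta> * \<theta> = s * \<theta> - n" using th(4) by (simp add: power2_eq_square)
  show ?thesis unfolding is_subfield_def
  proof (intro conjI ballI)
    show "0 \<in> ?E" by (rule I[of _ 0 0]) (simp_all add: subfieldD[OF E])
    show "1 \<in> ?E" by (rule I[of _ 1 0]) (simp_all add: subfieldD[OF E])
    fix x assume "x \<in> ?E"
    then obtain a b where x: "x = a + b * \<theta>" and ab: "a \<in> E" "b \<in> E" by blast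
    show "inverse x \<in> ?E"
    proof (cases "x = 0")
      case True then show ?thesis by (intro I[of _ 0 0]) (simp_all add: subfieldD[OF E])
    next
      case False
      \<comment> \<open>\<open>N\<close> is the norm of \<open>x\<close>, with
        \<open>s - \<theta>\<close> as the conjugate of \<theta>; if it vanished, \<theta> would lie
        in \<open>E\<close>.\<close>
      define N where "N = a * a + a * b * s + b * b * n"
      have "(a + b * \<theta>) * (a + b * (s - \<theta>)) = a * a + a * b * s + b * b * (s * \<theta> - \<theta> * \<theta>)"
        by (simp add: algebra_simps)
      then have xN: "x * (a + b * (s - \<theta>)) = N" by (simp add: x N_def sq)
      have "N \<noteq> 0"
      proof
        assume "N = 0"
        then have z: "a + b * (s - \<theta>) = 0" using xN False by simp
        show False
        proof (cases "b = 0")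
          case True then show False using z x False by simp
        next
          case bn: False
          have "b * \<theta> = b * (s + a / b)" using z bn by (simp add: field_simps)
          then have "\<theta> = s + a / b" using bn by (simp only: mult_cancel_left) simp
          then show False using th(1,2) ab by (simp add: subfieldD[OF E])
        qed
      qed
      have "x * ((a + b * s) / N + (- b / N) * \<theta>) = x * (a + b * (s - \<theta>)) / N"
        by (simp add: diff_divide_distrib add_divide_distrib algebra_simps)
      also have "\<dots> = 1" using xN \<open>N \<noteq> 0\<close> by simp
      finally have "inverse x = (a + b * s) / N + (- b / N) * \<theta>" by (rule inverse_unique)
      then show ?thesis using ab th(2,3)
        by (intro I[of _ "(a + b * s) / N" "- b / N"]) (simp_all add: subfieldD[OF E] N_def)
    qed
    fix y assume "y \<in> ?E"
    then obtain c d where y: "y = c + d * \<theta>" and cd: "c \<in> E" "d \<in> E" by blast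
    show "x - y \<in> ?E" by (rule I[of _ "a - c" "b - d"]) (simp_all add: x y algebra_simps ab cd subfieldD[OF E])
    have "x * y = a * c + (a * d + b * c) * \<theta> + b * d * (\<theta> * \<theta>)" by (simp add: x y algebra_simps)
    also have "\<dots> = (a * c - b * d * n) + (a * d + b * c + b * d * s) * \<theta>" unfolding sq by (simp add: algebra_simps)
    finally show "x * y \<in> ?E" using ab cd th(2,3)
      by (intro I[of _ "a * c - b * d * n" "a * d + b * c + b * d * s"]) (simp_all add: subfieldD[OF E])
  qed
qed

lemma subfield_sum: "is_subfield E \<Longrightarrow> (\<And>b. b \<in> B \<Longrightarrow> f b \<in> E) \<Longrightarrow> sum f B \<in> E"
  by (induction B rule: infinite_finite_induct) (auto simp: subfieldD)

lemma adjoin_quadratic_finite_ext: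
  fixes \<theta> :: "'a::field"
  assumes E: "finite_ext k E" and th: "\<theta> \<notin> E" "s \<in> E" "n \<in> E" "\<theta> ^ 2 = s * \<theta> - n"
  shows "finite_ext k {a + b * \<theta> | a b. a \<in> E \<and> b \<in> E}" (is "finite_ext k ?E")
proof -
  note sE = finite_ext_subfield(2)[OF E] and kE = finite_ext_subfield(3)[OF E]
  have I: "x \<in> ?E" if "x = a + b * \<theta>" "a \<in> E" "b \<in> E" for x a b using that by blast
  have sub: "is_subfield ?E" by (rule adjoin_quadratic_subfield[OF sE th])
  obtain B where B: "finite B" "E = {\<Sum>b\<in>B. q b * b | q. q \<in> B \<rightarrow> k}" "B \<subseteq> E"
    using E unfolding finite_ext_def by blast
  have EE: "E \<subseteq> ?E"
  proof
    fix x assume "x \<in> E"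
    then show "x \<in> ?E" using subfieldD(1)[OF sE] by (intro I[of x x 0]) simp_all
  qed
  have \<theta>0: "\<theta> \<noteq> 0" using th(1) subfieldD(1)[OF sE] by auto
  define C where "C = (\<lambda>b. b * \<theta>) ` B"
  have C: "finite C" "C \<subseteq> ?E"
  proof -
    show "finite C" using B by (simp add: C_def)
    show "C \<subseteq> ?E"
    proof
      fix x assume "x \<in> C"
      then obtain b where "b \<in> B" "x = b * \<theta>" by (auto simp: C_def)
      then show "x \<in> ?E" using B(3) subfieldD(1)[OF sE] by (intro I[of x 0 b]) auto
    qed
  qed
  have "?E = {\<Sum>b\<in>B \<union> C. q b * b | q. q \<in> B \<union> C \<rightarrow> k}"
  proof (intro equalityI subsetI)
    fix x assume "x \<in> ?E"
    then obtain a b where x: "x = a + b * \<theta>" "a \<in> E" "b \<in> E" by blast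
    obtain q where q: "a = (\<Sum>b\<in>B. q b * b)" "q \<in> B \<rightarrow> k" using x(2) B(2) by blast
    obtain q' where q': "b = (\<Sum>b\<in>B. q' b * b)" "q' \<in> B \<rightarrow> k" using x(3) B(2) by blast
    \<comment> \<open>\<open>B\<close> and its multiples by \<theta> may share the element 0; the
      two conditional coefficients are therefore added.\<close>
    define r where "r c = (if c \<in> B then q c else 0) + (if c \<in> C then q' (c / \<theta>) else 0)" for c
    have "(\<Sum>c\<in>B \<union> C. r c * c) = (\<Sum>c\<in>B \<union> C. if c \<in> B then q c * c else 0) + (\<Sum>c\<in>B \<union> C. if c \<in> C then q' (c / \<theta>) * c else 0)"
      unfolding sum.distrib[symmetric] by (rule sum.cong) (auto simp: r_def distrib_right)
    also have "(\<Sum>c\<in>B \<union> C. if c \<in> B then q c * c else 0) = a"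
      unfolding q(1) by (subst sum.inter_restrict[symmetric]) (auto simp: B C intro: sum.cong)
    also have "(\<Sum>c\<in>B \<union> C. if c \<in> C then q' (c / \<theta>) * c else 0) = (\<Sum>c\<in>C. q' (c / \<theta>) * c)"
      by (subst sum.inter_restrict[symmetric]) (auto simp: B C intro: sum.cong)
    also have "\<dots> = (\<Sum>b\<in>B. q' b * (b * \<theta>))"
      unfolding C_def by (subst sum.reindex) (auto simp: inj_on_def \<theta>0)
    also have "\<dots> = b * \<theta>" unfolding q'(1) by (simp add: sum_distrib_right mult.assoc)
    finally have "x = (\<Sum>c\<in>B \<union> C. r c * c)" by (simp add: x(1))
    moreover have "r \<in> B \<union> C \<rightarrow> k"
      using q(2) q'(2) finite_ext_subfield(1)[OF E] \<theta>0 by (auto simp: r_def C_def subfieldD Pi_iff)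
    ultimately show "x \<in> {\<Sum>b\<in>B \<union> C. q b * b | q. q \<in> B \<union> C \<rightarrow> k}" by blast
  next
    fix x assume "x \<in> {\<Sum>b\<in>B \<union> C. q b * b | q. q \<in> B \<union> C \<rightarrow> k}"
    then obtain q where q: "x = (\<Sum>b\<in>B \<union> C. q b * b)" "q \<in> B \<union> C \<rightarrow> k" by blast
    have "q c * c \<in> ?E" if c: "c \<in> B \<union> C" for c
    proof -
      have "q c \<in> ?E" using q(2) c kE EE by blast
      moreover have "c \<in> ?E" using c B(3) EE C(2) by blast
      ultimately show ?thesis by (rule subfieldD(4)[OF sub])
    qed
    then show "x \<in> ?E" unfolding q(1) by (rule subfield_sum[OF sub])
  qed
  moreover have "finite (B \<union> C)" "B \<union> C \<subseteq> ?E" using B C EE by auto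
  ultimately show ?thesis unfolding finite_ext_def using sub finite_ext_subfield(1)[OF E] kE EE by blast
qed

locale sh_setting = quad_setting S
  for S :: "'c::{alg_closed_field, field_char_0, complete_space} sh_data" +
  assumes quad_K: "quadratic_ext (base S) (quad S)"
    and inert: "inert_in (pp S) (quad S)"
    and L_fin: "finite_ext Qp (coef S)"
    and K_L: "Kp S \<subseteq> coef S"
    and wt_even: "even (wt S)"
begin

abbreviation "K \<equiv> quad S"

lemma pabs_diff_commute: "pabs (x - y :: 'c) = pabs (y - x)"
  using pabs_minus[of "x - y"] by simp

lemma closure_pabs: "x \<in> closure E \<longleftrightarrow> (\<forall>e>0. \<exists>y\<in>E. pabs (x - y :: 'c) < e)"
  by (simp add: closure_approachable dist_pabs pabs_diff_commute[of x])

lemma closure_subfield: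
  assumes E: "is_subfield (E :: 'c set)" shows "is_subfield (closure E)"
  unfolding is_subfield_def
proof (intro conjI ballI)
  show "0 \<in> closure E" "1 \<in> closure E" using subfieldD(1,2)[OF E] closure_subset[of E] by blast+
  fix x assume x: "x \<in> closure E"
  show "inverse x \<in> closure E"
  proof (cases "x = 0")
    case True then show ?thesis using x by simp
  next
    case False
    show ?thesis unfolding closure_pabs
    proof (intro allI impI)
      fix e :: real assume e: "0 < e"
      have px: "0 < pabs x" using False by simp
      obtain y where y: "y \<in> E" "pabs (x - y) < min (pabs x) (e * (pabs x * pabs x))"
        using x px e unfolding closure_pabs by (metis min_less_iff_conj mult_pos_pos)
      have py: "pabs y = pabs x" using pabs_add_eq[of "- (x - y)" x] y(2) unfolding pabs_minus by simp
      have y0: "y \<noteq> 0" using py px by auto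
      have "inverse x - inverse y = - (x - y) / (x * y)" using False y0 by (simp add: field_simps)
      then have "pabs (inverse x - inverse y) = pabs (x - y) / (pabs x * pabs x)"
        by (simp only: pabs_divide pabs_minus pabs_mult py)
      also have "\<dots> < e" using y(2) px by (simp add: pos_divide_less_eq)
      finally show "\<exists>y\<in>E. pabs (inverse x - y) < e" using subfieldD(5)[OF E y(1)] by blast
    qed
  qed
  fix y assume y: "y \<in> closure E"
  show "x - y \<in> closure E" unfolding closure_pabs
  proof (intro allI impI)
    fix e :: real assume e: "0 < e"
    obtain x' where x': "x' \<in> E" "pabs (x - x') < e" using x e unfolding closure_pabs by blast
    obtain y' where y': "y' \<in> E" "pabs (y - y') < e" using y e unfolding closure_pabs by blast
    have eq: "x - y - (x' - y') = (x - x') - (y - y')" by simp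
    have "pabs (x - y - (x' - y')) < e" unfolding eq by (rule le_less_trans[OF pabs_diff]) (use x' y' in simp)
    then show "\<exists>z\<in>E. pabs (x - y - z) < e" using subfieldD(3)[OF E x'(1) y'(1)] by blast
  qed
  show "x * y \<in> closure E" unfolding closure_pabs
  proof (intro allI impI)
    fix e :: real assume e: "0 < e"
    define C where "C = pabs x + 1"
    have C: "0 < C" by (simp add: C_def add_nonneg_pos)
    obtain y' where y': "y' \<in> E" "pabs (y - y') < e / C" using y e C unfolding closure_pabs by (metis divide_pos_pos)
    define D where "D = pabs y' + 1"
    have D: "0 < D" by (simp add: D_def add_nonneg_pos)
    obtain x' where x': "x' \<in> E" "pabs (x - x') < e / D" using x e D unfolding closure_pabs by (metis divide_pos_pos)
    have 1: "pabs (x * (y - y')) < e"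
    proof -
      have "pabs (x * (y - y')) \<le> C * pabs (y - y')" unfolding pabs_mult by (intro mult_right_mono) (simp_all add: C_def)
      also have "\<dots> < C * (e / C)" using y'(2) C by (intro mult_strict_left_mono)
      finally show ?thesis using C by simp
    qed
    have 2: "pabs ((x - x') * y') < e"
    proof -
      have "pabs ((x - x') * y') \<le> pabs (x - x') * D" unfolding pabs_mult by (intro mult_left_mono) (simp_all add: D_def)
      also have "\<dots> < e / D * D" using x'(2) D by (intro mult_strict_right_mono)
      finally show ?thesis using D by simp
    qed
    have eq: "x * y - x' * y' = x * (y - y') + (x - x') * y'" by (simp add: algebra_simps)
    have "pabs (x * y - x' * y') < e" unfolding eq by (rule le_less_trans[OF pabs_add]) (use 1 2 in simp)
    then show "\<exists>z\<in>E. pabs (x * y - z) < e" using subfieldD(4)[OF E x'(1) y'(1)] by blast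
  qed
qed

lemma embF_subfield: "is_subfield (emb S ` F)"
  unfolding is_subfield_def
proof (intro conjI ballI)
  show "0 \<in> emb S ` F" using subfieldD(1)[OF F_subfield] emb_0 by (metis imageI)
  show "1 \<in> emb S ` F" using subfieldD(2)[OF F_subfield] emb_1 by (metis imageI)
  fix x assume "x \<in> emb S ` F"
  then obtain a where a: "a \<in> F" "x = emb S a" by blast
  show "inverse x \<in> emb S ` F"
  proof (cases "a = 0")
    case True then show ?thesis using a emb_0 by (metis imageI inverse_zero)
  next
    case False
    have "x * emb S (inverse a) = 1" using a False emb_mult[OF a(1) subfieldD(5)[OF F_subfield a(1)]] by (simp add: emb_1)
    then have "inverse x = emb S (inverse a)" by (rule inverse_unique)
    then show ?thesis using subfieldD(5)[OF F_subfield a(1)] by blast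
  qed
  fix y assume "y \<in> emb S ` F"
  then obtain b where b: "b \<in> F" "y = emb S b" by blast
  show "x - y \<in> emb S ` F" using a b emb_diff[OF a(1) b(1)] subfieldD(3)[OF F_subfield a(1) b(1)] by (metis imageI)
  show "x * y \<in> emb S ` F" using a b emb_mult[OF a(1) b(1)] subfieldD(4)[OF F_subfield a(1) b(1)] by (metis imageI)
qed

lemma Fp_subfield: "is_subfield (Fp S)"
  unfolding Fp_def by (rule closure_subfield[OF embF_subfield])

lemma Qp_subfield: "is_subfield (Qp :: 'c set)" by (rule finite_ext_subfield(1)[OF L_fin])
lemma L_subfield: "is_subfield (coef S)" by (rule finite_ext_subfield(2)[OF L_fin])

lemma ur_I: "finite_ext Qp (E :: 'c set) \<Longrightarrow> pabs ` (E - {0}) = pabs ` (Qp - {0} :: 'c set) \<Longrightarrow> E \<subseteq> Qp_ur"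
  unfolding Qp_ur_def by (rule Union_upper) simp

text \<open>Adjoining \<open>\<omega>\<close> with \<open>\<omega> - cnj \<omega>\<close> a unit at \<open>p\<close> does not enlarge the value group: if
  \<open>|e - \<theta>| < 1\<close> for some \<open>e\<close> in the smaller field, then \<open>|e - \<theta>| = |(e - \<theta>)(e - \<theta>')|\<close>.\<close>
lemma ur_field:
  assumes "x \<in> Qp_ur"
  obtains E where "is_subfield E" "E \<subseteq> Qp_ur" "x \<in> E" "emb S ` F \<subseteq> E"
proof -
  obtain E :: "'c set" where E: "finite_ext Qp E" "pabs ` (E - {0}) = pabs ` (Qp - {0} :: 'c set)" "x \<in> E"
    using assms unfolding Qp_ur_def by blast
  note sE = finite_ext_subfield(2)[OF E(1)]
  obtain \<omega> where w: "\<omega> \<in> OF S" "pabs (emb S (\<omega> - cnj \<omega>)) = 1" using unramified_generator by blast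
  have wF: "\<omega> \<in> F" "cnj \<omega> \<in> F" using w(1) OF_F cnj_OF by blast+
  have "\<omega> - cnj \<omega> \<noteq> 0" using w(2) by (auto simp: emb_0)
  then have im: "Im \<omega> \<noteq> 0" by (auto simp: complex_eq_iff)
  define \<theta> where "\<theta> = emb S \<omega>"
  define \<theta>' where "\<theta>' = emb S (cnj \<omega>)"
  obtain s where s: "\<omega> + cnj \<omega> = of_int s" using OF_trace_norm(1)[OF w(1)] by (auto elim: Ints_cases)
  obtain n where n: "\<omega> * cnj \<omega> = of_int n" using OF_trace_norm(2)[OF w(1)] by (auto elim: Ints_cases)
  have th: "\<theta> + \<theta>' = of_int s" "\<theta> * \<theta>' = of_int n" "pabs (\<theta> - \<theta>') = 1"
    using emb_add[OF wF] emb_mult[OF wF] emb_diff[OF wF] w(2) by (simp_all add: \<theta>_def \<theta>'_def s n emb_of_int)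
  have \<theta>': "\<theta>' = of_int s - \<theta>" using th(1) by (simp add: algebra_simps)
  have sq: "\<theta> ^ 2 = of_int s * \<theta> - of_int n" using th(2) unfolding \<theta>' by (simp add: power2_eq_square algebra_simps)
  have span: "emb S ` F \<subseteq> E'" if E': "is_subfield E'" "\<theta> \<in> E'" for E'
  proof
    fix y assume "y \<in> emb S ` F"
    then obtain z where z: "z \<in> F" "y = emb S z" by blast
    obtain a b where ab: "z = of_rat a + of_rat b * \<omega>" by (rule F_span[OF wF(1) im z(1)])
    have "of_rat a \<in> F" "of_rat b \<in> F" by (rule subfield_of_rat[OF F_subfield])+
    then have "y = of_rat a + of_rat b * \<theta>"
      using z(2) wF(1) by (simp add: ab emb_add emb_mult subfieldD[OF F_subfield] emb_of_rat \<theta>_def)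
    then show "y \<in> E'" using E' by (simp add: subfieldD subfield_of_rat)
  qed
  show thesis
  proof (cases "\<theta> \<in> E")
    case True
    show thesis by (rule that[OF sE ur_I[OF E(1,2)] E(3) span[OF sE True]])
  next
    case False
    define E' where "E' = {a + b * \<theta> | a b. a \<in> E \<and> b \<in> E}"
    have sn: "of_int s \<in> E" "of_int n \<in> E" by (rule subfieldD[OF sE])+
    have fe: "finite_ext Qp E'" unfolding E'_def by (rule adjoin_quadratic_finite_ext[OF E(1) False sn sq])
    note sE' = finite_ext_subfield(2)[OF fe]
    have EE': "y \<in> E'" if y: "y \<in> E" for y
      unfolding E'_def using y subfieldD(1)[OF sE] by (intro CollectI exI[of _ y] exI[of _ 0]) simp
    have \<theta>E: "\<theta> \<in> E'" unfolding E'_def using subfieldD(1,2)[OF sE] by (intro CollectI exI[of _ 0] exI[of _ 1]) simp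
    have val: "\<exists>z\<in>E - {0}. pabs y = pabs z" if y: "y \<in> E'" "y \<noteq> 0" for y
    proof -
      obtain a b where ab: "y = a + b * \<theta>" "a \<in> E" "b \<in> E" using y(1) unfolding E'_def by blast
      show ?thesis
      proof (cases "b = 0")
        case True then show ?thesis using y ab by (intro bexI[of _ a]) auto
      next
        case b0: False
        define e where "e = - a / b"
        have eE: "e \<in> E" using ab by (simp add: e_def subfieldD[OF sE])
        have ye: "y = b * (\<theta> - e)" using b0 by (simp add: ab e_def field_simps)
        have t1: "pabs \<theta> \<le> 1" unfolding \<theta>_def by (rule pabs_OF[OF w(1)])
        \<comment> \<open>Up to the factor \<open>b\<close>, \<open>y\<close> is
          \<open>\<theta> - e\<close>. If \<open>e\<close> is large it dominates; if the difference
          is a unit only \<open>b\<close> counts; in the last case \<open>\<theta>' - e\<close> is a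
          unit because \<open>\<theta>' - \<theta>\<close> is.\<close>
        consider "1 < pabs e" | "pabs (\<theta> - e) = 1" | "pabs (\<theta> - e) < 1"
        proof -
          have "pabs (\<theta> - e) \<le> 1" if "pabs e \<le> 1" by (rule order_trans[OF pabs_diff]) (use t1 that in simp)
          then have "1 < pabs e \<or> pabs (\<theta> - e) = 1 \<or> pabs (\<theta> - e) < 1" by linarith
          then show thesis using that by blast
        qed
        then show ?thesis
        proof cases
          case 1
          have "pabs (\<theta> - e) = pabs e" using pabs_add_eq[of \<theta> "- e"] 1 t1 by simp
          then have "pabs y = pabs (b * e)" unfolding ye pabs_mult by simp
          moreover have "b * e \<in> E - {0}" using ab eE b0 1 by (auto simp: subfieldD[OF sE])
          ultimately show ?thesis by blast
        next
          case 2
          then have "pabs y = pabs b" unfolding ye pabs_mult by simp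
          then show ?thesis using ab b0 by blast
        next
          case 3
          have "pabs (\<theta>' - \<theta>) = 1" using th(3) pabs_minus[of "\<theta> - \<theta>'"] by simp
          then have p1: "pabs (\<theta>' - e) = 1" using pabs_add_eq[of "\<theta> - e" "\<theta>' - \<theta>"] 3 by simp
          define N where "N = b * (e * e - of_int s * e + of_int n)"
          have "(\<theta> - e) * (\<theta>' - e) = \<theta> * \<theta>' - (\<theta> + \<theta>') * e + e * e" by (simp add: algebra_simps)
          also have "\<dots> = e * e - of_int s * e + of_int n" by (simp only: th(1,2)) simp
          finally have "y * (\<theta>' - e) = N" unfolding ye N_def by (simp only: mult.assoc)
          then have "pabs y = pabs N" using p1 pabs_mult[of y "\<theta>' - e"] by simp
          moreover have "N \<in> E" using ab eE sn by (simp add: N_def subfieldD[OF sE])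
          moreover have "N \<noteq> 0" using \<open>pabs y = pabs N\<close> y(2) by auto
          ultimately show ?thesis by blast
        qed
      qed
    qed
    have "pabs ` (E' - {0}) = pabs ` (E - {0})"
    proof
      show "pabs ` (E' - {0}) \<subseteq> pabs ` (E - {0})" using val by fastforce
      show "pabs ` (E - {0}) \<subseteq> pabs ` (E' - {0})" using EE' by blast
    qed
    then have "E' \<subseteq> Qp_ur" using ur_I[OF fe] E(2) by simp
    then show thesis using that[OF sE' _ EE'[OF E(3)] span[OF sE' \<theta>E]] by blast
  qed
qed

lemma embF_ur: "emb S ` F \<subseteq> Qp_ur"
proof -
  have "0 \<in> (Qp_ur :: 'c set)" using ur_I[OF finite_ext_refl[OF Qp_subfield]] subfieldD(1)[OF Qp_subfield] by blast
  then obtain E :: "'c set" where "E \<subseteq> Qp_ur" "emb S ` F \<subseteq> E" by (rule ur_field)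
  then show ?thesis by blast
qed

section \<open>Fractional linear action on the p-adic upper half plane\<close>

definition GLF :: "(complex^2^2) set" where "GLF = {g. (\<forall>i j. g $ i $ j \<in> F) \<and> det g \<noteq> 0}"

lemma GLF_D: "g \<in> GLF \<Longrightarrow> g $ i $ j \<in> F" "g \<in> GLF \<Longrightarrow> det g \<noteq> 0"
  by (simp_all add: GLF_def)

lemma emb_det:
  assumes "g \<in> GLF"
  shows "emb S (det g) = emb S (g $ 1 $ 1) * emb S (g $ 2 $ 2) - emb S (g $ 1 $ 2) * emb S (g $ 2 $ 1)" "emb S (det g) \<noteq> 0"
proof -
  show "emb S (det g) = emb S (g $ 1 $ 1) * emb S (g $ 2 $ 2) - emb S (g $ 1 $ 2) * emb S (g $ 2 $ 1)"
    using GLF_D(1)[OF assms] by (simp add: det_2 emb_diff emb_mult subfieldD[OF F_subfield])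
  have "det g \<in> F" using GLF_D(1)[OF assms] by (simp add: det_2 subfieldD[OF F_subfield])
  then show "emb S (det g) \<noteq> 0" using GLF_D(2)[OF assms] by (simp add: emb_eq_0)
qed

text \<open>Only points of \<open>Fp S\<close> can have a vanishing denominator or an image in
  \<open>Fp S\<close>, because the inverse substitution has coefficients in that field. The image
  stays in \<open>Qp_ur\<close> because \<open>ur_field\<close> provides a subfield of it containing
  \<open>x\<close> and the entries of \<open>g\<close>.\<close>

lemma Hp_moebius_Hur:
  assumes g: "g \<in> GLF" and x: "x \<in> Hur S"
  shows "Hp_moebius S g x \<in> Hur S" "emb S (g $ 2 $ 2) - emb S (g $ 2 $ 1) * x \<noteq> 0"
    "x = (emb S (g $ 2 $ 2) * Hp_moebius S g x + emb S (g $ 1 $ 2)) / (emb S (g $ 1 $ 1) + emb S (g $ 2 $ 1) * Hp_moebius S g x)"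
proof -
  define a b c d where "a = emb S (g $ 1 $ 1)" "b = emb S (g $ 1 $ 2)" "c = emb S (g $ 2 $ 1)" "d = emb S (g $ 2 $ 2)"
  note abcd = this
  have inF: "a \<in> emb S ` F" "b \<in> emb S ` F" "c \<in> emb S ` F" "d \<in> emb S ` F" using GLF_D(1)[OF g] by (auto simp: abcd)
  have Fp: "emb S ` F \<subseteq> Fp S" unfolding Fp_def by (rule closure_subset)
  have det: "a * d - b * c \<noteq> 0" using emb_det[OF g] by (simp add: abcd)
  have xur: "x \<in> Qp_ur" "x \<notin> Fp S" using x by (auto simp: Hur_def)
  have den: "d - c * x \<noteq> 0"
  proof
    assume z: "d - c * x = 0"
    show False
    proof (cases "c = 0")
      case True then show False using z det by simp
    next
      case False
      then have "x = d / c" using z by (simp add: field_simps)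
      moreover have "d / c \<in> Fp S" using inF(3,4) Fp by (intro subfieldD(8)[OF Fp_subfield]) blast+
      ultimately show False using xur(2) by simp
    qed
  qed
  define y where "y = Hp_moebius S g x"
  have y: "y = (a * x - b) / (d - c * x)" by (simp add: y_def Hp_moebius_def abcd)
  then have y1: "y * (d - c * x) = a * x - b" using den by simp
  then have x1: "x * (a + c * y) = d * y + b" by (simp add: algebra_simps)
  have den': "a + c * y \<noteq> 0"
  proof
    assume z: "a + c * y = 0"
    then have "d * y + b = 0" using x1 by simp
    then have "a = - (c * y)" "b = - (d * y)" using z by (simp_all add: eq_neg_iff_add_eq_0 add.commute)
    then show False using det by (simp add: algebra_simps)
  qed
  have x2: "x = (d * y + b) / (a + c * y)" using x1 den' by (simp add: field_simps)
  show "emb S (g $ 2 $ 2) - emb S (g $ 2 $ 1) * x \<noteq> 0" using den by (simp add: abcd)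
  show "x = (emb S (g $ 2 $ 2) * Hp_moebius S g x + emb S (g $ 1 $ 2)) / (emb S (g $ 1 $ 1) + emb S (g $ 2 $ 1) * Hp_moebius S g x)"
    using x2 by (simp add: abcd y_def)
  obtain E where E: "is_subfield E" "E \<subseteq> Qp_ur" "x \<in> E" "emb S ` F \<subseteq> E" by (rule ur_field[OF xur(1)])
  have "y \<in> E" unfolding y using E(3,4) inF by (intro subfieldD[OF E(1)]) blast+
  moreover have "y \<notin> Fp S"
  proof
    assume "y \<in> Fp S"
    then have "x \<in> Fp S" using inF Fp by (subst x2, intro subfieldD[OF Fp_subfield]) blast+
    then show False using xur(2) by simp
  qed
  ultimately show "Hp_moebius S g x \<in> Hur S" using E(2) by (auto simp: Hur_def y_def)
qed

end

section \<open>Divisors and tori\<close>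

lemma lookup_frag_extend_inj:
  assumes "inj_on \<phi> A" "Poly_Mapping.keys E \<subseteq> A" "x \<in> A"
  shows "Poly_Mapping.lookup (frag_extend (\<lambda>x. frag_of (\<phi> x)) E) (\<phi> x) = Poly_Mapping.lookup E x"
proof -
  have "Poly_Mapping.lookup (frag_extend (\<lambda>x. frag_of (\<phi> x)) E) (\<phi> x) =
      (\<Sum>i\<in>Poly_Mapping.keys E. Poly_Mapping.lookup E i * (if \<phi> x = \<phi> i then 1 else 0))"
    by (simp add: frag_extend_def Poly_Mapping.lookup_sum)
  also have "\<dots> = (\<Sum>i\<in>Poly_Mapping.keys E. if i = x then Poly_Mapping.lookup E i else 0)"
    using assms by (intro sum.cong) (auto dest: inj_onD)
  also have "\<dots> = Poly_Mapping.lookup E x" by (simp add: sum.delta in_keys_iff)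
  finally show ?thesis .
qed

lemma keys_frag_act: "Poly_Mapping.keys (frag_extend (\<lambda>x. frag_of (\<phi> x)) E) \<subseteq> \<phi> ` Poly_Mapping.keys E"
  using keys_frag_extend[of "\<lambda>x. frag_of (\<phi> x)" E] by (auto simp: keys_frag_of split: if_splits)

lemma frag_deg_superset:
  assumes "finite A" "Poly_Mapping.keys D \<subseteq> A" shows "frag_deg D = (\<Sum>x\<in>A. Poly_Mapping.lookup D x)"
  unfolding frag_deg_def using assms by (intro sum.mono_neutral_left) (auto simp: in_keys_iff)

lemma frag_deg_of [simp]: "frag_deg (frag_of x) = 1" by (simp add: frag_deg_def)
lemma frag_deg_0 [simp]: "frag_deg 0 = 0" by (simp add: frag_deg_def)

lemma frag_deg_diff: "frag_deg (D - E) = frag_deg D - frag_deg E"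
proof -
  let ?A = "Poly_Mapping.keys D \<union> Poly_Mapping.keys E"
  have "frag_deg (D - E) = (\<Sum>x\<in>?A. Poly_Mapping.lookup (D - E) x)"
    by (rule frag_deg_superset) (use keys_diff[of D E] in auto)
  also have "\<dots> = (\<Sum>x\<in>?A. Poly_Mapping.lookup D x) - (\<Sum>x\<in>?A. Poly_Mapping.lookup E x)"
    by (simp add: lookup_minus sum_subtractf)
  also have "\<dots> = frag_deg D - frag_deg E"
    using frag_deg_superset[of ?A D] frag_deg_superset[of ?A E] by simp
  finally show ?thesis .
qed

lemma frag_deg_minus: "frag_deg (- D) = - frag_deg D"
  using frag_deg_diff[of 0 D] by simp

lemma frag_deg_add: "frag_deg (D + E) = frag_deg D + frag_deg E"
  using frag_deg_diff[of D "- E"] by (simp add: frag_deg_minus)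

lemma frag_deg_act: "frag_deg (frag_extend (\<lambda>x. frag_of (\<phi> x)) E) = frag_deg E"
  by (rule frag_induction[of E UNIV]) (simp_all add: frag_extend_diff frag_deg_diff)

lemma ring_onI:
  assumes "0 \<in> A" "1 \<in> A" "\<And>x y. x \<in> A \<Longrightarrow> y \<in> A \<Longrightarrow> x - y \<in> A" "\<And>x y. x \<in> A \<Longrightarrow> y \<in> A \<Longrightarrow> x * y \<in> A"
  shows "ring (ring_on A)"
proof (rule ringI)
  have neg: "- x \<in> A" if "x \<in> A" for x using assms(3)[OF assms(1) that] by simp
  have add: "x + y \<in> A" if "x \<in> A" "y \<in> A" for x y using assms(3)[OF that(1) neg[OF that(2)]] by simp
  show "abelian_group (ring_on A)"
    by (rule abelian_groupI) (use assms add neg in \<open>auto simp: add_ac intro: bexI[of _ "- _"]\<close>)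
  show "monoid (ring_on A)" by (rule monoidI) (use assms in \<open>auto simp: mult_ac\<close>)
qed (auto simp: algebra_simps)

section \<open>Tori in two by two matrices, integrality over a quadratic field\<close>

primrec mpow :: "complex^2^2 \<Rightarrow> nat \<Rightarrow> complex^2^2" where
  "mpow g 0 = mat 1"
| "mpow g (Suc n) = g ** mpow g n"

definition torus :: "complex^2^2 \<Rightarrow> complex \<Rightarrow> complex \<Rightarrow> complex^2^2" where
  "torus X \<alpha> \<beta> = mat2 (\<alpha> + \<beta> * X $ 1 $ 1) (\<beta> * X $ 1 $ 2) (\<beta> * X $ 2 $ 1) (\<alpha> + \<beta> * X $ 2 $ 2)"

lemma torus_commute: "torus X \<alpha> \<beta> ** X = X ** torus X \<alpha> \<beta>"
  by (simp add: mat2_eq_iff mat2_mult_sel torus_def algebra_simps)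

text \<open>An element of the normaliser of the torus of \<open>X\<close> inducing the inversion, found by solving
  \<open>w X + X w = 0\<close> in trace zero matrices.\<close>
lemma torus_reflection:
  fixes X :: "complex^2^2"
  assumes X: "X $ 2 $ 2 = - X $ 1 $ 1"
  shows "\<exists>w\<in>SL2C. w ** X = - (X ** w) \<and> (\<forall>\<alpha> \<beta>. w ** torus X \<alpha> \<beta> = adj2 (torus X \<alpha> \<beta>) ** w)"
proof -
  define a b c where abc: "a = X $ 1 $ 1" "b = X $ 1 $ 2" "c = X $ 2 $ 1"
  \<comment> \<open>The condition on \<open>P\<close>, \<open>Q\<close>, \<open>R\<close> is linear
    and leaves at least a plane, on which the determinant does not vanish identically;
    \<open>l\<close> below scales the determinant to 1.\<close>
  have "\<exists>P Q R. 2 * P * a + Q * c + R * b = 0 \<and> - (P * P) - Q * R \<noteq> 0"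
  proof -
    consider "c \<noteq> 0" | "c = 0" "b \<noteq> 0" | "c = 0" "b = 0" by blast
    then show ?thesis
    proof cases
      case 1 then show ?thesis by (intro exI[of _ c] exI[of _ "- 2 * a"] exI[of _ 0]) simp
    next
      case 2 then show ?thesis by (intro exI[of _ b] exI[of _ 0] exI[of _ "- 2 * a"]) simp
    next
      case 3 then show ?thesis by (intro exI[of _ 0] exI[of _ 1] exI[of _ "- 1"]) simp
    qed
  qed
  then obtain P Q R where PQR: "2 * P * a + Q * c + R * b = 0" "- (P * P) - Q * R \<noteq> 0" by blast
  define l where "l = csqrt (inverse (- (P * P) - Q * R))"
  have l: "l * l * (- (P * P) - Q * R) = 1"
    using PQR(2) by (simp add: l_def power2_csqrt[unfolded power2_eq_square])
  define w where "w = mat2 (l * P) (l * Q) (l * R) (- l * P)"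
  have "det w = l * l * (- (P * P) - Q * R)" by (simp add: w_def det_2 algebra_simps)
  then have "w \<in> SL2C" using l by (simp add: SL2C_def)
  have wX: "w ** X = - (X ** w)"
  proof -
    have "(w ** X) $ 1 $ 1 + (X ** w) $ 1 $ 1 = l * (2 * P * a + Q * c + R * b)"
      "(w ** X) $ 2 $ 2 + (X ** w) $ 2 $ 2 = l * (2 * P * a + Q * c + R * b)"
      "(w ** X) $ 1 $ 2 + (X ** w) $ 1 $ 2 = 0" "(w ** X) $ 2 $ 1 + (X ** w) $ 2 $ 1 = 0"
      by (simp_all add: mat2_mult_sel w_def X abc[symmetric] algebra_simps)
    then show ?thesis unfolding PQR(1) by (simp add: mat2_eq_iff eq_neg_iff_add_eq_0)
  qed
  have "w ** torus X \<alpha> \<beta> = adj2 (torus X \<alpha> \<beta>) ** w" for \<alpha> \<beta>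
  proof -
    have "(w ** torus X \<alpha> \<beta>) $ i $ j = \<alpha> * w $ i $ j + \<beta> * (w ** X) $ i $ j" for i j
      using exhaust_2[of i] exhaust_2[of j] by (auto simp: mat2_mult_sel torus_def algebra_simps)
    moreover have "(adj2 (torus X \<alpha> \<beta>) ** w) $ i $ j = \<alpha> * w $ i $ j - \<beta> * (X ** w) $ i $ j" for i j
      using exhaust_2[of i] exhaust_2[of j] by (auto simp: mat2_mult_sel torus_def X algebra_simps)
    ultimately show ?thesis unfolding wX by (simp add: vec_eq_iff)
  qed
  then show ?thesis using \<open>w \<in> SL2C\<close> wX by blast
qed

text \<open>If \<open>y\<close> is a root of \<open>y\<^sup>2 - T y + P\<close> then it is a root of the product of this polynomial and its
  conjugate.\<close>
lemma algebraic_int_quadratic_over: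
  fixes y :: complex
  assumes "y ^ 2 = T * y - P" and ints: "T + cnj T \<in> \<int>" "P + cnj P + T * cnj T \<in> \<int>" "T * cnj P + cnj T * P \<in> \<int>" "P * cnj P \<in> \<int>"
  shows "algebraic_int y"
proof -
  have gen: "coeff [:a0, - a1, a2, - a3, 1:] i \<in> \<int>" if "a0 \<in> \<int>" "a1 \<in> \<int>" "a2 \<in> \<int>" "a3 \<in> \<int>" for a0 a1 a2 a3 :: complex and i
    using that by (auto simp: coeff_pCons split: nat.splits)
  show ?thesis unfolding algebraic_int.simps
  proof (intro exI[of _ "[:P * cnj P, - (T * cnj P + cnj T * P), P + cnj P + T * cnj T, - (T + cnj T), 1:]"] exI[of _ y] conjI allI refl)
    show "coeff [:P * cnj P, - (T * cnj P + cnj T * P), P + cnj P + T * cnj T, - (T + cnj T), 1:] i \<in> \<int>" for i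
      using gen[OF ints(4,3,2,1)] .
    have 0: "y * y - T * y + P = 0" using assms(1) by (simp add: power2_eq_square)
    have "poly [:P * cnj P, - (T * cnj P + cnj T * P), P + cnj P + T * cnj T, - (T + cnj T), 1:] y =
        (y * y - T * y + P) * (y * y - cnj T * y + cnj P)" by (simp add: algebra_simps)
    then show "poly [:P * cnj P, - (T * cnj P + cnj T * P), P + cnj P + T * cnj T, - (T + cnj T), 1:] y = 0"
      by (simp only: 0 mult_zero_left)
  qed simp
qed

text \<open>Values at conjugate points are conjugate. The coordinates \<open>A\<close> and
  \<open>B\<close> are carried through the induction, which avoids constructing the
  automorphism.\<close>

lemma poly_conjugate_root:
  fixes z :: complex
  assumes E: "is_subfield E" and d: "\<delta> * \<delta> \<in> E" "a \<in> E" "b \<in> E" "\<And>i. coeff f i \<in> E"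
  shows "\<exists>A\<in>E. \<exists>B\<in>E. poly f (a + b * \<delta>) = A + B * \<delta> \<and> poly f (a - b * \<delta>) = A - B * \<delta>"
  using d(4)
proof (induction f)
  case 0
  show ?case using subfieldD(1)[OF E] by (intro bexI[of _ 0]) auto
next
  case (pCons c f)
  have c: "c \<in> E" using pCons.prems[of 0] by simp
  have "coeff f i \<in> E" for i using pCons.prems[of "Suc i"] by simp
  then obtain A B where AB: "A \<in> E" "B \<in> E" "poly f (a + b * \<delta>) = A + B * \<delta>" "poly f (a - b * \<delta>) = A - B * \<delta>"
    using pCons.IH by blast
  have 1: "poly (pCons c f) (a + b * \<delta>) = (c + a * A + b * B * (\<delta> * \<delta>)) + (a * B + b * A) * \<delta>"
    unfolding poly_pCons AB(3,4) by (simp add: algebra_simps)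
  have 2: "poly (pCons c f) (a - b * \<delta>) = (c + a * A + b * B * (\<delta> * \<delta>)) - (a * B + b * A) * \<delta>"
    unfolding poly_pCons AB(3,4) by (simp add: algebra_simps)
  have "c + a * A + b * B * (\<delta> * \<delta>) \<in> E" "a * B + b * A \<in> E" using c AB d(1-3) by (simp_all add: subfieldD[OF E])
  then show ?case using 1 2 by blast
qed

context sh_setting
begin

section \<open>Galois stable divisors and divisors of cusps\<close>

lemma DivH_D:
  assumes "E \<in> DivH S"
  shows "Poly_Mapping.keys E \<subseteq> Hur S"
    "field_embedding (coef S \<inter> Qp_ur) Qp_ur s \<Longrightarrow> bij_betw s Qp_ur Qp_ur \<Longrightarrow> x \<in> Hur S \<Longrightarrow>
      Poly_Mapping.lookup E (s x) = Poly_Mapping.lookup E x"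
  using assms by (auto simp: DivH_def)

lemma K_subfield: "is_subfield K" and F_K: "F \<subseteq> K"
  using quad_K by (auto simp: quadratic_ext_def)

lemma embK_L: "emb S ` K \<subseteq> coef S"
  using K_L closure_subset unfolding Kp_def by blast

lemma embF_L: "emb S ` F \<subseteq> coef S" using embK_L F_K by blast

lemma adj2_GLF: "g \<in> GLF \<Longrightarrow> adj2 g \<in> GLF"
  unfolding GLF_def by (auto simp: forall_2 subfieldD[OF F_subfield])

lemma Hp_moebius_adj2:
  assumes g: "g \<in> GLF" and y: "y \<in> Hur S"
  shows "Hp_moebius S (adj2 g) y \<in> Hur S" "Hp_moebius S g (Hp_moebius S (adj2 g) y) = y"
proof -
  show "Hp_moebius S (adj2 g) y \<in> Hur S" by (rule Hp_moebius_Hur(1)[OF adj2_GLF[OF g] y])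
  show "Hp_moebius S g (Hp_moebius S (adj2 g) y) = y"
    using Hp_moebius_Hur(3)[OF adj2_GLF[OF g] y] GLF_D(1)[OF g] by (simp add: Hp_moebius_def emb_minus)
qed

lemma Hp_moebius_inj:
  assumes g: "g \<in> GLF" shows "inj_on (Hp_moebius S g) (Hur S)"
proof (rule inj_onI)
  fix x y assume x: "x \<in> Hur S" and y: "y \<in> Hur S" and eq: "Hp_moebius S g x = Hp_moebius S g y"
  note Hp_moebius_Hur(3)[OF g x]
  also have "(emb S (g $ 2 $ 2) * Hp_moebius S g x + emb S (g $ 1 $ 2)) / (emb S (g $ 1 $ 1) + emb S (g $ 2 $ 1) * Hp_moebius S g x) = y"
    unfolding eq by (rule Hp_moebius_Hur(3)[OF g y, symmetric])
  finally show "x = y" .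
qed

text \<open>The automorphism fixes the entries of \<open>g\<close>, which lie in
  \<open>coef S\<close> and in \<open>Qp_ur\<close>. Denominators are cleared since
  \<open>s x\<close> is not yet known to avoid \<open>Fp S\<close>.\<close>

lemma galois_moebius:
  assumes g: "g \<in> GLF" and x: "x \<in> Hur S" and s: "field_embedding (coef S \<inter> Qp_ur) Qp_ur s"
  shows "s (Hp_moebius S g x) * (emb S (g $ 2 $ 2) - emb S (g $ 2 $ 1) * s x) = emb S (g $ 1 $ 1) * s x - emb S (g $ 1 $ 2)"
proof -
  define a b c d where "a = emb S (g $ 1 $ 1)" "b = emb S (g $ 1 $ 2)" "c = emb S (g $ 2 $ 1)" "d = emb S (g $ 2 $ 2)"
  note abcd = this
  define y where "y = Hp_moebius S g x"
  have sF: "s z = z" if "z \<in> emb S ` F" for z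
    using s that embF_ur embF_L unfolding field_embedding_def by blast
  have inF: "a \<in> emb S ` F" "b \<in> emb S ` F" "c \<in> emb S ` F" "d \<in> emb S ` F" using GLF_D(1)[OF g] by (auto simp: abcd)
  have "x \<in> Qp_ur" using x by (simp add: Hur_def)
  then obtain E where E: "is_subfield E" "E \<subseteq> Qp_ur" "x \<in> E" "emb S ` F \<subseteq> E" by (rule ur_field)
  have abE: "a \<in> E" "b \<in> E" "c \<in> E" "d \<in> E" using inF E(4) by blast+
  have yd: "y = (a * x - b) / (d - c * x)" by (simp add: y_def Hp_moebius_def abcd)
  have yE: "y \<in> E" unfolding yd using abE E(3) by (intro subfieldD[OF E(1)])
  have "y * (d - c * x) = a * x - b" using yd Hp_moebius_Hur(2)[OF g x] by (simp add: abcd)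
  then have eq: "y * d + b = (a + y * c) * x" by (simp add: algebra_simps)
  have sadd: "s (u + v) = s u + s v" "s (u * v) = s u * s v" if "u \<in> E" "v \<in> E" for u v
    using s that E(2) unfolding field_embedding_def by blast+
  have "s (y * d + b) = s y * d + b" using sadd sF inF yE abE by (simp add: subfieldD[OF E(1)])
  moreover have "s ((a + y * c) * x) = (a + s y * c) * s x" using sadd sF inF yE abE E(3) by (simp add: subfieldD[OF E(1)])
  ultimately have "s y * d + b = (a + s y * c) * s x" using eq by simp
  then show ?thesis unfolding abcd[symmetric] y_def[symmetric] by (simp add: algebra_simps)
qed

text \<open>Where \<open>s x\<close> is in \<open>Hur S\<close>, the automorphism commutes with
  \<open>g\<close>. Otherwise \<open>s x\<close> and \<open>s y\<close> both lie in
  \<open>Fp S\<close>, outside the supports, and the multiplicity of \<open>E\<close> at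
  \<open>x\<close> is the one at \<open>s x\<close>, namely 0.\<close>

lemma Hp_act_DivH:
  assumes g: "g \<in> GLF" and E: "E \<in> DivH S" shows "Hp_act S g E \<in> DivH S"
proof -
  define D where "D = Hp_act S g E"
  note Ek = DivH_D(1)[OF E]
  have Dl: "Poly_Mapping.lookup D (Hp_moebius S g x) = Poly_Mapping.lookup E x" if "x \<in> Hur S" for x
    unfolding D_def Hp_act_def by (rule lookup_frag_extend_inj[OF Hp_moebius_inj[OF g] Ek that])
  have Dk: "Poly_Mapping.keys D \<subseteq> Hur S"
    unfolding D_def Hp_act_def using keys_frag_act[of "Hp_moebius S g" E] Ek Hp_moebius_Hur(1)[OF g] by blast
  have "Poly_Mapping.lookup D (s y) = Poly_Mapping.lookup D y"
    if s: "field_embedding (coef S \<inter> Qp_ur) Qp_ur s" "bij_betw s Qp_ur Qp_ur" and y: "y \<in> Hur S" for s y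
  proof -
    define x where "x = Hp_moebius S (adj2 g) y"
    have x: "x \<in> Hur S" "y = Hp_moebius S g x" using Hp_moebius_adj2[OF g y] by (simp_all add: x_def)
    have gal: "s y * (emb S (g $ 2 $ 2) - emb S (g $ 2 $ 1) * s x) = emb S (g $ 1 $ 1) * s x - emb S (g $ 1 $ 2)"
      unfolding x(2) by (rule galois_moebius[OF g x(1) s(1)])
    have le: "Poly_Mapping.lookup E (s x) = Poly_Mapping.lookup E x" by (rule DivH_D(2)[OF E s x(1)])
    have sur: "s x \<in> Qp_ur" using s(2) x(1) by (auto simp: Hur_def bij_betw_def)
    show ?thesis
    proof (cases "s x \<in> Hur S")
      case True
      have "s y = Hp_moebius S g (s x)"
        using gal Hp_moebius_Hur(2)[OF g True] by (simp add: Hp_moebius_def eq_divide_eq)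
      then show ?thesis using Dl[OF True] Dl[OF x(1)] le x(2) by simp
    next
      case False
      then have F: "s x \<in> Fp S" using sur by (simp add: Hur_def)
      have "Poly_Mapping.lookup E (s x) = 0" using False Ek by (metis in_keys_iff subsetD)
      then have 0: "Poly_Mapping.lookup D y = 0" using le Dl[OF x(1)] x(2) by simp
      have den: "emb S (g $ 2 $ 2) - emb S (g $ 2 $ 1) * s x \<noteq> 0"
      proof
        assume z: "emb S (g $ 2 $ 2) - emb S (g $ 2 $ 1) * s x = 0"
        then have "emb S (g $ 1 $ 1) * s x - emb S (g $ 1 $ 2) = 0" using gal by simp
        then have "emb S (g $ 2 $ 2) = emb S (g $ 2 $ 1) * s x" "emb S (g $ 1 $ 2) = emb S (g $ 1 $ 1) * s x" using z by simp_all
        then have "emb S (det g) = 0" using emb_det(1)[OF g] by (simp add: algebra_simps)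
        then show False using emb_det(2)[OF g] by simp
      qed
      have "s y = (emb S (g $ 1 $ 1) * s x - emb S (g $ 1 $ 2)) / (emb S (g $ 2 $ 2) - emb S (g $ 2 $ 1) * s x)"
        using gal den by (simp add: eq_divide_eq)
      moreover have "emb S (g $ i $ j) \<in> Fp S" for i j
        unfolding Fp_def using GLF_D(1)[OF g] closure_subset[of "emb S ` F"] by blast
      ultimately have "s y \<in> Fp S" using F by (simp add: subfieldD[OF Fp_subfield])
      then have "s y \<notin> Poly_Mapping.keys D" using Dk by (auto simp: Hur_def)
      then show ?thesis using 0 by (simp add: in_keys_iff)
    qed
  qed
  then show ?thesis using Dk unfolding DivH_def D_def by simp
qed

lemma Hp_act_Div0H: "g \<in> GLF \<Longrightarrow> E \<in> Div0H S \<Longrightarrow> Hp_act S g E \<in> Div0H S"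
  using Hp_act_DivH frag_deg_act[of "Hp_moebius S g"] by (simp add: Div0H_def Hp_act_def)

lemma DivH_diff:
  assumes D: "D \<in> DivH S" and E: "E \<in> DivH S" shows "D - E \<in> DivH S"
proof -
  have "Poly_Mapping.keys (D - E) \<subseteq> Hur S" using keys_diff[of D E] DivH_D(1)[OF D] DivH_D(1)[OF E] by blast
  then show ?thesis using DivH_D(2)[OF D] DivH_D(2)[OF E] by (simp add: DivH_def lookup_minus)
qed

lemma DivH_0: "0 \<in> DivH S" by (simp add: DivH_def)

lemma DivH_add: "D \<in> DivH S \<Longrightarrow> E \<in> DivH S \<Longrightarrow> D + E \<in> DivH S"
  using DivH_diff[OF _ DivH_diff[OF DivH_0], of D E] by simp

lemma Div0H_add: "D \<in> Div0H S \<Longrightarrow> E \<in> Div0H S \<Longrightarrow> D + E \<in> Div0H S"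
  by (simp add: Div0H_def DivH_add frag_deg_add)

text \<open>The automorphisms in question fix \<tau>, because \<open>coef S\<close> contains the
  image of \<open>K\<close>, and they are injective.\<close>

lemma frag_of_DivH:
  assumes \<tau>: "\<tau> \<in> Hur S" "\<tau> \<in> emb S ` K" shows "frag_of \<tau> \<in> DivH S"
proof -
  have "Poly_Mapping.lookup (frag_of \<tau>) (s x) = Poly_Mapping.lookup (frag_of \<tau>) x"
    if s: "field_embedding (coef S \<inter> Qp_ur) Qp_ur s" "bij_betw s Qp_ur Qp_ur" and x: "x \<in> Hur S" for s x
  proof -
    have "\<tau> \<in> coef S \<inter> Qp_ur" using \<tau> embK_L by (auto simp: Hur_def)
    then have "s \<tau> = \<tau>" using s(1) unfolding field_embedding_def by blast
    moreover have "inj_on s Qp_ur" using s(2) by (simp add: bij_betw_def)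
    ultimately have "s x = \<tau> \<longleftrightarrow> x = \<tau>" using x \<tau>(1) unfolding Hur_def inj_on_def by (metis DiffD1)
    then show ?thesis by simp
  qed
  then show ?thesis using \<tau>(1) by (simp add: DivH_def keys_frag_of)
qed

lemma frag_diff_Delta0: "c \<in> P1 F \<Longrightarrow> c' \<in> P1 F \<Longrightarrow> frag_of c' - frag_of c \<in> Delta0 S"
  using keys_diff[of "frag_of c'" "frag_of c"] by (fastforce simp: Delta0_def frag_deg_diff keys_frag_of)

lemma moebius_P1: "g \<in> GLF \<Longrightarrow> c \<in> P1 F \<Longrightarrow> moebius g c \<in> P1 F"
  by (auto simp: P1_def moebius_def Let_def GLF_D subfieldD[OF F_subfield] split: option.splits)

lemma cusp_act_Delta0:
  assumes g: "g \<in> GLF" and D: "D \<in> Delta0 S" shows "cusp_act g D \<in> Delta0 S"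
proof -
  have "Poly_Mapping.keys (cusp_act g D) \<subseteq> P1 F"
    using keys_frag_act[of "moebius g" D] D moebius_P1[OF g] unfolding cusp_act_def Delta0_def by auto
  then show ?thesis using D frag_deg_act[of "moebius g" D] by (simp add: Delta0_def cusp_act_def)
qed

lemma Delta0_add: "D \<in> Delta0 S \<Longrightarrow> E \<in> Delta0 S \<Longrightarrow> D + E \<in> Delta0 S"
  using Poly_Mapping.keys_add[of D E] by (fastforce simp: Delta0_def frag_deg_add)


section \<open>The p-arithmetic group\<close>

lemma pi_F: "\<pi> \<in> F" by (rule OF_F[OF pi_OF])

lemma OF_pow: "x \<in> OF S \<Longrightarrow> x ^ n \<in> OF S"
  by (induction n) (auto intro: OF_closed)

text \<open>Any generator \<open>w\<close> of \<open>pp S\<close> divides \<pi>, so a power of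
  \<open>w\<close> that clears denominators may be replaced by one of the fixed generator.\<close>

lemma OFp_iff: "x \<in> OFp S \<longleftrightarrow> x \<in> F \<and> (\<exists>n. \<pi> ^ n * x \<in> OF S)"
proof
  assume "x \<in> OFp S"
  then obtain w n where x: "x \<in> F" and w: "pp S = cgenideal (ring_on (OF S)) w" "w ^ n * x \<in> OF S"
    unfolding OFp_def away_def OF_def by blast
  have pw: "(*) \<pi> ` OF S = (*) w ` OF S" using w(1) pi(3) by (simp add: cgenideal_ring_on)
  have "\<pi> * 1 \<in> (*) \<pi> ` OF S" using OF_closed(2) by blast
  then obtain v where v: "v \<in> OF S" "\<pi> = w * v" unfolding pw by auto
  have "v ^ n \<in> OF S" by (rule OF_pow[OF v(1)])
  then have "v ^ n * (w ^ n * x) \<in> OF S" using w(2) by (rule OF_closed(4))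
  also have "v ^ n * (w ^ n * x) = \<pi> ^ n * x" unfolding v(2) by (simp add: power_mult_distrib mult_ac)
  finally show "x \<in> F \<and> (\<exists>n. \<pi> ^ n * x \<in> OF S)" using x by blast
next
  assume "x \<in> F \<and> (\<exists>n. \<pi> ^ n * x \<in> OF S)"
  moreover have "pp S = cgenideal (ring_on (OF S)) \<pi>" by (simp add: cgenideal_ring_on pi(3))
  ultimately show "x \<in> OFp S" unfolding OFp_def away_def OF_def by blast
qed

lemma pi_pow_mono:
  assumes "\<pi> ^ n * x \<in> A" "n \<le> N" "\<And>y a. y \<in> A \<Longrightarrow> a \<in> OF S \<Longrightarrow> a * y \<in> A" shows "\<pi> ^ N * x \<in> A"
proof -
  have "\<pi> ^ (N - n) * (\<pi> ^ n * x) \<in> A" by (rule assms(3)[OF assms(1) OF_pow[OF pi_OF]])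
  also have "\<pi> ^ (N - n) * (\<pi> ^ n * x) = \<pi> ^ N * x"
    using assms(2) by (simp add: mult.assoc[symmetric] power_add[symmetric])
  finally show ?thesis .
qed

lemma OF_OFp: "x \<in> OF S \<Longrightarrow> x \<in> OFp S"
  unfolding OFp_iff by (auto intro: OF_F exI[of _ 0])

lemma OFp_ring_closed:
  assumes "x \<in> OFp S" "y \<in> OFp S" shows "x - y \<in> OFp S" "x * y \<in> OFp S"
proof -
  obtain m n where mn: "\<pi> ^ m * x \<in> OF S" "\<pi> ^ n * y \<in> OF S" "x \<in> F" "y \<in> F" using assms unfolding OFp_iff by blast
  have "\<pi> ^ (m + n) * x \<in> OF S" "\<pi> ^ (m + n) * y \<in> OF S"
    using pi_pow_mono[OF mn(1), of "m + n"] pi_pow_mono[OF mn(2), of "m + n"] OF_closed(4) by auto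
  from OF_closed(6)[OF this] have "\<pi> ^ (m + n) * (x - y) \<in> OF S" by (simp add: right_diff_distrib)
  then show "x - y \<in> OFp S" unfolding OFp_iff using mn subfieldD(3)[OF F_subfield] by blast
  have "\<pi> ^ (m + n) * (x * y) \<in> OF S" using OF_closed(4)[OF mn(1,2)] by (simp add: power_add mult_ac)
  then show "x * y \<in> OFp S" unfolding OFp_iff using mn subfieldD(4)[OF F_subfield] by blast
qed

lemma OFp_ring: "ring (ring_on (OFp S))"
  by (rule ring_onI) (auto intro: OFp_ring_closed OF_OFp OF_closed)

lemma tame_genideal: "tame S \<subseteq> genideal (ring_on (OFp S)) (tame S)" "0 \<in> genideal (ring_on (OFp S)) (tame S)"
  unfolding genideal_def using ideal_ring_onD(3) by blast+

text \<open>The elements that some power of \<pi> multiplies into \<open>tame S\<close> form an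
  ideal of \<open>OFp S\<close> containing \<open>tame S\<close>.\<close>

lemma genideal_tame:
  assumes "x \<in> genideal (ring_on (OFp S)) (tame S)" shows "\<exists>n. \<pi> ^ n * x \<in> tame S"
proof -
  define J where "J = {x \<in> OFp S. \<exists>n. \<pi> ^ n * x \<in> tame S}"
  have "ideal J (ring_on (OFp S))"
  proof (rule ideal_ring_onI[OF OFp_ring])
    show "J \<subseteq> OFp S" by (auto simp: J_def)
    show "0 \<in> J" unfolding J_def using tame(2) OF_OFp[OF OF_closed(1)] by simp
    show "x + y \<in> J" if xy: "x \<in> J" "y \<in> J" for x y
    proof -
      obtain m n where mn: "\<pi> ^ m * x \<in> tame S" "\<pi> ^ n * y \<in> tame S" "x \<in> OFp S" "y \<in> OFp S"
        using xy unfolding J_def by blast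
      have "\<pi> ^ (m + n) * x \<in> tame S" "\<pi> ^ (m + n) * y \<in> tame S"
        using pi_pow_mono[OF mn(1), of "m + n"] pi_pow_mono[OF mn(2), of "m + n"] tame(4) by auto
      from tame(3)[OF this] have "\<pi> ^ (m + n) * (x + y) \<in> tame S" by (simp add: distrib_left)
      then show ?thesis unfolding J_def using mn ring_on_closed(3)[OF OFp_ring] by blast
    qed
    show "a * x \<in> J" if xa: "x \<in> J" "a \<in> OFp S" for x a
    proof -
      obtain m n where mn: "\<pi> ^ m * x \<in> tame S" "\<pi> ^ n * a \<in> OF S" "x \<in> OFp S"
        using xa unfolding J_def OFp_iff by blast
      have "(\<pi> ^ n * a) * (\<pi> ^ m * x) \<in> tame S" by (rule tame(4)[OF mn(1,2)])
      then have "\<pi> ^ (n + m) * (a * x) \<in> tame S" by (simp add: power_add mult_ac)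
      then show ?thesis unfolding J_def using mn(3) xa(2) OFp_ring_closed(2) by blast
    qed
  qed
  moreover have "tame S \<subseteq> J"
  proof
    fix x assume x: "x \<in> tame S"
    then have "x \<in> OFp S" using OF_OFp tame(1) by blast
    moreover have "\<pi> ^ 0 * x \<in> tame S" using x by simp
    ultimately show "x \<in> J" unfolding J_def by blast
  qed
  ultimately have "x \<in> J" using assms unfolding genideal_def by blast
  then show ?thesis by (simp add: J_def)
qed

lemma R1_D:
  assumes "g \<in> R1 S"
  shows "g $ i $ j \<in> OFp S" "det g = 1" "g $ 2 $ 1 \<in> genideal (ring_on (OFp S)) (tame S)" "g \<in> GLF"
proof -
  show 1: "g $ i $ j \<in> OFp S" for i j using assms by (simp add: R1_def RR_def)
  show "det g = 1" "g $ 2 $ 1 \<in> genideal (ring_on (OFp S)) (tame S)" using assms by (simp_all add: R1_def RR_def)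
  then show "g \<in> GLF" using 1 by (simp add: GLF_def OFp_iff)
qed

lemma GamL_R1: "g \<in> BL.GamL (tame S) \<Longrightarrow> g \<in> R1 S"
  using tame_genideal(1) OF_OFp by (auto simp: BL.GamL_def R1_def RR_def)

text \<open>These elements are integral only away from \<pi>. They belong to the p-arithmetic group,
  which is what turns the steps of the walk into symmetries of the symbol.\<close>

lemma hk_R1:
  assumes "q \<in> BL.hk \<times> BL.hk" shows "BL.rho q \<in> R1 S"
proof -
  obtain r s where q: "q = (r, s)" "r \<in> BL.hk" "s \<in> BL.hk" using assms by auto
  have e: "BL.rho q $ i $ j = inverse \<pi> * (r $ i $ 1 * s $ 1 $ j + r $ i $ 2 * s $ 2 $ j)" for i j
    using exhaust_2[of i] by (auto simp: BL.rho_def q(1) mat2_mult_sel mat_sel algebra_simps)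
  have "BL.rho q $ i $ j \<in> OFp S" for i j
    unfolding OFp_iff
  proof (intro conjI exI[of _ 1])
    have "r $ i $ 1 * s $ 1 $ j + r $ i $ 2 * s $ 2 $ j \<in> OF S"
      by (intro OF_closed(3,4) BL.hk_R[OF q(2)] BL.hk_R[OF q(3)])
    then show "BL.rho q $ i $ j \<in> F" "\<pi> ^ 1 * BL.rho q $ i $ j \<in> OF S"
      unfolding e using pi_F pi(2) OF_F by (simp_all add: subfieldD[OF F_subfield] mult.assoc[symmetric])
  qed
  moreover have "BL.rho q $ 2 $ 1 = 0" unfolding e by (simp add: BL.hk_21 q)
  moreover have "det (BL.rho q) = 1" using BL.rho_SL2C[OF assms] by (simp add: SL2C_def)
  ultimately show ?thesis using tame_genideal(2) by (simp add: R1_def RR_def)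
qed

section \<open>Norm one elements of the quadratic extension\<close>

lemma intsK_ring: "ring (ring_on (ints K))"
  using inert unfolding inert_in_def by (blast intro: ideal_ring_onD(1) primeideal.axioms(1))

lemma intsK_F: "x \<in> ints K \<Longrightarrow> x \<in> F \<Longrightarrow> x \<in> OF S" by (simp add: ints_def OF_def)

lemma OF_intsK: "x \<in> OF S \<Longrightarrow> x \<in> ints K" using F_K by (auto simp: ints_def OF_def)

text \<open>The prime ideal generated by \<open>pp S\<close> in \<open>ints K\<close> is contained
  in the set of multiples of \<pi>, so its primality yields divisibility by \<pi>.\<close>

lemma inert_prime:
  assumes "y \<in> ints K" "y' \<in> ints K" "y * y' \<in> (*) \<pi> ` OF S"
  shows "y \<in> (*) \<pi> ` ints K \<or> y' \<in> (*) \<pi> ` ints K"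
proof -
  let ?Q = "genideal (ring_on (ints K)) (pp S)"
  interpret Q: primeideal ?Q "ring_on (ints K)" using inert by (simp add: inert_in_def)
  note cl = ring_on_closed[OF intsK_ring]
  have "ideal ((*) \<pi> ` ints K) (ring_on (ints K))"
  proof (rule ideal_ring_onI[OF intsK_ring])
    show "(*) \<pi> ` ints K \<subseteq> ints K" using cl(4)[OF OF_intsK[OF pi_OF]] by blast
    show "0 \<in> (*) \<pi> ` ints K" using cl(1) by (auto intro!: image_eqI[of _ _ 0])
    show "x + y \<in> (*) \<pi> ` ints K" if xy: "x \<in> (*) \<pi> ` ints K" "y \<in> (*) \<pi> ` ints K" for x y
    proof -
      obtain a b where "a \<in> ints K" "b \<in> ints K" "x = \<pi> * a" "y = \<pi> * b" using xy by blast
      then show ?thesis using cl(3) by (intro image_eqI[of _ _ "a + b"]) (simp_all add: distrib_left)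
    qed
    show "a * x \<in> (*) \<pi> ` ints K" if xa: "x \<in> (*) \<pi> ` ints K" "a \<in> ints K" for x a
    proof -
      obtain b where "b \<in> ints K" "x = \<pi> * b" using xa by blast
      then show ?thesis using cl(4) xa(2) by (intro image_eqI[of _ _ "a * b"]) simp_all
    qed
  qed
  moreover have "pp S \<subseteq> (*) \<pi> ` ints K" unfolding pi(3) using OF_intsK by blast
  ultimately have sub: "?Q \<subseteq> (*) \<pi> ` ints K" unfolding genideal_def by blast
  have "pp S \<subseteq> ?Q" unfolding genideal_def by blast
  then have "y * y' \<in> ?Q" using assms(3) pi(3) by blast
  then have "y \<in> ?Q \<or> y' \<in> ?Q" using Q.I_prime[of y y'] assms(1,2) by simp
  then show ?thesis using sub by blast
qed

context
  fixes \<delta> :: complex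
  assumes delta: "\<delta> \<in> ints K - OF S" "\<delta> ^ 2 \<in> OF S"
begin

lemma delta': "\<delta> \<in> K" "\<delta> \<notin> F" "\<delta> * \<delta> \<in> F" "\<delta> \<noteq> 0"
proof -
  show d: "\<delta> \<in> K" "\<delta> \<notin> F" using delta by (auto simp: ints_def OF_def)
  show "\<delta> * \<delta> \<in> F" using OF_F[OF delta(2)] by (simp add: power2_eq_square)
  show "\<delta> \<noteq> 0" using d(2) subfieldD(1)[OF F_subfield] by auto
qed

lemma K_delta: "x \<in> K \<Longrightarrow> \<exists>a\<in>F. \<exists>b\<in>F. x = a + b * \<delta>"
proof -
  assume x: "x \<in> K"
  obtain \<theta> where th: "K = {a + b * \<theta> | a b. a \<in> F \<and> b \<in> F}" using quad_K unfolding quadratic_ext_def by blast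
  obtain c e where ce: "\<delta> = c + e * \<theta>" "c \<in> F" "e \<in> F" using delta'(1) th by blast
  have e0: "e \<noteq> 0" using ce delta'(2) by auto
  obtain a b where ab: "x = a + b * \<theta>" "a \<in> F" "b \<in> F" using x th by blast
  have th': "\<theta> = (\<delta> - c) / e" using ce(1) e0 by simp
  have "x = (a - b * c / e) + (b / e) * \<delta>" unfolding ab(1) th' using e0 by (simp add: field_simps)
  moreover have "a - b * c / e \<in> F" "b / e \<in> F" using ab ce by (simp_all add: subfieldD[OF F_subfield])
  ultimately show ?thesis by blast
qed

lemma delta_indep:
  assumes "a \<in> F" "b \<in> F" "a + b * \<delta> \<in> F" shows "b = 0"
proof (rule ccontr)
  assume b: "b \<noteq> 0"
  have "\<delta> = ((a + b * \<delta>) - a) / b" using b by simp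
  then have "\<delta> \<in> F" using subfieldD(8)[OF F_subfield subfieldD(3)[OF F_subfield assms(3,1)] assms(2)] by simp
  then show False using delta'(2) by simp
qed

text \<open>An integral equation for one conjugate has coefficients in \<open>F\<close>. Its value
  there is \<open>A + B * \<delta>\<close>; being 0 it forces \<open>B = 0\<close> and
  \<open>A = 0\<close>, hence the value 0 at the other conjugate.\<close>

lemma conj_intsK:
  assumes ab: "a \<in> F" "b \<in> F" and z: "a + b * \<delta> \<in> ints K" shows "a - b * \<delta> \<in> ints K"
proof -
  obtain f where f: "\<And>i. coeff f i \<in> \<int>" "lead_coeff f = 1" "poly f (a + b * \<delta>) = 0"
    using z by (auto simp: ints_def elim!: algebraic_int.cases)
  have fF: "coeff f i \<in> F" for i using f(1)[of i] subfieldD(11)[OF F_subfield] by (auto elim: Ints_cases)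
  obtain A B where AB: "A \<in> F" "B \<in> F" "poly f (a + b * \<delta>) = A + B * \<delta>" "poly f (a - b * \<delta>) = A - B * \<delta>"
    using poly_conjugate_root[OF F_subfield delta'(3) ab fF] by blast
  have "A + B * \<delta> \<in> F" using f(3) AB(3) subfieldD(1)[OF F_subfield] by simp
  from delta_indep[OF AB(1,2) this] have "poly f (a - b * \<delta>) = 0" using AB(3,4) f(3) by simp
  then have "algebraic_int (a - b * \<delta>)" using f(1,2) by (auto simp: algebraic_int.simps)
  moreover have "a - b * \<delta> \<in> K" using ab F_K delta'(1) by (auto intro!: subfieldD[OF K_subfield])
  ultimately show ?thesis by (simp add: ints_def)
qed

text \<open>A norm one element of \<open>K\<close> whose trace \<open>2\<alpha>\<close> is integral away from \<open>\<pi>\<close> has integral trace, because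
  \<open>\<pi>\<close> is inert: if \<open>n > 0\<close> is minimal with \<open>\<pi>\<^sup>n 2\<alpha>\<close> integral, then \<open>\<pi>\<^sup>n u\<close> and its conjugate are
  integers with product \<open>\<pi>\<^sup>2\<^sup>n\<close>.\<close>
lemma norm_one_trace:
  assumes ab: "\<alpha> \<in> F" "\<beta> \<in> F" and norm: "\<alpha> * \<alpha> - \<beta> * \<beta> * (\<delta> * \<delta>) = 1" and t: "2 * \<alpha> \<in> OFp S"
  shows "2 * \<alpha> \<in> OF S"
proof -
  define n where "n = (LEAST n. \<pi> ^ n * (2 * \<alpha>) \<in> OF S)"
  have ex: "\<exists>n. \<pi> ^ n * (2 * \<alpha>) \<in> OF S" using t by (simp add: OFp_iff)
  define T where "T = \<pi> ^ n * (2 * \<alpha>)"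
  have T: "T \<in> OF S" unfolding n_def T_def by (rule LeastI_ex[OF ex])
  show ?thesis
  proof (cases n)
    case 0
    then show ?thesis using T by (simp add: T_def)
  next
    case (Suc m)
    have nm: "\<pi> ^ m * (2 * \<alpha>) \<notin> OF S" using not_less_Least[of m "\<lambda>n. \<pi> ^ n * (2 * \<alpha>) \<in> OF S"] Suc by (simp add: n_def)
    define Q where "Q = \<pi> ^ n * \<pi> ^ n"
    have Q: "Q \<in> OF S" unfolding Q_def by (intro OF_closed(4) OF_pow pi_OF)
    define y where "y = \<pi> ^ n * \<alpha> + \<pi> ^ n * \<beta> * \<delta>"
    define y' where "y' = \<pi> ^ n * \<alpha> - \<pi> ^ n * \<beta> * \<delta>"
    have sum: "y + y' = T" by (simp add: y_def y'_def T_def)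
    have "y * y' = \<pi> ^ n * \<pi> ^ n * (\<alpha> * \<alpha> - \<beta> * \<beta> * (\<delta> * \<delta>))" by (simp add: y_def y'_def algebra_simps)
    then have prod: "y * y' = Q" by (simp only: norm Q_def mult_1_right)
    have sq: "y ^ 2 = T * y - Q" unfolding sum[symmetric] prod[symmetric] by (simp add: power2_eq_square algebra_simps)
    have pF: "\<pi> ^ n * \<alpha> \<in> F" "\<pi> ^ n * \<beta> \<in> F" using ab pi_F by (simp_all add: subfieldD[OF F_subfield])
    have tr: "Q * cnj Q \<in> \<int>" "T + cnj T \<in> \<int>" by (rule OF_trace_norm(2)[OF Q], rule OF_trace_norm(1)[OF T])
    have t2: "Q + cnj Q + T * cnj T \<in> \<int>" by (intro Ints_add OF_trace_norm(1)[OF Q] OF_trace_norm(2)[OF T])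
    have "T * cnj Q + cnj (T * cnj Q) \<in> \<int>" by (rule OF_trace_norm(1)[OF OF_closed(4)[OF T cnj_OF[OF Q]]])
    then have t3: "T * cnj Q + cnj T * Q \<in> \<int>" by simp
    have "algebraic_int y" by (rule algebraic_int_quadratic_over[OF sq tr(2) t2 t3 tr(1)])
    moreover have "y \<in> K" unfolding y_def
      by (rule subfieldD(7)[OF K_subfield _ subfieldD(4)[OF K_subfield _ delta'(1)]]) (use pF F_K in blast)+
    ultimately have yK: "y \<in> ints K" by (simp add: ints_def)
    have yK': "y' \<in> ints K" unfolding y'_def by (rule conj_intsK[OF pF]) (use yK in \<open>simp add: y_def\<close>)
    have Qpi: "Q \<in> (*) \<pi> ` OF S" unfolding Q_def Suc
      by (rule image_eqI[of _ _ "\<pi> ^ m * \<pi> ^ Suc m"]) (auto intro: OF_closed(4) OF_pow pi_OF simp: mult_ac)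
    \<comment> \<open>Inertness divides \<pi> out of one of the two conjugates,
      \<open>conj_intsK\<close> then out of both, and the sum contradicts the minimality of
      \<open>n\<close>.\<close>
    have half: "\<pi> ^ m * \<alpha> + \<pi> ^ m * \<beta> * \<delta> \<in> ints K \<or> \<pi> ^ m * \<alpha> + (- (\<pi> ^ m * \<beta>)) * \<delta> \<in> ints K"
    proof -
      have e: "y = \<pi> * (\<pi> ^ m * \<alpha> + \<pi> ^ m * \<beta> * \<delta>)" "y' = \<pi> * (\<pi> ^ m * \<alpha> + (- (\<pi> ^ m * \<beta>)) * \<delta>)"
        by (simp_all add: y_def y'_def Suc algebra_simps)
      have "y \<in> (*) \<pi> ` ints K \<or> y' \<in> (*) \<pi> ` ints K" by (rule inert_prime[OF yK yK']) (simp add: prod Qpi)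
      then show ?thesis unfolding e using pi(2) by (auto simp only: mult_cancel_left image_iff)
    qed
    have mF: "\<pi> ^ m * \<alpha> \<in> F" "\<pi> ^ m * \<beta> \<in> F" "- (\<pi> ^ m * \<beta>) \<in> F" using ab pi_F by (simp_all add: subfieldD[OF F_subfield])
    have "\<pi> ^ m * \<alpha> + \<pi> ^ m * \<beta> * \<delta> \<in> ints K \<and> \<pi> ^ m * \<alpha> - \<pi> ^ m * \<beta> * \<delta> \<in> ints K"
      using half conj_intsK[OF mF(1,2)] conj_intsK[OF mF(1,3)] by auto
    then have "(\<pi> ^ m * \<alpha> + \<pi> ^ m * \<beta> * \<delta>) + (\<pi> ^ m * \<alpha> - \<pi> ^ m * \<beta> * \<delta>) \<in> ints K"
      using ring_on_closed(3)[OF intsK_ring] by blast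
    then have "\<pi> ^ m * (2 * \<alpha>) \<in> ints K" by (simp add: mult_ac)
    moreover have "\<pi> ^ m * (2 * \<alpha>) \<in> F" using mF(1) subfieldD(7)[OF F_subfield mF(1) mF(1)] by (simp add: algebra_simps)
    ultimately show ?thesis using nm intsK_F by blast
  qed
qed

end

text \<open>By the Cayley-Hamilton theorem the powers are \<open>\<gamma>\<^sup>j = p\<^sub>j \<gamma> - p\<^sub>j\<^sub>-\<^sub>1\<close> for a linear recurrence with
  coefficients in the ring, which is purely periodic modulo \<open>N\<close>.\<close>
lemma recurrence_periodic:
  assumes t: "t \<in> OF S" and N: "N \<in> OF S" "N \<noteq> 0"
    and cf: "cf 0 = 0" "cf (Suc 0) = 1" "\<And>j. cf (Suc (Suc j)) = t * cf (Suc j) - cf j"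
  shows "\<exists>j>0. cf j \<in> (*) N ` OF S \<and> cf (Suc j) \<in> OF S"
proof -
  have pO: "cf j \<in> OF S \<and> cf (Suc j) \<in> OF S" for j
    by (induction j) (auto simp: cf intro!: OF_closed(1,2,4,6) t)
  obtain f :: "complex \<Rightarrow> complex" and D where f: "finite D" "\<And>x. x \<in> OF S \<Longrightarrow> f x \<in> D"
    "\<And>x y. x \<in> OF S \<Longrightarrow> y \<in> OF S \<Longrightarrow> f x = f y \<Longrightarrow> x - y \<in> (*) N ` OF S"
    using OL.finite_residues[OF N] by metis
  have NI: "ideal ((*) N ` OF S) (ring_on (OF S))"
  proof (rule ideal_ring_onI[OF OF_ring])
    show "(*) N ` OF S \<subseteq> OF S" using OF_closed(4)[OF N(1)] by blast
    show "0 \<in> (*) N ` OF S" using OF_closed(1) by (auto intro!: image_eqI[of _ _ 0])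
    show "x + y \<in> (*) N ` OF S" if xy: "x \<in> (*) N ` OF S" "y \<in> (*) N ` OF S" for x y
    proof -
      obtain a b where "a \<in> OF S" "b \<in> OF S" "x = N * a" "y = N * b" using xy by blast
      then show ?thesis using OF_closed(3) by (intro image_eqI[of _ _ "a + b"]) (simp_all add: distrib_left)
    qed
    show "a * x \<in> (*) N ` OF S" if xa: "x \<in> (*) N ` OF S" "a \<in> OF S" for x a
    proof -
      obtain b where "b \<in> OF S" "x = N * b" using xa by blast
      then show ?thesis using OF_closed(4) xa(2) by (intro image_eqI[of _ _ "a * b"]) simp_all
    qed
  qed
  have Nd: "x - y \<in> (*) N ` OF S" if "x \<in> (*) N ` OF S" "y \<in> (*) N ` OF S" for x y
    using ideal_ring_onD(4)[OF NI that(1) ideal_ring_onD(5)[OF NI that(2) OF_closed(5)[OF OF_closed(2)]]] by simp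
  define G where "G j = (f (cf j), f (cf (Suc j)))" for j
  have "range G \<subseteq> D \<times> D" using f(2) pO by (auto simp: G_def)
  then have "finite (range G)" using f(1) finite_subset finite_cartesian_product by blast
  then have "\<not> inj G" using finite_imageD[of G UNIV] by auto
  then obtain i' j' where "i' \<noteq> j'" "G i' = G j'" unfolding inj_def by blast
  then obtain i j where ij: "i < j" "G i = G j" by (cases "i' < j'") (auto simp: not_less le_less)
  \<comment> \<open>The recurrence can be run backwards,
    \<open>cf k = t * cf (Suc k) - cf (Suc (Suc k))\<close>, so the coincidence at \<open>i\<close>
    and \<open>j\<close> descends to 0.\<close>
  have backward: "cf (j - i + k) - cf k \<in> (*) N ` OF S \<and> cf (Suc (j - i + k)) - cf (Suc k) \<in> (*) N ` OF S" if "k \<le> i" for k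
    using that
  proof (induction k rule: inc_induct)
    case base
    have "f (cf j) = f (cf i)" "f (cf (Suc j)) = f (cf (Suc i))" using ij(2) by (simp_all add: G_def)
    then have "cf j - cf i \<in> (*) N ` OF S \<and> cf (Suc j) - cf (Suc i) \<in> (*) N ` OF S" using f(3) pO by blast
    then show ?case using ij(1) by simp
  next
    case (step k)
    let ?m = "j - i + k"
    have IH: "cf (Suc ?m) - cf (Suc k) \<in> (*) N ` OF S" "cf (Suc (Suc ?m)) - cf (Suc (Suc k)) \<in> (*) N ` OF S"
      using step.IH by simp_all
    have "cf ?m - cf k = t * (cf (Suc ?m) - cf (Suc k)) - (cf (Suc (Suc ?m)) - cf (Suc (Suc k)))"
      by (simp add: cf algebra_simps)
    then have "cf ?m - cf k \<in> (*) N ` OF S" using Nd[OF ideal_ring_onD(5)[OF NI IH(1) t] IH(2)] by simp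
    then show ?case using IH(1) by simp
  qed
  have "cf (j - i) \<in> (*) N ` OF S" using backward[of 0] cf(1) by simp
  then show ?thesis using ij(1) pO by (intro exI[of _ "j - i"]) simp
qed

text \<open>A power \<pi>^n clears the denominators of \<open>g\<close>, and its multiple of the
  lower left entry lies in \<open>tame S\<close>. In the powers of \<open>g\<close> the matrix
  \<open>g\<close> occurs with coefficient \<open>cf j\<close>, and some \<open>cf j\<close> with
  \<open>j > 0\<close> is divisible by \<pi>^n. The integral trace makes the recurrence one over
  \<open>OF S\<close>.\<close>

lemma torus_power_integral:
  assumes g: "g \<in> R1 S" and t: "g $ 1 $ 1 + g $ 2 $ 2 \<in> OF S"
  shows "\<exists>j>0. mpow g j \<in> BL.GamL (tame S) \<and> (\<exists>a b. mpow g j = mat a ** g + mat b)"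
proof -
  define t where "t = g $ 1 $ 1 + g $ 2 $ 2"
  have "\<exists>n. \<pi> ^ n * g $ i $ j \<in> OF S" for i j using R1_D(1)[OF g] by (simp add: OFp_iff)
  then obtain N where N: "\<And>i j. \<pi> ^ N i j * g $ i $ j \<in> OF S" by metis
  obtain n0 where n0: "\<pi> ^ n0 * g $ 2 $ 1 \<in> tame S" using genideal_tame[OF R1_D(3)[OF g]] by blast
  define n where "n = n0 + (\<Sum>i\<in>UNIV. \<Sum>j\<in>UNIV. N i j)"
  have nO: "\<pi> ^ n * g $ i $ j \<in> OF S" for i j
  proof (rule pi_pow_mono[OF N[of i j]])
    have "N i j \<le> (\<Sum>j\<in>UNIV. N i j)" by (rule member_le_sum) auto
    also have "\<dots> \<le> (\<Sum>i\<in>UNIV. \<Sum>j\<in>UNIV. N i j)" by (rule member_le_sum[of i UNIV "\<lambda>i. \<Sum>j\<in>UNIV. N i j"]) auto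
    finally show "N i j \<le> n" by (simp add: n_def)
  qed (rule OF_closed(4))
  have nM: "\<pi> ^ n * g $ 2 $ 1 \<in> tame S" by (rule pi_pow_mono[OF n0]) (auto simp: n_def intro: tame(4))
  \<comment> \<open>The iteration runs on pairs of consecutive terms starting from
    \<open>cf 1 = 1\<close> and \<open>cf 0 = 0\<close>; hence the exponent \<open>j - 1\<close> and
    the separate value at 0.\<close>
  define cf where "cf j = (if j = 0 then 0 else fst (((\<lambda>(a, b). (t * a - b, a)) ^^ (j - 1)) (1 :: complex, 0)))" for j :: nat
  have p0: "cf 0 = 0" "cf (Suc 0) = 1" by (simp_all add: cf_def)
  have snd: "snd (((\<lambda>(a, b). (t * a - b, a)) ^^ j) (1, 0)) = cf j" for j
    by (cases j) (simp_all add: cf_def case_prod_unfold)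
  have pS: "cf (Suc (Suc j)) = t * cf (Suc j) - cf j" for j
    using snd[of j] by (simp add: cf_def case_prod_unfold)
  have piN: "\<pi> ^ n \<in> OF S" "\<pi> ^ n \<noteq> 0" using OF_pow[OF pi_OF] pi(2) by simp_all
  have tO: "t \<in> OF S" using t by (simp add: t_def)
  obtain j where j: "0 < j" "cf j \<in> (*) (\<pi> ^ n) ` OF S" "cf (Suc j) \<in> OF S"
    using recurrence_periodic[of t "\<pi> ^ n" cf, OF tO piN p0 pS] by blast
  have det: "g $ 1 $ 1 * g $ 2 $ 2 - g $ 1 $ 2 * g $ 2 $ 1 = 1" using R1_D(2)[OF g] by (simp add: det_2)
  have CH: "g ** g = mat t ** g + mat (-1)"
    using det by (simp add: mat2_eq_iff mat2_mult_sel mat_sel t_def algebra_simps)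
  have pow: "mpow g (Suc i) = mat (cf (Suc i)) ** g + mat (- cf i)" for i
  proof (induction i)
    case 0
    show ?case by (simp add: p0 mat2_eq_iff mat2_mult_sel mat_sel)
  next
    case (Suc i)
    have "mpow g (Suc (Suc i)) = mat (cf (Suc i)) ** (g ** g) + mat (- cf i) ** g"
      unfolding mpow.simps(2)[of g "Suc i"] Suc.IH by (simp add: mat2_eq_iff mat2_mult_sel mat_sel algebra_simps)
    also have "\<dots> = mat (cf (Suc (Suc i))) ** g + mat (- cf (Suc i))"
      unfolding CH pS by (simp add: mat2_eq_iff mat2_mult_sel mat_sel algebra_simps)
    finally show ?case .
  qed
  obtain i where i: "j = Suc i" using j(1) by (cases j) auto
  obtain q where q: "q \<in> OF S" "cf j = \<pi> ^ n * q" using j(2) by blast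
  have pi': "cf i \<in> OF S"
  proof -
    have "cf j \<in> OF S" unfolding q(2) by (rule OF_closed(4)[OF piN(1) q(1)])
    then have "t * cf j - cf (Suc j) \<in> OF S" by (intro OF_closed(6) OF_closed(4)[OF tO] j(3))
    then show ?thesis unfolding i pS by simp
  qed
  have pg: "cf j * g $ k $ l \<in> OF S" for k l
  proof -
    have eq: "cf j * g $ k $ l = q * (\<pi> ^ n * g $ k $ l)" unfolding q(2) by (simp only: mult_ac)
    show ?thesis unfolding eq by (rule OF_closed(4)[OF q(1) nO])
  qed
  have eq: "mpow g j = mat (cf j) ** g + mat (- cf i)" unfolding i by (rule pow)
  have "det (mpow g m) = 1" for m by (induction m) (simp_all add: det_mul R1_D(2)[OF g])
  moreover have "mpow g j $ k $ l \<in> OF S" for k l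
    unfolding eq using exhaust_2[of k] exhaust_2[of l] pg pi'
    by (auto simp: mat2_mult_sel mat_sel intro!: OF_closed(5,6))
  moreover have "mpow g j $ 2 $ 1 \<in> tame S"
  proof -
    have "mpow g j $ 2 $ 1 = q * (\<pi> ^ n * g $ 2 $ 1)" unfolding eq by (simp add: mat2_mult_sel mat_sel q)
    then show ?thesis using tame(4)[OF nM q(1)] by simp
  qed
  ultimately have "mpow g j \<in> BL.GamL (tame S)" by (simp add: BL.GamL_def)
  then show ?thesis using j(1) eq by blast
qed

lemma optimal_embedding_torus:
  assumes opt: "optimal_embedding S \<O> \<Psi>" and ord: "is_order (OFp S) K \<O>" and u: "u \<in> norm_one S \<O>"
    and delta: "\<delta> \<in> ints K - OF S" "\<delta> ^ 2 \<in> OF S"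
  shows "\<Psi> u \<in> R1 S" "\<Psi> \<delta> $ i $ j \<in> F" "\<Psi> \<delta> $ 2 $ 2 = - \<Psi> \<delta> $ 1 $ 1"
    "\<exists>\<alpha> \<beta>. \<Psi> u = torus (\<Psi> \<delta>) \<alpha> \<beta>" "\<Psi> u $ 1 $ 1 + \<Psi> u $ 2 $ 2 \<in> OF S"
proof -
  note d = delta'[OF delta]
  have \<Psi>: "\<And>x i j. x \<in> K \<Longrightarrow> \<Psi> x $ i $ j \<in> F" "\<And>x y. x \<in> K \<Longrightarrow> y \<in> K \<Longrightarrow> \<Psi> (x + y) = \<Psi> x + \<Psi> y"
    "\<And>x y. x \<in> K \<Longrightarrow> y \<in> K \<Longrightarrow> \<Psi> (x * y) = \<Psi> x ** \<Psi> y" "\<And>x. x \<in> F \<Longrightarrow> \<Psi> x = mat x"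
    "inj_on \<Psi> K" "\<Psi> ` K \<inter> RR S = \<Psi> ` \<O>"
    using opt unfolding optimal_embedding_def by blast+
  define X where "X = \<Psi> \<delta>"
  define D where "D = \<delta> * \<delta>"
  show "\<Psi> \<delta> $ i $ j \<in> F" by (rule \<Psi>(1)[OF d(1)])
  have XX: "X ** X = mat D" using \<Psi>(3)[OF d(1) d(1)] \<Psi>(4)[OF d(3)] by (simp add: X_def D_def)
  have XF: "X $ i $ j \<in> F" for i j unfolding X_def by (rule \<Psi>(1)[OF d(1)])
  have ent: "X $ 1 $ 1 * X $ 1 $ 1 + X $ 1 $ 2 * X $ 2 $ 1 = D" "X $ 1 $ 2 * (X $ 1 $ 1 + X $ 2 $ 2) = 0"
    "X $ 2 $ 1 * (X $ 1 $ 1 + X $ 2 $ 2) = 0" "X $ 2 $ 2 * X $ 2 $ 2 + X $ 1 $ 2 * X $ 2 $ 1 = D"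
    using XX by (simp_all add: mat2_eq_iff mat2_mult_sel mat_sel algebra_simps)
  \<comment> \<open>\<open>X ** X\<close> is the scalar \<open>D\<close>. A non-zero trace would
    force \<open>X\<close> itself to be scalar, and injectivity of \<Psi> would put \<delta> into
    \<open>F\<close>.\<close>
  have trX: "X $ 1 $ 1 + X $ 2 $ 2 = 0"
  proof (rule ccontr)
    assume n: "X $ 1 $ 1 + X $ 2 $ 2 \<noteq> 0"
    then have z: "X $ 1 $ 2 = 0" "X $ 2 $ 1 = 0" using ent(2,3) by simp_all
    have "(X $ 1 $ 1 - X $ 2 $ 2) * (X $ 1 $ 1 + X $ 2 $ 2) = 0" using ent(1,4) z by (simp add: algebra_simps)
    then have "X $ 1 $ 1 = X $ 2 $ 2" using n by simp
    then have "X = mat (X $ 1 $ 1)" using z by (simp add: mat2_eq_iff mat_sel)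
    then have "\<Psi> \<delta> = \<Psi> (X $ 1 $ 1)" using \<Psi>(4)[OF XF[of 1 1]] by (simp add: X_def)
    then have "\<delta> = X $ 1 $ 1" using \<Psi>(5) d(1) XF[of 1 1] F_K by (auto dest: inj_onD)
    then show False using XF[of 1 1] d(2) by simp
  qed
  then have X22: "X $ 2 $ 2 = - X $ 1 $ 1" by (simp add: eq_neg_iff_add_eq_0 add.commute)
  then show "\<Psi> \<delta> $ 2 $ 2 = - \<Psi> \<delta> $ 1 $ 1" by (simp add: X_def)
  have uO: "u \<in> \<O>" "u * rel_conj F K u = 1" using u by (auto simp: norm_one_def)
  have uK: "u \<in> K" using uO(1) ord by (auto simp: is_order_def)
  obtain \<alpha> \<beta> where ab: "\<alpha> \<in> F" "\<beta> \<in> F" "u = \<alpha> + \<beta> * \<delta>" using K_delta[OF delta uK] by blast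
  have norm: "\<alpha> * \<alpha> - \<beta> * \<beta> * (\<delta> * \<delta>) = 1"
  proof (cases "u \<in> F")
    case True
    have "\<beta> = 0" by (rule delta_indep[OF delta ab(1,2)]) (use True ab in simp)
    then show ?thesis using uO(2) True ab(3) by (simp add: rel_conj_def)
  next
    case False
    have b0: "\<beta> \<noteq> 0" using False ab by auto
    have "rel_conj F K u = (THE y. y \<in> K \<and> u + y \<in> F \<and> u * y \<in> F)" using False by (simp add: rel_conj_def)
    \<comment> \<open>\<open>THE\<close> singles out the conjugate: the conditions on sum and
      product determine both coordinates, as \<beta> is non-zero.\<close>
    also have "\<dots> = \<alpha> - \<beta> * \<delta>"
    proof (rule the_equality)
      have "\<alpha> - \<beta> * \<delta> \<in> K" using ab F_K d(1) by (auto intro!: subfieldD[OF K_subfield])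
      moreover have "u + (\<alpha> - \<beta> * \<delta>) \<in> F" using ab subfieldD(7)[OF F_subfield ab(1) ab(1)] by simp
      moreover have "u * (\<alpha> - \<beta> * \<delta>) = \<alpha> * \<alpha> - \<beta> * \<beta> * (\<delta> * \<delta>)" by (simp add: ab(3) algebra_simps)
      moreover have "\<alpha> * \<alpha> - \<beta> * \<beta> * (\<delta> * \<delta>) \<in> F" using ab d(3) by (simp add: subfieldD[OF F_subfield])
      ultimately show "\<alpha> - \<beta> * \<delta> \<in> K \<and> u + (\<alpha> - \<beta> * \<delta>) \<in> F \<and> u * (\<alpha> - \<beta> * \<delta>) \<in> F" by simp
    next
      fix y assume y: "y \<in> K \<and> u + y \<in> F \<and> u * y \<in> F"
      obtain a' b' where ab': "a' \<in> F" "b' \<in> F" "y = a' + b' * \<delta>" using K_delta[OF delta] y by blast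
      have "(\<alpha> + a') + (\<beta> + b') * \<delta> \<in> F" using y by (simp add: ab ab' algebra_simps)
      from delta_indep[OF delta _ _ this] have 1: "b' = - \<beta>"
        using ab ab' by (simp add: subfieldD[OF F_subfield] eq_neg_iff_add_eq_0 add.commute)
      have "u * y = (\<alpha> * a' + \<beta> * b' * (\<delta> * \<delta>)) + (\<alpha> * b' + \<beta> * a') * \<delta>" by (simp add: ab(3) ab'(3) algebra_simps)
      then have "(\<alpha> * a' + \<beta> * b' * (\<delta> * \<delta>)) + (\<alpha> * b' + \<beta> * a') * \<delta> \<in> F" using y by simp
      from delta_indep[OF delta _ _ this] have "\<alpha> * b' + \<beta> * a' = 0" using ab ab' d(3) by (simp add: subfieldD[OF F_subfield])
      then have "\<beta> * a' = \<beta> * \<alpha>" by (simp add: 1 algebra_simps)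
      then have "a' = \<alpha>" using b0 by simp
      then show "y = \<alpha> - \<beta> * \<delta>" by (simp add: 1 ab')
    qed
    finally have "(\<alpha> + \<beta> * \<delta>) * (\<alpha> - \<beta> * \<delta>) = 1" using uO(2) ab(3) by simp
    then show ?thesis by (simp add: algebra_simps)
  qed
  have K: "\<alpha> \<in> K" "\<beta> \<in> K" "\<beta> * \<delta> \<in> K" using ab F_K d(1) by (auto intro!: subfieldD[OF K_subfield])
  have "\<Psi> u = mat \<alpha> + mat \<beta> ** X"
    using \<Psi>(2)[OF K(1,3)] \<Psi>(3)[OF K(2) d(1)] \<Psi>(4) ab by (simp add: X_def)
  then have tor: "\<Psi> u = torus X \<alpha> \<beta>" by (simp add: mat2_eq_iff mat2_mult_sel mat_sel torus_def)
  then show "\<exists>\<alpha> \<beta>. \<Psi> u = torus (\<Psi> \<delta>) \<alpha> \<beta>" by (auto simp: X_def)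
  have "det (\<Psi> u) = \<alpha> * \<alpha> - \<beta> * \<beta> * (X $ 1 $ 1 * X $ 1 $ 1 + X $ 1 $ 2 * X $ 2 $ 1)"
    by (simp add: tor det_2 torus_def X22 algebra_simps)
  then have det: "det (\<Psi> u) = 1" using norm by (simp add: ent(1) D_def)
  have "\<Psi> u \<in> RR S" using \<Psi>(6) uO(1) by blast
  then show R1: "\<Psi> u \<in> R1 S" using det by (simp add: R1_def)
  have tr: "\<Psi> u $ 1 $ 1 + \<Psi> u $ 2 $ 2 = 2 * \<alpha>" by (simp add: tor torus_def X22)
  have "2 * \<alpha> \<in> OFp S" unfolding tr[symmetric]
    by (intro ring_on_closed(3)[OF OFp_ring] R1_D(1)[OF R1])
  then show "\<Psi> u $ 1 $ 1 + \<Psi> u $ 2 $ 2 \<in> OF S" unfolding tr by (rule norm_one_trace[OF delta ab(1,2) norm])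
qed

end

section \<open>Tensor products and coinvariants\<close>

lemma r_coset_eqI:
  assumes G: "comm_group G" and H: "subgroup H G" and xy: "x \<in> carrier G" "y \<in> carrier G" "x \<otimes>\<^bsub>G\<^esub> inv\<^bsub>G\<^esub> y \<in> H"
  shows "H #>\<^bsub>G\<^esub> x = H #>\<^bsub>G\<^esub> y"
proof -
  interpret comm_group G by fact
  have "x \<otimes>\<^bsub>G\<^esub> inv\<^bsub>G\<^esub> y \<otimes>\<^bsub>G\<^esub> y = x" using xy by (simp add: m_assoc)
  then have "x \<in> H #>\<^bsub>G\<^esub> y" using xy(3) by (force simp: r_coset_def)
  then show ?thesis using repr_independence[OF _ xy(2) H] by simp
qed

lemma r_coset_mult:
  assumes G: "comm_group G" and H: "subgroup H G" and xy: "x \<in> carrier G" "y \<in> carrier G"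
  shows "(H #>\<^bsub>G\<^esub> x) <#>\<^bsub>G\<^esub> (H #>\<^bsub>G\<^esub> y) = H #>\<^bsub>G\<^esub> (x \<otimes>\<^bsub>G\<^esub> y)"
  using normal.rcos_sum[OF comm_group.subgroup_imp_normal[OF G H] xy] .

text \<open>All elements of a coset have the same image coset, so that the set inside
  \<open>the_elem\<close> is a singleton.\<close>

lemma quot_map_coset:
  assumes G: "comm_group G" "comm_group G'" and H: "subgroup H G" "subgroup H' G'" and hom: "\<phi> \<in> hom G G'"
    and sub: "\<phi> ` H \<subseteq> H'" and x: "x \<in> carrier G"
  shows "quot_map G' H' \<phi> (H #>\<^bsub>G\<^esub> x) = H' #>\<^bsub>G'\<^esub> \<phi> x"
proof -
  interpret G: comm_group G by fact
  interpret G': comm_group G' by fact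
  have "H' #>\<^bsub>G'\<^esub> \<phi> y = H' #>\<^bsub>G'\<^esub> \<phi> x" if y: "y \<in> H #>\<^bsub>G\<^esub> x" for y
  proof -
    obtain h where h: "h \<in> H" "y = h \<otimes>\<^bsub>G\<^esub> x" using y by (auto simp: r_coset_def)
    have hG: "h \<in> carrier G" using h(1) subgroup.subset[OF H(1)] by blast
    have c: "\<phi> h \<in> carrier G'" "\<phi> x \<in> carrier G'" using hom_in_carrier[OF hom] hG x by blast+
    have "\<phi> y = \<phi> h \<otimes>\<^bsub>G'\<^esub> \<phi> x" unfolding h(2) by (rule hom_mult[OF hom hG x])
    then have "\<phi> y \<otimes>\<^bsub>G'\<^esub> inv\<^bsub>G'\<^esub> \<phi> x = \<phi> h" using c by (simp add: G'.m_assoc)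
    then show ?thesis using r_coset_eqI[OF G(2) H(2), of "\<phi> y" "\<phi> x"] \<open>\<phi> y = _\<close> c h(1) sub by auto
  qed
  moreover have "x \<in> H #>\<^bsub>G\<^esub> x" by (rule G.rcos_self[OF x H(1)])
  ultimately have "(\<lambda>y. H' #>\<^bsub>G'\<^esub> \<phi> y) ` (H #>\<^bsub>G\<^esub> x) = {H' #>\<^bsub>G'\<^esub> \<phi> x}" by blast
  then show ?thesis by (simp add: quot_map_def)
qed

lemma quot_map_hom:
  assumes G: "comm_group G" "comm_group G'" and H: "subgroup H G" "subgroup H' G'" and hom: "\<phi> \<in> hom G G'"
    and sub: "\<phi> ` H \<subseteq> H'"
  shows "quot_map G' H' \<phi> \<in> hom (G Mod H) (G' Mod H')"
proof (rule homI)
  note q = quot_map_coset[OF assms]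
  fix X assume "X \<in> carrier (G Mod H)"
  then obtain x where x: "x \<in> carrier G" "X = H #>\<^bsub>G\<^esub> x" by (auto simp: carrier_FactGroup)
  then show "quot_map G' H' \<phi> X \<in> carrier (G' Mod H')"
    using hom_in_carrier[OF hom x(1)] by (auto simp: carrier_FactGroup q)
  fix Y assume "Y \<in> carrier (G Mod H)"
  then obtain y where y: "y \<in> carrier G" "Y = H #>\<^bsub>G\<^esub> y" by (auto simp: carrier_FactGroup)
  interpret G: comm_group G by fact
  show "quot_map G' H' \<phi> (X \<otimes>\<^bsub>G Mod H\<^esub> Y) = quot_map G' H' \<phi> X \<otimes>\<^bsub>G' Mod H'\<^esub> quot_map G' H' \<phi> Y"
    using x y hom_in_carrier[OF hom] hom_mult[OF hom]
    by (simp add: r_coset_mult[OF G(1) H(1)] r_coset_mult[OF G(2) H(2)] q)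
qed

lemma hom_generate_subset:
  assumes G: "group G" "group G'" and hom: "\<phi> \<in> hom G G'" and S: "A \<subseteq> carrier G" "\<phi> ` A \<subseteq> H'" and H: "subgroup H' G'"
  shows "\<phi> ` generate G A \<subseteq> H'"
proof -
  interpret G: group G by fact
  interpret h: group_hom G G' \<phi> using G hom by (simp add: group_hom_def group_hom_axioms_def)
  have "\<phi> x \<in> H'" if "x \<in> generate G A" for x
    using that
  proof (induction x rule: generate.induct)
    case one then show ?case using subgroup.one_closed[OF H] by simp
  next
    case (incl h) then show ?case using S by blast
  next
    case (inv h) then show ?case using S subgroup.m_inv_closed[OF H, of "\<phi> h"] by (auto simp: subset_iff)
  next
    case (eng h1 h2)
    have "h1 \<in> carrier G" "h2 \<in> carrier G" using eng G.generate_in_carrier[OF S(1)] by blast+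
    then show ?case using eng subgroup.m_closed[OF H] by simp
  qed
  then show ?thesis by blast
qed

lemma frag_extend_hom:
  assumes "\<And>x. x \<in> X \<Longrightarrow> f x \<in> carrier (free_Abelian_group Y)"
  shows "frag_extend f \<in> hom (free_Abelian_group X) (free_Abelian_group Y)"
proof (rule homI)
  fix c assume "c \<in> carrier (free_Abelian_group X)"
  then show "frag_extend f c \<in> carrier (free_Abelian_group Y)"
    using keys_frag_extend[of f c] assms by (auto simp: subset_iff)
qed (simp add: frag_extend_add)

section \<open>Relations of the triple tensor product\<close>

definition gens3 :: "'a::ab_group_add set \<Rightarrow> 'b::ab_group_add set \<Rightarrow> 'd::ab_group_add set \<Rightarrow> ('a \<times> 'b \<times> 'd \<Rightarrow>\<^sub>0 int) set" where
  "gens3 A B C =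
     ({frag_of (a + a', b, c) - frag_of (a, b, c) - frag_of (a', b, c) | a a' b c.
         a \<in> A \<and> a' \<in> A \<and> b \<in> B \<and> c \<in> C} \<union>
      {frag_of (a, b + b', c) - frag_of (a, b, c) - frag_of (a, b', c) | a b b' c.
         a \<in> A \<and> b \<in> B \<and> b' \<in> B \<and> c \<in> C} \<union>
      {frag_of (a, b, c + c') - frag_of (a, b, c) - frag_of (a, b, c') | a b c c'.
         a \<in> A \<and> b \<in> B \<and> c \<in> C \<and> c' \<in> C})"

lemma gens3I:
  "a \<in> A \<Longrightarrow> a' \<in> A \<Longrightarrow> b \<in> B \<Longrightarrow> c \<in> C \<Longrightarrow> frag_of (a + a', b, c) - frag_of (a, b, c) - frag_of (a', b, c) \<in> gens3 A B C"
  "a \<in> A \<Longrightarrow> b \<in> B \<Longrightarrow> b' \<in> B \<Longrightarrow> c \<in> C \<Longrightarrow> frag_of (a, b + b', c) - frag_of (a, b, c) - frag_of (a, b', c) \<in> gens3 A B C"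
  "a \<in> A \<Longrightarrow> b \<in> B \<Longrightarrow> c \<in> C \<Longrightarrow> c' \<in> C \<Longrightarrow> frag_of (a, b, c + c') - frag_of (a, b, c) - frag_of (a, b, c') \<in> gens3 A B C"
  unfolding gens3_def by blast+

lemma rel3_gens: "rel3 A B C = generate (free_Abelian_group (A \<times> B \<times> C)) (gens3 A B C)"
  by (simp add: rel3_def gens3_def)

definition add_closed :: "'a::ab_group_add set \<Rightarrow> bool" where
  "add_closed A \<longleftrightarrow> (\<forall>a\<in>A. \<forall>b\<in>A. a + b \<in> A)"

lemma keys_diff3: "Poly_Mapping.keys (frag_of x - frag_of y - frag_of z) \<subseteq> {x, y, z}"
  using keys_diff[of "frag_of x - frag_of y" "frag_of z"] keys_diff[of "frag_of x" "frag_of y"] by (auto simp: keys_frag_of)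

lemma gens3_carrier:
  assumes "add_closed A" "add_closed B" "add_closed C"
  shows "gens3 A B C \<subseteq> carrier (free_Abelian_group (A \<times> B \<times> C))"
proof -
  have *: "frag_of x - frag_of y - frag_of z \<in> carrier (free_Abelian_group Z)" if "{x, y, z} \<subseteq> Z" for x y z :: "'a \<times> 'b \<times> 'c" and Z
    using subset_trans[OF keys_diff3 that] by simp
  show ?thesis unfolding gens3_def using assms unfolding add_closed_def by (auto intro!: * simp del: carrier_free_Abelian_group_iff)
qed

lemma rel3_subgroup:
  assumes "add_closed A" "add_closed B" "add_closed C"
  shows "subgroup (rel3 A B C) (free_Abelian_group (A \<times> B \<times> C))"
  unfolding rel3_gens by (rule group.generate_is_subgroup[OF group_free_Abelian_group gens3_carrier[OF assms]])

lemma rel3_map: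
  fixes f :: "'a::ab_group_add \<Rightarrow> 'a1::ab_group_add" and g :: "'b::ab_group_add \<Rightarrow> 'b1::ab_group_add"
    and h :: "'d::ab_group_add \<Rightarrow> 'd1::ab_group_add"
  assumes cl: "add_closed A" "add_closed B" "add_closed C" "add_closed A'" "add_closed B'" "add_closed C'"
    and f: "\<And>a. a \<in> A \<Longrightarrow> f a \<in> A'" "\<And>a b. a \<in> A \<Longrightarrow> b \<in> A \<Longrightarrow> f (a + b) = f a + f b"
    and g: "\<And>a. a \<in> B \<Longrightarrow> g a \<in> B'" "\<And>a b. a \<in> B \<Longrightarrow> b \<in> B \<Longrightarrow> g (a + b) = g a + g b"
    and h: "\<And>a. a \<in> C \<Longrightarrow> h a \<in> C'" "\<And>a b. a \<in> C \<Longrightarrow> b \<in> C \<Longrightarrow> h (a + b) = h a + h b"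
  defines "\<phi> \<equiv> frag_extend (\<lambda>(a, b, c). frag_of (f a, g b, h c))"
  shows "\<phi> \<in> hom (free_Abelian_group (A \<times> B \<times> C)) (free_Abelian_group (A' \<times> B' \<times> C'))"
    "\<phi> ` rel3 A B C \<subseteq> rel3 A' B' C'"
proof -
  show hom: "\<phi> \<in> hom (free_Abelian_group (A \<times> B \<times> C)) (free_Abelian_group (A' \<times> B' \<times> C'))"
    unfolding \<phi>_def by (rule frag_extend_hom) (auto simp: f g h keys_frag_of)
  have "\<phi> x \<in> gens3 A' B' C'" if x: "x \<in> gens3 A B C" for x
  proof -
    consider a a' b c where "x = frag_of (a + a', b, c) - frag_of (a, b, c) - frag_of (a', b, c)" "a \<in> A" "a' \<in> A" "b \<in> B" "c \<in> C"
      | a b b' c where "x = frag_of (a, b + b', c) - frag_of (a, b, c) - frag_of (a, b', c)" "a \<in> A" "b \<in> B" "b' \<in> B" "c \<in> C"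
      | a b c c' where "x = frag_of (a, b, c + c') - frag_of (a, b, c) - frag_of (a, b, c')" "a \<in> A" "b \<in> B" "c \<in> C" "c' \<in> C"
      using x unfolding gens3_def by blast
    then show ?thesis
    proof cases
      case 1
      then have "\<phi> x = frag_of (f a + f a', g b, h c) - frag_of (f a, g b, h c) - frag_of (f a', g b, h c)"
        by (simp add: \<phi>_def frag_extend_diff f)
      then show ?thesis using 1 f(1) g(1) h(1) by (simp add: gens3I)
    next
      case 2
      then have "\<phi> x = frag_of (f a, g b + g b', h c) - frag_of (f a, g b, h c) - frag_of (f a, g b', h c)"
        by (simp add: \<phi>_def frag_extend_diff g)
      then show ?thesis using 2 f(1) g(1) h(1) by (simp add: gens3I)
    next
      case 3
      then have "\<phi> x = frag_of (f a, g b, h c + h c') - frag_of (f a, g b, h c) - frag_of (f a, g b, h c')"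
        by (simp add: \<phi>_def frag_extend_diff h)
      then show ?thesis using 3 f(1) g(1) h(1) by (simp add: gens3I)
    qed
  qed
  then have sub: "\<phi> ` gens3 A B C \<subseteq> rel3 A' B' C'" unfolding rel3_gens by (auto intro: generate.incl)
  show "\<phi> ` rel3 A B C \<subseteq> rel3 A' B' C'"
    unfolding rel3_gens[of A B C]
    by (rule hom_generate_subset[OF group_free_Abelian_group group_free_Abelian_group hom gens3_carrier[OF cl(1-3)] sub rel3_subgroup[OF cl(4-6)]])
qed

lemma tensor3_comm_group:
  assumes "add_closed A" "add_closed B" "add_closed C" shows "comm_group (tensor3 A B C)"
  unfolding tensor3_def by (rule comm_group.abelian_FactGroup[OF abelian_free_Abelian_group rel3_subgroup[OF assms]])

definition pure :: "'a::ab_group_add set \<Rightarrow> 'b::ab_group_add set \<Rightarrow> 'd::ab_group_add set \<Rightarrow> 'a \<times> 'b \<times> 'd \<Rightarrow> ('a \<times> 'b \<times> 'd \<Rightarrow>\<^sub>0 int) set" where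
  "pure A B C t = rel3 A B C #>\<^bsub>free_Abelian_group (A \<times> B \<times> C)\<^esub> frag_of t"

lemma pure_carrier: "t \<in> A \<times> B \<times> C \<Longrightarrow> pure A B C t \<in> carrier (tensor3 A B C)"
  unfolding pure_def tensor3_def carrier_FactGroup by (rule imageI) (simp add: keys_frag_of)

lemma pure_sum:
  assumes cl: "add_closed A" "add_closed B" "add_closed C" and t: "t \<in> A \<times> B \<times> C" "t' \<in> A \<times> B \<times> C" "t'' \<in> A \<times> B \<times> C"
    and g: "frag_of t - frag_of t' - frag_of t'' \<in> gens3 A B C"
  shows "pure A B C t = pure A B C t' \<otimes>\<^bsub>tensor3 A B C\<^esub> pure A B C t''"
proof -
  let ?G = "free_Abelian_group (A \<times> B \<times> C)"
  have c: "frag_of t \<in> carrier ?G" "frag_of t' \<in> carrier ?G" "frag_of t'' \<in> carrier ?G" using t by (simp_all add: keys_frag_of)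
  have k: "Poly_Mapping.keys (frag_of t' + frag_of t'') \<subseteq> A \<times> B \<times> C"
    using Poly_Mapping.keys_add[of "frag_of t'" "frag_of t''"] t by (auto simp: keys_frag_of)
  have "rel3 A B C #>\<^bsub>?G\<^esub> frag_of t = rel3 A B C #>\<^bsub>?G\<^esub> (frag_of t' + frag_of t'')"
  proof (rule r_coset_eqI[OF abelian_free_Abelian_group rel3_subgroup[OF cl] c(1)])
    show "frag_of t' + frag_of t'' \<in> carrier ?G" using k by simp
    have "frag_of t - frag_of t' - frag_of t'' \<in> rel3 A B C" unfolding rel3_gens by (rule generate.incl[OF g])
    moreover have "frag_of t \<otimes>\<^bsub>?G\<^esub> inv\<^bsub>?G\<^esub> (frag_of t' + frag_of t'') = frag_of t - frag_of t' - frag_of t''"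
      using k by (simp add: algebra_simps)
    ultimately show "frag_of t \<otimes>\<^bsub>?G\<^esub> inv\<^bsub>?G\<^esub> (frag_of t' + frag_of t'') \<in> rel3 A B C"
      by (simp only:)
  qed
  also have "\<dots> = (rel3 A B C #>\<^bsub>?G\<^esub> frag_of t') <#>\<^bsub>?G\<^esub> (rel3 A B C #>\<^bsub>?G\<^esub> frag_of t'')"
    using r_coset_mult[OF abelian_free_Abelian_group rel3_subgroup[OF cl] c(2,3)] by simp
  finally show ?thesis by (simp add: pure_def tensor3_def)
qed

lemma pure_add:
  assumes cl: "add_closed A" "add_closed B" "add_closed C" and t: "a \<in> A" "b \<in> B" "c \<in> C"
  shows "a' \<in> A \<Longrightarrow> pure A B C (a + a', b, c) = pure A B C (a, b, c) \<otimes>\<^bsub>tensor3 A B C\<^esub> pure A B C (a', b, c)"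
    "b' \<in> B \<Longrightarrow> pure A B C (a, b + b', c) = pure A B C (a, b, c) \<otimes>\<^bsub>tensor3 A B C\<^esub> pure A B C (a, b', c)"
    "c' \<in> C \<Longrightarrow> pure A B C (a, b, c + c') = pure A B C (a, b, c) \<otimes>\<^bsub>tensor3 A B C\<^esub> pure A B C (a, b, c')"
proof -
  show "a' \<in> A \<Longrightarrow> pure A B C (a + a', b, c) = pure A B C (a, b, c) \<otimes>\<^bsub>tensor3 A B C\<^esub> pure A B C (a', b, c)"
    using cl(1) t unfolding add_closed_def
    by (intro pure_sum[OF cl]) (simp_all add: gens3I)
  show "b' \<in> B \<Longrightarrow> pure A B C (a, b + b', c) = pure A B C (a, b, c) \<otimes>\<^bsub>tensor3 A B C\<^esub> pure A B C (a, b', c)"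
    using cl(2) t unfolding add_closed_def
    by (intro pure_sum[OF cl]) (simp_all add: gens3I)
  show "c' \<in> C \<Longrightarrow> pure A B C (a, b, c + c') = pure A B C (a, b, c) \<otimes>\<^bsub>tensor3 A B C\<^esub> pure A B C (a, b, c')"
    using cl(3) t unfolding add_closed_def
    by (intro pure_sum[OF cl]) (simp_all add: gens3I)
qed

section \<open>The module of triples and its coinvariants\<close>

context sh_setting
begin

lemma Delta0_closed: "add_closed (Delta0 S)" by (simp add: add_closed_def Delta0_add)

lemma bicoeff_add: "bicoeff (P + Q) i j = bicoeff P i j + bicoeff Q i j" by (simp add: bicoeff_def)

lemma Vkk_add: "P \<in> Vkk S \<Longrightarrow> Q \<in> Vkk S \<Longrightarrow> P + Q \<in> Vkk S"
  unfolding Vkk_def bicoeff_add mem_Collect_eq using subfieldD(7)[OF L_subfield] by (metis add_0)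

lemma Vkk_closed: "add_closed (Vkk S)" by (simp add: add_closed_def Vkk_add)

lemma Vkk_0: "0 \<in> Vkk S" by (simp add: Vkk_def bicoeff_def subfieldD[OF L_subfield])

lemma coeff_poly_Y: "coeff (poly_Y q) j = [:coeff q j:]"
  by (simp add: poly_Y_def coeff_map_poly)

lemma bicoeff_tensor: "bicoeff (smult [:r:] (poly_X A * poly_Y B)) i j = r * coeff A i * coeff B j"
  by (simp add: bicoeff_def poly_X_def coeff_poly_Y)

lemma Vkk_tensor:
  assumes "r \<in> coef S" "\<And>i. coeff A i \<in> coef S" "\<And>i. coeff B i \<in> coef S" "degree A \<le> wt S" "degree B \<le> wt S"
  shows "smult [:r:] (poly_X A * poly_Y B) \<in> Vkk S"
proof -
  have "coeff A i = 0" "coeff B i = 0" if "\<not> i \<le> wt S" for i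
    using that assms(4,5) by (simp_all add: coeff_eq_0)
  then show ?thesis unfolding Vkk_def mem_Collect_eq bicoeff_tensor using assms(1-3) by (auto simp: subfieldD[OF L_subfield])
qed

lemma Vkk_sum: "(\<And>x. x \<in> A \<Longrightarrow> f x \<in> Vkk S) \<Longrightarrow> sum f A \<in> Vkk S"
  by (induction A rule: infinite_finite_induct) (auto simp: Vkk_0 Vkk_add)

lemma poly_linear_power:
  assumes "e \<in> coef S" "e' \<in> coef S" "f \<in> coef S" "f' \<in> coef S" "i \<le> k"
  shows "coeff ([:e, e':] ^ i * [:f, f':] ^ (k - i)) j \<in> coef S" "degree ([:e, e':] ^ i * [:f, f':] ^ (k - i)) \<le> k"
proof -
  have mult: "coeff (P * Q) j \<in> coef S" if "\<And>j. coeff P j \<in> coef S" "\<And>j. coeff Q j \<in> coef S" for P Q :: "'c poly" and j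
    unfolding coeff_mult by (rule subfield_sum[OF L_subfield]) (intro subfieldD(4)[OF L_subfield] that)
  have pow: "coeff (P ^ n) j \<in> coef S" if "\<And>j. coeff P j \<in> coef S" for P :: "'c poly" and j n
    using that by (induction n arbitrary: j) (auto simp: one_pCons coeff_pCons intro!: mult subfieldD(1,2)[OF L_subfield] split: nat.splits)
  have lin: "coeff [:a, b:] j \<in> coef S" if "a \<in> coef S" "b \<in> coef S" for a b :: 'c and j
    using that by (auto simp: coeff_pCons subfieldD[OF L_subfield] split: nat.splits)
  show "coeff ([:e, e':] ^ i * [:f, f':] ^ (k - i)) j \<in> coef S"
    by (intro mult pow lin assms)
  have "degree ([:e, e':] ^ i) \<le> 1 * i" "degree ([:f, f':] ^ (k - i)) \<le> 1 * (k - i)"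
    by (intro order_trans[OF degree_power_le] mult_right_mono; simp)+
  then show "degree ([:e, e':] ^ i * [:f, f':] ^ (k - i)) \<le> k"
    using degree_mult_le[of "[:e, e':] ^ i" "[:f, f':] ^ (k - i)"] assms(5) by linarith
qed

lemma V_act_Vkk:
  assumes g: "g \<in> GLF" and P: "P \<in> Vkk S" shows "V_act S g P \<in> Vkk S"
  unfolding V_act_def Let_def
proof (intro Vkk_sum Vkk_tensor)
  have e: "emb S (g $ i $ j) \<in> coef S" "emb2 S (g $ i $ j) \<in> coef S" for i j
    using embF_L GLF_D(1)[OF g] cnj_F(1) by (auto simp: emb2_def)
  have "det g \<in> F" using GLF_D(1)[OF g] by (simp add: det_2 subfieldD[OF F_subfield])
  then have "emb S (det g) \<in> coef S" "emb2 S (det g) \<in> coef S" using embF_L cnj_F(1) by (auto simp: emb2_def)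
  then have "det_factor S g \<in> coef S" unfolding det_factor_def by (intro subfieldD(9,4)[OF L_subfield])
  then show "bicoeff P i j / det_factor S g \<in> coef S" for i j
    using P by (intro subfieldD(8)[OF L_subfield]) (auto simp: Vkk_def)
  show "coeff ([:emb S (g $ 1 $ 2), emb S (g $ 2 $ 2):] ^ i * [:emb S (g $ 1 $ 1), emb S (g $ 2 $ 1):] ^ (wt S - i)) l \<in> coef S"
    "degree ([:emb S (g $ 1 $ 2), emb S (g $ 2 $ 2):] ^ i * [:emb S (g $ 1 $ 1), emb S (g $ 2 $ 1):] ^ (wt S - i)) \<le> wt S"
    if "i \<in> {..wt S}" for i l using that by (intro poly_linear_power e; simp)+
  show "coeff ([:emb2 S (g $ 1 $ 2), emb2 S (g $ 2 $ 2):] ^ i * [:emb2 S (g $ 1 $ 1), emb2 S (g $ 2 $ 1):] ^ (wt S - i)) l \<in> coef S"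
    "degree ([:emb2 S (g $ 1 $ 2), emb2 S (g $ 2 $ 2):] ^ i * [:emb2 S (g $ 1 $ 1), emb2 S (g $ 2 $ 1):] ^ (wt S - i)) \<le> wt S"
    if "i \<in> {..wt S}" for i l using that by (intro poly_linear_power e; simp)+
qed

lemma V_act_add: "V_act S g (P + Q) = V_act S g P + V_act S g Q"
proof -
  have "smult [:(x + y) / d:] r = smult [:x / d:] r + smult [:y / d:] r" for x y d :: 'c and r
  proof -
    have "[:(x + y) / d:] = [:x / d:] + [:y / d:]" by (simp add: add_divide_distrib)
    then show ?thesis by (simp only: smult_add_left)
  qed
  then show ?thesis by (simp add: V_act_def Let_def bicoeff_add sum.distrib)
qed

text \<open>The two instances are \<open>DivH S\<close> and \<open>Div0H S\<close>, whose
  coinvariants are treated at once.\<close>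

definition stable :: "('c \<Rightarrow>\<^sub>0 int) set \<Rightarrow> bool" where
  "stable B \<longleftrightarrow> add_closed B \<and> (\<forall>g\<in>GLF. \<forall>E\<in>B. Hp_act S g E \<in> B)"

lemma stable_DivH: "stable (DivH S)" "stable (Div0H S)"
  by (simp_all add: stable_def add_closed_def DivH_add Div0H_add Hp_act_DivH Hp_act_Div0H)

abbreviation "rl B \<equiv> rel3 (Delta0 S) B (Vkk S)"
abbreviation "fr B \<equiv> free_Abelian_group (Delta0 S \<times> B \<times> Vkk S)"
abbreviation "actf g \<equiv> frag_extend (\<lambda>(D, E, P). frag_of (cusp_act g D, Hp_act S g E, V_act S g P))"

lemma T3_group: "stable B \<Longrightarrow> comm_group (T3 S B)"
  unfolding T3_def by (rule tensor3_comm_group) (simp_all add: Delta0_closed Vkk_closed stable_def)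

lemma T3_Mod: "T3 S B = fr B Mod rl B" by (simp add: T3_def tensor3_def)

lemma rl_subgroup: "stable B \<Longrightarrow> subgroup (rl B) (fr B)"
  by (rule rel3_subgroup) (simp_all add: Delta0_closed Vkk_closed stable_def)

lemma actf_hom:
  assumes g: "g \<in> GLF" and B: "stable B"
  shows "actf g \<in> hom (fr B) (fr B)" "actf g ` rl B \<subseteq> rl B"
proof -
  have cl: "add_closed (Delta0 S)" "add_closed B" "add_closed (Vkk S)" using Delta0_closed Vkk_closed B by (simp_all add: stable_def)
  note R = rel3_map[of "Delta0 S" B "Vkk S" "Delta0 S" B "Vkk S" "cusp_act g" "Hp_act S g" "V_act S g", OF cl cl]
  have a: "cusp_act g (D + E) = cusp_act g D + cusp_act g E" for D E by (simp add: cusp_act_def frag_extend_add)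
  have b: "Hp_act S g (D + E) = Hp_act S g D + Hp_act S g E" for D E by (simp add: Hp_act_def frag_extend_add)
  have c: "Hp_act S g E \<in> B" if "E \<in> B" for E using that B g by (simp add: stable_def)
  show "actf g \<in> hom (fr B) (fr B)"
    by (rule R(1)) (simp_all add: a b c cusp_act_Delta0[OF g] V_act_Vkk[OF g] V_act_add)
  show "actf g ` rl B \<subseteq> rl B"
    by (rule R(2)) (simp_all add: a b c cusp_act_Delta0[OF g] V_act_Vkk[OF g] V_act_add)
qed

lemma rep_pgl:
  obtains z where "z \<in> F" "z \<noteq> 0" "rep (pgl F g) = mat z ** g"
proof -
  have "pgl F g = (\<Union>h\<in>scalars F. {h ** g})" by (simp add: pgl_def r_coset_def GL2_def)
  also have "\<dots> = (\<lambda>z. mat z ** g) ` (F - {0})" unfolding scalars_def by blast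
  finally have eq: "pgl F g = (\<lambda>z. mat z ** g) ` (F - {0})" .
  have "mat 1 ** g \<in> pgl F g" unfolding eq by (rule imageI) (simp add: subfieldD[OF F_subfield])
  from someI[of "\<lambda>h. h \<in> pgl F g", OF this] have "rep (pgl F g) \<in> pgl F g" unfolding rep_def .
  then have "rep (pgl F g) \<in> (\<lambda>z. mat z ** g) ` (F - {0})" by (simp only: eq)
  then obtain z where z: "rep (pgl F g) = mat z ** g" "z \<in> F - {0}" by (rule imageE)
  show thesis by (rule that[OF _ _ z(1)]) (use z(2) in simp_all)
qed

lemma Gam_rep:
  assumes "\<gamma> \<in> carrier (Gam S)" obtains g z where "g \<in> R1 S" "z \<in> F" "z \<noteq> 0" "rep \<gamma> = mat z ** g"
proof -
  obtain g where g: "g \<in> R1 S" "\<gamma> = pgl F g" using assms by (auto simp: Gam_def)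
  obtain z where "z \<in> F" "z \<noteq> 0" "rep (pgl F g) = mat z ** g" by (rule rep_pgl)
  then show thesis using that g by simp
qed

lemma scalar_GLF: "g \<in> GLF \<Longrightarrow> z \<in> F \<Longrightarrow> z \<noteq> 0 \<Longrightarrow> mat z ** g \<in> GLF"
  unfolding GLF_def by (auto simp: det_mul det_2 mat_sel mat2_mult_sel forall_2 subfieldD[OF F_subfield])

lemma Gam_rep_GLF: "\<gamma> \<in> carrier (Gam S) \<Longrightarrow> rep \<gamma> \<in> GLF"
  by (erule Gam_rep) (simp add: scalar_GLF R1_D(4))

lemma moebius_scalar: "z \<noteq> 0 \<Longrightarrow> moebius (mat z ** g) c = moebius g c"
  by (cases c) (simp_all add: moebius_def Let_def mat2_mult_sel mat_sel mult.assoc distrib_left[symmetric])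

lemma Hp_moebius_scalar:
  assumes "g \<in> GLF" "z \<in> F" "z \<noteq> 0" shows "Hp_moebius S (mat z ** g) y = Hp_moebius S g y"
proof -
  have "emb S z \<noteq> 0" using assms emb_eq_0 by blast
  then show ?thesis using assms(2) GLF_D(1)[OF assms(1)]
    by (simp add: Hp_moebius_def mat2_mult_sel mat_sel emb_mult mult.assoc right_diff_distrib[symmetric])
qed

text \<open>The binary forms contribute \<open>Z\<close> and \<open>Z2\<close> to the power
  \<open>wt S\<close>, and \<open>det_factor\<close> contributes their squares to the power
  \<open>wt S div 2\<close>; the weight being even, these cancel.\<close>

lemma V_act_scalar:
  assumes g: "g \<in> GLF" and z: "z \<in> F" "z \<noteq> 0" shows "V_act S (mat z ** g) P = V_act S g P"
proof -
  define Z Z2 where "Z = emb S z" "Z2 = emb2 S z"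
  have zc: "cnj z \<in> F" "cnj z \<noteq> 0" using z cnj_F(1) by auto
  have Z: "Z \<noteq> 0" "Z2 \<noteq> 0" using emb_eq_0[OF z(1)] emb_eq_0[OF zc(1)] z(2) zc(2) by (simp_all add: Z_Z2_def emb2_def)
  have gc: "cnj (g $ i $ j) \<in> F" for i j using GLF_D(1)[OF g] cnj_F(1) by blast
  have ent: "emb S ((mat z ** g) $ i $ j) = Z * emb S (g $ i $ j)" "emb2 S ((mat z ** g) $ i $ j) = Z2 * emb2 S (g $ i $ j)" for i j
    using GLF_D(1)[OF g] gc z zc exhaust_2[of i] by (auto simp: mat2_mult_sel mat_sel Z_Z2_def emb2_def emb_mult)
  have dF: "det g \<in> F" "cnj (det g) \<in> F" using GLF_D(1)[OF g] cnj_F(1) by (simp_all add: det_2 subfieldD[OF F_subfield])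
  have "det (mat z :: complex^2^2) = z * z" by (simp add: det_2 mat_sel)
  then have "det (mat z ** g) = (z * z) * det g" by (simp only: det_mul)
  then have "emb S (det (mat z ** g)) = Z * Z * emb S (det g)" "emb2 S (det (mat z ** g)) = Z2 * Z2 * emb2 S (det g)"
    using dF z zc by (simp_all add: emb2_def emb_mult subfieldD[OF F_subfield] Z_Z2_def)
  then have "det_factor S (mat z ** g) = ((Z * Z2) ^ 2 * (emb S (det g) * emb2 S (det g))) ^ (wt S div 2)"
    by (simp add: det_factor_def power2_eq_square mult_ac)
  also have "\<dots> = (Z * Z2) ^ (2 * (wt S div 2)) * det_factor S g"
    by (simp only: power_mult_distrib[of "(Z * Z2) ^ 2"] power_mult det_factor_def)
  finally have d: "det_factor S (mat z ** g) = (Z * Z2) ^ wt S * det_factor S g" using wt_even by simp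
  have lin: "[:x * a, x * b:] = smult x [:a, b:]" for x a b :: 'c by simp
  have "smult [:r / det_factor S (mat z ** g):] (poly_X ([:Z * b, Z * d:] ^ i * [:Z * a, Z * c:] ^ (wt S - i)) *
      poly_Y ([:Z2 * b', Z2 * d':] ^ j * [:Z2 * a', Z2 * c':] ^ (wt S - j))) =
    smult [:r / det_factor S g:] (poly_X ([:b, d:] ^ i * [:a, c:] ^ (wt S - i)) * poly_Y ([:b', d':] ^ j * [:a', c':] ^ (wt S - j)))"
    if ij: "i \<le> wt S" "j \<le> wt S" for r a b c d a' b' c' d' i j
  proof (rule poly_eqI, rule poly_eqI)
    fix n l
    have pw: "Z ^ i * Z ^ (wt S - i) = Z ^ wt S" "Z ^ (wt S - i) * Z ^ i = Z ^ wt S"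
      "Z2 ^ j * Z2 ^ (wt S - j) = Z2 ^ wt S" "Z2 ^ (wt S - j) * Z2 ^ j = Z2 ^ wt S"
      using ij by (simp_all add: power_add[symmetric])
    have A: "[:Z * b, Z * d:] ^ i * [:Z * a, Z * c:] ^ (wt S - i) = smult (Z ^ wt S) ([:b, d:] ^ i * [:a, c:] ^ (wt S - i))"
      by (simp only: lin smult_power mult_smult_left mult_smult_right smult_smult pw)
    have B: "[:Z2 * b', Z2 * d':] ^ j * [:Z2 * a', Z2 * c':] ^ (wt S - j) = smult (Z2 ^ wt S) ([:b', d':] ^ j * [:a', c':] ^ (wt S - j))"
      by (simp only: lin smult_power mult_smult_left mult_smult_right smult_smult pw)
    show "coeff (coeff (smult [:r / det_factor S (mat z ** g):] (poly_X ([:Z * b, Z * d:] ^ i * [:Z * a, Z * c:] ^ (wt S - i)) *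
      poly_Y ([:Z2 * b', Z2 * d':] ^ j * [:Z2 * a', Z2 * c':] ^ (wt S - j)))) n) l =
      coeff (coeff (smult [:r / det_factor S g:] (poly_X ([:b, d:] ^ i * [:a, c:] ^ (wt S - i)) * poly_Y ([:b', d':] ^ j * [:a', c':] ^ (wt S - j)))) n) l"
      unfolding A B bicoeff_def[symmetric] bicoeff_tensor d using Z by (simp add: field_simps)
  qed
  then show ?thesis unfolding V_act_def Let_def ent by (intro sum.cong refl) simp
qed

lemma act3_coset:
  assumes g: "\<gamma> \<in> carrier (Gam S)" and B: "stable B" and c: "c \<in> carrier (fr B)"
  shows "act3 S B \<gamma> (rl B #>\<^bsub>fr B\<^esub> c) = rl B #>\<^bsub>fr B\<^esub> actf (rep \<gamma>) c"
  unfolding act3_def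
  by (rule quot_map_coset[OF abelian_free_Abelian_group abelian_free_Abelian_group rl_subgroup[OF B] rl_subgroup[OF B]
      actf_hom[OF Gam_rep_GLF[OF g] B] c])

lemma act3_carrier:
  assumes g: "\<gamma> \<in> carrier (Gam S)" and B: "stable B" and m: "m \<in> carrier (T3 S B)"
  shows "act3 S B \<gamma> m \<in> carrier (T3 S B)"
proof -
  obtain c where c: "c \<in> carrier (fr B)" "m = rl B #>\<^bsub>fr B\<^esub> c" using m unfolding T3_Mod carrier_FactGroup by blast
  show ?thesis unfolding c(2) act3_coset[OF g B c(1)] T3_Mod carrier_FactGroup
    by (rule imageI, rule hom_in_carrier[OF actf_hom(1)[OF Gam_rep_GLF[OF g] B] c(1)])
qed

abbreviation "cgens B \<equiv> {act3 S B g m \<otimes>\<^bsub>T3 S B\<^esub> inv\<^bsub>T3 S B\<^esub> m | g m. g \<in> carrier (Gam S) \<and> m \<in> carrier (T3 S B)}"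
abbreviation "csub B \<equiv> coinv_sub (Gam S) (act3 S B) (T3 S B)"

lemma cgens_carrier:
  assumes B: "stable B" shows "cgens B \<subseteq> carrier (T3 S B)"
proof -
  interpret T: comm_group "T3 S B" by (rule T3_group[OF B])
  show ?thesis using act3_carrier[OF _ B] by auto
qed

lemma csub_subgroup: "stable B \<Longrightarrow> subgroup (csub B) (T3 S B)"
  unfolding coinv_sub_def by (rule group.generate_is_subgroup[OF comm_group.axioms(2)[OF T3_group] cgens_carrier])

lemma Coinv3_Mod: "Coinv3 S B = T3 S B Mod csub B" by (simp add: Coinv3_def coinv_def)

lemma pure3_eq: "pure3 S B D E P = csub B #>\<^bsub>T3 S B\<^esub> pure (Delta0 S) B (Vkk S) (D, E, P)"
  by (simp add: pure3_def coinv_class_def pure_def)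

lemma pure_T3: "D \<in> Delta0 S \<Longrightarrow> E \<in> B \<Longrightarrow> P \<in> Vkk S \<Longrightarrow> pure (Delta0 S) B (Vkk S) (D, E, P) \<in> carrier (T3 S B)"
  unfolding T3_def by (rule pure_carrier) simp

lemma pure3_carrier: "D \<in> Delta0 S \<Longrightarrow> E \<in> B \<Longrightarrow> P \<in> Vkk S \<Longrightarrow> pure3 S B D E P \<in> carrier (Coinv3 S B)"
  unfolding pure3_eq Coinv3_Mod carrier_FactGroup by (rule imageI, rule pure_T3)

lemma pure3_add:
  assumes B: "stable B" and t: "D \<in> Delta0 S" "E \<in> B" "P \<in> Vkk S"
  shows "D' \<in> Delta0 S \<Longrightarrow> pure3 S B (D + D') E P = pure3 S B D E P \<otimes>\<^bsub>Coinv3 S B\<^esub> pure3 S B D' E P"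
    "E' \<in> B \<Longrightarrow> pure3 S B D (E + E') P = pure3 S B D E P \<otimes>\<^bsub>Coinv3 S B\<^esub> pure3 S B D E' P"
    "P' \<in> Vkk S \<Longrightarrow> pure3 S B D E (P + P') = pure3 S B D E P \<otimes>\<^bsub>Coinv3 S B\<^esub> pure3 S B D E P'"
proof -
  have cl: "add_closed (Delta0 S)" "add_closed B" "add_closed (Vkk S)" using Delta0_closed Vkk_closed B by (simp_all add: stable_def)
  note m = r_coset_mult[OF T3_group[OF B] csub_subgroup[OF B]]
  note a = pure_add[OF cl t, folded T3_def]
  show "D' \<in> Delta0 S \<Longrightarrow> pure3 S B (D + D') E P = pure3 S B D E P \<otimes>\<^bsub>Coinv3 S B\<^esub> pure3 S B D' E P"
    "E' \<in> B \<Longrightarrow> pure3 S B D (E + E') P = pure3 S B D E P \<otimes>\<^bsub>Coinv3 S B\<^esub> pure3 S B D E' P"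
    "P' \<in> Vkk S \<Longrightarrow> pure3 S B D E (P + P') = pure3 S B D E P \<otimes>\<^bsub>Coinv3 S B\<^esub> pure3 S B D E P'"
    unfolding pure3_eq Coinv3_Mod mult_FactGroup using t by (simp_all add: m pure_T3 a)
qed

text \<open>The relations of the coinvariants are written with the chosen representatives
  \<open>rep\<close>; as scalars act trivially, any matrix in the class may be used.\<close>

lemma pure3_act:
  assumes B: "stable B" and t: "D \<in> Delta0 S" "E \<in> B" "P \<in> Vkk S" and g: "g \<in> R1 S"
  shows "pure3 S B (cusp_act g D) (Hp_act S g E) (V_act S g P) = pure3 S B D E P"
proof -
  have \<gamma>: "pgl F g \<in> carrier (Gam S)" using g by (simp add: Gam_def)
  obtain z where z: "z \<in> F" "z \<noteq> 0" "rep (pgl F g) = mat z ** g" by (rule rep_pgl)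
  have gG: "g \<in> GLF" by (rule R1_D(4)[OF g])
  have "cusp_act (rep (pgl F g)) = cusp_act g" "Hp_act S (rep (pgl F g)) = Hp_act S g" "V_act S (rep (pgl F g)) = V_act S g"
    unfolding z(3) cusp_act_def[abs_def] Hp_act_def[abs_def]
    by (simp_all add: moebius_scalar[OF z(2)] Hp_moebius_scalar[OF gG z(1,2)] V_act_scalar[OF gG z(1,2)] fun_eq_iff)
  then have "actf (rep (pgl F g)) (frag_of (D, E, P)) = frag_of (cusp_act g D, Hp_act S g E, V_act S g P)" by simp
  then have act: "act3 S B (pgl F g) (pure (Delta0 S) B (Vkk S) (D, E, P)) =
      pure (Delta0 S) B (Vkk S) (cusp_act g D, Hp_act S g E, V_act S g P)"
    unfolding pure_def by (subst act3_coset[OF \<gamma> B]) (use t in \<open>simp_all add: keys_frag_of\<close>)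
  have c: "pure (Delta0 S) B (Vkk S) (D, E, P) \<in> carrier (T3 S B)" using t by (rule pure_T3)
  show ?thesis unfolding pure3_eq act[symmetric]
  proof (rule r_coset_eqI[OF T3_group[OF B] csub_subgroup[OF B] act3_carrier[OF \<gamma> B c] c])
    show "act3 S B (pgl F g) (pure (Delta0 S) B (Vkk S) (D, E, P)) \<otimes>\<^bsub>T3 S B\<^esub>
        inv\<^bsub>T3 S B\<^esub> pure (Delta0 S) B (Vkk S) (D, E, P) \<in> csub B"
      unfolding coinv_sub_def by (rule generate.incl) (use \<gamma> c in blast)
  qed
qed

text \<open>The inclusion of divisor groups carries bilinearity relations and coinvariance relations
  into those of the larger module, so both maps induced on quotients can be computed on
  representatives.\<close>

lemma pure3_partial1:
  assumes t: "D \<in> Delta0 S" "E \<in> Div0H S" "P \<in> Vkk S"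
  shows "pure3 S (DivH S) D E P = partial1 S (pure3 S (Div0H S) D E P)"
proof -
  let ?B = "Div0H S" and ?B' = "DivH S"
  note B = stable_DivH(2) and B' = stable_DivH(1)
  have cl: "add_closed (Delta0 S)" "add_closed (Vkk S)" "add_closed ?B" "add_closed ?B'"
    using Delta0_closed Vkk_closed B B' by (simp_all add: stable_def)
  have sub: "?B \<subseteq> ?B'" by (auto simp: Div0H_def)
  have id: "frag_extend (\<lambda>(a, b, c). frag_of (a, b, c)) x = x" for x :: "'c triple \<Rightarrow>\<^sub>0 int"
    using frag_expansion[of x, symmetric] by (simp add: case_prod_unfold)
  have i: "(\<lambda>c. c) \<in> hom (fr ?B) (fr ?B')" "(\<lambda>c. c) ` rl ?B \<subseteq> rl ?B'"
  proof -
    note R = rel3_map[of "Delta0 S" ?B "Vkk S" "Delta0 S" ?B' "Vkk S" "\<lambda>x. x" "\<lambda>x. x" "\<lambda>x. x", OF cl(1,3,2,1,4,2), unfolded id]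
    show "(\<lambda>c. c) \<in> hom (fr ?B) (fr ?B')" by (rule R(1)) (use sub in auto)
    show "(\<lambda>c. c) ` rl ?B \<subseteq> rl ?B'" by (rule R(2)) (use sub in auto)
  qed
  note ab = abelian_free_Abelian_group[of "Delta0 S \<times> ?B \<times> Vkk S"] abelian_free_Abelian_group[of "Delta0 S \<times> ?B' \<times> Vkk S"]
  have inc: "incl3 S (rl ?B #>\<^bsub>fr ?B\<^esub> c) = rl ?B' #>\<^bsub>fr ?B'\<^esub> c" if "c \<in> carrier (fr ?B)" for c
    unfolding incl3_def by (rule quot_map_coset[OF ab rl_subgroup[OF B] rl_subgroup[OF B'] i that])
  have ih: "incl3 S \<in> hom (T3 S ?B) (T3 S ?B')"
    unfolding incl3_def T3_Mod by (rule quot_map_hom[OF ab rl_subgroup[OF B] rl_subgroup[OF B'] i])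
  interpret T: comm_group "T3 S ?B" by (rule T3_group[OF B])
  interpret T': comm_group "T3 S ?B'" by (rule T3_group[OF B'])
  interpret h: group_hom "T3 S ?B" "T3 S ?B'" "incl3 S" by unfold_locales (rule ih)
  have gens: "incl3 S ` cgens ?B \<subseteq> csub ?B'"
  proof
    fix y assume "y \<in> incl3 S ` cgens ?B"
    then obtain \<gamma> m where gm: "\<gamma> \<in> carrier (Gam S)" "m \<in> carrier (T3 S ?B)"
      "y = incl3 S (act3 S ?B \<gamma> m \<otimes>\<^bsub>T3 S ?B\<^esub> inv\<^bsub>T3 S ?B\<^esub> m)" by blast
    obtain c where c: "c \<in> carrier (fr ?B)" "m = rl ?B #>\<^bsub>fr ?B\<^esub> c" using gm(2) unfolding T3_Mod carrier_FactGroup by blast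
    have c': "c \<in> carrier (fr ?B')" using hom_in_carrier[OF i(1) c(1)] .
    have ac: "actf (rep \<gamma>) c \<in> carrier (fr ?B)" by (rule hom_in_carrier[OF actf_hom(1)[OF Gam_rep_GLF[OF gm(1)] B] c(1)])
    have "incl3 S (act3 S ?B \<gamma> m) = act3 S ?B' \<gamma> (incl3 S m)"
      unfolding c(2) act3_coset[OF gm(1) B c(1)] inc[OF ac] inc[OF c(1)] act3_coset[OF gm(1) B' c'] ..
    then have "y = act3 S ?B' \<gamma> (incl3 S m) \<otimes>\<^bsub>T3 S ?B'\<^esub> inv\<^bsub>T3 S ?B'\<^esub> (incl3 S m)"
      unfolding gm(3) using gm(2) act3_carrier[OF gm(1) B gm(2)] by simp
    then show "y \<in> csub ?B'" unfolding coinv_sub_def using gm(1) h.hom_closed[OF gm(2)] by (intro generate.incl) blast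
  qed
  have csub: "incl3 S ` csub ?B \<subseteq> csub ?B'"
    using hom_generate_subset[OF T.group_axioms T'.group_axioms ih cgens_carrier[OF B] gens csub_subgroup[OF B']]
    unfolding coinv_sub_def[of "Gam S" "act3 S ?B"] .
  have fc: "frag_of (D, E, P) \<in> carrier (fr ?B)" using t by (simp add: keys_frag_of)
  have "partial1 S (pure3 S ?B D E P) = csub ?B' #>\<^bsub>T3 S ?B'\<^esub> incl3 S (pure (Delta0 S) ?B (Vkk S) (D, E, P))"
    unfolding partial1_def pure3_eq
    by (rule quot_map_coset[OF T3_group[OF B] T3_group[OF B'] csub_subgroup[OF B] csub_subgroup[OF B'] ih csub pure_T3[OF t]])
  also have "incl3 S (pure (Delta0 S) ?B (Vkk S) (D, E, P)) = pure (Delta0 S) ?B' (Vkk S) (D, E, P)"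
    unfolding pure_def by (rule inc[OF fc])
  finally show ?thesis by (simp add: pure3_eq)
qed

end

section \<open>Functionals on Abel-Jacobi images\<close>

text \<open>A basis over the rationals that contains \<open>y\<close>. Additivity is all that is
  kept of the field; real values are wanted for the averaging.\<close>

lemma rational_functional:
  assumes y: "(y :: 'c::field_char_0) \<noteq> 0"
  shows "\<exists>l :: 'c \<Rightarrow> real. (\<forall>a b. l (a + b) = l a + l b) \<and> l y = 1"
proof -
  interpret vector_space_pair "\<lambda>(q :: rat) x :: 'c. of_rat q * x" "\<lambda>(q :: rat) x :: real. of_rat q * x"
    by unfold_locales (simp_all add: algebra_simps of_rat_add of_rat_mult)
  have "vs1.independent {y}" using y by simp
  from linear_independent_extend[OF this, of "\<lambda>_. 1"]
  obtain g where g: "Vector_Spaces.linear (\<lambda>(q :: rat) x :: 'c. of_rat q * x) (\<lambda>(q :: rat) x :: real. of_rat q * x) g" "g y = 1"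
    by auto
  have "g (a + b) = g a + g b" for a b by (rule linear_add[OF g(1)])
  then show ?thesis using g(2) by blast
qed

lemma of_real_of_rat: "complex_of_real (of_rat q) = of_rat q"
  by (cases q) (simp add: of_rat_rat)

text \<open>For \<open>\<mu>\<close> in \<open>MSf S\<close> these functionals vanish on
  \<open>Fil S l\<close>, and together they separate the classes modulo it, see
  \<open>coset_le\<close>; so equations in the quotient become equations between p-adic
  numbers.\<close>

definition ev :: "'c::field \<Rightarrow> 'm \<Rightarrow> ('m \<Rightarrow> 'c) \<times> ('m \<Rightarrow> 'c) \<Rightarrow> 'c" where
  "ev l \<mu> y = fst y \<mu> + l * snd y \<mu>"

definition evc :: "'c::field \<Rightarrow> 'm \<Rightarrow> (('m \<Rightarrow> 'c) \<times> ('m \<Rightarrow> 'c)) set \<Rightarrow> 'c" where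
  "evc l \<mu> W = ev l \<mu> (SOME y. y \<in> W)"

lemma DfL_mult: "x \<otimes>\<^bsub>DfL S\<^esub> y = (\<lambda>\<mu>\<in>MSf S. fst x \<mu> + fst y \<mu>, \<lambda>\<mu>\<in>MSf S. snd x \<mu> + snd y \<mu>)"
  by (cases x; cases y) (simp add: DfL_def MSf_dual_def DirProd_def)

lemma DfL_carrier: "x \<in> carrier (DfL S) \<longleftrightarrow> fst x \<in> carrier (MSf_dual S) \<and> snd x \<in> carrier (MSf_dual S)"
  by (cases x) (simp add: DfL_def)

lemma ev_mult: "\<mu> \<in> MSf S \<Longrightarrow> ev l \<mu> (x \<otimes>\<^bsub>DfL S\<^esub> y) = ev l \<mu> x + ev l \<mu> y"
  by (simp add: ev_def DfL_mult algebra_simps)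

lemma ev_Fil: "\<mu> \<in> MSf S \<Longrightarrow> h \<in> Fil S l \<Longrightarrow> ev l \<mu> h = 0"
  by (auto simp: Fil_def ev_def dual_scale_def)

lemma ev_coset:
  assumes "\<mu> \<in> MSf S" "y \<in> Fil S l #>\<^bsub>DfL S\<^esub> w" shows "ev l \<mu> y = ev l \<mu> w"
proof -
  obtain h where "h \<in> Fil S l" "y = h \<otimes>\<^bsub>DfL S\<^esub> w" using assms(2) by (auto simp: r_coset_def)
  then show ?thesis using assms(1) by (simp add: ev_mult ev_Fil)
qed

lemma coset_nonempty:
  assumes "w \<in> carrier (DfL S)" shows "\<exists>y. y \<in> Fil S l #>\<^bsub>DfL S\<^esub> w"
proof -
  have "(dual_scale S (- l) (snd w), snd w) \<in> Fil S l" using assms unfolding Fil_def DfL_carrier by blast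
  then show ?thesis unfolding r_coset_def by blast
qed

lemma evc_coset:
  assumes "\<mu> \<in> MSf S" "w \<in> carrier (DfL S)" shows "evc l \<mu> (Fil S l #>\<^bsub>DfL S\<^esub> w) = ev l \<mu> w"
  unfolding evc_def by (rule ev_coset[OF assms(1) someI_ex[OF coset_nonempty[OF assms(2)]]])

lemma evc_mult:
  assumes \<mu>: "\<mu> \<in> MSf S" and w: "w \<in> carrier (DfL S)" "w' \<in> carrier (DfL S)"
  shows "evc l \<mu> ((Fil S l #>\<^bsub>DfL S\<^esub> w) <#>\<^bsub>DfL S\<^esub> (Fil S l #>\<^bsub>DfL S\<^esub> w')) = ev l \<mu> w + ev l \<mu> w'"
proof -
  let ?W = "(Fil S l #>\<^bsub>DfL S\<^esub> w) <#>\<^bsub>DfL S\<^esub> (Fil S l #>\<^bsub>DfL S\<^esub> w')"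
  have "\<exists>y. y \<in> ?W" using coset_nonempty[OF w(1), of l] coset_nonempty[OF w(2), of l] unfolding set_mult_def by blast
  from someI_ex[OF this] obtain y y' where "y \<in> Fil S l #>\<^bsub>DfL S\<^esub> w" "y' \<in> Fil S l #>\<^bsub>DfL S\<^esub> w'"
    "(SOME y. y \<in> ?W) = y \<otimes>\<^bsub>DfL S\<^esub> y'" unfolding set_mult_def by blast
  then show ?thesis using \<mu> by (simp add: evc_def ev_mult ev_coset)
qed

text \<open>Only affine combinations of elements of the carrier are formed, since closure of the carrier under
  addition would require \<open>MSf\<close> to be closed under addition.\<close>
lemma coset_le:
  assumes L: "is_subfield (coef S)" and w: "w \<in> carrier (DfL S)" "z \<in> carrier (DfL S)"
    and eq: "\<And>\<mu>. \<mu> \<in> MSf S \<Longrightarrow> ev l \<mu> w = ev l \<mu> z"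
  shows "Fil S l #>\<^bsub>DfL S\<^esub> w \<subseteq> Fil S l #>\<^bsub>DfL S\<^esub> z"
proof
  fix x assume "x \<in> Fil S l #>\<^bsub>DfL S\<^esub> w"
  then obtain y where y: "y \<in> carrier (MSf_dual S)" "x = (dual_scale S (- l) y, y) \<otimes>\<^bsub>DfL S\<^esub> w"
    unfolding r_coset_def Fil_def by blast
  \<comment> \<open>Outside \<open>MSf S\<close> all three functionals are \<open>undefined\<close>,
    and \<open>undefined + undefined - undefined\<close> is again \<open>undefined\<close>, so y'
    stays extensional.\<close>
  define y' where "y' = (\<lambda>\<mu>. y \<mu> + snd w \<mu> - snd z \<mu>)"
  have C: "snd w \<in> carrier (MSf_dual S)" "snd z \<in> carrier (MSf_dual S)" using w by (simp_all add: DfL_carrier)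
  have y': "y' \<in> carrier (MSf_dual S)"
  proof -
    have "y' \<mu> \<in> coef S" if "\<mu> \<in> MSf S" for \<mu>
      using that y(1) C unfolding y'_def MSf_dual_def by (auto simp: PiE_iff intro!: subfieldD(3,7)[OF L])
    moreover have "y' \<mu> = undefined" if "\<mu> \<notin> MSf S" for \<mu>
      using that y(1) C unfolding y'_def MSf_dual_def by (simp add: PiE_iff extensional_def)
    ultimately have "y' \<in> MSf S \<rightarrow>\<^sub>E coef S" by (simp add: PiE_iff extensional_def)
    then show ?thesis using y(1) C unfolding MSf_dual_def by (simp add: y'_def algebra_simps)
  qed
  have "x = (dual_scale S (- l) y', y') \<otimes>\<^bsub>DfL S\<^esub> z"
  proof -
    have 1: "dual_scale S (- l) y \<mu> + fst w \<mu> = dual_scale S (- l) y' \<mu> + fst z \<mu>" if \<mu>: "\<mu> \<in> MSf S" for \<mu>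
      using eq[OF \<mu>] \<mu> by (simp add: ev_def dual_scale_def y'_def algebra_simps)
    have 2: "y \<mu> + snd w \<mu> = y' \<mu> + snd z \<mu>" for \<mu> by (simp add: y'_def)
    show ?thesis unfolding y(2) DfL_mult fst_conv snd_conv
      by (intro arg_cong2[where f = Pair] restrict_ext 1) (simp_all add: 2)
  qed
  then show "x \<in> Fil S l #>\<^bsub>DfL S\<^esub> z" unfolding r_coset_def Fil_def using y' by blast
qed

section \<open>The difference of two Abel-Jacobi maps\<close>

locale aj_setting = sh_setting S
  for S :: "'c::{alg_closed_field, field_char_0, complete_space} sh_data" +
  fixes \<L> :: 'c and \<Phi>1 \<Phi>2 and \<mu> :: "'c msymb"
  assumes aj1: "abel_jacobi_map S \<L> \<Phi>1" and aj2: "abel_jacobi_map S \<L> \<Phi>2" and mu: "\<mu> \<in> MSf S"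
begin

lemma aj_coset:
  assumes "abel_jacobi_map S \<L> \<Phi>" "Z \<in> carrier (Coinv3 S (DivH S))"
  obtains w where "w \<in> carrier (DfL S)" "\<Phi> Z = Fil S \<L> #>\<^bsub>DfL S\<^esub> w"
  using assms unfolding abel_jacobi_map_def hom_def carrier_FactGroup by blast

lemma aj_add:
  assumes aj: "abel_jacobi_map S \<L> \<Phi>" and Z: "Z \<in> carrier (Coinv3 S (DivH S))" "Z' \<in> carrier (Coinv3 S (DivH S))"
  shows "evc \<L> \<mu> (\<Phi> (Z \<otimes>\<^bsub>Coinv3 S (DivH S)\<^esub> Z')) = evc \<L> \<mu> (\<Phi> Z) + evc \<L> \<mu> (\<Phi> Z')"
proof -
  obtain w where w: "w \<in> carrier (DfL S)" "\<Phi> Z = Fil S \<L> #>\<^bsub>DfL S\<^esub> w" by (rule aj_coset[OF aj Z(1)])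
  obtain w' where w': "w' \<in> carrier (DfL S)" "\<Phi> Z' = Fil S \<L> #>\<^bsub>DfL S\<^esub> w'" by (rule aj_coset[OF aj Z(2)])
  have "\<Phi> \<in> hom (Coinv3 S (DivH S)) (DfL S Mod Fil S \<L>)" using aj by (simp add: abel_jacobi_map_def)
  from hom_mult[OF this Z] have "\<Phi> (Z \<otimes>\<^bsub>Coinv3 S (DivH S)\<^esub> Z') = \<Phi> Z <#>\<^bsub>DfL S\<^esub> \<Phi> Z'" by simp
  then show ?thesis unfolding w(2) w'(2) by (simp add: evc_mult[OF mu w(1) w'(1)] evc_coset[OF mu w(1)] evc_coset[OF mu w'(1)])
qed

definition Th :: "(complex option \<Rightarrow>\<^sub>0 int) \<Rightarrow> ('c \<Rightarrow>\<^sub>0 int) \<Rightarrow> 'c poly poly \<Rightarrow> 'c" where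
  "Th D E P = evc \<L> \<mu> (\<Phi>1 (pure3 S (DivH S) D E P)) - evc \<L> \<mu> (\<Phi>2 (pure3 S (DivH S) D E P))"

lemma Th_add:
  assumes t: "D \<in> Delta0 S" "E \<in> DivH S" "P \<in> Vkk S"
  shows "D' \<in> Delta0 S \<Longrightarrow> Th (D + D') E P = Th D E P + Th D' E P"
    "E' \<in> DivH S \<Longrightarrow> Th D (E + E') P = Th D E P + Th D E' P"
    "P' \<in> Vkk S \<Longrightarrow> Th D E (P + P') = Th D E P + Th D E P'"
  using t by (simp_all add: Th_def pure3_add[OF stable_DivH(1) t] aj_add[OF aj1] aj_add[OF aj2] pure3_carrier)

lemma Th_Div0H: "D \<in> Delta0 S \<Longrightarrow> E \<in> Div0H S \<Longrightarrow> P \<in> Vkk S \<Longrightarrow> Th D E P = 0"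
  using aj1 aj2 pure3_carrier[of D E "Div0H S" P] by (simp add: Th_def pure3_partial1 abel_jacobi_map_def)

text \<open>The class is unchanged when all three factors are moved by \<open>g\<close>; the middle
  one may be moved back, because \<open>frag_of \<tau> - E\<close> has degree zero.\<close>

lemma Th_act:
  assumes g: "g \<in> R1 S" and D: "D \<in> Delta0 S" and \<tau>: "frag_of \<tau> \<in> DivH S" and P: "P \<in> Vkk S"
  shows "Th (cusp_act g D) (frag_of \<tau>) (V_act S g P) = Th D (frag_of \<tau>) P"
proof -
  note G = R1_D(4)[OF g]
  define E where "E = Hp_act S g (frag_of \<tau>)"
  have E: "E \<in> DivH S" unfolding E_def by (rule Hp_act_DivH[OF G \<tau>])
  have deg: "frag_deg E = 1" by (simp add: E_def Hp_act_def)
  have "frag_of \<tau> - E \<in> DivH S" by (rule DivH_diff[OF \<tau> E])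
  moreover have "frag_deg (frag_of \<tau> - E) = 0" by (simp add: frag_deg_diff deg)
  ultimately have d: "frag_of \<tau> - E \<in> Div0H S" by (simp add: Div0H_def)
  have gD: "cusp_act g D \<in> Delta0 S" "V_act S g P \<in> Vkk S" by (rule cusp_act_Delta0[OF G D], rule V_act_Vkk[OF G P])
  have "Th (cusp_act g D) (E + (frag_of \<tau> - E)) (V_act S g P) = Th (cusp_act g D) E (V_act S g P) + Th (cusp_act g D) (frag_of \<tau> - E) (V_act S g P)"
    by (rule Th_add(2)[OF gD(1) E gD(2) DivH_diff[OF \<tau> E]])
  then have "Th (cusp_act g D) (frag_of \<tau>) (V_act S g P) = Th (cusp_act g D) E (V_act S g P)"
    using Th_Div0H[OF gD(1) d gD(2)] by simp
  also have "\<dots> = Th D (frag_of \<tau>) P"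
    unfolding Th_def E_def using pure3_act[OF stable_DivH(1) D \<tau> P g] by simp
  finally show ?thesis .
qed

lemma Th_0: "D \<in> Delta0 S \<Longrightarrow> E \<in> DivH S \<Longrightarrow> Th D E 0 = 0"
  using Th_add(3)[of D E 0 0] Vkk_0 by simp

lemma Th_sum:
  assumes "D \<in> Delta0 S" "E \<in> DivH S" "\<And>x. x \<in> A \<Longrightarrow> f x \<in> Vkk S"
  shows "Th D E (sum f A) = (\<Sum>x\<in>A. Th D E (f x))"
  using assms(3)
  by (induction A rule: infinite_finite_induct) (simp_all add: Th_0 assms(1,2) Th_add(3) Vkk_sum)

end

section \<open>From polynomials to a modular symbol\<close>

definition qpoly :: "complex^2^2 \<Rightarrow> complex poly" where
  "qpoly X = [:- X $ 1 $ 2, X $ 1 $ 1 - X $ 2 $ 2, X $ 2 $ 1:]"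

text \<open>\<open>e\<close> is a homomorphism on the subfield \<open>E\<close> only, so membership
  of the coefficients in \<open>E\<close> has to be carried along in the induction.\<close>

lemma coeff_power_hom:
  assumes E: "is_subfield E" and e: "\<And>x y. x \<in> E \<Longrightarrow> y \<in> E \<Longrightarrow> e (x + y) = e x + e y"
      "\<And>x y. x \<in> E \<Longrightarrow> y \<in> E \<Longrightarrow> e (x * y) = e x * e y" "e 0 = 0" "e 1 = (1 :: 'b::comm_ring_1)"
    and p: "\<And>i. coeff p i \<in> E" "\<And>i. coeff q i = e (coeff p i)"
  shows "coeff (p ^ n) i \<in> E \<and> coeff (q ^ n) i = e (coeff (p ^ n) i)"
proof (induction n arbitrary: i)
  case 0
  show ?case using subfieldD(1,2)[OF E] e(3,4) by (cases i) (simp_all add: one_pCons)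
next
  case (Suc n)
  have sum: "e (sum f A) = (\<Sum>x\<in>A. e (f x)) \<and> sum f A \<in> E" if "\<And>x. x \<in> A \<Longrightarrow> f x \<in> E" for f :: "nat \<Rightarrow> 'a" and A
    using that by (induction A rule: infinite_finite_induct) (auto simp: e subfieldD[OF E])
  have t: "coeff p k * coeff (p ^ n) (i - k) \<in> E" for k using p(1) Suc.IH by (simp add: subfieldD[OF E])
  have "coeff (q ^ Suc n) i = (\<Sum>k\<le>i. e (coeff p k * coeff (p ^ n) (i - k)))"
    unfolding power_Suc coeff_mult by (intro sum.cong refl) (simp add: p Suc.IH e)
  then show ?case using sum[of "{..i}" "\<lambda>k. coeff p k * coeff (p ^ n) (i - k)"] t
    by (simp add: coeff_mult)
qed

lemma poly_Y_mult: "poly_Y (p * q) = poly_Y p * poly_Y q"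
proof (rule poly_eqI)
  fix n
  have s: "[:sum f A:] = (\<Sum>x\<in>A. [:f x:])" for f :: "nat \<Rightarrow> 'a" and A
  proof -
    have p: "[:a + b:] = [:a:] + [:b:]" for a b :: 'a by simp
    show ?thesis
      by (induction A rule: infinite_finite_induct)
        (simp_all only: sum.infinite sum.empty sum.insert p pCons_0_0 not_False_eq_True)
  qed
  have "coeff (poly_Y (p * q)) n = [:\<Sum>i\<le>n. coeff p i * coeff q (n - i):]"
    by (simp add: poly_Y_def coeff_map_poly coeff_mult)
  also have "\<dots> = (\<Sum>i\<le>n. [:coeff p i:] * [:coeff q (n - i):])" by (simp add: s mult.commute)
  also have "\<dots> = coeff (poly_Y p * poly_Y q) n" by (simp add: poly_Y_def coeff_map_poly coeff_mult)
  finally show "coeff (poly_Y (p * q)) n = coeff (poly_Y p * poly_Y q) n" .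
qed

lemma poly_XY_power: "(poly_X p * poly_Y q) ^ n = poly_X (p ^ n) * poly_Y (q ^ n)"
proof -
  have "poly_X p ^ n = poly_X (p ^ n)" by (induction n) (simp_all add: poly_X_def one_pCons)
  moreover have "poly_Y q ^ n = poly_Y (q ^ n)"
    by (induction n) (simp_all add: poly_Y_mult, simp add: poly_Y_def)
  ultimately show ?thesis by (simp add: power_mult_distrib)
qed

lemma poly_eq_infinite:
  fixes p q :: "'a::field_char_0 poly"
  assumes "r \<noteq> 0" "\<And>t. poly r t \<noteq> 0 \<Longrightarrow> poly p t = poly q t" shows "p = q"
proof (rule ccontr)
  assume "p \<noteq> q"
  then have "p - q \<noteq> 0" by simp
  then have f: "finite {t. poly (p - q) t = 0}" by (rule poly_roots_finite)
  have f': "finite {t. poly r t = 0}" by (rule poly_roots_finite[OF assms(1)])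
  have "UNIV \<subseteq> {t. poly (p - q) t = 0} \<union> {t. poly r t = 0}" using assms(2) by auto
  then have "finite (UNIV :: 'a set)" using finite_UnI[OF f f'] finite_subset by blast
  then show False using infinite_UNIV_char_0 by blast
qed

lemma poly_sum_atMost:
  fixes p :: "'a::comm_ring_1 poly"
  assumes "degree p \<le> N" shows "poly p x = (\<Sum>i\<le>N. coeff p i * x ^ i)"
  unfolding poly_altdef using assms by (intro sum.mono_neutral_left) (auto simp: coeff_eq_0)

lemma norm_vec_le_sum: "norm (x :: 'a::real_normed_vector ^ 'n) \<le> (\<Sum>i\<in>UNIV. norm (x $ i))"
  unfolding norm_vec_def by (rule L2_set_le_sum) simp

lemma bicoeff_sum: "bicoeff (sum f A) r s = (\<Sum>x\<in>A. bicoeff (f x) r s)"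
  by (simp add: bicoeff_def coeff_sum)

text \<open>The left hand side is the homogenisation of the power of a quadratic polynomial, evaluated at two
  linear forms; both sides are compared where the second form does not vanish.\<close>
lemma homogenise_power:
  fixes q q' u v :: "'a::field_char_0 poly"
  assumes q: "degree q \<le> 2" "v \<noteq> 0"
    and eq: "\<And>t. coeff q 0 * poly v t ^ 2 + coeff q 1 * poly u t * poly v t + coeff q 2 * poly u t ^ 2 = poly q' t"
  shows "(\<Sum>i\<le>2 * n. smult (coeff (q ^ n) i) (u ^ i * v ^ (2 * n - i))) = q' ^ n"
proof (rule poly_eq_infinite[OF q(2)])
  fix t assume v: "poly v t \<noteq> 0"
  define x where "x = poly u t / poly v t"
  have deg: "degree (q ^ n) \<le> 2 * n" using degree_power_le[of q n] q(1) by (meson mult_le_mono1 order_trans)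
  have "poly (\<Sum>i\<le>2 * n. smult (coeff (q ^ n) i) (u ^ i * v ^ (2 * n - i))) t =
      (\<Sum>i\<le>2 * n. coeff (q ^ n) i * (poly u t ^ i * poly v t ^ (2 * n - i)))"
    by (simp add: poly_sum)
  also have "\<dots> = (\<Sum>i\<le>2 * n. poly v t ^ (2 * n) * (coeff (q ^ n) i * x ^ i))"
  proof (intro sum.cong refl)
    fix i assume "i \<in> {..2 * n}"
    then have "poly v t ^ (2 * n) = poly v t ^ i * poly v t ^ (2 * n - i)" by (simp add: power_add[symmetric])
    then show "coeff (q ^ n) i * (poly u t ^ i * poly v t ^ (2 * n - i)) = poly v t ^ (2 * n) * (coeff (q ^ n) i * x ^ i)"
      using v by (simp add: x_def power_divide)
  qed
  also have "\<dots> = poly v t ^ (2 * n) * poly (q ^ n) x"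
    by (simp only: poly_sum_atMost[OF deg] sum_distrib_left)
  also have "\<dots> = (poly v t ^ 2 * poly q x) ^ n" by (simp add: power_mult power_mult_distrib)
  also have "poly v t ^ 2 * poly q x = poly q' t"
    unfolding eq[symmetric] poly_sum_atMost[OF q(1)] using v
    by (simp add: x_def numeral_2_eq_2 power2_eq_square field_simps)
  finally show "poly (\<Sum>i\<le>2 * n. smult (coeff (q ^ n) i) (u ^ i * v ^ (2 * n - i))) t = poly (q' ^ n) t" by simp
qed

section \<open>The polynomial attached to a matrix\<close>

locale torus_poly = sh_setting S
  for S :: "'c::{alg_closed_field, field_char_0, complete_space} sh_data" +
  fixes \<kappa> :: 'c
  assumes kap: "\<kappa> \<in> coef S"
begin

abbreviation "n \<equiv> wt S div 2"

lemma wt_n: "2 * n = wt S" using wt_even by simp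

lemma cnj_F': "x \<in> F \<Longrightarrow> cnj x \<in> F" by (rule cnj_F(1))

lemma emb2_hom:
  "x \<in> F \<Longrightarrow> y \<in> F \<Longrightarrow> emb2 S (x + y) = emb2 S x + emb2 S y"
  "x \<in> F \<Longrightarrow> y \<in> F \<Longrightarrow> emb2 S (x * y) = emb2 S x * emb2 S y"
  "x \<in> F \<Longrightarrow> y \<in> F \<Longrightarrow> emb2 S (x - y) = emb2 S x - emb2 S y"
  "x \<in> F \<Longrightarrow> emb2 S (- x) = - emb2 S x" "emb2 S 0 = 0" "emb2 S 1 = 1"
  by (simp_all add: emb2_def emb_add emb_mult emb_diff emb_minus emb_0 emb_1 cnj_F')

definition MF :: "(complex^2^2) set" where "MF = {X. \<forall>i j. X $ i $ j \<in> F}"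

definition qe :: "(complex \<Rightarrow> 'c) \<Rightarrow> complex^2^2 \<Rightarrow> 'c poly" where
  "qe e X = [:- e (X $ 1 $ 2), e (X $ 1 $ 1 - X $ 2 $ 2), e (X $ 2 $ 1):]"

definition Pol :: "complex^2^2 \<Rightarrow> 'c poly poly" where
  "Pol X = smult [:\<kappa>:] ((poly_X (qe (emb S) X) * poly_Y (qe (emb2 S) X)) ^ n)"

definition uc :: "complex^2^2 \<Rightarrow> nat \<Rightarrow> complex" where
  "uc X i = coeff (qpoly X ^ n) i"

lemma qe_coeff:
  assumes X: "X \<in> MF" and e: "e = emb S \<or> e = emb2 S"
  shows "uc X i \<in> F \<and> coeff (qe e X ^ n) i = e (uc X i)"
  unfolding uc_def
proof (rule coeff_power_hom[OF F_subfield])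
  have F: "X $ i $ j \<in> F" for i j using X by (simp add: MF_def)
  show "e (x + y) = e x + e y" "e (x * y) = e x * e y" if "x \<in> F" "y \<in> F" for x y
    using e that by (auto simp: emb_add emb_mult emb2_hom)
  show "e 0 = 0" "e 1 = 1" using e by (auto simp: emb_0 emb_1 emb2_hom)
  show "coeff (qpoly X) i \<in> F" for i
    using F by (auto simp: qpoly_def coeff_pCons subfieldD[OF F_subfield] split: nat.splits)
  show "coeff (qe e X) i = e (coeff (qpoly X) i)" for i
    using e F by (auto simp: qe_def qpoly_def coeff_pCons emb_minus emb2_hom emb_0 split: nat.splits)
qed

lemma Pol_tensor: "Pol X = smult [:\<kappa>:] (poly_X (qe (emb S) X ^ n) * poly_Y (qe (emb2 S) X ^ n))"
  by (simp add: Pol_def poly_XY_power)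

lemma qe_degree: "degree (qe e X) \<le> 2" "degree (qe e X ^ n) \<le> wt S"
proof -
  show d: "degree (qe e X) \<le> 2" by (simp add: qe_def)
  have "degree (qe e X ^ n) \<le> degree (qe e X) * n" by (rule degree_power_le)
  also have "\<dots> \<le> 2 * n" using d by (rule mult_right_mono) simp
  finally show "degree (qe e X ^ n) \<le> wt S" by (simp add: wt_n)
qed

lemma Pol_bicoeff: "X \<in> MF \<Longrightarrow> bicoeff (Pol X) i j = \<kappa> * emb S (uc X i * cnj (uc X j))"
  using qe_coeff[of X "emb S" i] qe_coeff[of X "emb2 S" j]
  by (simp add: Pol_tensor bicoeff_tensor emb_mult cnj_F' emb2_def)

lemma Pol_Vkk: "X \<in> MF \<Longrightarrow> Pol X \<in> Vkk S"
  unfolding Pol_tensor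
proof (rule Vkk_tensor[OF kap _ _ qe_degree(2) qe_degree(2)])
  assume X: "X \<in> MF"
  show "coeff (qe (emb S) X ^ n) i \<in> coef S" for i using qe_coeff[OF X, of "emb S" i] embF_L by auto
  show "coeff (qe (emb2 S) X ^ n) i \<in> coef S" for i using qe_coeff[OF X, of "emb2 S" i] embF_L cnj_F' by (auto simp: emb2_def)
qed

text \<open>\<open>qe e X\<close> is the quadratic form \<open>wedge v (X v)\<close> at
  \<open>v = (-t, 1)\<close>, transported by \<open>e\<close>. The substitution replaces
  \<open>v\<close> by its image under \<open>adj2 g\<close>, which amounts to replacing
  \<open>X\<close> by \<open>cj g X\<close>.\<close>

lemma qe_cj:
  assumes g: "\<And>i j. g $ i $ j \<in> F" and X: "X \<in> MF" and e: "e = emb S \<or> e = emb2 S"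
    and nz: "[:e (g $ 1 $ 1), e (g $ 2 $ 1):] \<noteq> 0"
  shows "(\<Sum>i\<le>wt S. smult (coeff (qe e X ^ n) i) ([:e (g $ 1 $ 2), e (g $ 2 $ 2):] ^ i *
      [:e (g $ 1 $ 1), e (g $ 2 $ 1):] ^ (wt S - i))) = qe e (cj g X) ^ n"
proof -
  have hom: "e (x + y) = e x + e y" "e (x * y) = e x * e y" "e (x - y) = e x - e y" "e (- x) = - e x" if "x \<in> F" "y \<in> F" for x y
    using e that by (auto simp: emb_add emb_mult emb_diff emb_minus emb2_hom)
  have F: "X $ i $ j \<in> F" for i j using X by (simp add: MF_def)
  have ent: "e (cj g X $ 1 $ 2) = (e (g $ 1 $ 1) * e (X $ 1 $ 1) + e (g $ 1 $ 2) * e (X $ 2 $ 1)) * (- e (g $ 1 $ 2)) +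
      (e (g $ 1 $ 1) * e (X $ 1 $ 2) + e (g $ 1 $ 2) * e (X $ 2 $ 2)) * e (g $ 1 $ 1)"
    "e (cj g X $ 1 $ 1 - cj g X $ 2 $ 2) = (e (g $ 1 $ 1) * e (X $ 1 $ 1) + e (g $ 1 $ 2) * e (X $ 2 $ 1)) * e (g $ 2 $ 2) +
      (e (g $ 1 $ 1) * e (X $ 1 $ 2) + e (g $ 1 $ 2) * e (X $ 2 $ 2)) * (- e (g $ 2 $ 1)) -
      ((e (g $ 2 $ 1) * e (X $ 1 $ 1) + e (g $ 2 $ 2) * e (X $ 2 $ 1)) * (- e (g $ 1 $ 2)) +
      (e (g $ 2 $ 1) * e (X $ 1 $ 2) + e (g $ 2 $ 2) * e (X $ 2 $ 2)) * e (g $ 1 $ 1))"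
    "e (cj g X $ 2 $ 1) = (e (g $ 2 $ 1) * e (X $ 1 $ 1) + e (g $ 2 $ 2) * e (X $ 2 $ 1)) * e (g $ 2 $ 2) +
      (e (g $ 2 $ 1) * e (X $ 1 $ 2) + e (g $ 2 $ 2) * e (X $ 2 $ 2)) * (- e (g $ 2 $ 1))"
    unfolding cj_def mat2_mult_sel adj2_sel using F g by (simp_all add: hom subfieldD[OF F_subfield])
  have "coeff (qe e X) 0 * poly [:e (g $ 1 $ 1), e (g $ 2 $ 1):] t ^ 2 + coeff (qe e X) 1 * poly [:e (g $ 1 $ 2), e (g $ 2 $ 2):] t * poly [:e (g $ 1 $ 1), e (g $ 2 $ 1):] t
      + coeff (qe e X) 2 * poly [:e (g $ 1 $ 2), e (g $ 2 $ 2):] t ^ 2 = poly (qe e (cj g X)) t" for t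
    unfolding qe_def[of e "cj g X"] ent using F by (simp add: qe_def hom power2_eq_square numeral_2_eq_2 algebra_simps)
  from homogenise_power[OF qe_degree(1) nz this, of n] show ?thesis unfolding wt_n .
qed

lemma V_act_Pol:
  assumes g: "g \<in> GLF" "det g = 1" and X: "X \<in> MF"
  shows "V_act S g (Pol X) = Pol (cj g X)"
proof -
  have gF: "\<And>i j. g $ i $ j \<in> F" using GLF_D(1)[OF g(1)] .
  have d1: "det_factor S g = 1" by (simp add: det_factor_def g(2) emb_1 emb2_hom)
  have row: "[:e (g $ 1 $ 1), e (g $ 2 $ 1):] \<noteq> 0" if e: "e = emb S \<or> e = emb2 S" for e :: "complex \<Rightarrow> 'c"
  proof
    assume z: "[:e (g $ 1 $ 1), e (g $ 2 $ 1):] = 0"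
    then have "g $ 1 $ 1 = 0" "g $ 2 $ 1 = 0" using e gF cnj_F' emb_eq_0 by (auto simp: emb2_def)
    then show False using g(2) by (simp add: det_2)
  qed
  let ?A = "\<lambda>i. [:emb S (g $ 1 $ 2), emb S (g $ 2 $ 2):] ^ i * [:emb S (g $ 1 $ 1), emb S (g $ 2 $ 1):] ^ (wt S - i)"
  let ?B = "\<lambda>i. [:emb2 S (g $ 1 $ 2), emb2 S (g $ 2 $ 2):] ^ i * [:emb2 S (g $ 1 $ 1), emb2 S (g $ 2 $ 1):] ^ (wt S - i)"
  let ?a = "\<lambda>i. coeff (qe (emb S) X ^ n) i" and ?b = "\<lambda>i. coeff (qe (emb2 S) X ^ n) i"
  note q = qe_cj[OF gF X, of "emb S", OF disjI1[OF refl] row[OF disjI1[OF refl]]]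
    and q2 = qe_cj[OF gF X, of "emb2 S", OF disjI2[OF refl] row[OF disjI2[OF refl]]]
  show ?thesis
  proof (rule poly_eqI, rule poly_eqI, unfold bicoeff_def[symmetric])
    fix s r
    have "bicoeff (V_act S g (Pol X)) r s = (\<Sum>i\<le>wt S. \<Sum>j\<le>wt S. \<kappa> * ?a i * ?b j * coeff (?A i) r * coeff (?B j) s)"
      by (simp only: V_act_def Let_def bicoeff_sum bicoeff_tensor Pol_tensor d1 div_by_1)
    also have "\<dots> = \<kappa> * (\<Sum>i\<le>wt S. ?a i * coeff (?A i) r) * (\<Sum>j\<le>wt S. ?b j * coeff (?B j) s)"
      by (simp add: sum_product sum_distrib_left mult_ac)
    also have "\<dots> = \<kappa> * coeff (qe (emb S) (cj g X) ^ n) r * coeff (qe (emb2 S) (cj g X) ^ n) s"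
      unfolding q[symmetric] q2[symmetric] by (simp add: coeff_sum)
    finally show "bicoeff (V_act S g (Pol X)) r s = bicoeff (Pol (cj g X)) r s" by (simp add: Pol_tensor bicoeff_tensor)
  qed
qed

definition mon :: "nat \<Rightarrow> nat \<Rightarrow> 'c \<Rightarrow> 'c poly poly" where "mon i j a = monom (monom a i) j"

lemma mon_bicoeff: "bicoeff (mon i j a) i' j' = (if i = i' \<and> j = j' then a else 0)"
  by (simp add: mon_def bicoeff_def)

lemma mon_Vkk: "i \<le> wt S \<Longrightarrow> j \<le> wt S \<Longrightarrow> a \<in> coef S \<Longrightarrow> mon i j a \<in> Vkk S"
  using subfieldD(1)[OF L_subfield] by (simp add: Vkk_def mon_bicoeff)

lemma Vkk_expand:
  assumes "P \<in> Vkk S" shows "P = (\<Sum>i\<le>wt S. \<Sum>j\<le>wt S. mon i j (bicoeff P i j))"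
proof (rule poly_eqI, rule poly_eqI, unfold bicoeff_def[symmetric])
  fix s r
  have "bicoeff (\<Sum>i\<le>wt S. \<Sum>j\<le>wt S. mon i j (bicoeff P i j)) r s = (\<Sum>i\<le>wt S. \<Sum>j\<le>wt S. bicoeff (mon i j (bicoeff P i j)) r s)"
    by (simp add: bicoeff_def coeff_sum)
  also have "\<dots> = (\<Sum>i\<le>wt S. \<Sum>j\<le>wt S. if j = s then (if i = r then bicoeff P i j else 0) else 0)"
    by (intro sum.cong refl) (simp add: mon_bicoeff)
  also have "\<dots> = (if r \<le> wt S \<and> s \<le> wt S then bicoeff P r s else 0)"
    by (cases "s \<le> wt S") (simp_all add: sum.delta)
  also have "\<dots> = bicoeff P r s" using assms by (auto simp: Vkk_def)
  finally show "bicoeff P r s = bicoeff (\<Sum>i\<le>wt S. \<Sum>j\<le>wt S. mon i j (bicoeff P i j)) r s" ..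
qed

end

section \<open>The real modular symbol\<close>

locale aj_functional = aj_setting S \<L> \<Phi>1 \<Phi>2 \<mu> + torus_poly S \<kappa>
  for S :: "'c::{alg_closed_field, field_char_0, complete_space} sh_data" and \<L> :: 'c and \<Phi>1 \<Phi>2 \<mu> \<kappa> +
  fixes \<tau> :: 'c and lam :: "'c \<Rightarrow> real"
  assumes tau: "\<tau> \<in> Hur S" "\<tau> \<in> emb S ` quad S" and lam_add: "lam (a + b) = lam a + lam b"
begin

lemmas tau_DivH = frag_of_DivH[OF tau]

definition bet :: "complex option \<Rightarrow> complex option \<Rightarrow> nat \<Rightarrow> nat \<Rightarrow> complex \<Rightarrow> real" where
  "bet c c' i j a = lam (Th (frag_of c' - frag_of c) (frag_of \<tau>) (mon i j (\<kappa> * emb S a)))"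

lemma lam_0: "lam 0 = 0" using lam_add[of 0 0] by simp

lemma lam_sum: "lam (sum f A) = (\<Sum>x\<in>A. lam (f x))"
  by (induction A rule: infinite_finite_induct) (simp_all add: lam_0 lam_add)

lemma kap_emb: "a \<in> F \<Longrightarrow> \<kappa> * emb S a \<in> coef S"
  using embF_L by (intro subfieldD(4)[OF L_subfield kap]) blast

lemma bet_add:
  assumes "c \<in> P1 F" "c' \<in> P1 F" "i \<le> wt S" "j \<le> wt S" "a \<in> F" "b \<in> F"
  shows "bet c c' i j (a + b) = bet c c' i j a + bet c c' i j b"
proof -
  have "mon i j (\<kappa> * emb S (a + b)) = mon i j (\<kappa> * emb S a) + mon i j (\<kappa> * emb S b)"
    by (simp add: mon_def emb_add[OF assms(5,6)] distrib_left add_monom)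
  then show ?thesis unfolding bet_def
    using Th_add(3)[OF frag_diff_Delta0[OF assms(1,2)] tau_DivH mon_Vkk[OF assms(3,4) kap_emb[OF assms(5)]] mon_Vkk[OF assms(3,4) kap_emb[OF assms(6)]]]
    by (simp add: lam_add)
qed

lemma bet_chain:
  assumes "c \<in> P1 F" "c' \<in> P1 F" "c'' \<in> P1 F" "i \<le> wt S" "j \<le> wt S" "a \<in> F"
  shows "bet c c'' i j a = bet c c' i j a + bet c' c'' i j a"
proof -
  have "frag_of c'' - frag_of c = (frag_of c' - frag_of c) + (frag_of c'' - frag_of c')" by simp
  then show ?thesis unfolding bet_def
    using Th_add(1)[OF frag_diff_Delta0[OF assms(1,2)] tau_DivH mon_Vkk[OF assms(4,5) kap_emb[OF assms(6)]] frag_diff_Delta0[OF assms(2,3)]]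
    by (simp only: lam_add)
qed

definition om :: complex where "om = (SOME w. w \<in> OF S \<and> Im w \<noteq> 0)"

lemma om: "om \<in> F" "Im om \<noteq> 0"
proof -
  have "\<exists>w. w \<in> OF S \<and> Im w \<noteq> 0" using OF_nonreal by blast
  from someI_ex[OF this] show "om \<in> F" "Im om \<noteq> 0" using OF_F by (auto simp: om_def)
qed

text \<open>As \<open>1\<close> and \<open>om\<close> form a real basis of the complex numbers, this is the real linear extension of an
  additive function on \<open>F\<close>.\<close>
definition ell :: "(complex \<Rightarrow> real) \<Rightarrow> complex \<Rightarrow> real" where
  "ell f z = (Re z - Im z * Re om / Im om) * f 1 + Im z / Im om * f om"

lemma additive_rat:
  assumes f: "\<And>a b. a \<in> F \<Longrightarrow> b \<in> F \<Longrightarrow> f (a + b) = f a + (f b :: real)" and a: "a \<in> F"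
  shows "f (of_rat q * a) = of_rat q * f a"
proof -
  have 0: "f 0 = 0" using f[of 0 0] subfieldD(1)[OF F_subfield] by simp
  have nat: "f (of_nat m * b) = of_nat m * f b" if "b \<in> F" for m b
    using that by (induction m) (simp_all add: 0 distrib_right f subfieldD[OF F_subfield])
  have int: "f (of_int m * b) = of_int m * f b" if b: "b \<in> F" for m b
  proof (cases m)
    case (nonneg k) then show ?thesis using nat[OF b, of k] by simp
  next
    case (neg k)
    have "f (of_nat (Suc k) * b + - (of_nat (Suc k) * b)) = f (of_nat (Suc k) * b) + f (- (of_nat (Suc k) * b))"
      using b by (intro f subfieldD[OF F_subfield])
    then have "f (- (of_nat (Suc k) * b)) = - (of_nat (Suc k) * f b)" using nat[OF b, of "Suc k"] 0 by (simp del: of_nat_Suc)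
    then show ?thesis using neg by (simp del: of_nat_Suc)
  qed
  obtain u v where q: "q = Fract u v" "v > 0" by (cases q) (rule that, assumption+)
  have qa: "of_rat q * a \<in> F" using a subfield_of_rat[OF F_subfield] by (simp add: subfieldD[OF F_subfield])
  have "of_int v * f (of_rat q * a) = f (of_int v * (of_rat q * a))" by (simp only: int[OF qa])
  also have "of_int v * (of_rat q * a) = of_int u * a" using q by (simp add: of_rat_rat)
  also have "f (of_int u * a) = of_int u * f a" by (rule int[OF a])
  finally show ?thesis using q by (simp add: of_rat_rat field_simps)
qed

lemma ell_F:
  assumes f: "\<And>a b. a \<in> F \<Longrightarrow> b \<in> F \<Longrightarrow> f (a + b) = f a + f b" and a: "a \<in> F"
  shows "ell f a = f a"
proof -
  obtain q r where qr: "a = of_rat q + of_rat r * om" by (rule F_span[OF om a])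
  have F: "of_rat q * 1 \<in> F" "of_rat r * om \<in> F"
    using om(1) subfield_of_rat[OF F_subfield] by (simp_all add: subfieldD[OF F_subfield])
  have "f a = f (of_rat q * 1) + f (of_rat r * om)" unfolding qr using f[OF F] by simp
  also have "\<dots> = of_rat q * f 1 + of_rat r * f om"
    by (simp only: additive_rat[OF f subfieldD(2)[OF F_subfield]] additive_rat[OF f om(1)])
  finally have fa: "f a = of_rat q * f 1 + of_rat r * f om" .
  have a': "a = complex_of_real (of_rat q) + complex_of_real (of_rat r) * om" using qr by (simp add: of_real_of_rat)
  have "Im a = of_rat r * Im om" "Re a = of_rat q + of_rat r * Re om" unfolding a' by simp_all
  then show ?thesis using om(2) by (simp add: ell_def fa)
qed

text \<open>In monomials \<open>Pol X\<close> has coefficients \<open>\<kappa> * emb S a\<close>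
  with \<open>a = uc X i * cnj (uc X j)\<close>, which lies in \<open>F\<close> for \<open>X\<close>
  over \<open>F\<close>. Each of them enters additively, and \<open>ell\<close> extends this
  dependence to all complex \<open>a\<close>; so the symbol makes sense for every complex
  matrix.\<close>

definition ms :: "complex option \<Rightarrow> complex option \<Rightarrow> complex^2^2 \<Rightarrow> real" where
  "ms c c' X = (\<Sum>i\<le>wt S. \<Sum>j\<le>wt S. ell (bet c c' i j) (uc X i * cnj (uc X j)))"

lemma ms_MF:
  assumes c: "c \<in> P1 F" "c' \<in> P1 F" and X: "X \<in> MF"
  shows "ms c c' X = lam (Th (frag_of c' - frag_of c) (frag_of \<tau>) (Pol X))"
proof -
  note D = frag_diff_Delta0[OF c]
  have uF: "uc X i \<in> F" "uc X i * cnj (uc X j) \<in> F" for i j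
    using qe_coeff[OF X, of "emb S"] cnj_F' by (auto simp: subfieldD[OF F_subfield])
  have mV: "mon i j (\<kappa> * emb S (uc X i * cnj (uc X j))) \<in> Vkk S" if "i \<in> {..wt S}" "j \<in> {..wt S}" for i j
    using that by (intro mon_Vkk kap_emb uF) simp_all
  have "Pol X = (\<Sum>i\<le>wt S. \<Sum>j\<le>wt S. mon i j (\<kappa> * emb S (uc X i * cnj (uc X j))))"
    using Vkk_expand[OF Pol_Vkk[OF X]] by (simp only: Pol_bicoeff[OF X])
  then have "Th (frag_of c' - frag_of c) (frag_of \<tau>) (Pol X) =
      (\<Sum>i\<le>wt S. \<Sum>j\<le>wt S. Th (frag_of c' - frag_of c) (frag_of \<tau>) (mon i j (\<kappa> * emb S (uc X i * cnj (uc X j)))))"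
  proof -
    assume P: "Pol X = (\<Sum>i\<le>wt S. \<Sum>j\<le>wt S. mon i j (\<kappa> * emb S (uc X i * cnj (uc X j))))"
    have "Th (frag_of c' - frag_of c) (frag_of \<tau>) (Pol X) =
      (\<Sum>i\<le>wt S. Th (frag_of c' - frag_of c) (frag_of \<tau>) (\<Sum>j\<le>wt S. mon i j (\<kappa> * emb S (uc X i * cnj (uc X j)))))"
      unfolding P by (rule Th_sum[OF D tau_DivH]) (intro Vkk_sum mV)
    also have "\<dots> = (\<Sum>i\<le>wt S. \<Sum>j\<le>wt S. Th (frag_of c' - frag_of c) (frag_of \<tau>) (mon i j (\<kappa> * emb S (uc X i * cnj (uc X j)))))"
      by (intro sum.cong refl Th_sum[OF D tau_DivH] mV)
    finally show ?thesis .
  qed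
  then have "lam (Th (frag_of c' - frag_of c) (frag_of \<tau>) (Pol X)) =
      (\<Sum>i\<le>wt S. \<Sum>j\<le>wt S. bet c c' i j (uc X i * cnj (uc X j)))"
    by (simp add: lam_sum bet_def)
  also have "\<dots> = ms c c' X" unfolding ms_def
    by (intro sum.cong refl ell_F[symmetric] bet_add c uF) simp_all
  finally show ?thesis ..
qed

lemma ms_chain:
  assumes "c \<in> P1 F" "c' \<in> P1 F" "c'' \<in> P1 F"
  shows "ms c c'' X = ms c c' X + ms c' c'' X"
proof -
  have "ell (bet c c'' i j) z = ell (bet c c' i j) z + ell (bet c' c'' i j) z" if "i \<le> wt S" "j \<le> wt S" for i j z
    using bet_chain[OF assms that subfieldD(2)[OF F_subfield]] bet_chain[OF assms that om(1)]
    by (simp add: ell_def algebra_simps)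
  then show ?thesis by (simp add: ms_def sum.distrib)
qed

lemma ms_equivariant_MF:
  assumes g: "g \<in> R1 S" and c: "c \<in> P1 F" "c' \<in> P1 F" and X: "X \<in> MF"
  shows "ms (moebius g c) (moebius g c') (cj g X) = ms c c' X"
proof -
  note G = R1_D(4)[OF g]
  have gX: "cj g X \<in> MF"
    using X GLF_D(1)[OF G] by (auto simp: MF_def cj_def forall_2 mat2_mult_sel subfieldD[OF F_subfield])
  have D: "frag_of (moebius g c') - frag_of (moebius g c) = cusp_act g (frag_of c' - frag_of c)"
    by (simp add: cusp_act_def frag_extend_diff)
  have "ms (moebius g c) (moebius g c') (cj g X) = lam (Th (cusp_act g (frag_of c' - frag_of c)) (frag_of \<tau>) (V_act S g (Pol X)))"
    unfolding V_act_Pol[OF G R1_D(2)[OF g] X] D[symmetric] by (rule ms_MF[OF moebius_P1[OF G c(1)] moebius_P1[OF G c(2)] gX])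
  also have "\<dots> = ms c c' X"
    unfolding Th_act[OF g frag_diff_Delta0[OF c] tau_DivH Pol_Vkk[OF X]] by (rule ms_MF[OF c X, symmetric])
  finally show ?thesis .
qed

lemma ms_cont: "continuous_on UNIV (ms c c')"
proof -
  have "continuous_on UNIV (\<lambda>X. coeff (qpoly X ^ k) i)" for k i
  proof (induction k arbitrary: i)
    case 0
    then show ?case by simp
  next
    case (Suc k)
    have "continuous_on UNIV (\<lambda>X. coeff (qpoly X) l)" for l
    proof -
      consider "l = 0" | "l = 1" | "l = 2" | m where "l = Suc (Suc (Suc m))"
        by (metis One_nat_def Suc_1 not0_implies_Suc)
      then show ?thesis by cases (auto simp: qpoly_def numeral_2_eq_2 intro!: continuous_intros)
    qed
    then show ?case using Suc.IH unfolding power_Suc coeff_mult by (intro continuous_intros)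
  qed
  then have "continuous_on UNIV (\<lambda>X. uc X i)" for i by (simp add: uc_def)
  then show ?thesis unfolding ms_def[abs_def] ell_def using om(2) by (intro continuous_intros) auto
qed

text \<open>The sign \<open>(-1) ^ n\<close> occurs once in each of the two variables and
  cancels.\<close>

lemma ms_even: "ms c c' (- X) = ms c c' X"
proof -
  have "qpoly (- X) = smult (-1) (qpoly X)" by (simp add: qpoly_def)
  then have e: "uc (- X) i = (-1) ^ n * uc X i" for i by (simp only: uc_def smult_power coeff_smult)
  have "uc (- X) i * cnj (uc (- X) j) = uc X i * cnj (uc X j)" for i j
    by (cases "even n") (simp_all add: e)
  then show ?thesis by (simp only: ms_def)
qed

lemma Rats_dense: "0 < e \<Longrightarrow> \<exists>q. \<bar>s - real_of_rat q\<bar> < e"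
  using of_rat_dense[of s "s + e"] by (metis abs_minus_commute abs_of_pos diff_gt_0_iff_gt diff_less_eq add.commute less_add_same_cancel1)

lemma F_dense:
  assumes e: "0 < e" shows "\<exists>a\<in>F. cmod (z - a) < e"
proof -
  define t where "t = Im z / Im om"
  define s where "s = Re z - t * Re om"
  have z: "z = complex_of_real s + complex_of_real t * om" using om(2) by (simp add: complex_eq_iff s_def t_def)
  have om0: "0 < cmod om" using om(2) by auto
  obtain q where q: "\<bar>s - real_of_rat q\<bar> < e / 2" using Rats_dense[of "e / 2" s] e by auto
  obtain r where r: "\<bar>t - real_of_rat r\<bar> < e / 2 / cmod om" using Rats_dense[of "e / 2 / cmod om" t] e om0 by auto
  define a where "a = of_rat q + of_rat r * om"
  have aF: "a \<in> F" using om(1) subfield_of_rat[OF F_subfield] by (simp add: a_def subfieldD[OF F_subfield])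
  have "z - a = complex_of_real (s - of_rat q) + complex_of_real (t - of_rat r) * om"
    unfolding z a_def of_real_of_rat[symmetric] by (simp add: algebra_simps)
  then have "cmod (z - a) \<le> \<bar>s - of_rat q\<bar> + \<bar>t - of_rat r\<bar> * cmod om"
    using norm_triangle_ineq[of "complex_of_real (s - of_rat q)" "complex_of_real (t - of_rat r) * om"] by (simp only: norm_mult norm_of_real)
  also have "\<dots> < e / 2 + e / 2 / cmod om * cmod om"
    using q r om0 by (intro add_strict_mono mult_strict_right_mono)
  finally show ?thesis using aF om0 by auto
qed

lemma MF_dense: "closure MF = UNIV"
proof -
  have "X \<in> closure MF" for X
    unfolding closure_approachable
  proof (intro allI impI)
    fix e :: real assume e: "0 < e"
    have "\<exists>a\<in>F. cmod (X $ i $ j - a) < e / 4" for i j by (rule F_dense) (use e in simp)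
    then obtain f where f: "\<And>i j. f i j \<in> F" "\<And>i j. cmod (X $ i $ j - f i j) < e / 4" by metis
    define Y where "Y = (\<chi> i j. f i j)"
    have "norm (X - Y) \<le> (\<Sum>i\<in>UNIV. norm ((X - Y) $ i))" by (rule norm_vec_le_sum)
    also have "\<dots> \<le> (\<Sum>i\<in>UNIV. \<Sum>j\<in>UNIV. cmod ((X - Y) $ i $ j))" by (intro sum_mono norm_vec_le_sum)
    also have "\<dots> < e" using f(2)[of 1 1] f(2)[of 1 2] f(2)[of 2 1] f(2)[of 2 2] by (simp add: sum_2 Y_def)
    finally have "dist Y X < e" by (simp add: dist_norm norm_minus_commute)
    moreover have "Y \<in> MF" by (simp add: MF_def Y_def f)
    ultimately show "\<exists>Y\<in>MF. dist Y X < e" by blast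
  qed
  then show ?thesis by blast
qed

text \<open>For matrices over \<open>F\<close> this comes from the Abel-Jacobi maps. These matrices
  are dense and both sides are continuous in \<open>X\<close>.\<close>

lemma ms_equivariant:
  assumes g: "g \<in> R1 S" and c: "c \<in> P1 F" "c' \<in> P1 F"
  shows "ms (moebius g c) (moebius g c') (cj g X) = ms c c' X"
proof -
  have cc: "continuous_on UNIV (\<lambda>X. cj g X)" unfolding cj_def by (intro continuous_intros)
  have "continuous_on UNIV (\<lambda>X. ms (moebius g c) (moebius g c') (cj g X) - ms c c' X)"
    by (intro continuous_on_diff ms_cont continuous_on_compose2[OF ms_cont cc]) simp
  then have "closed {X. ms (moebius g c) (moebius g c') (cj g X) - ms c c' X = 0}"
    using continuous_closed_preimage_constant[of UNIV "\<lambda>X. ms (moebius g c) (moebius g c') (cj g X) - ms c c' X" 0] by simp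
  moreover have "MF \<subseteq> {X. ms (moebius g c) (moebius g c') (cj g X) - ms c c' X = 0}"
    using ms_equivariant_MF[OF g c] by auto
  ultimately have "closure MF \<subseteq> {X. ms (moebius g c) (moebius g c') (cj g X) - ms c c' X = 0}" by (rule closure_minimal[rotated])
  then show ?thesis using MF_dense by auto
qed

text \<open>\<open>torus_period_zero\<close> applies to a power of \<open>g\<close> in
  \<open>GamL\<close>. As \<open>g\<close> fixes \<open>X\<close>, equivariance makes the period
  additive along the powers, so the period of \<open>g\<close> itself vanishes, being a real number
  with a positive multiple equal to 0.\<close>

lemma period_zero:
  assumes x: "x \<in> P1 F" and g: "g \<in> R1 S" "g = torus X \<alpha> \<beta>" "g $ 1 $ 1 + g $ 2 $ 2 \<in> OF S" and X: "X $ 2 $ 2 = - X $ 1 $ 1"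
  shows "ms x (moebius g x) X = 0"
proof -
  have GR: "\<gamma> \<in> R1 S" if "\<gamma> \<in> BL.GamL (tame S) \<union> BL.rho ` (BL.hk \<times> BL.hk)" for \<gamma>
    using that GamL_R1 hk_R1 by blast
  have cu: "cusp e \<in> P1 F" if "e \<in> BL.Lam" for e
    using that OF_F by (auto simp: cusp_def P1_def BL.Lam_def subfieldD[OF F_subfield])
  interpret MS: modular_symbol "OF S" \<pi> Res "tame S" "P1 F" ms x
    by unfold_locales
      (auto intro: is_level_tame cu moebius_P1[OF R1_D(4)[OF GR]] ms_chain ms_equivariant[OF GR] ms_cont ms_even x)
  obtain j a b where j: "0 < j" "mpow g j \<in> BL.GamL (tame S)" "mpow g j = mat a ** g + mat b"
    using torus_power_integral[OF g(1,3)] by blast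
  have t: "mpow g j = torus X (a * \<alpha> + b) (a * \<beta>)"
    unfolding j(3) unfolding g(2) by (simp add: mat2_eq_iff mat2_mult_sel mat_sel torus_def algebra_simps)
  obtain w where w: "w \<in> SL2C" "w ** X = - (X ** w)" "\<forall>\<alpha> \<beta>. w ** torus X \<alpha> \<beta> = adj2 (torus X \<alpha> \<beta>) ** w"
    using torus_reflection[OF X] by blast
  have "mpow g j ** X = X ** mpow g j" unfolding t by (rule torus_commute)
  moreover have "w ** mpow g j = adj2 (mpow g j) ** w" unfolding t using w(3) by blast
  ultimately have zero: "ms x (moebius (mpow g j) x) X = 0" using MS.torus_period_zero[OF j(2) _ w(1,2)] by blast
  note G = R1_D(4)[OF g(1)]
  have gX: "cj g X = X"
  proof -
    have "cj g X = X ** (g ** adj2 g)" unfolding cj_def g(2) torus_commute by (simp add: matrix_mul_assoc)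
    then show ?thesis using mult_adj2[of g] R1_D(2)[OF g(1)] by simp
  qed
  have det: "det (mpow g k) = 1" for k by (induction k) (simp_all add: det_mul R1_D(2)[OF g(1)])
  have m1: "moebius (mat 1) c = c" for c by (cases c) (simp_all add: moebius_def mat_sel)
  have P: "moebius (mpow g k) x \<in> P1 F" for k
    by (induction k) (simp_all add: m1 x moebius_mult det moebius_P1[OF G])
  have "ms x (moebius (mpow g k) x) X = real k * ms x (moebius g x) X" for k
  proof (induction k)
    case 0
    show ?case using ms_chain[OF x x x, of X] by (simp add: m1)
  next
    case (Suc k)
    have "ms x (moebius (mpow g (Suc k)) x) X = ms x (moebius g x) X + ms (moebius g x) (moebius g (moebius (mpow g k) x)) X"
      using ms_chain[OF x moebius_P1[OF G x] moebius_P1[OF G P[of k]]] by (simp add: moebius_mult det)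
    also have "ms (moebius g x) (moebius g (moebius (mpow g k) x)) X = ms x (moebius (mpow g k) x) X"
      using ms_equivariant[OF g(1) x P[of k], of X] by (simp only: gX)
    finally show ?case using Suc.IH by (simp add: algebra_simps)
  qed
  then show ?thesis using zero j(1) by simp
qed

end

section \<open>Independence of the choice of the Abel-Jacobi map\<close>

theorem theorem6p5:
  fixes S :: "'c::{alg_closed_field, field_char_0, complete_space} sh_data"
    and \<delta>K :: complex and x :: "complex option" and \<L> :: 'c
    and \<Phi>1 \<Phi>2 :: "('c triple \<Rightarrow>\<^sub>0 int) set set \<Rightarrow> (('c msymb \<Rightarrow> 'c) \<times> ('c msymb \<Rightarrow> 'c)) set"
    and \<O> :: "complex set"
  assumes "prime (prm S)"
    and "padic_absolute_value TYPE('c) (prm S)"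
    and "embeds_algebraic_numbers (emb S)"
    and "imaginary_quadratic (base S)"
    and "class_number (base S) = 1"
    and "unramified_at (prm S) (base S)"
    and "even (wt S)"
    and "ideal (tame S) (ring_on (OF S))"
    and "squarefree_ideal (base S) (level S)"
    and "\<not> tame S \<subseteq> pp S"
    and "hecke_eigenform (base S) (wt S) (level S) (form S)"
    and "new_at (base S) (wt S) (pp S) (tame S) (form S)"
    and "quadratic_ext (base S) (quad S)"
    and "coprime_ideals (OF S) (rel_disc (base S) (quad S)) (level S)"
    and "inert_in (pp S) (quad S)"
    and "\<And>q. primeideal q (ring_on (OF S)) \<Longrightarrow> tame S \<subseteq> q \<Longrightarrow> split_in q (quad S)"
    and "finite_ext Qp (coef S)"
    and "Kp S \<subseteq> coef S"
    and "\<And>s. field_embedding Qp (Fp S) s \<Longrightarrow> s ` Fp S \<subseteq> coef S"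
    and "\<And>w. prime_elem_of (base S) w \<Longrightarrow> eigval S w \<in> coef S"
    and "\<delta>K \<in> ints (quad S) - OF S"
    and "\<delta>K ^ 2 \<in> OF S"
    and "cgenideal (ring_on (OF S)) (\<delta>K ^ 2) = rel_disc (base S) (quad S)"
    and "x \<in> P1 (base S)"
    and "field_embedding Qp Qp_ur (sig S)"
    and "is_padic_log (prm S) (plog S)"
    and "is_L_invariant S \<L>"
    and "is_order (OFp S) (quad S) \<O>"
    and "coprime_ideals (OFp S) (conductor S \<O>)
           (genideal (ring_on (OFp S)) (ideal_prod (ring_on (OF S)) (rel_disc (base S) (quad S)) (level S)))"
    and "abel_jacobi_map S \<L> \<Phi>1"
    and "abel_jacobi_map S \<L> \<Phi>2"
  shows "\<forall>\<Psi> \<tau> u. optimal_embedding S \<O> \<Psi> \<and> is_tau S \<Psi> \<tau> \<and>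
           generator_mod_torsion (norm_one S \<O>) u \<longrightarrow>
         \<Phi>1 (stark_heegner_cycle S \<delta>K x \<Psi> \<tau> (pgl (base S) (\<Psi> u))) =
         \<Phi>2 (stark_heegner_cycle S \<delta>K x \<Psi> \<tau> (pgl (base S) (\<Psi> u)))"
proof (intro allI impI, elim conjE)
  fix \<Psi> \<tau> u
  assume opt: "optimal_embedding S \<O> \<Psi>" and tau: "is_tau S \<Psi> \<tau>" and gen: "generator_mod_torsion (norm_one S \<O>) u"
  interpret sh_setting S by (intro sh_setting.intro quad_setting.intro sh_setting_axioms.intro) (fact assms)+
  have u: "u \<in> norm_one S \<O>" using gen by (simp add: generator_mod_torsion_def)
  note T = optimal_embedding_torus[OF opt assms(28) u assms(21,22)]
  have \<tau>: "\<tau> \<in> Hur S" "\<tau> \<in> emb S ` quad S" using tau by (auto simp: is_tau_def)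
  define \<kappa> where "\<kappa> = inverse (emb S \<delta>K) ^ (wt S div 2)"
  have "emb S \<delta>K \<in> coef S" using embK_L assms(21) by (auto simp: ints_def)
  then have \<kappa>: "\<kappa> \<in> coef S" unfolding \<kappa>_def by (intro subfieldD(5,9)[OF L_subfield])
  define D where "D = frag_of (moebius (\<Psi> u) x) - frag_of x"
  define P where "P = smult [:\<kappa>:] (P_Psi S \<delta>K \<Psi> ^ (wt S div 2))"
  define Z where "Z = pure3 S (DivH S) D (frag_of \<tau>) P"
  \<comment> \<open>The cycle is formed with the arbitrary representative \<open>rep\<close>, which
    differs from \<open>\<Psi> u\<close> by a scalar.\<close>
  obtain z where z: "z \<in> F" "z \<noteq> 0" "rep (pgl F (\<Psi> u)) = mat z ** \<Psi> u" by (rule rep_pgl)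
  have Zeq: "stark_heegner_cycle S \<delta>K x \<Psi> \<tau> (pgl F (\<Psi> u)) = Z"
    by (simp add: stark_heegner_cycle_def Z_def D_def P_def \<kappa>_def z(3) moebius_scalar[OF z(2)])
  have gx: "moebius (\<Psi> u) x \<in> P1 F" by (rule moebius_P1[OF R1_D(4)[OF T(1)] assms(24)])
  have Dd: "D \<in> Delta0 S" unfolding D_def by (rule frag_diff_Delta0[OF assms(24) gx])
  interpret torus_poly S \<kappa> by (rule torus_poly.intro[OF sh_setting_axioms torus_poly_axioms.intro[OF \<kappa>]])
  have MFX: "\<Psi> \<delta>K \<in> MF" using T(2) by (simp add: MF_def)
  have Pol: "Pol (\<Psi> \<delta>K) = P" by (simp add: Pol_def P_def P_Psi_def qe_def Let_def)
  have Zc: "Z \<in> carrier (Coinv3 S (DivH S))"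
    unfolding Z_def Pol[symmetric] by (rule pure3_carrier[OF Dd frag_of_DivH[OF \<tau>] Pol_Vkk[OF MFX]])
  \<comment> \<open>A discrepancy at some \<mu> would give, after scaling by a rational functional,
    a real symbol with period 1, against \<open>period_zero\<close>.\<close>
  have evZ: "evc \<L> \<mu> (\<Phi>1 Z) = evc \<L> \<mu> (\<Phi>2 Z)" if \<mu>: "\<mu> \<in> MSf S" for \<mu>
  proof (rule ccontr)
    interpret aj_setting S \<L> \<Phi>1 \<Phi>2 \<mu>
      by (rule aj_setting.intro[OF sh_setting_axioms aj_setting_axioms.intro[OF assms(30,31) \<mu>]])
    assume "evc \<L> \<mu> (\<Phi>1 Z) \<noteq> evc \<L> \<mu> (\<Phi>2 Z)"
    then have "Th D (frag_of \<tau>) P \<noteq> 0" by (simp add: Th_def Z_def)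
    from rational_functional[OF this] obtain lam :: "'c \<Rightarrow> real"
      where lam: "\<And>a b. lam (a + b) = lam a + lam b" "lam (Th D (frag_of \<tau>) P) = 1" by blast
    interpret aj_functional S \<L> \<Phi>1 \<Phi>2 \<mu> \<kappa> \<tau> lam
      by (rule aj_functional.intro[OF aj_setting_axioms torus_poly_axioms aj_functional_axioms.intro[OF \<tau> lam(1)]])
    obtain \<alpha> \<beta> where ab: "\<Psi> u = torus (\<Psi> \<delta>K) \<alpha> \<beta>" using T(4) by blast
    have "ms x (moebius (\<Psi> u) x) (\<Psi> \<delta>K) = 1"
      unfolding ms_MF[OF assms(24) gx MFX] Pol D_def[symmetric] by (rule lam(2))
    then show False using period_zero[OF assms(24) T(1) ab T(5,3)] by simp
  qed
  have coset: "\<exists>w\<in>carrier (DfL S). \<Phi> Z = Fil S \<L> #>\<^bsub>DfL S\<^esub> w" if "abel_jacobi_map S \<L> \<Phi>" for \<Phi>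
    using that Zc unfolding abel_jacobi_map_def hom_def carrier_FactGroup by blast
  obtain w1 where w1: "w1 \<in> carrier (DfL S)" "\<Phi>1 Z = Fil S \<L> #>\<^bsub>DfL S\<^esub> w1" using coset[OF assms(30)] by blast
  obtain w2 where w2: "w2 \<in> carrier (DfL S)" "\<Phi>2 Z = Fil S \<L> #>\<^bsub>DfL S\<^esub> w2" using coset[OF assms(31)] by blast
  have eq: "ev \<L> \<mu> w1 = ev \<L> \<mu> w2" if "\<mu> \<in> MSf S" for \<mu>
    using evZ[OF that] unfolding w1(2) w2(2) by (simp add: evc_coset[OF that] w1(1) w2(1))
  have "\<Phi>1 Z = \<Phi>2 Z" unfolding w1(2) w2(2)
    using coset_le[OF L_subfield w1(1) w2(1) eq] coset_le[OF L_subfield w2(1) w1(1) eq[symmetric]] by blast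
  then show "\<Phi>1 (stark_heegner_cycle S \<delta>K x \<Psi> \<tau> (pgl (base S) (\<Psi> u))) =
      \<Phi>2 (stark_heegner_cycle S \<delta>K x \<Psi> \<tau> (pgl (base S) (\<Psi> u)))"
    unfolding Zeq .
qed

end
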